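(* Let $F^N(t)$, $t\ge 0$, be the solution of the $N$-particle equation $\frac{d}{dt}F^N=(K_0^N+V^N)F^N$ whose initial datum $F^N(0)\in\mathfrak A_N$ is a state, with marginals $F_j(t)$, let $F(t)$ be the solution of the mean field equation $\partial_tF=K_0(F)+Q(F,F)$ with initial datum $F(0)\in\mathfrak A$, $F(0)\ge 0$, $\|F(0)\|_1=1$, and let $E_j(t)$, $j=1,\dots,N$, be the associated correlation errors. Suppose that for some $C_0\ge1$ and all $j=1,\dots,N$, $$\|E_j(0)\|_1\le C_0^{\,j}\left(\frac{j}{\sqrt N}\right)^{j},$$ and that $\|E_1(0)\|_1\le\frac{B_0}{N}$ for some $B_0>0$. Then for all $t>0$ and all $j=1,\dots,N$, $$\left\|F_j(t)-F(t)^{\otimes j}\right\|_1\le D_2\,e^{D_1t\|V\|}\,\frac{j^2}{N},$$ where $D_2=\sup\{B_2,\,8(eC_2)^2\}$, $D_1=\sup\{B_1,2C_1\}$ and $$C_1=4\,\frac{16(2e)^{\frac1{12e}+1}}{\left|\log\left(1-\frac1{24e}\right)\right|},\quad C_2=16(2e)^{1+\frac1{12e}}C_0,\quad B_1=2C_1,\quad B_2=B_0+\frac12+\frac{16C_2^2}{C_1-2}.$$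
   Context: **Algebras and norms.** Let $\mathfrak H$ be a complex separable Hilbert space, $\mathfrak H_n=\mathfrak H^{\otimes n}$. For $1\le k,s\le n$ let $\sigma_{k,s}$ be the unitary on $\mathfrak H_n$ exchanging the $k$-th and $s$-th tensor factors ($\sigma_{k,k}=\mathbb I$). An operator $A$ on $\mathfrak H_n$ is symmetric if $A=\sigma_{k,s}A\sigma_{k,s}^*$ for all $k,s$. For each $n\geq 1$ a $*$-algebra $\mathfrak A_n=\mathfrak A^{\otimes n}\subset\mathcal B(\mathfrak H_n)$, $\mathfrak A_1=\mathfrak A$ (possibly without unit), stable under $A\mapsto|A|=\sqrt{A^*A}$, is given, with a positive linear functional $\ell:\mathfrak A_n\to\mathbb C$ such that $\|A\|_1:=\ell(|A|)$ is a norm on $\mathfrak A_n$ and: - $|\ell(A)|\le\ell(|A|)$; - $\ell(A\otimes B)=\ell(A)\ell(B)$ for $A\in\mathfrak A_j$, $B\in\mathfrak A_{n-j}$ (hence $\|A\otimes B\|_1=\|A\|_1\|B\|_1$); - $\|\sigma_{k,s}A\sigma_{k,s}^*\|_1=\|A\|_1$. $\mathfrak A_n$ is replaced by its completion for $\|\cdot\|_1$ (same notation), and all operations are extended by continuity. A state of the $N$-particle system is a positive, symmetric $F^N\in\mathfrak A_N$ with $\|F^N\|_1=1$. **Marginals.** $\ell_n:\mathfrak A_n\to\mathfrak A_{n-1}$ are positive linear maps with $\ell_n(A_1\otimes\cdots\otimes A_n)=\ell(A_n)\,A_1\otimes\cdots\otimes A_{n-1}$ and $|\ell_n(A)|\le\ell_n(|A|)$.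 Put $\ell_{j,n}=\ell_{j+1}\cdots\ell_n:\mathfrak A_n\to\mathfrak A_j$. The $j$-particle marginal of $F^N$ is $F_j=F^N_j:=\ell_{j,N}(F^N)$ ($F_N=F^N$). **Dynamics.** $K_0$ is a (possibly unbounded) linear operator on $\mathfrak A$; $K_0^j=\sum_{i=1}^j\mathbb I_{\mathfrak A_{i-1}}\otimes K_0\otimes\mathbb I_{\mathfrak A_{j-i}}$. $V\in\mathcal B(\mathfrak A_2)$ is a symmetry preserving bounded operator (it maps symmetric elements to symmetric elements), and $\|V\|=\|V\|_{\mathfrak A_2\to\mathfrak A_2}$. For $i<r\le j$, $T_{i,r}:\mathfrak A_j\to\mathfrak A_j$ denotes $V$ acting on slots $i$ and $r$ (and as the identity on the other slots); it is a bounded operator with $\|T_{i,r}\|\le\|V\|$. Put $T_j=\sum_{1\le i<r\le j}T_{i,r}$. For $j=N$ write $V_{i,r}=T_{i,r}$ and $V^N=\frac1N\sum_{1\le i<r\le N}V_{i,r}=T_N/N$. Standing assumptions: $K_0$ and $K_0^N+V^N$ generate strongly continuous, positivity preserving, isometric semigroups for $\|\cdot\|_1$; $\|e^{t(K_0^j+T_j/N)}\|=1$ for all $t\ge0$, $1\le j\le N$; the equation $\frac{d}{dt}F^N=(K_0^N+V^N)F^N$ has a unique mild solution for every initial datum in $\mathfrak A_N$; $\ell(K_0(F))=0$ for $F\in\mathfrak A$ and $\ell_{j,N}(V_{i,r}(F^N))=0$ for $F^N\in\mathfrak A_N$, $i,r>j$, $i\ne r$. With $Q(F,G):=\ell_2(V(F\otimes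 G))$, the mean field equation $\partial_tF=K_0(F)+Q(F,F)$, $F(0)\ge0$, $\|F(0)\|_1=1$, has a unique global mild solution, which preserves positivity and $\|\cdot\|_1$. **Correlation error.** Let $J=\{1,\dots,j\}$, $K\subset J$, $k=|K|$, and $J\setminus K=\{i_1<\dots<i_{j-k}\}$, $\sigma_{J\setminus K,j}=\sigma_{i_1,1}\sigma_{i_2,2}\cdots\sigma_{i_{j-k},j-k}$ ($\sigma_{\emptyset,j}=\mathbb I$). The correlation error of order $j$ is $$E_j=\sum_{K\subset J}(-1)^{k}\,\sigma_{J\setminus K,j}\left(F_{j-k}\otimes F^{\otimes k}\right)\sigma_{J\setminus K,j}^*\in\mathfrak A_j,$$ i.e. the $K$-term has the marginal $F_{j-k}$ in the slots of $J\setminus K$ and $F$ in each slot of $K$; the terms $K=\emptyset$, $K=J$ are $F_j$ and $(-1)^jF^{\otimes j}$. $E_j(t)$ is obtained by using the marginals $F_j(t)$ of $F^N(t)$ and the mean field solution $F(t)$. *)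

theory Defs
  imports "HOL-Analysis.Analysis"
begin

section \<open>Complex normed and Hilbert spaces\<close>

text \<open>The distribution only has real normed spaces; \<open>scaleC\<close> extends \<open>scaleR\<close> and
  \<open>cinner\<close>, conjugate-linear in its first argument, has \<open>inner\<close> as its real part.\<close>

class complex_normed_vector = real_normed_vector +
  fixes scaleC :: "complex \<Rightarrow> 'a \<Rightarrow> 'a"  (infixr \<open>*\<^sub>C\<close> 75)
  assumes scaleC_add_right: "c *\<^sub>C (x + y) = c *\<^sub>C x + c *\<^sub>C y"
    and scaleC_add_left: "(c + d) *\<^sub>C x = c *\<^sub>C x + d *\<^sub>C x"
    and scaleC_scaleC: "c *\<^sub>C d *\<^sub>C x = (c * d) *\<^sub>C x"
    and scaleC_of_real: "complex_of_real r *\<^sub>C x = r *\<^sub>R x"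
    and norm_scaleC: "norm (c *\<^sub>C x) = cmod c * norm x"

class complex_inner = complex_normed_vector + real_inner +
  fixes cinner :: "'a \<Rightarrow> 'a \<Rightarrow> complex"
  assumes cinner_commute: "cinner x y = cnj (cinner y x)"
    and cinner_add_right: "cinner x (y + z) = cinner x y + cinner x z"
    and cinner_scaleC_right: "cinner x (c *\<^sub>C y) = c * cinner x y"
    and Re_cinner: "Re (cinner x y) = inner x y"

class complex_banach = complex_normed_vector + banach

class complex_hilbert = complex_inner + banach

definition cspan :: "'a::complex_normed_vector set \<Rightarrow> 'a set" where
  "cspan X = {\<Sum>p<m. c p *\<^sub>C x p | (m::nat) c x. \<forall>p<m. x p \<in> X}"

definition clinear_on ::
    "'a::complex_normed_vector set \<Rightarrow> 'b::complex_normed_vector set \<Rightarrow> ('a \<Rightarrow> 'b) \<Rightarrow> bool" where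
  "clinear_on X Y f \<longleftrightarrow> (\<forall>x\<in>X. f x \<in> Y) \<and> (\<forall>x\<in>X. \<forall>y\<in>X. f (x + y) = f x + f y) \<and>
     (\<forall>c. \<forall>x\<in>X. f (c *\<^sub>C x) = c *\<^sub>C f x)"

definition bounded_clinear_on ::
    "'a::complex_normed_vector set \<Rightarrow> 'b::complex_normed_vector set \<Rightarrow> ('a \<Rightarrow> 'b) \<Rightarrow> bool" where
  "bounded_clinear_on X Y f \<longleftrightarrow> clinear_on X Y f \<and> (\<exists>C. \<forall>x\<in>X. norm (f x) \<le> C * norm x)"

definition op_norm_on ::
    "'a::real_normed_vector set \<Rightarrow> ('a \<Rightarrow> 'b::real_normed_vector) \<Rightarrow> real" where
  "op_norm_on X f = Sup {norm (f x) | x. x \<in> X \<and> norm x \<le> 1}"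

definition bounded_op :: "('f::complex_hilbert \<Rightarrow> 'f) \<Rightarrow> bool" where
  "bounded_op A \<longleftrightarrow> bounded_clinear_on UNIV UNIV A"

definition adjoint_op :: "('f::complex_hilbert \<Rightarrow> 'f) \<Rightarrow> 'f \<Rightarrow> 'f" where
  "adjoint_op A = (THE B. \<forall>x y. cinner (A x) y = cinner x (B y))"

definition positive_op :: "('f::complex_hilbert \<Rightarrow> 'f) \<Rightarrow> bool" where
  "positive_op A \<longleftrightarrow> bounded_op A \<and> (\<forall>x. cinner x (A x) \<in> \<real>\<^sub>\<ge>\<^sub>0)"

text \<open>\<open>|A|\<close>, the unique positive square root of \<open>A\<^sup>* A\<close>.\<close>

definition abs_op :: "('f::complex_hilbert \<Rightarrow> 'f) \<Rightarrow> 'f \<Rightarrow> 'f" where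
  "abs_op A = (THE P. positive_op P \<and> P \<circ> P = adjoint_op A \<circ> A)"


section \<open>Strongly continuous semigroups\<close>

text \<open>Unbounded operators are given by their graphs.\<close>

definition c0_semigroup :: "'b::complex_banach set \<Rightarrow> (real \<Rightarrow> 'b \<Rightarrow> 'b) \<Rightarrow> bool" where
  "c0_semigroup X U \<longleftrightarrow>
     (\<forall>t\<ge>0. bounded_clinear_on X X (U t)) \<and> (\<forall>x\<in>X. U 0 x = x) \<and>
     (\<forall>s\<ge>0. \<forall>t\<ge>0. \<forall>x\<in>X. U (s + t) x = U s (U t x)) \<and>
     (\<forall>x\<in>X. continuous_on {0..} (\<lambda>t. U t x))"

definition generator_graph :: "'b::complex_banach set \<Rightarrow> (real \<Rightarrow> 'b \<Rightarrow> 'b) \<Rightarrow> ('b \<times> 'b) set" where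
  "generator_graph X U =
     {(x, y). x \<in> X \<and> ((\<lambda>t. (U t x - x) /\<^sub>R t) \<longlongrightarrow> y) (at_right 0)}"

definition generates ::
    "'b::complex_banach set \<Rightarrow> ('b \<times> 'b) set \<Rightarrow> (real \<Rightarrow> 'b \<Rightarrow> 'b) \<Rightarrow> bool" where
  "generates X G U \<longleftrightarrow> c0_semigroup X U \<and> generator_graph X U = G"

text \<open>Mild solution of \<open>f' = G f\<close>, \<open>f 0 = f0\<close>: \<open>f\<close> is continuous, \<open>\<integral>\<^sub>0\<^sup>t f\<close> lies in the domain
  of \<open>G\<close> and \<open>f t = f0 + G (\<integral>\<^sub>0\<^sup>t f)\<close>.\<close>

definition mild_solution ::
    "'b::complex_banach set \<Rightarrow> ('b \<times> 'b) set \<Rightarrow> 'b \<Rightarrow> (real \<Rightarrow> 'b) \<Rightarrow> bool" where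
  "mild_solution X G f0 f \<longleftrightarrow>
     continuous_on {0..} f \<and> (\<forall>t\<ge>0. f t \<in> X) \<and> (\<forall>t\<ge>0. (integral {0..t} f, f t - f0) \<in> G)"


section \<open>The data\<close>

text \<open>
  \<open>'h\<close> is the one-particle Hilbert space. Since the tensor powers for all \<open>n\<close> have to live in
  one type, they are closed subspaces of one Hilbert space \<open>'f\<close> (for instance the full Fock
  space), and the completed algebras are closed subspaces of one Banach space \<open>'b\<close> (for
  instance the \<open>\<ell>\<^sup>1\<close>-sum of the completions). Particles are numbered from 1; only the spaces with
  \<open>n \<ge> 1\<close> are used.

  The components \<open>op_tensor\<close> and \<open>op_swap\<close>, and \<open>ell\<close>, \<open>tens\<close>, \<open>swap_conj\<close>, \<open>absv\<close>, \<open>semigroup0\<close>,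
  \<open>pair_op\<close>, \<open>semigroup\<close>, are determined by the remaining ones on the spaces where they are used,
  through the axioms of the locales below.
\<close>

record ('h, 'f, 'b) mean_field_data =
  etensor :: "'h list \<Rightarrow> 'f"                      \<comment> \<open>\<open>x\<^sub>1 \<otimes> \<dots> \<otimes> x\<^sub>n\<close> for \<open>x\<^sub>i\<close> in the Hilbert space\<close>
  op_swap :: "nat \<Rightarrow> nat \<Rightarrow> nat \<Rightarrow> 'f \<Rightarrow> 'f"        \<comment> \<open>\<open>n, k, s\<close>: the unitary \<open>\<sigma>\<^sub>k\<^sub>s\<close> on the \<open>n\<close>-th power\<close>
  op_tensor :: "nat \<Rightarrow> nat \<Rightarrow> ('f \<Rightarrow> 'f) \<Rightarrow> ('f \<Rightarrow> 'f) \<Rightarrow> ('f \<Rightarrow> 'f)"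
  alg :: "nat \<Rightarrow> ('f \<Rightarrow> 'f) set"                  \<comment> \<open>the \<open>*\<close>-algebras, before completion\<close>
  op_ell :: "nat \<Rightarrow> ('f \<Rightarrow> 'f) \<Rightarrow> complex"        \<comment> \<open>\<open>\<ell>\<close> before completion\<close>
  emb :: "nat \<Rightarrow> ('f \<Rightarrow> 'f) \<Rightarrow> 'b"                \<comment> \<open>embedding into the completion\<close>
  ell :: "nat \<Rightarrow> 'b \<Rightarrow> complex"
  absv :: "nat \<Rightarrow> 'b \<Rightarrow> 'b"
  tens :: "nat \<Rightarrow> nat \<Rightarrow> 'b \<Rightarrow> 'b \<Rightarrow> 'b"
  swap_conj :: "nat \<Rightarrow> nat \<Rightarrow> nat \<Rightarrow> 'b \<Rightarrow> 'b"      \<comment> \<open>\<open>A \<mapsto> \<sigma>\<^sub>k\<^sub>s A \<sigma>\<^sub>k\<^sub>s\<^sup>*\<close>\<close>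
  marg :: "nat \<Rightarrow> 'b \<Rightarrow> 'b"                       \<comment> \<open>\<open>\<ell>\<^sub>n\<close>\<close>
  dom0 :: "'b set"                              \<comment> \<open>domain of \<open>K\<^sub>0\<close>\<close>
  kin0 :: "'b \<Rightarrow> 'b"                              \<comment> \<open>\<open>K\<^sub>0\<close>\<close>
  semigroup0 :: "real \<Rightarrow> 'b \<Rightarrow> 'b"                \<comment> \<open>generated by \<open>K\<^sub>0\<close>\<close>
  pot :: "'b \<Rightarrow> 'b"                               \<comment> \<open>\<open>V\<close>\<close>
  pair_op :: "nat \<Rightarrow> nat \<Rightarrow> nat \<Rightarrow> 'b \<Rightarrow> 'b"        \<comment> \<open>\<open>j, i, r\<close>: \<open>T\<^sub>i\<^sub>r\<close> on \<open>j\<close> particles\<close>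
  npart :: nat                                  \<comment> \<open>\<open>N\<close>\<close>
  semigroup :: "nat \<Rightarrow> real \<Rightarrow> 'b \<Rightarrow> 'b"          \<comment> \<open>\<open>j\<close>: generated by \<open>K\<^sub>0\<^sup>j + T\<^sub>j / N\<close>\<close>


section \<open>Operator algebras\<close>

definition hspace :: "('h::complex_hilbert, 'f::complex_hilbert, 'b) mean_field_data \<Rightarrow> nat \<Rightarrow> 'f set" where
  "hspace S n = closure (cspan {etensor S xs | xs. length xs = n})"

text \<open>The bounded operators on \<open>hspace S n\<close>, extended by 0 to the orthogonal complement.\<close>

definition ops :: "('h::complex_hilbert, 'f::complex_hilbert, 'b) mean_field_data \<Rightarrow> nat \<Rightarrow> ('f \<Rightarrow> 'f) set" where
  "ops S n = {A. bounded_op A \<and> range A \<subseteq> hspace S n \<and>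
                 (\<forall>x. (\<forall>y\<in>hspace S n. cinner y x = 0) \<longrightarrow> A x = 0)}"

definition op_norm1 :: "('h::complex_hilbert, 'f::complex_hilbert, 'b) mean_field_data \<Rightarrow> nat \<Rightarrow> ('f \<Rightarrow> 'f) \<Rightarrow> real" where
  "op_norm1 S n A = Re (op_ell S n (abs_op A))"

text \<open>The formula for the inner products of elementary tensors entails multilinearity, so that
  \<open>hspace S n\<close> is the Hilbert space tensor power.\<close>

locale hilbert_tensor_powers =
  fixes S :: "('h::complex_hilbert, 'f::complex_hilbert, 'b::complex_banach) mean_field_data"
  assumes separable: "separable_space (euclidean :: 'h topology)"
    and cinner_etensor: "length xs = length ys \<Longrightarrow>
      cinner (etensor S xs) (etensor S ys) = (\<Prod>i<length xs. cinner (xs ! i) (ys ! i))"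
    and op_swap_ops: "\<lbrakk>k \<in> {1..n}; s \<in> {1..n}\<rbrakk> \<Longrightarrow> op_swap S n k s \<in> ops S n"
    and op_swap_etensor: "\<lbrakk>k \<in> {1..n}; s \<in> {1..n}; length xs = n\<rbrakk> \<Longrightarrow>
      op_swap S n k s (etensor S xs) =
        etensor S (xs[k - 1 := xs ! (s - 1), s - 1 := xs ! (k - 1)])"

locale operator_algebras = hilbert_tensor_powers S
  for S :: "('h::complex_hilbert, 'f::complex_hilbert, 'b::complex_banach) mean_field_data" +
  assumes alg_ops: "n \<ge> 1 \<Longrightarrow> alg S n \<subseteq> ops S n"
    and alg_zero: "n \<ge> 1 \<Longrightarrow> (\<lambda>x. 0) \<in> alg S n"
    and alg_add: "\<lbrakk>n \<ge> 1; A \<in> alg S n; B \<in> alg S n\<rbrakk> \<Longrightarrow> (\<lambda>x. A x + B x) \<in> alg S n"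
    and alg_scale: "\<lbrakk>n \<ge> 1; A \<in> alg S n\<rbrakk> \<Longrightarrow> (\<lambda>x. c *\<^sub>C A x) \<in> alg S n"
    and alg_mult: "\<lbrakk>n \<ge> 1; A \<in> alg S n; B \<in> alg S n\<rbrakk> \<Longrightarrow> A \<circ> B \<in> alg S n"
    and alg_adjoint: "\<lbrakk>n \<ge> 1; A \<in> alg S n\<rbrakk> \<Longrightarrow> adjoint_op A \<in> alg S n"
    and alg_abs: "\<lbrakk>n \<ge> 1; A \<in> alg S n\<rbrakk> \<Longrightarrow> abs_op A \<in> alg S n"
    and alg_swap: "\<lbrakk>A \<in> alg S n; k \<in> {1..n}; s \<in> {1..n}\<rbrakk> \<Longrightarrow>
      op_swap S n k s \<circ> A \<circ> adjoint_op (op_swap S n k s) \<in> alg S n"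
    and alg_tensor: "\<lbrakk>j \<ge> 1; m \<ge> 1; A \<in> alg S j; B \<in> alg S m\<rbrakk> \<Longrightarrow>
      op_tensor S j m A B \<in> alg S (j + m)"
    \<comment> \<open>matrix elements of \<open>A \<otimes> B\<close>\<close>
    and cinner_op_tensor: "\<lbrakk>j \<ge> 1; m \<ge> 1; A \<in> alg S j; B \<in> alg S m;
        length xs = j; length xs' = j; length ys = m; length ys' = m\<rbrakk> \<Longrightarrow>
      cinner (etensor S (xs' @ ys')) (op_tensor S j m A B (etensor S (xs @ ys))) =
        cinner (etensor S xs') (A (etensor S xs)) * cinner (etensor S ys') (B (etensor S ys))"
    and op_ell_add: "\<lbrakk>n \<ge> 1; A \<in> alg S n; B \<in> alg S n\<rbrakk> \<Longrightarrow>
      op_ell S n (\<lambda>x. A x + B x) = op_ell S n A + op_ell S n B"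
    and op_ell_scale: "\<lbrakk>n \<ge> 1; A \<in> alg S n\<rbrakk> \<Longrightarrow> op_ell S n (\<lambda>x. c *\<^sub>C A x) = c * op_ell S n A"
    and op_ell_positive: "\<lbrakk>n \<ge> 1; A \<in> alg S n; positive_op A\<rbrakk> \<Longrightarrow> op_ell S n A \<in> \<real>\<^sub>\<ge>\<^sub>0"
    and op_norm1_definite: "\<lbrakk>n \<ge> 1; A \<in> alg S n; op_norm1 S n A = 0\<rbrakk> \<Longrightarrow> A = (\<lambda>x. 0)"
    and op_norm1_triangle: "\<lbrakk>n \<ge> 1; A \<in> alg S n; B \<in> alg S n\<rbrakk> \<Longrightarrow>
      op_norm1 S n (\<lambda>x. A x + B x) \<le> op_norm1 S n A + op_norm1 S n B"
    and op_norm1_scale: "\<lbrakk>n \<ge> 1; A \<in> alg S n\<rbrakk> \<Longrightarrow>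
      op_norm1 S n (\<lambda>x. c *\<^sub>C A x) = cmod c * op_norm1 S n A"
    and op_ell_le: "\<lbrakk>n \<ge> 1; A \<in> alg S n\<rbrakk> \<Longrightarrow> cmod (op_ell S n A) \<le> op_norm1 S n A"
    and op_ell_tensor: "\<lbrakk>j \<ge> 1; m \<ge> 1; A \<in> alg S j; B \<in> alg S m\<rbrakk> \<Longrightarrow>
      op_ell S (j + m) (op_tensor S j m A B) = op_ell S j A * op_ell S m B"
    and op_norm1_tensor: "\<lbrakk>j \<ge> 1; m \<ge> 1; A \<in> alg S j; B \<in> alg S m\<rbrakk> \<Longrightarrow>
      op_norm1 S (j + m) (op_tensor S j m A B) = op_norm1 S j A * op_norm1 S m B"
    and op_norm1_swap: "\<lbrakk>A \<in> alg S n; k \<in> {1..n}; s \<in> {1..n}\<rbrakk> \<Longrightarrow>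
      op_norm1 S n (op_swap S n k s \<circ> A \<circ> adjoint_op (op_swap S n k s)) = op_norm1 S n A"


section \<open>Completion and marginals\<close>

definition cspace :: "('h, 'f, 'b::complex_banach) mean_field_data \<Rightarrow> nat \<Rightarrow> 'b set" where
  "cspace S n = closure (emb S n ` alg S n)"

definition pos_cone :: "('h, 'f::complex_hilbert, 'b::complex_banach) mean_field_data \<Rightarrow> nat \<Rightarrow> 'b set" where
  "pos_cone S n = closure (emb S n ` {A \<in> alg S n. positive_op A})"

text \<open>\<open>ptens S a n\<close> is \<open>a 1 \<otimes> \<dots> \<otimes> a n\<close>, for \<open>n \<ge> 1\<close>.\<close>

fun ptens :: "('h, 'f, 'b::complex_banach) mean_field_data \<Rightarrow> (nat \<Rightarrow> 'b) \<Rightarrow> nat \<Rightarrow> 'b" where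
  "ptens S a 0 = 0"
| "ptens S a (Suc 0) = a 1"
| "ptens S a (Suc (Suc n)) = tens S (Suc n) 1 (ptens S a (Suc n)) (a (Suc (Suc n)))"

abbreviation tpower :: "('h, 'f, 'b::complex_banach) mean_field_data \<Rightarrow> 'b \<Rightarrow> nat \<Rightarrow> 'b" where
  "tpower S f n \<equiv> ptens S (\<lambda>_. f) n"

text \<open>For \<open>is = [i\<^sub>1 < \<dots> < i\<^sub>m]\<close>, \<open>place S j is x y\<close> is \<open>x \<otimes> y\<close>, where \<open>x\<close> has \<open>m\<close> and \<open>y\<close> has \<open>j - m\<close>
  particles, conjugated by \<open>\<sigma>\<^bsub>i\<^sub>1,1\<^esub> \<dots> \<sigma>\<^bsub>i\<^sub>m,m\<^esub>\<close>: \<open>x\<close> is moved to the slots \<open>is\<close>. If \<open>m = 0\<close>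
  or \<open>m = j\<close> then \<open>x \<otimes> y\<close> is read as \<open>y\<close> or \<open>x\<close>.\<close>

definition place :: "('h, 'f, 'b::complex_banach) mean_field_data \<Rightarrow> nat \<Rightarrow> nat list \<Rightarrow> 'b \<Rightarrow> 'b \<Rightarrow> 'b" where
  "place S j is x y =
     foldr (\<lambda>(i, p). swap_conj S j i p) (zip is [1..<Suc (length is)])
       (if length is = 0 then y else if length is = j then x
        else tens S (length is) (j - length is) x y)"

definition symmetric :: "('h, 'f, 'b::complex_banach) mean_field_data \<Rightarrow> nat \<Rightarrow> 'b \<Rightarrow> bool" where
  "symmetric S n x \<longleftrightarrow> (\<forall>k\<in>{1..n}. \<forall>s\<in>{1..n}. swap_conj S n k s x = x)"

definition state :: "('h, 'f::complex_hilbert, 'b::complex_banach) mean_field_data \<Rightarrow> nat \<Rightarrow> 'b \<Rightarrow> bool" where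
  "state S n x \<longleftrightarrow> x \<in> pos_cone S n \<and> symmetric S n x \<and> norm x = 1"

text \<open>\<open>marginal S j n\<close> is \<open>\<ell>\<^bsub>j+1\<^esub> \<dots> \<ell>\<^sub>n\<close>.\<close>

fun marginal :: "('h, 'f, 'b) mean_field_data \<Rightarrow> nat \<Rightarrow> nat \<Rightarrow> 'b \<Rightarrow> 'b" where
  "marginal S j 0 x = x"
| "marginal S j (Suc n) x = (if Suc n \<le> j then x else marginal S j n (marg S (Suc n) x))"

text \<open>\<open>emb\<close> is an isometric embedding with dense range in \<open>cspace S n\<close>, hence the latter is the
  completion; operations are extended by continuity. That \<open>alg S n\<close> is the \<open>n\<close>-th tensor power
  of \<open>alg S 1\<close> means, after completion, that the span of the elementary tensors is dense.\<close>

locale completed_algebras = operator_algebras S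
  for S :: "('h::complex_hilbert, 'f::complex_hilbert, 'b::complex_banach) mean_field_data" +
  assumes emb_add: "\<lbrakk>n \<ge> 1; A \<in> alg S n; B \<in> alg S n\<rbrakk> \<Longrightarrow>
      emb S n (\<lambda>x. A x + B x) = emb S n A + emb S n B"
    and emb_scale: "\<lbrakk>n \<ge> 1; A \<in> alg S n\<rbrakk> \<Longrightarrow> emb S n (\<lambda>x. c *\<^sub>C A x) = c *\<^sub>C emb S n A"
    and norm_emb: "\<lbrakk>n \<ge> 1; A \<in> alg S n\<rbrakk> \<Longrightarrow> norm (emb S n A) = op_norm1 S n A"
    and ell_emb: "\<lbrakk>n \<ge> 1; A \<in> alg S n\<rbrakk> \<Longrightarrow> ell S n (emb S n A) = op_ell S n A"
    and ell_continuous: "n \<ge> 1 \<Longrightarrow> continuous_on (cspace S n) (ell S n)"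
    and absv_emb: "\<lbrakk>n \<ge> 1; A \<in> alg S n\<rbrakk> \<Longrightarrow> absv S n (emb S n A) = emb S n (abs_op A)"
    and absv_continuous: "n \<ge> 1 \<Longrightarrow> continuous_on (cspace S n) (absv S n)"
    and tens_emb: "\<lbrakk>j \<ge> 1; m \<ge> 1; A \<in> alg S j; B \<in> alg S m\<rbrakk> \<Longrightarrow>
      tens S j m (emb S j A) (emb S m B) = emb S (j + m) (op_tensor S j m A B)"
    and tens_continuous: "\<lbrakk>j \<ge> 1; m \<ge> 1\<rbrakk> \<Longrightarrow>
      continuous_on (cspace S j \<times> cspace S m) (\<lambda>(x, y). tens S j m x y)"
    and swap_conj_emb: "\<lbrakk>A \<in> alg S n; k \<in> {1..n}; s \<in> {1..n}\<rbrakk> \<Longrightarrow>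
      swap_conj S n k s (emb S n A) =
        emb S n (op_swap S n k s \<circ> A \<circ> adjoint_op (op_swap S n k s))"
    and swap_conj_continuous: "\<lbrakk>k \<in> {1..n}; s \<in> {1..n}\<rbrakk> \<Longrightarrow>
      continuous_on (cspace S n) (swap_conj S n k s)"
    and ptens_dense: "n \<ge> 1 \<Longrightarrow>
      closure (cspan {ptens S a n | a. \<forall>i\<in>{1..n}. a i \<in> cspace S 1}) = cspace S n"
    and marg_linear: "n \<ge> 2 \<Longrightarrow> bounded_clinear_on (cspace S n) (cspace S (n - 1)) (marg S n)"
    and marg_positive: "\<lbrakk>n \<ge> 2; x \<in> pos_cone S n\<rbrakk> \<Longrightarrow> marg S n x \<in> pos_cone S (n - 1)"
    and marg_ptens: "\<lbrakk>n \<ge> 2; \<forall>i\<in>{1..n}. a i \<in> cspace S 1\<rbrakk> \<Longrightarrow>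
      marg S n (ptens S a n) = ell S 1 (a n) *\<^sub>C ptens S a (n - 1)"
    and abs_marg_le: "\<lbrakk>n \<ge> 2; x \<in> cspace S n\<rbrakk> \<Longrightarrow>
      marg S n (absv S n x) - absv S (n - 1) (marg S n x) \<in> pos_cone S (n - 1)"


section \<open>Dynamics\<close>

text \<open>Graph of \<open>K\<^sub>0\<^sup>j = \<Sum>\<^sub>i I \<otimes> K\<^sub>0 \<otimes> I\<close>: the closure of the operator with this formula on the
  span of the elementary tensors with factors in the domain of \<open>K\<^sub>0\<close>.\<close>

definition kin_graph :: "('h, 'f, 'b::complex_banach) mean_field_data \<Rightarrow> nat \<Rightarrow> ('b \<times> 'b) set" where
  "kin_graph S j = closure
     {(\<Sum>p<m. c p *\<^sub>C ptens S (a p) j,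
       \<Sum>p<m. c p *\<^sub>C (\<Sum>i=1..j. ptens S ((a p)(i := kin0 S (a p i))) j))
      | (m::nat) c a. \<forall>p<m. \<forall>i\<in>{1..j}. a p i \<in> dom0 S}"

definition pair_sum :: "('h, 'f, 'b::complex_banach) mean_field_data \<Rightarrow> nat \<Rightarrow> 'b \<Rightarrow> 'b" where
  "pair_sum S j x = (\<Sum>(i, r)\<in>{(i, r). 1 \<le> i \<and> i < r \<and> r \<le> j}. pair_op S j i r x)"

text \<open>Graph of \<open>K\<^sub>0\<^sup>j + T\<^sub>j / N\<close>; for \<open>j = N\<close> this is the \<open>N\<close>-particle generator \<open>K\<^sub>0\<^sup>N + V\<^sup>N\<close>.\<close>

definition dyn_graph :: "('h, 'f, 'b::complex_banach) mean_field_data \<Rightarrow> nat \<Rightarrow> ('b \<times> 'b) set" where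
  "dyn_graph S j = {(x, y + pair_sum S j x /\<^sub>R real (npart S)) | x y. (x, y) \<in> kin_graph S j}"

definition pot_norm :: "('h, 'f, 'b::complex_banach) mean_field_data \<Rightarrow> real" where
  "pot_norm S = op_norm_on (cspace S 2) (pot S)"

definition mf_op :: "('h, 'f, 'b::complex_banach) mean_field_data \<Rightarrow> 'b \<Rightarrow> 'b \<Rightarrow> 'b" where
  "mf_op S f g = marg S 2 (pot S (tens S 1 1 f g))"

definition particle_solution ::
    "('h, 'f, 'b::complex_banach) mean_field_data \<Rightarrow> 'b \<Rightarrow> (real \<Rightarrow> 'b) \<Rightarrow> bool" where
  "particle_solution S f0 f \<longleftrightarrow> mild_solution (cspace S (npart S)) (dyn_graph S (npart S)) f0 f"

definition mean_field_solution ::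
    "('h, 'f, 'b::complex_banach) mean_field_data \<Rightarrow> 'b \<Rightarrow> (real \<Rightarrow> 'b) \<Rightarrow> bool" where
  "mean_field_solution S f0 f \<longleftrightarrow>
     continuous_on {0..} f \<and> (\<forall>t\<ge>0. f t \<in> cspace S 1) \<and>
     (\<forall>t\<ge>0. f t = semigroup0 S t f0 +
        integral {0..t} (\<lambda>s. semigroup0 S (t - s) (mf_op S (f s) (f s))))"

locale mean_field_system = completed_algebras S
  for S :: "('h::complex_hilbert, 'f::complex_hilbert, 'b::complex_banach) mean_field_data" +
  assumes npart_ge_1: "npart S \<ge> 1"
    and dom0_subset: "dom0 S \<subseteq> cspace S 1"
    and dom0_zero: "0 \<in> dom0 S"
    and dom0_add: "\<lbrakk>f \<in> dom0 S; g \<in> dom0 S\<rbrakk> \<Longrightarrow> f + g \<in> dom0 S"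
    and dom0_scale: "f \<in> dom0 S \<Longrightarrow> c *\<^sub>C f \<in> dom0 S"
    and kin0_linear: "clinear_on (dom0 S) (cspace S 1) (kin0 S)"
    and pot_bounded: "bounded_clinear_on (cspace S 2) (cspace S 2) (pot S)"
    and pot_symmetric: "\<lbrakk>x \<in> cspace S 2; symmetric S 2 x\<rbrakk> \<Longrightarrow> symmetric S 2 (pot S x)"
    \<comment> \<open>\<open>T\<^sub>i\<^sub>r\<close> is \<open>V\<close> acting on the slots \<open>i\<close> and \<open>r\<close>\<close>
    and pair_op_bounded: "\<lbrakk>1 \<le> i; i < r; r \<le> j\<rbrakk> \<Longrightarrow>
      bounded_clinear_on (cspace S j) (cspace S j) (pair_op S j i r) \<and>
      op_norm_on (cspace S j) (pair_op S j i r) \<le> pot_norm S"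
    and pair_op_2: "x \<in> cspace S 2 \<Longrightarrow> pair_op S 2 1 2 x = pot S x"
    and pair_op_place: "\<lbrakk>1 \<le> i; i < r; r \<le> j; j > 2; x \<in> cspace S 2; y \<in> cspace S (j - 2)\<rbrakk> \<Longrightarrow>
      pair_op S j i r (place S j [i, r] x y) = place S j [i, r] (pot S x) y"
    and semigroup0: "generates (cspace S 1) {(f, kin0 S f) | f. f \<in> dom0 S} (semigroup0 S)"
    and semigroup0_positive: "\<lbrakk>t \<ge> 0; f \<in> pos_cone S 1\<rbrakk> \<Longrightarrow> semigroup0 S t f \<in> pos_cone S 1"
    and semigroup0_isometric: "\<lbrakk>t \<ge> 0; f \<in> cspace S 1\<rbrakk> \<Longrightarrow> norm (semigroup0 S t f) = norm f"
    and semigroup: "j \<in> {1..npart S} \<Longrightarrow> generates (cspace S j) (dyn_graph S j) (semigroup S j)"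
    and semigroup_norm: "\<lbrakk>j \<in> {1..npart S}; t \<ge> 0\<rbrakk> \<Longrightarrow>
      op_norm_on (cspace S j) (semigroup S j t) = 1"
    and semigroup_positive: "\<lbrakk>t \<ge> 0; x \<in> pos_cone S (npart S)\<rbrakk> \<Longrightarrow>
      semigroup S (npart S) t x \<in> pos_cone S (npart S)"
    and semigroup_isometric: "\<lbrakk>t \<ge> 0; x \<in> cspace S (npart S)\<rbrakk> \<Longrightarrow>
      norm (semigroup S (npart S) t x) = norm x"
    and particle_solution_unique: "f0 \<in> cspace S (npart S) \<Longrightarrow>
      \<exists>f. particle_solution S f0 f \<and>
          (\<forall>g. particle_solution S f0 g \<longrightarrow> (\<forall>t\<ge>0. g t = f t))"
    and ell_kin0: "f \<in> dom0 S \<Longrightarrow> ell S 1 (kin0 S f) = 0"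
    and marginal_pair_op: "\<lbrakk>1 \<le> j; j < i; i < r; r \<le> npart S; x \<in> cspace S (npart S)\<rbrakk> \<Longrightarrow>
      marginal S j (npart S) (pair_op S (npart S) i r x) = 0"
    and mean_field_solution_unique: "\<lbrakk>f0 \<in> pos_cone S 1; norm f0 = 1\<rbrakk> \<Longrightarrow>
      \<exists>f. mean_field_solution S f0 f \<and>
          (\<forall>g. mean_field_solution S f0 g \<longrightarrow> (\<forall>t\<ge>0. g t = f t)) \<and>
          (\<forall>t\<ge>0. f t \<in> pos_cone S 1 \<and> norm (f t) = 1)"


section \<open>Correlation errors\<close>

text \<open>\<open>FN\<close> is the \<open>N\<close>-particle state and \<open>F\<close> the one-particle element.\<close>

definition corr_error :: "('h, 'f, 'b::complex_banach) mean_field_data \<Rightarrow> nat \<Rightarrow> 'b \<Rightarrow> 'b \<Rightarrow> 'b" where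
  "corr_error S j FN F = (\<Sum>K\<in>Pow {1..j}. (-1) ^ card K *\<^sub>R
     place S j (sorted_list_of_set ({1..j} - K))
       (marginal S (j - card K) (npart S) FN) (tpower S F (card K)))"

end

theory Submission imports Defs
begin

text \<open>
  Let \<open>R\<^sub>l\<close> trace out slot \<open>l\<close> and insert \<open>F\<close> there. Then \<open>E\<^sub>j = (1 - R\<^sub>1) \<cdots> (1 - R\<^sub>j) F\<^sub>j\<close>. Since the \<open>R\<^sub>l\<close> intertwine
  the free evolutions, no unbounded operator survives in the evolution of \<open>E\<^sub>j\<close>, and with \<open>e\<^sub>j = \<parallel>E\<^sub>j\<parallel>\<close>, \<open>v = \<parallel>V\<parallel>\<close>
  it gives, in the sense of Dini derivatives,
  \<open>e\<^sub>j' \<le> v (9 j e\<^sub>j + 2 j e\<^sub>j\<^sub>+\<^sub>1 + (j\<^sup>2/N) (9 e\<^sub>j\<^sub>-\<^sub>1 + 4 e\<^sub>j\<^sub>-\<^sub>2))\<close>.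
  The functions \<open>(3 C\<^sub>0 e\<^sup>5\<^sup>0\<^sup>v\<^sup>t j/\<surd>N)\<^sup>j\<close> form a supersolution of this hierarchy, which is closed at large \<open>j\<close> by the
  trivial bound \<open>e\<^sub>j \<le> 2\<^sup>j\<close>. Inserting the bound on \<open>e\<^sub>2\<close> into the inequality for \<open>e\<^sub>1\<close> gives \<open>e\<^sub>1 = O(1/N)\<close>, and
  \<open>\<parallel>F\<^sub>j - F\<^sup>\<otimes>\<^sup>j\<parallel> \<le> \<Sum>\<^sub>k\<^sub>\<ge>\<^sub>1 (j choose k) e\<^sub>k\<close> yields the claim.
\<close>

section \<open>Complex Hilbert spaces and operator square roots\<close>

text \<open>Three obstacles shape the argument. Both solutions are only mild, so \<open>E_j\<close>
  need not be differentiable, and for \<open>j > 1\<close> the given semigroups \<open>U_j\<close>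
  belong to \<open>K_0^j + T_j/N\<close>, not to \<open>K_0^j\<close>. Hence the quantity followed
  is \<open>E_j(t+h) - U_j(h) E_j(t)\<close>: its right difference quotient converges because the
  unbounded parts cancel and \<open>T_j/N\<close> is bounded. Since \<open>U_j\<close> contracts,
  right Dini bounds for the norms result. \<open>V\<close> is only known to map symmetric elements
  to symmetric ones, so it need not commute with the flip. Symmetry of \<open>F^N(t)\<close> follows
  from a Gronwall estimate for its distance to its permuted copies, which also bounds the
  commutators. The \<open>O(1)\<close> part of the collision term cancels against the mean field
  source only because \<open>V\<close> produces trace zero. This is read off from a pair of
  traced-out particles next to a third one, so \<open>N \<ge> 3\<close> is needed; small
  \<open>N\<close> fall under the trivial bound 2. On the supersolution the four coefficients add up
  to \<open>9 + 2*12 + 9 + 4 = 46\<close>, below its rate 50. The bound on \<open>e_2\<close>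
  squares the exponential, giving rate \<open>100 \<le> 2 C_1\<close>.\<close>

lemma bounded_bilinear_scaleC:
  "bounded_bilinear (scaleC :: complex \<Rightarrow> 'a::complex_normed_vector \<Rightarrow> 'a)"
proof
  fix r :: real and c :: complex and x :: 'a
  have "(r *\<^sub>R c) *\<^sub>C x = complex_of_real r *\<^sub>C c *\<^sub>C x"
    by (simp add: scaleC_scaleC scaleR_conv_of_real)
  then show "(r *\<^sub>R c) *\<^sub>C x = r *\<^sub>R c *\<^sub>C x"
    by (simp add: scaleC_of_real)
  have "c *\<^sub>C r *\<^sub>R x = c *\<^sub>C complex_of_real r *\<^sub>C x"
    by (simp add: scaleC_of_real)
  also have "\<dots> = complex_of_real r *\<^sub>C c *\<^sub>C x"
    by (simp add: scaleC_scaleC mult.commute)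
  finally show "c *\<^sub>C r *\<^sub>R x = r *\<^sub>R c *\<^sub>C x"
    by (simp add: scaleC_of_real)
next
  show "\<exists>K. \<forall>a (b::'a). norm (a *\<^sub>C b) \<le> norm a * norm b * K"
    by (rule exI[of _ 1]) (simp add: norm_scaleC)
qed (simp_all add: scaleC_add_left scaleC_add_right)

interpretation scaleC: bounded_bilinear "scaleC :: complex \<Rightarrow> 'a::complex_normed_vector \<Rightarrow> 'a"
  by (rule bounded_bilinear_scaleC)

lemma scaleC_one [simp]: "1 *\<^sub>C (x::'a::complex_normed_vector) = x"
  using scaleC_of_real[of 1 x] by simp

lemma scaleC_cancel: "c *\<^sub>C (x::'a::complex_normed_vector) = d *\<^sub>C x \<Longrightarrow> x \<noteq> 0 \<Longrightarrow> c = d"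
  using norm_scaleC[of "c - d" x] by (simp add: scaleC.diff_left)

text \<open>Spaces for different particle numbers are subsets of one ambient type, so every linear
  notion is relative to a set; this is the complex subspace predicate.\<close>

definition csub :: "'a::complex_normed_vector set \<Rightarrow> bool" where
  "csub X \<longleftrightarrow> 0 \<in> X \<and> (\<forall>x\<in>X. \<forall>y\<in>X. x + y \<in> X) \<and> (\<forall>c. \<forall>x\<in>X. c *\<^sub>C x \<in> X)"

lemma csub_UNIV [simp]: "csub UNIV"
  by (simp add: csub_def)

lemma csub_zero: "csub X \<Longrightarrow> 0 \<in> X"
  by (simp add: csub_def)

lemma csub_add: "csub X \<Longrightarrow> x \<in> X \<Longrightarrow> y \<in> X \<Longrightarrow> x + y \<in> X"
  by (simp add: csub_def)

lemma csub_scaleC: "csub X \<Longrightarrow> x \<in> X \<Longrightarrow> c *\<^sub>C x \<in> X"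
  by (simp add: csub_def)

lemma csub_scaleR: "csub X \<Longrightarrow> x \<in> X \<Longrightarrow> r *\<^sub>R x \<in> X"
  using csub_scaleC[of X x "complex_of_real r"] by (simp add: scaleC_of_real)

lemma csub_diff: "csub X \<Longrightarrow> x \<in> X \<Longrightarrow> y \<in> X \<Longrightarrow> x - y \<in> X"
  using csub_add[of X x "(-1) *\<^sub>R y"] csub_scaleR[of X y "-1"] by simp

lemma csub_sum: "csub X \<Longrightarrow> (\<And>i. i \<in> I \<Longrightarrow> f i \<in> X) \<Longrightarrow> sum f I \<in> X"
  by (induction I rule: infinite_finite_induct) (auto simp: csub_zero csub_add)

lemma csub_closure:
  assumes "csub X" shows "csub (closure X)"
  unfolding csub_def
proof (intro conjI ballI allI)
  show "0 \<in> closure X"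
    using assms closure_subset csub_zero by blast
  fix x y c assume "x \<in> closure X" "y \<in> closure X"
  then obtain f g where f: "\<And>n. f n \<in> X" "f \<longlonglongrightarrow> x" and g: "\<And>n. g n \<in> X" "g \<longlonglongrightarrow> y"
    by (auto simp: closure_sequential)
  show "x + y \<in> closure X"
    unfolding closure_sequential
    by (rule exI[of _ "\<lambda>n. f n + g n"]) (auto intro: tendsto_add f g csub_add assms)
  show "c *\<^sub>C x \<in> closure X"
    unfolding closure_sequential
    by (rule exI[of _ "\<lambda>n. c *\<^sub>C f n"]) (auto intro: scaleC.tendsto f csub_scaleC assms)
qed

lemma csub_cspan: "csub (cspan X)"
  unfolding csub_def
proof (intro conjI ballI allI)
  show "0 \<in> cspan X"
    by (auto simp: cspan_def intro!: exI[of _ 0])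
  fix x y c assume "x \<in> cspan X" "y \<in> cspan X"
  then obtain m d f m' d' f' where
    x: "x = (\<Sum>p<(m::nat). d p *\<^sub>C f p)" "\<forall>p<m. f p \<in> X" and
    y: "y = (\<Sum>p<(m'::nat). d' p *\<^sub>C f' p)" "\<forall>p<m'. f' p \<in> X"
    unfolding cspan_def mem_Collect_eq by blast
  define D where "D p = (if p < m then d p else d' (p - m))" for p
  define G where "G p = (if p < m then f p else f' (p - m))" for p
  have "(\<Sum>p<m + k. h p) = (\<Sum>p<m. h p) + (\<Sum>p<k. h (m + p))" for k and h :: "nat \<Rightarrow> 'a"
    by (induction k) (simp_all add: add.assoc)
  then have "(\<Sum>p<m + m'. D p *\<^sub>C G p) = x + y"
    by (simp add: x y D_def G_def)
  moreover have "\<forall>p<m + m'. G p \<in> X"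
    using x y by (auto simp: G_def)
  ultimately show "x + y \<in> cspan X"
    unfolding cspan_def by (intro CollectI exI[of _ "m + m'"] exI[of _ D] exI[of _ G]) simp
  have "c *\<^sub>C x = (\<Sum>p<m. (c * d p) *\<^sub>C f p)"
    by (simp add: x scaleC.sum_right scaleC_scaleC)
  then show "c *\<^sub>C x \<in> cspan X"
    unfolding cspan_def mem_Collect_eq using x(2)
    by (intro exI[of _ m] exI[of _ "\<lambda>p. c * d p"] exI[of _ f]) simp
qed

lemma cspan_superset: "X \<subseteq> cspan X"
proof
  fix x assume "x \<in> X"
  then show "x \<in> cspan X"
    unfolding cspan_def
    by (intro CollectI exI[of _ 1] exI[of _ "\<lambda>_. 1"] exI[of _ "\<lambda>_. x"]) auto
qed

lemma cspan_subset: "csub Y \<Longrightarrow> X \<subseteq> Y \<Longrightarrow> cspan X \<subseteq> Y"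
  unfolding cspan_def by (auto intro!: csub_sum csub_scaleC)

text \<open>The property need only behave well inside the closed span, so both side conditions
  concern the part of the closed span where it holds.\<close>

lemma closure_cspan_induct [consumes 1, case_names base csub closed]:
  assumes "x \<in> closure (cspan X)" and "\<And>x. x \<in> X \<Longrightarrow> P x"
    and "csub {x \<in> closure (cspan X). P x}" and "closed {x \<in> closure (cspan X). P x}"
  shows "P x"
proof -
  have "cspan X \<subseteq> {x \<in> closure (cspan X). P x}"
    using cspan_superset closure_subset assms(2) by (intro cspan_subset assms(3)) fast
  then have "closure (cspan X) \<subseteq> {x \<in> closure (cspan X). P x}"
    by (intro closure_minimal assms(4))
  then show ?thesis using assms(1) by blast
qed

lemma bounded_bilinear_cinner:
  "bounded_bilinear (cinner :: 'a::complex_inner \<Rightarrow> 'a \<Rightarrow> complex)"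
proof
  fix x y z :: 'a and r :: real
  show add_left: "cinner (x + y) z = cinner x z + cinner y z"
    by (metis cinner_add_right cinner_commute complex_cnj_add)
  show "cinner x (y + z) = cinner x y + cinner x z" by (rule cinner_add_right)
  show scale: "cinner x (r *\<^sub>R y) = r *\<^sub>R cinner x y" for x y :: 'a
    using cinner_scaleC_right[of x "complex_of_real r" y] by (simp add: scaleC_of_real scaleR_conv_of_real)
  have "cinner (r *\<^sub>R x) y = cnj (r *\<^sub>R cinner y x)"
    by (metis cinner_commute scale)
  also have "\<dots> = r *\<^sub>R cinner x y"
    by (simp add: cinner_commute[of x y])
  finally show "cinner (r *\<^sub>R x) y = r *\<^sub>R cinner x y" .
next
  have "norm (cinner x y) \<le> norm x * norm y" for x y :: 'a
  proof -
    define z where "z = cinner x y"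
    \<comment> \<open>Multiplying \<open>y\<close> by the conjugate of the inner product makes the
      latter real, so that the real Cauchy-Schwarz inequality applies.\<close>
    have "cnj z * z = of_real ((cmod z)\<^sup>2)"
      by (simp add: complex_norm_square[symmetric] mult.commute flip: complex_norm_square)
    then have "(cmod z)\<^sup>2 = Re (cinner x (cnj z *\<^sub>C y))"
      by (simp add: cinner_scaleC_right z_def)
    also have "\<dots> \<le> norm x * norm (cnj z *\<^sub>C y)"
      unfolding Re_cinner by (rule norm_cauchy_schwarz)
    also have "\<dots> = cmod z * (norm x * norm y)"
      by (simp add: norm_scaleC)
    finally show ?thesis
      unfolding z_def[symmetric] power2_eq_square
      by (metis mult_le_cancel_left_pos norm_ge_zero order_le_less mult_nonneg_nonneg)
  qed
  then show "\<exists>K. \<forall>a b::'a. norm (cinner a b) \<le> norm a * norm b * K"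
    by (intro exI[of _ 1]) simp
qed

interpretation cinner: bounded_bilinear "cinner :: 'a::complex_inner \<Rightarrow> 'a \<Rightarrow> complex"
  by (rule bounded_bilinear_cinner)

lemma cinner_scaleC_left: "cinner (c *\<^sub>C x) (y::'a::complex_inner) = cnj c * cinner x y"
  by (metis cinner_commute cinner_scaleC_right complex_cnj_mult)

lemma cinner_self: "cinner x x = complex_of_real ((norm (x::'a::complex_inner))\<^sup>2)"
proof -
  have "Im (cinner x x) = 0"
    using cinner_commute[of x x] by (metis Reals_cnj_iff complex_is_Real_iff)
  then show ?thesis
    by (simp add: complex_eq_iff Re_cinner power2_norm_eq_inner)
qed

lemma cinner_ext: "(\<And>y. cinner y (x::'a::complex_inner) = cinner y x') \<Longrightarrow> x = x'"
  using cinner_self[of "x - x'"] by (simp add: cinner.diff_right)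

text \<open>A complex subspace contains \<open>\<i> *\<^sub>C y\<close> along with \<open>y\<close>,
  and the real inner product with it is the missing imaginary part up to sign.\<close>

lemma inner_orth_cinner:
  assumes "csub M" "\<And>y. y \<in> M \<Longrightarrow> inner y (x::'a::complex_inner) = 0" "y \<in> M"
  shows "cinner y x = 0"
proof -
  have "Re (cinner (\<i> *\<^sub>C y) x) = 0"
    using assms by (simp add: Re_cinner csub_scaleC)
  moreover have "Re (cinner y x) = 0"
    using assms by (simp add: Re_cinner)
  ultimately show ?thesis
    by (simp add: cinner_scaleC_left complex_eq_iff)
qed

text \<open>Needed because operators on the tensor powers are operators on the ambient space that
  vanish on an orthogonal complement: vectors must be split accordingly.\<close>

lemma projection_exists:
  fixes M :: "'a::complex_hilbert set"
  assumes M: "csub M" "closed M"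
  shows "\<exists>p\<in>M. \<forall>y\<in>M. cinner y (x - p) = 0"
proof -
  define d where "d = infdist x M"
  have ne: "M \<noteq> {}" using M csub_zero by blast
  have d_le: "d \<le> norm (x - y)" if "y \<in> M" for y
    using infdist_le[OF that, of x] by (simp add: d_def dist_norm)
  have d0: "d \<ge> 0" by (simp add: d_def infdist_nonneg)
  have "\<exists>y\<in>M. norm (x - y) < d + 1 / Suc n" for n
  proof -
    have "infdist x M < d + 1 / Suc n" by (simp add: d_def)
    then show ?thesis
      unfolding infdist_notempty[OF ne] dist_norm[symmetric]
      by (subst (asm) cINF_less_iff) (auto simp: ne intro!: bdd_belowI2[of _ 0])
  qed
  then obtain p where p: "\<And>n. p n \<in> M" "\<And>n. norm (x - p n) < d + 1 / Suc n"
    by metis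
  \<comment> \<open>Parallelogram law for \<open>x - p m\<close> and \<open>x - p n\<close>; the
    midpoint lies in \<open>M\<close> and is therefore at distance at least \<open>d\<close> from
    \<open>x\<close>.\<close>
  have par: "(norm (p m - p n))\<^sup>2 \<le> 2 * (norm (x - p m))\<^sup>2 + 2 * (norm (x - p n))\<^sup>2 - 4 * d\<^sup>2" for m n
  proof -
    have "(1/2) *\<^sub>R (p m + p n) \<in> M"
      by (intro csub_scaleR csub_add p M)
    then have "d \<le> norm (x - (1/2) *\<^sub>R (p m + p n))" by (rule d_le)
    then have "d\<^sup>2 \<le> (norm (x - (1/2) *\<^sub>R (p m + p n)))\<^sup>2" using d0 by (rule power_mono)
    then show ?thesis
      unfolding power2_norm_eq_inner by (simp add: algebra_simps inner_commute)
  qed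
  have lim: "(\<lambda>n. norm (x - p n)) \<longlonglongrightarrow> d"
  proof (rule real_tendsto_sandwich)
    show "\<forall>\<^sub>F n in sequentially. d \<le> norm (x - p n)" using d_le p by simp
    show "\<forall>\<^sub>F n in sequentially. norm (x - p n) \<le> d + 1 / Suc n" using p(2) by (simp add: less_imp_le)
    have "(\<lambda>n. d + 1 / real (Suc n)) \<longlonglongrightarrow> d + 0"
      by (intro tendsto_add tendsto_const LIMSEQ_Suc lim_1_over_n)
    then show "(\<lambda>n. d + 1 / real (Suc n)) \<longlonglongrightarrow> d" by simp
  qed simp
  have "Cauchy p"
  proof (rule metric_CauchyI)
    fix e :: real assume e: "e > 0"
    have "(\<lambda>n. (norm (x - p n))\<^sup>2) \<longlonglongrightarrow> d\<^sup>2" by (intro tendsto_power lim)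
    moreover have "d\<^sup>2 < d\<^sup>2 + e\<^sup>2 / 8" using e by simp
    ultimately have "\<forall>\<^sub>F n in sequentially. (norm (x - p n))\<^sup>2 < d\<^sup>2 + e\<^sup>2 / 8"
      by (rule order_tendstoD)
    then obtain n0 where n0: "\<And>n. n \<ge> n0 \<Longrightarrow> (norm (x - p n))\<^sup>2 < d\<^sup>2 + e\<^sup>2 / 8"
      by (auto simp: eventually_sequentially)
    show "\<exists>M. \<forall>m\<ge>M. \<forall>n\<ge>M. dist (p m) (p n) < e"
    proof (intro exI[of _ n0] allI impI)
      fix m n assume "n0 \<le> m" "n0 \<le> n"
      then have "(norm (p m - p n))\<^sup>2 < e\<^sup>2"
        using par[of m n] n0[of m] n0[of n] zero_less_power[OF e, of 2] by linarith
      then show "dist (p m) (p n) < e"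
        using e by (simp add: dist_norm power_less_imp_less_base)
    qed
  qed
  then obtain q where q: "p \<longlonglongrightarrow> q"
    using Cauchy_convergent_iff convergent_def by blast
  have qM: "q \<in> M" using closed_sequentially[OF M(2)] p q by blast
  have "(\<lambda>n. norm (x - p n)) \<longlonglongrightarrow> norm (x - q)"
    by (intro tendsto_norm tendsto_diff tendsto_const q)
  then have nq: "norm (x - q) = d" using lim LIMSEQ_unique by blast
  have "inner y (x - q) = 0" if y: "y \<in> M" for y
  proof (cases "y = 0")
    case False
    \<comment> \<open>The minimiser of the distance from \<open>x\<close> to
      \<open>q + s *\<^sub>R y\<close> over real \<open>s\<close>; since \<open>q\<close> is already
      optimal, the gain must vanish.\<close>
    define s where "s = inner y (x - q) / (norm y)\<^sup>2"
    have "q + s *\<^sub>R y \<in> M" by (intro csub_add csub_scaleR M qM y)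
    then have "d\<^sup>2 \<le> (norm (x - (q + s *\<^sub>R y)))\<^sup>2" using d_le d0 by (simp add: power_mono)
    also have "\<dots> = (norm (x - q))\<^sup>2 - 2 * s * inner y (x - q) + s\<^sup>2 * (norm y)\<^sup>2"
      unfolding power2_norm_eq_inner by (simp add: algebra_simps inner_commute power2_eq_square)
    also have "s\<^sup>2 * (norm y)\<^sup>2 = s * inner y (x - q)"
      using False by (simp add: s_def power2_eq_square)
    finally have "s * inner y (x - q) \<le> 0" by (simp add: nq)
    then have "(inner y (x - q))\<^sup>2 \<le> 0"
      using False by (simp add: s_def power2_eq_square[symmetric] divide_le_0_iff)
    then show ?thesis by simp
  qed simp
  then show ?thesis
    using inner_orth_cinner[OF M(1), of "x - q"] qM by blast
qed

text \<open>For a unit vector \<open>x\<close> almost attaining the norm, \<open>D (D x)\<close> is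
  close to \<open>m\<^sup>2 *\<^sub>R x\<close>. Factoring
  \<open>D^2 - m^2 = (D - s m)(D + s m)\<close> shows that \<open>y s = D x + s m x\<close> is
  nearly an eigenvector for \<open>s m\<close>, provided it is not short; one of the signs
  \<open>s = 1, -1\<close> guarantees this.\<close>

lemma approx_eigenvector:
  fixes D :: "'a::complex_hilbert \<Rightarrow> 'a"
  assumes D: "bounded_linear D" and sa: "\<And>x y. inner (D x) y = inner x (D y)"
    and m: "m = onorm D" and e: "e > 0" and mpos: "m > 0"
  shows "\<exists>l z. \<bar>l\<bar> = m \<and> norm z = 1 \<and> norm (D z - l *\<^sub>R z) \<le> e"
proof -
  interpret D: bounded_linear D by fact
  have bd: "norm (D x) \<le> m * norm x" for x
    using onorm[OF D] by (simp add: m)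
  define r where "r = e * m"
  have r: "r > 0" using e mpos by (simp add: r_def)
  \<comment> \<open>The defect \<open>r^2 / (2 m^2)\<close> is what makes the later bound on the
    squared norm of \<open>w\<close> come out as exactly \<open>r^2\<close>; the maximum with 0 only
    keeps the root well behaved for large \<open>r\<close>.\<close>
  define m' where "m' = sqrt (max 0 (m\<^sup>2 - r\<^sup>2 / (2 * m\<^sup>2)))"
  have "m\<^sup>2 - r\<^sup>2 / (2 * m\<^sup>2) < m\<^sup>2" using mpos r by simp
  then have "m' < sqrt (m\<^sup>2)" unfolding m'_def using mpos by (intro real_sqrt_less_mono) simp
  then have m': "m' < m" using mpos by simp
  have "\<exists>x. norm (D x) > m' * norm x"
  proof (rule ccontr)
    assume "\<not> ?thesis"
    then have "onorm D \<le> m'" by (intro onorm_bound) (simp_all add: not_less m'_def)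
    then show False using m m' by simp
  qed
  then obtain x0 where x0: "norm (D x0) > m' * norm x0" by blast
  then have "x0 \<noteq> 0" by (auto simp: D.zero)
  define x where "x = x0 /\<^sub>R norm x0"
  have nx: "norm x = 1" using \<open>x0 \<noteq> 0\<close> by (simp add: x_def)
  have Dx: "norm (D x) > m'"
    using x0 \<open>x0 \<noteq> 0\<close> by (simp add: x_def D.scaleR field_simps)
  have m'0: "m' \<ge> 0" by (simp add: m'_def)
  have "(norm (D x))\<^sup>2 \<ge> m'\<^sup>2" using Dx m'0 by (intro power_mono) auto
  also have "m'\<^sup>2 = max 0 (m\<^sup>2 - r\<^sup>2 / (2 * m\<^sup>2))" unfolding m'_def by (rule real_sqrt_pow2) simp
  finally have Dx2: "(norm (D x))\<^sup>2 \<ge> m\<^sup>2 - r\<^sup>2 / (2 * m\<^sup>2)" by simp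
  define w where "w = D (D x) - m\<^sup>2 *\<^sub>R x"
  have "norm (D (D x)) \<le> m * (m * 1)"
    by (rule order_trans[OF bd[of "D x"]]) (use bd[of x] nx mpos in \<open>simp add: mult_left_mono\<close>)
  then have DDx: "(norm (D (D x)))\<^sup>2 \<le> (m * m)\<^sup>2" by (intro power_mono) auto
  have "(norm w)\<^sup>2 = (norm (D (D x)))\<^sup>2 - 2 * m\<^sup>2 * (norm (D x))\<^sup>2 + (m\<^sup>2)\<^sup>2 * (norm x)\<^sup>2"
  proof -
    have "(norm (u - c *\<^sub>R x))\<^sup>2 = (norm u)\<^sup>2 - 2 * c * inner u x + c\<^sup>2 * (norm x)\<^sup>2" for u and c :: real
      unfolding power2_norm_eq_inner
      by (simp add: inner_diff_left inner_diff_right inner_commute[of x u] power2_eq_square right_diff_distrib)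
    moreover have "inner (D (D x)) x = (norm (D x))\<^sup>2"
      by (simp add: sa power2_norm_eq_inner)
    ultimately show ?thesis by (simp add: w_def)
  qed
  also have "\<dots> \<le> (m * m)\<^sup>2 - 2 * m\<^sup>2 * (m\<^sup>2 - r\<^sup>2 / (2 * m\<^sup>2)) + (m\<^sup>2)\<^sup>2"
  proof -
    have "2 * m\<^sup>2 * (m\<^sup>2 - r\<^sup>2 / (2 * m\<^sup>2)) \<le> 2 * m\<^sup>2 * (norm (D x))\<^sup>2"
      by (rule mult_left_mono[OF Dx2]) simp
    then show ?thesis unfolding nx power_one mult_1_right using DDx by linarith
  qed
  also have "\<dots> = r\<^sup>2"
  proof -
    have "(m * m)\<^sup>2 - 2 * m\<^sup>2 * (m\<^sup>2 - q) + (m\<^sup>2)\<^sup>2 = 2 * m\<^sup>2 * q" for q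
      by (simp add: power2_eq_square right_diff_distrib)
    moreover have "2 * m\<^sup>2 * (r\<^sup>2 / (2 * m\<^sup>2)) = r\<^sup>2"
      using mpos by simp
    ultimately show ?thesis by simp
  qed
  finally have w: "norm w \<le> r" by (rule power2_le_imp_le) (use r in simp)
  define y where "y s = D x + (s * m) *\<^sub>R x" for s :: real
  \<comment> \<open>The two candidates differ by a vector of length \<open>2 m\<close>, so at least
    one has norm \<open>m\<close> or more.\<close>
  have "y 1 - y (-1) = (2 * m) *\<^sub>R x"
    using scaleR_left_distrib[of m m x] by (simp add: y_def)
  then have "2 * m = norm (y 1 - y (-1))"
    using mpos nx by simp
  also have "\<dots> \<le> norm (y 1) + norm (y (-1))" by (rule norm_triangle_ineq4)
  finally have "norm (y 1) \<ge> m \<or> norm (y (-1)) \<ge> m" by linarith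
  then obtain s where s: "\<bar>s\<bar> = 1" "norm (y s) \<ge> m" by (metis abs_minus_cancel abs_one)
  have ss: "s * s = 1" using s(1) by (metis abs_mult_self_eq mult_1)
  have "D (y s) - (s * m) *\<^sub>R y s = w"
  proof -
    have "(s * m) *\<^sub>R (s * m) *\<^sub>R x = m\<^sup>2 *\<^sub>R x"
      using ss by (simp add: power2_eq_square algebra_simps)
    then show ?thesis by (simp add: y_def w_def D.add D.scaleR scaleR_add_right)
  qed
  then have "D (y s /\<^sub>R norm (y s)) - (s * m) *\<^sub>R (y s /\<^sub>R norm (y s)) = w /\<^sub>R norm (y s)"
    by (metis D.scaleR scaleR_diff_right scaleR_left_commute)
  then have "norm (D (y s /\<^sub>R norm (y s)) - (s * m) *\<^sub>R (y s /\<^sub>R norm (y s))) = norm w / norm (y s)"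
    by (simp add: divide_inverse_commute)
  also have "\<dots> \<le> r / m" using w s mpos r by (intro frac_le) auto
  also have "\<dots> = e" using mpos by (simp add: r_def)
  finally have "norm (D (y s /\<^sub>R norm (y s)) - (s * m) *\<^sub>R (y s /\<^sub>R norm (y s))) \<le> e" .
  moreover have "norm (y s /\<^sub>R norm (y s)) = 1"
  proof -
    have "norm (y s) \<noteq> 0" using s mpos by linarith
    then show ?thesis by simp
  qed
  moreover have "\<bar>s * m\<bar> = m" using s mpos by (simp add: abs_mult)
  ultimately show ?thesis by blast
qed

lemma positive_op_bounded_linear:
  assumes "positive_op A" shows "bounded_linear A"
proof -
  have A: "A (x + y) = A x + A y" "A (c *\<^sub>C x) = c *\<^sub>C A x" for x y c
    using assms by (simp_all add: positive_op_def bounded_op_def bounded_clinear_on_def clinear_on_def)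
  obtain C where "norm (A x) \<le> C * norm x" for x
    using assms unfolding positive_op_def bounded_op_def bounded_clinear_on_def by auto
  then show ?thesis
    using A by (intro bounded_linear_intro[of _ C]) (simp_all add: mult.commute flip: scaleC_of_real)
qed

text \<open>Polarisation: the imaginary part of the quadratic form vanishes at \<open>x + y\<close>
  and at \<open>x + \<i> *\<^sub>C y\<close>.\<close>

lemma positive_op_selfadjoint:
  assumes "positive_op A" shows "cinner (A x) y = cinner x (A y)"
proof -
  interpret A: bounded_linear A using assms by (rule positive_op_bounded_linear)
  have sc: "A (c *\<^sub>C x) = c *\<^sub>C A x" for x c
    using assms by (simp add: positive_op_def bounded_op_def bounded_clinear_on_def clinear_on_def)
  have im: "Im (cinner x (A x)) = 0" for x
    using assms unfolding positive_op_def by (metis complex_is_Real_iff nonneg_Reals_subset_Reals subset_iff)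
  have 1: "Im (cinner x (A y)) + Im (cinner y (A x)) = 0" for x y
    using im[of "x + y"] im[of x] im[of y] by (simp add: A.add cinner.add_left cinner.add_right)
  have "Im (cinner x (A (\<i> *\<^sub>C y))) + Im (cinner (\<i> *\<^sub>C y) (A x)) = 0" by (rule 1)
  then have "Re (cinner x (A y)) = Re (cinner y (A x))"
    by (simp add: sc cinner_scaleC_right cinner_scaleC_left)
  then have "cinner x (A y) = cnj (cinner y (A x))"
    using 1[of x y] by (simp add: complex_eq_iff)
  then show ?thesis by (metis cinner_commute)
qed

text \<open>With \<open>D = P - Q\<close> and \<open>S = P + Q\<close> one has \<open>SD + DS = 0\<close>. On an approximate eigenvector of \<open>D\<close>
  for \<open>\<plusminus>\<parallel>D\<parallel>\<close> this makes \<open>\<langle>z, S z\<rangle>\<close>, hence \<open>\<langle>z, P z\<rangle>\<close>, \<open>\<langle>z, Q z\<rangle>\<close> and \<open>\<langle>z, D z\<rangle>\<close>, small.\<close>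

lemma positive_sqrt_unique:
  fixes P Q :: "'a::complex_hilbert \<Rightarrow> 'a"
  assumes P: "positive_op P" and Q: "positive_op Q" and eq: "P \<circ> P = Q \<circ> Q"
  shows "P = Q"
proof -
  interpret P: bounded_linear P using P by (rule positive_op_bounded_linear)
  interpret Q: bounded_linear Q using Q by (rule positive_op_bounded_linear)
  define D where "D x = P x - Q x" for x
  define S where "S x = P x + Q x" for x
  have D: "bounded_linear D" unfolding D_def
    by (intro bounded_linear_sub P.bounded_linear_axioms Q.bounded_linear_axioms)
  have S: "bounded_linear S" unfolding S_def
    by (intro bounded_linear_add P.bounded_linear_axioms Q.bounded_linear_axioms)
  interpret D: bounded_linear D by fact
  interpret S: bounded_linear S by fact
  have saP: "inner (P x) y = inner x (P y)" for x y
    using positive_op_selfadjoint[OF P, of x y] by (metis Re_cinner)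
  have saQ: "inner (Q x) y = inner x (Q y)" for x y
    using positive_op_selfadjoint[OF Q, of x y] by (metis Re_cinner)
  have posP: "inner x (P x) \<ge> 0" and posQ: "inner x (Q x) \<ge> 0" for x
    using P Q unfolding positive_op_def by (metis Re_cinner complex_nonneg_Reals_iff)+
  have saD: "inner (D x) y = inner x (D y)" and saS: "inner (S x) y = inner x (S y)" for x y
    by (simp_all add: D_def S_def inner_diff_left inner_diff_right inner_add_left inner_add_right saP saQ)
  have "P (P x) = Q (Q x)" for x using fun_cong[OF eq, of x] by simp
  then have anti: "S (D x) = - D (S x)" for x
    by (simp add: S_def D_def P.add Q.add P.diff Q.diff)
  define m where "m = onorm D"
  have "m = 0"
  proof (rule ccontr)
    assume "m \<noteq> 0"
    then have m: "m > 0" using onorm_pos_le[OF D] by (simp add: m_def)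
    define K where "K = onorm S"
    have K: "K \<ge> 0" using onorm_pos_le[OF S] by (simp add: K_def)
    \<comment> \<open>Chosen so that \<open>(K + m) * e\<close> is half of \<open>m\<^sup>2\<close>,
      which contradicts the estimate reached at the end.\<close>
    define e where "e = m\<^sup>2 / (2 * (K + m))"
    have e: "e > 0" using m K by (simp add: e_def)
    obtain l z where l: "\<bar>l\<bar> = m" and z: "norm z = 1" and Dz: "norm (D z - l *\<^sub>R z) \<le> e"
      using approx_eigenvector[OF D saD m_def e m] by blast
    define w where "w = D z - l *\<^sub>R z"
    have "inner (S z) (D z) = inner z (S (D z))" by (rule saS)
    also have "\<dots> = - inner (D z) (S z)" by (simp add: anti saD)
    finally have "inner (S z) (D z) = 0" by (simp add: inner_commute)
    moreover have "D z = w + l *\<^sub>R z" by (simp add: w_def)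
    ultimately have "l * inner z (S z) = - inner (S z) w"
      by (simp add: inner_add_right inner_commute)
    then have "m * \<bar>inner z (S z)\<bar> = \<bar>inner (S z) w\<bar>" by (metis abs_minus_cancel abs_mult l)
    also have "\<dots> \<le> norm (S z) * norm w" by (rule Cauchy_Schwarz_ineq2)
    also have "\<dots> \<le> K * e"
      using onorm[OF S, of z] z Dz K by (intro mult_mono) (auto simp: K_def w_def)
    finally have Sz: "m * \<bar>inner z (S z)\<bar> \<le> K * e" .
    have "\<bar>inner z (D z)\<bar> \<le> \<bar>inner z (S z)\<bar>"
      using posP[of z] posQ[of z] by (simp add: D_def S_def inner_diff_right inner_add_right)
    then have "m * \<bar>inner z (D z)\<bar> \<le> K * e" using Sz m by (meson mult_left_mono order_less_imp_le order_trans)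
    moreover have "inner z (D z) = inner z w + l"
      using z by (simp add: w_def inner_diff_right dot_square_norm)
    moreover have "\<bar>inner z w\<bar> \<le> e"
      using Cauchy_Schwarz_ineq2[of z w] z Dz by (simp add: w_def)
    ultimately have "m * (m - e) \<le> K * e"
      using l m by (smt (verit) mult_left_mono)
    then have "m\<^sup>2 \<le> (K + m) * e" by (simp add: algebra_simps power2_eq_square)
    also have "\<dots> = m\<^sup>2 / 2" using add_nonneg_pos[OF K m] by (simp add: e_def divide_simps)
    finally show False using m by simp
  qed
  then have "D x = 0" for x using onorm_eq_0[OF D] by (simp add: m_def)
  then show ?thesis by (auto simp: D_def fun_eq_iff)
qed

lemma adjoint_op_eqI:
  assumes "\<And>x y. cinner (A x) y = cinner x (B y)" shows "adjoint_op A = B"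
  unfolding adjoint_op_def
proof (rule the_equality)
  fix C assume "\<forall>x y. cinner (A x) y = cinner x (C y)"
  then show "C = B" using assms by (intro ext cinner_ext) metis
qed (use assms in blast)

text \<open>This makes the norm of a positive element equal to its trace; uniqueness of the positive
  root is what evaluates the \<open>THE\<close> in \<open>abs_op\<close>.\<close>

lemma abs_op_positive:
  assumes "positive_op A" shows "abs_op A = A"
proof -
  have "adjoint_op A = A"
    by (intro adjoint_op_eqI positive_op_selfadjoint assms)
  then show ?thesis
    unfolding abs_op_def using assms by (intro the_equality) (auto intro: positive_sqrt_unique)
qed

section \<open>Operators on tensor powers\<close>

lemma
  assumes "bounded_clinear_on X Y f"
  shows bcl_mem: "x \<in> X \<Longrightarrow> f x \<in> Y"
    and bcl_add: "x \<in> X \<Longrightarrow> y \<in> X \<Longrightarrow> f (x + y) = f x + f y"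
    and bcl_scaleC: "x \<in> X \<Longrightarrow> f (c *\<^sub>C x) = c *\<^sub>C f x"
  using assms by (auto simp: bounded_clinear_on_def clinear_on_def)

lemma bcl_scaleR: "bounded_clinear_on X Y f \<Longrightarrow> x \<in> X \<Longrightarrow> f (r *\<^sub>R x) = r *\<^sub>R f x"
  using bcl_scaleC[of X Y f x "complex_of_real r"] by (simp add: scaleC_of_real)

lemma bcl_zero: "bounded_clinear_on X Y f \<Longrightarrow> csub X \<Longrightarrow> f 0 = 0"
  using bcl_scaleR[of X Y f 0 0] by (simp add: csub_zero)

lemma bcl_diff: "bounded_clinear_on X Y f \<Longrightarrow> csub X \<Longrightarrow> x \<in> X \<Longrightarrow> y \<in> X \<Longrightarrow> f (x - y) = f x - f y"
  using bcl_add[of X Y f x "(-1) *\<^sub>R y"] bcl_scaleR[of X Y f y "-1"] csub_scaleR[of X y "-1"] by simp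

lemma bcl_sum:
  "bounded_clinear_on X Y f \<Longrightarrow> csub X \<Longrightarrow> (\<And>i. i \<in> I \<Longrightarrow> g i \<in> X) \<Longrightarrow> f (sum g I) = (\<Sum>i\<in>I. f (g i))"
  by (induction I rule: infinite_finite_induct) (auto simp: bcl_zero bcl_add csub_sum)

lemma bcl_bound:
  assumes "bounded_clinear_on X Y f" shows "\<exists>C\<ge>0. \<forall>x\<in>X. norm (f x) \<le> C * norm x"
proof -
  obtain C where C: "\<And>x. x \<in> X \<Longrightarrow> norm (f x) \<le> C * norm x"
    using assms by (auto simp: bounded_clinear_on_def)
  have "norm (f x) \<le> max C 0 * norm x" if "x \<in> X" for x
    by (rule order_trans[OF C[OF that]]) (simp add: mult_right_mono)
  then show ?thesis by (intro exI[of _ "max C 0"]) simp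
qed

lemma bcl_continuous_on:
  assumes "bounded_clinear_on X Y f" "csub X" shows "continuous_on X f"
proof -
  obtain C where C: "C \<ge> 0" "\<And>x. x \<in> X \<Longrightarrow> norm (f x) \<le> C * norm x"
    using bcl_bound[OF assms(1)] by blast
  have "C-lipschitz_on X f"
    using C assms by (intro lipschitz_onI) (auto simp: dist_norm bcl_diff[symmetric] csub_diff)
  then show ?thesis by (rule lipschitz_on_continuous_on)
qed

lemma bclI:
  assumes "\<And>x. x \<in> X \<Longrightarrow> f x \<in> Y" "\<And>x y. x \<in> X \<Longrightarrow> y \<in> X \<Longrightarrow> f (x + y) = f x + f y"
    "\<And>x c. x \<in> X \<Longrightarrow> f (c *\<^sub>C x) = c *\<^sub>C f x" "\<And>x. x \<in> X \<Longrightarrow> norm (f x) \<le> C * norm x"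
  shows "bounded_clinear_on X Y f"
  using assms unfolding bounded_clinear_on_def clinear_on_def by blast

lemma bcl_id: "bounded_clinear_on X X (\<lambda>x. x)"
  by (rule bclI[of _ _ _ 1]) auto

lemma bcl_compose:
  assumes f: "bounded_clinear_on X Y f" and g: "bounded_clinear_on Y Z g"
  shows "bounded_clinear_on X Z (\<lambda>x. g (f x))"
proof -
  obtain C where C: "C \<ge> 0" "\<And>x. x \<in> X \<Longrightarrow> norm (f x) \<le> C * norm x" using bcl_bound[OF f] by blast
  obtain D where D: "D \<ge> 0" "\<And>x. x \<in> Y \<Longrightarrow> norm (g x) \<le> D * norm x" using bcl_bound[OF g] by blast
  show ?thesis
  proof (rule bclI[of _ _ _ "D * C"])
    fix x assume x: "x \<in> X"
    have "norm (g (f x)) \<le> D * norm (f x)" by (rule D bcl_mem[OF f] x)+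
    also have "\<dots> \<le> D * (C * norm x)" by (intro mult_left_mono C x D)
    finally show "norm (g (f x)) \<le> D * C * norm x" by (simp add: mult.assoc)
  qed (use bcl_mem[OF f] bcl_mem[OF g] bcl_add[OF f] bcl_add[OF g] bcl_scaleC[OF f] bcl_scaleC[OF g] in auto)
qed

lemma bcl_plus:
  assumes f: "bounded_clinear_on X Y f" and g: "bounded_clinear_on X Y g" and Y: "csub Y"
  shows "bounded_clinear_on X Y (\<lambda>x. f x + g x)"
proof -
  obtain C where C: "C \<ge> 0" "\<And>x. x \<in> X \<Longrightarrow> norm (f x) \<le> C * norm x" using bcl_bound[OF f] by blast
  obtain D where D: "D \<ge> 0" "\<And>x. x \<in> X \<Longrightarrow> norm (g x) \<le> D * norm x" using bcl_bound[OF g] by blast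
  show ?thesis
  proof (rule bclI[of _ _ _ "C + D"])
    fix x assume x: "x \<in> X"
    show "norm (f x + g x) \<le> (C + D) * norm x"
      using norm_triangle_ineq[of "f x" "g x"] C(2)[OF x] D(2)[OF x] by (simp add: algebra_simps)
  qed (use f g in \<open>simp_all add: bcl_mem bcl_add bcl_scaleC csub_add Y scaleC_add_right\<close>)
qed

lemma bcl_scale:
  assumes f: "bounded_clinear_on X Y f" and Y: "csub Y"
  shows "bounded_clinear_on X Y (\<lambda>x. c *\<^sub>C f x)"
proof -
  obtain C where C: "C \<ge> 0" "\<And>x. x \<in> X \<Longrightarrow> norm (f x) \<le> C * norm x" using bcl_bound[OF f] by blast
  show ?thesis
  proof (rule bclI[of _ _ _ "cmod c * C"])
    fix x assume x: "x \<in> X"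
    show "norm (c *\<^sub>C f x) \<le> cmod c * C * norm x"
      using C(2)[OF x] by (simp add: norm_scaleC mult.assoc mult_left_mono)
  qed (use f in \<open>simp_all add: bcl_mem bcl_add bcl_scaleC csub_scaleC Y scaleC_add_right scaleC_scaleC mult.commute\<close>)
qed

lemma bcl_minus:
  assumes f: "bounded_clinear_on X Y f" and g: "bounded_clinear_on X Y g" and Y: "csub Y"
  shows "bounded_clinear_on X Y (\<lambda>x. f x - g x)"
  using bcl_plus[OF f bcl_scale[OF g Y, of "-1"] Y] by (simp add: scaleC.minus_left)

lemma bcl_zero_fun: "csub Y \<Longrightarrow> bounded_clinear_on X Y (\<lambda>x. 0)"
  by (rule bclI[of _ _ _ 0]) (auto simp: csub_zero scaleC.zero_right)

lemma bcl_sum_fun: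
  assumes "\<And>i. i \<in> I \<Longrightarrow> bounded_clinear_on X Y (f i)" and Y: "csub Y"
  shows "bounded_clinear_on X Y (\<lambda>x. \<Sum>i\<in>I. f i x)"
  using assms(1) by (induction I rule: infinite_finite_induct) (auto intro: bcl_zero_fun bcl_plus Y)

lemma op_norm_on_bound:
  assumes f: "bounded_clinear_on X Y f" and X: "csub X" and x: "x \<in> X"
  shows "norm (f x) \<le> op_norm_on X f * norm x"
proof (cases "x = 0")
  case False
  obtain C where C: "C \<ge> 0" "\<And>x. x \<in> X \<Longrightarrow> norm (f x) \<le> C * norm x" using bcl_bound[OF f] by blast
  have "bdd_above {norm (f x) |x. x \<in> X \<and> norm x \<le> 1}"
    by (intro bdd_aboveI[of _ C]) (auto intro: order_trans[OF C(2)] mult_left_le C(1))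
  then have "norm (f (x /\<^sub>R norm x)) \<le> op_norm_on X f"
    unfolding op_norm_on_def using False X x
    by (intro cSup_upper) (auto intro!: exI[of _ "x /\<^sub>R norm x"] csub_scaleR)
  then show ?thesis using False by (simp add: bcl_scaleR[OF f x] field_simps)
qed (simp add: bcl_zero[OF f X])

section \<open>Transpositions of slots and matrix elements\<close>

definition swp :: "nat \<Rightarrow> nat \<Rightarrow> nat \<Rightarrow> nat" where
  "swp k s p = (if p = k then s else if p = s then k else p)"

lemma swp_swp [simp]: "swp k s (swp k s p) = p"
  by (simp add: swp_def)

lemma swp_refl [simp]: "swp k k p = p"
  by (simp add: swp_def)

context hilbert_tensor_powers
begin

lemma csub_hspace: "csub (hspace S n)"
  unfolding hspace_def by (intro csub_closure csub_cspan)

lemma closed_hspace: "closed (hspace S n)"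
  by (simp add: hspace_def)

lemma hspace_induct [consumes 1, case_names etensor csub closed]:
  assumes "x \<in> hspace S n" "\<And>xs. length xs = n \<Longrightarrow> P (etensor S xs)"
    "csub {x \<in> hspace S n. P x}" "closed {x \<in> hspace S n. P x}"
  shows "P x"
  using assms(1)[unfolded hspace_def]
  by (rule closure_cspan_induct) (use assms(2-4) in \<open>auto simp: hspace_def\<close>)

lemma ops_bcl: "A \<in> ops S n \<Longrightarrow> bounded_clinear_on UNIV UNIV A"
  by (simp add: ops_def bounded_op_def)

lemma closed_zero_set:
  assumes "continuous_on UNIV f" "closed M" shows "closed {x \<in> M. f x = (0::'z::real_normed_vector)}"
proof -
  have "{x \<in> M. f x = 0} = M \<inter> f -` {0}" by auto
  then show ?thesis using assms closed_vimage[of "{0}" f] by (simp add: closed_Int)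
qed

text \<open>Elementary tensors are total in \<open>hspace S n\<close>, and on the orthogonal
  complement both operators vanish by definition of \<open>ops\<close>. All tensor identities for
  operators are checked through this.\<close>

lemma ops_eqI:
  assumes A: "A \<in> ops S n" and B: "B \<in> ops S n"
    and eq: "\<And>xs xs'. length xs = n \<Longrightarrow> length xs' = n \<Longrightarrow>
      cinner (etensor S xs') (A (etensor S xs)) = cinner (etensor S xs') (B (etensor S xs))"
  shows "A = B"
proof
  define D where "D x = A x - B x" for x
  have D: "bounded_clinear_on UNIV UNIV D"
    unfolding D_def by (intro bcl_minus ops_bcl[OF A] ops_bcl[OF B] csub_UNIV)
  have Dh: "D x \<in> hspace S n" for x
    unfolding D_def using A B by (intro csub_diff csub_hspace) (auto simp: ops_def)
  \<comment> \<open>The image lies in \<open>hspace S n\<close> and is orthogonal to all elementary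
    tensors, hence to itself.\<close>
  have 1: "D (etensor S xs) = 0" if xs: "length xs = n" for xs
  proof -
    define z where "z = D (etensor S xs)"
    have "cinner y z = 0" if "y \<in> hspace S n" for y
      using that
    proof (induction rule: hspace_induct)
      case (etensor xs')
      then show ?case using eq[OF xs] by (simp add: z_def D_def cinner.diff_right)
    next
      case csub
      show ?case
        using csub_hspace[of n] by (auto simp: csub_def cinner.add_left cinner_scaleC_left cinner.zero_left)
    next
      case closed
      show ?case
        by (intro closed_zero_set closed_hspace continuous_intros cinner.continuous_on)
    qed
    from this[of z] show ?thesis using Dh by (simp add: z_def cinner_self)
  qed
  have 2: "D x = 0" if "x \<in> hspace S n" for x
    using that
  proof (induction rule: hspace_induct)
    case csub
    show ?case using csub_hspace[of n] D
      by (auto simp: csub_def bcl_add bcl_scaleC bcl_zero scaleC.zero_right)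
  next
    case closed
    show ?case by (intro closed_zero_set closed_hspace bcl_continuous_on[OF D] csub_UNIV)
  qed (use 1 in auto)
  fix x
  obtain p where p: "p \<in> hspace S n" "\<forall>y\<in>hspace S n. cinner y (x - p) = 0"
    using projection_exists[OF csub_hspace closed_hspace] by blast
  have "D (x - p) = 0" using p A B by (simp add: D_def ops_def)
  then have "D x = D p" using bcl_diff[OF D csub_UNIV, of x p] by simp
  then show "A x = B x" using 2[OF p(1)] by (simp add: D_def)
qed

lemma op_swap_etensor':
  assumes "k \<in> {1..n}" "s \<in> {1..n}" "length xs = n"
  shows "\<exists>xs'. op_swap S n k s (etensor S xs) = etensor S xs' \<and> length xs' = n \<and>
    (\<forall>i\<in>{1..n}. xs' ! (i - 1) = xs ! (swp k s i - 1))"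
  using assms
  by (intro exI[of _ "xs[k - 1 := xs ! (s - 1), s - 1 := xs ! (k - 1)]"])
    (auto simp: op_swap_etensor swp_def nth_list_update)

lemma prod_lessThan_shift: "(\<Prod>i<n. f i) = (\<Prod>i=1..n. f (i - 1))" for f :: "nat \<Rightarrow> 'z::comm_monoid_mult"
  by (rule prod.reindex_bij_witness[of _ "\<lambda>i. i - 1" Suc]) auto

lemma prod_swp:
  "k \<in> {1..n} \<Longrightarrow> s \<in> {1..n} \<Longrightarrow> (\<Prod>i=1..n. f (swp k s i)) = (\<Prod>i=1..n. f i)"
  for f :: "nat \<Rightarrow> 'z::comm_monoid_mult"
  by (rule prod.reindex_bij_witness[of _ "swp k s" "swp k s"]) (auto simp: swp_def)

text \<open>On elementary tensors this is a reindexing of a product of inner products. Density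
  extends it in one argument and then in the other, and the projection onto
  \<open>hspace S n\<close> extends it to the ambient space, where \<open>adjoint_op\<close> is
  defined.\<close>

lemma op_swap_selfadjoint:
  assumes k: "k \<in> {1..n}" and s: "s \<in> {1..n}"
  shows "cinner (op_swap S n k s x) y = cinner x (op_swap S n k s y)"
proof -
  let ?w = "op_swap S n k s"
  have w: "bounded_clinear_on UNIV UNIV ?w" by (rule ops_bcl[OF op_swap_ops[OF k s]])
  have cw: "continuous_on UNIV ?w" by (intro bcl_continuous_on[OF w] csub_UNIV)
  note wlin = bcl_add[OF w] bcl_scaleC[OF w] bcl_zero[OF w csub_UNIV]
  have wh: "?w x \<in> hspace S n" for x using op_swap_ops[OF k s] by (auto simp: ops_def)
  have 1: "cinner (?w (etensor S xs)) (etensor S ys) = cinner (etensor S xs) (?w (etensor S ys))"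
    if xs: "length xs = n" and ys: "length ys = n" for xs ys
  proof -
    obtain xs' where xs': "?w (etensor S xs) = etensor S xs'" "length xs' = n"
      "\<forall>i\<in>{1..n}. xs' ! (i - 1) = xs ! (swp k s i - 1)"
      using op_swap_etensor'[OF k s xs] by blast
    obtain ys' where ys': "?w (etensor S ys) = etensor S ys'" "length ys' = n"
      "\<forall>i\<in>{1..n}. ys' ! (i - 1) = ys ! (swp k s i - 1)"
      using op_swap_etensor'[OF k s ys] by blast
    have "(\<Prod>i=1..n. cinner (xs' ! (i - 1)) (ys ! (i - 1)))
      = (\<Prod>i=1..n. cinner (xs ! (swp k s i - 1)) (ys ! (swp k s (swp k s i) - 1)))"
      using xs' by (intro prod.cong) auto
    also have "\<dots> = (\<Prod>i=1..n. cinner (xs ! (i - 1)) (ys ! (swp k s i - 1)))"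
      by (rule prod_swp[OF k s])
    also have "\<dots> = (\<Prod>i=1..n. cinner (xs ! (i - 1)) (ys' ! (i - 1)))"
      using ys' by (intro prod.cong) auto
    finally show ?thesis
      using xs ys xs' ys' by (simp add: cinner_etensor prod_lessThan_shift)
  qed
  have 2: "cinner (?w x) (etensor S ys) = cinner x (?w (etensor S ys))"
    if ys: "length ys = n" and "x \<in> hspace S n" for x ys
    using \<open>x \<in> hspace S n\<close>
  proof (induction rule: hspace_induct)
    case csub
    show ?case using csub_hspace[of n]
      by (auto simp: csub_def wlin cinner.add_left cinner_scaleC_left cinner.zero_left)
  next
    case closed
    have "closed {x \<in> hspace S n. cinner (?w x) (etensor S ys) - cinner x (?w (etensor S ys)) = 0}"
      by (intro closed_zero_set closed_hspace continuous_on_diff cinner.continuous_on cw continuous_on_id continuous_on_const)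
    then show ?case by simp
  qed (use 1 ys in auto)
  have 3: "cinner (?w x) y = cinner x (?w y)" if x: "x \<in> hspace S n" and "y \<in> hspace S n" for x y
    using \<open>y \<in> hspace S n\<close>
  proof (induction rule: hspace_induct)
    case csub
    show ?case using csub_hspace[of n]
      by (auto simp: csub_def wlin cinner.add_right cinner_scaleC_right cinner.zero_right)
  next
    case closed
    have "closed {y \<in> hspace S n. cinner (?w x) y - cinner x (?w y) = 0}"
      by (intro closed_zero_set closed_hspace continuous_on_diff cinner.continuous_on cw continuous_on_id continuous_on_const)
    then show ?case by simp
  qed (use 2 x in auto)
  obtain p where p: "p \<in> hspace S n" "\<forall>z\<in>hspace S n. cinner z (x - p) = 0"
    using projection_exists[OF csub_hspace closed_hspace] by blast
  obtain q where q: "q \<in> hspace S n" "\<forall>z\<in>hspace S n. cinner z (y - q) = 0"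
    using projection_exists[OF csub_hspace closed_hspace] by blast
  have wp: "?w x = ?w p" "?w y = ?w q"
    using p q op_swap_ops[OF k s] bcl_diff[OF w csub_UNIV, of x p] bcl_diff[OF w csub_UNIV, of y q]
    by (auto simp: ops_def)
  have "cinner (?w p) y = cinner (?w p) q"
    using q(2) wh[of p] by (simp add: cinner.diff_right)
  also have "\<dots> = cinner p (?w q)" by (rule 3[OF p(1) q(1)])
  also have "\<dots> = cinner x (?w q)"
  proof -
    have "cinner (?w q) x = cinner (?w q) p" using p(2) wh[of q] by (simp add: cinner.diff_right)
    then show ?thesis by (metis cinner_commute)
  qed
  finally show ?thesis by (simp add: wp)
qed

lemma adjoint_op_swap: "k \<in> {1..n} \<Longrightarrow> s \<in> {1..n} \<Longrightarrow> adjoint_op (op_swap S n k s) = op_swap S n k s"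
  by (intro adjoint_op_eqI op_swap_selfadjoint)

end

text \<open>The counterpart of \<open>ptens\<close> before completion, with the same bracketing:
  combinatorial identities are proved here by matrix elements and then transported by
  \<open>emb\<close> and continuity.\<close>

fun op_ptens ::
    "('h::complex_hilbert, 'f::complex_hilbert, 'b) mean_field_data \<Rightarrow> (nat \<Rightarrow> 'f \<Rightarrow> 'f) \<Rightarrow> nat \<Rightarrow> 'f \<Rightarrow> 'f" where
  "op_ptens S a 0 = (\<lambda>_. 0)"
| "op_ptens S a (Suc 0) = a 1"
| "op_ptens S a (Suc (Suc n)) = op_tensor S (Suc n) 1 (op_ptens S a (Suc n)) (a (Suc (Suc n)))"

lemma ptens_induct [consumes 1, case_names one Suc]:
  assumes "n \<ge> 1" "P (Suc 0)" "\<And>n. P (Suc n) \<Longrightarrow> P (Suc (Suc n))" shows "P n"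
proof -
  have "P (Suc m)" for m by (induction m) (use assms in auto)
  then show ?thesis using assms(1) by (cases n) auto
qed

context operator_algebras
begin

lemma op_ptens_alg:
  assumes "n \<ge> 1" "\<And>i. i \<in> {1..n} \<Longrightarrow> a i \<in> alg S 1" shows "op_ptens S a n \<in> alg S n"
  using assms
proof (induction n rule: ptens_induct)
  case (Suc n)
  then show ?case using alg_tensor[of "Suc n" 1 "op_ptens S a (Suc n)" "a (Suc (Suc n))"] by simp
qed auto

lemma op_tensor_matrix:
  assumes "j \<ge> 1" "m \<ge> 1" "A \<in> alg S j" "B \<in> alg S m" "length xs = j + m" "length xs' = j + m"
  shows "cinner (etensor S xs') (op_tensor S j m A B (etensor S xs)) =
    cinner (etensor S (take j xs')) (A (etensor S (take j xs))) *
    cinner (etensor S (drop j xs')) (B (etensor S (drop j xs)))"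
  using cinner_op_tensor[of j m A B "take j xs" "take j xs'" "drop j xs" "drop j xs'"] assms by simp

lemma op_ptens_matrix:
  assumes "n \<ge> 1" "\<And>i. i \<in> {1..n} \<Longrightarrow> a i \<in> alg S 1" "length xs = n" "length xs' = n"
  shows "cinner (etensor S xs') (op_ptens S a n (etensor S xs)) =
    (\<Prod>i=1..n. cinner (etensor S [xs' ! (i - 1)]) (a i (etensor S [xs ! (i - 1)])))"
  using assms
proof (induction n arbitrary: xs xs' rule: ptens_induct)
  case one
  then show ?case by (auto simp: length_Suc_conv)
next
  case (Suc n)
  have d: "drop (Suc n) ys = [ys ! Suc n]" if "length ys = Suc (Suc n)" for ys :: "'h list"
    using that Cons_nth_drop_Suc[of "Suc n" ys] by simp
  have "cinner (etensor S (take (Suc n) xs')) (op_ptens S a (Suc n) (etensor S (take (Suc n) xs))) =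
    (\<Prod>i=1..Suc n. cinner (etensor S [take (Suc n) xs' ! (i - 1)]) (a i (etensor S [take (Suc n) xs ! (i - 1)])))"
    using Suc.prems by (intro Suc.IH) auto
  also have "\<dots> = (\<Prod>i=1..Suc n. cinner (etensor S [xs' ! (i - 1)]) (a i (etensor S [xs ! (i - 1)])))"
    by (intro prod.cong) auto
  finally show ?case
    using Suc.prems op_tensor_matrix[of "Suc n" 1 "op_ptens S a (Suc n)" "a (Suc (Suc n))" xs xs']
      op_ptens_alg[of "Suc n" a] by (simp add: d)
qed

lemma alg_eqI:
  assumes "n \<ge> 1" "A \<in> alg S n" "B \<in> alg S n"
    "\<And>xs xs'. length xs = n \<Longrightarrow> length xs' = n \<Longrightarrow>
      cinner (etensor S xs') (A (etensor S xs)) = cinner (etensor S xs') (B (etensor S xs))"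
  shows "A = B"
  using assms alg_ops[OF assms(1)] by (intro ops_eqI[of _ n]) auto

text \<open>Self-adjointness moves the left swap onto the test vector; both vectors are then
  permuted and the product of matrix elements is reindexed.\<close>

lemma op_swap_conj_ptens:
  assumes n: "n \<ge> 1" and a: "\<And>i. i \<in> {1..n} \<Longrightarrow> a i \<in> alg S 1"
    and k: "k \<in> {1..n}" and s: "s \<in> {1..n}"
  shows "op_swap S n k s \<circ> op_ptens S a n \<circ> adjoint_op (op_swap S n k s) =
    op_ptens S (\<lambda>i. a (swp k s i)) n"
proof (rule alg_eqI[OF n])
  have sw: "swp k s i \<in> {1..n}" if "i \<in> {1..n}" for i using that k s by (auto simp: swp_def)
  show "op_swap S n k s \<circ> op_ptens S a n \<circ> adjoint_op (op_swap S n k s) \<in> alg S n"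
    by (intro alg_swap op_ptens_alg n a k s)
  show "op_ptens S (\<lambda>i. a (swp k s i)) n \<in> alg S n"
    by (intro op_ptens_alg n a sw)
  fix xs xs' :: "'h list" assume xs: "length xs = n" "length xs' = n"
  let ?w = "op_swap S n k s"
  obtain ys where ys: "?w (etensor S xs) = etensor S ys" "length ys = n"
    "\<forall>i\<in>{1..n}. ys ! (i - 1) = xs ! (swp k s i - 1)"
    using op_swap_etensor'[OF k s xs(1)] by blast
  obtain ys' where ys': "?w (etensor S xs') = etensor S ys'" "length ys' = n"
    "\<forall>i\<in>{1..n}. ys' ! (i - 1) = xs' ! (swp k s i - 1)"
    using op_swap_etensor'[OF k s xs(2)] by blast
  have "cinner (etensor S xs') ((?w \<circ> op_ptens S a n \<circ> adjoint_op ?w) (etensor S xs)) =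
    cinner (etensor S ys') (op_ptens S a n (etensor S ys))"
    by (simp add: adjoint_op_swap[OF k s] ys ys' flip: op_swap_selfadjoint[OF k s])
  also have "\<dots> = (\<Prod>i=1..n. cinner (etensor S [ys' ! (i - 1)]) (a i (etensor S [ys ! (i - 1)])))"
    by (intro op_ptens_matrix n a ys ys')
  also have "\<dots> = (\<Prod>i=1..n. cinner (etensor S [xs' ! (swp k s i - 1)])
      (a (swp k s (swp k s i)) (etensor S [xs ! (swp k s i - 1)])))"
    using ys ys' by (intro prod.cong) auto
  also have "\<dots> = (\<Prod>i=1..n. cinner (etensor S [xs' ! (i - 1)]) (a (swp k s i) (etensor S [xs ! (i - 1)])))"
    by (rule prod_swp[OF k s])
  also have "\<dots> = cinner (etensor S xs') (op_ptens S (\<lambda>i. a (swp k s i)) n (etensor S xs))"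
    by (intro op_ptens_matrix[symmetric] n a sw xs)
  finally show "cinner (etensor S xs') ((?w \<circ> op_ptens S a n \<circ> adjoint_op ?w) (etensor S xs)) =
    cinner (etensor S xs') (op_ptens S (\<lambda>i. a (swp k s i)) n (etensor S xs))" .
qed

text \<open>Associativity of the tensor product: the matrix elements of both sides are the same
  product, split after the \<open>j\<close>-th factor.\<close>

lemma op_tensor_ptens:
  assumes j: "j \<ge> 1" and m: "m \<ge> 1" and a: "\<And>i. i \<in> {1..j + m} \<Longrightarrow> a i \<in> alg S 1"
  shows "op_tensor S j m (op_ptens S a j) (op_ptens S (\<lambda>i. a (i + j)) m) = op_ptens S a (j + m)"
proof (rule alg_eqI[of "j + m"])
  have A: "op_ptens S a j \<in> alg S j" "op_ptens S (\<lambda>i. a (i + j)) m \<in> alg S m"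
    using j m by (auto intro!: op_ptens_alg a)
  then show "op_tensor S j m (op_ptens S a j) (op_ptens S (\<lambda>i. a (i + j)) m) \<in> alg S (j + m)"
    by (intro alg_tensor j m)
  show "op_ptens S a (j + m) \<in> alg S (j + m)"
    using j by (intro op_ptens_alg a) auto
  fix xs xs' :: "'h list" assume xs: "length xs = j + m" "length xs' = j + m"
  let ?f = "\<lambda>i. cinner (etensor S [xs' ! (i - 1)]) (a i (etensor S [xs ! (i - 1)]))"
  have 1: "cinner (etensor S (take j xs')) (op_ptens S a j (etensor S (take j xs))) = (\<Prod>i=1..j. ?f i)"
    using j xs a by (subst op_ptens_matrix) (auto intro!: prod.cong)
  have 2: "cinner (etensor S (drop j xs')) (op_ptens S (\<lambda>i. a (i + j)) m (etensor S (drop j xs))) =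
    (\<Prod>i=1..m. ?f (i + j))"
    using m xs a by (subst op_ptens_matrix) (auto intro!: prod.cong simp: add.commute)
  also have "\<dots> = (\<Prod>i=j+1..j+m. ?f i)"
    by (rule prod.reindex_bij_witness[of _ "\<lambda>i. i - j" "\<lambda>i. i + j"]) auto
  finally have 2: "cinner (etensor S (drop j xs')) (op_ptens S (\<lambda>i. a (i + j)) m (etensor S (drop j xs))) =
    (\<Prod>i=j+1..j+m. ?f i)" .
  have "(\<Prod>i=1..j. ?f i) * (\<Prod>i=j+1..j+m. ?f i) = (\<Prod>i=1..j+m. ?f i)"
    by (rule prod.ub_add_nat[symmetric]) simp
  also have "\<dots> = cinner (etensor S xs') (op_ptens S a (j + m) (etensor S xs))"
    using j xs a by (intro op_ptens_matrix[symmetric]) auto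
  finally show "cinner (etensor S xs') (op_tensor S j m (op_ptens S a j) (op_ptens S (\<lambda>i. a (i + j)) m) (etensor S xs)) =
    cinner (etensor S xs') (op_ptens S a (j + m) (etensor S xs))"
    using A j m xs by (simp only: op_tensor_matrix 1 2)
qed (use j in auto)

text \<open>Bilinearity of \<open>op_tensor\<close> follows from its matrix elements; the same
  argument gives the next three facts.\<close>

lemma op_tensor_add_left:
  assumes "j \<ge> 1" "m \<ge> 1" "A \<in> alg S j" "A' \<in> alg S j" "B \<in> alg S m"
  shows "op_tensor S j m (\<lambda>x. A x + A' x) B = (\<lambda>x. op_tensor S j m A B x + op_tensor S j m A' B x)"
  by (rule alg_eqI[of "j + m"])
    (use assms in \<open>simp_all add: alg_tensor alg_add op_tensor_matrix cinner.add_right distrib_right\<close>)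

lemma op_tensor_add_right:
  assumes "j \<ge> 1" "m \<ge> 1" "A \<in> alg S j" "B \<in> alg S m" "B' \<in> alg S m"
  shows "op_tensor S j m A (\<lambda>x. B x + B' x) = (\<lambda>x. op_tensor S j m A B x + op_tensor S j m A B' x)"
  by (rule alg_eqI[of "j + m"])
    (use assms in \<open>simp_all add: alg_tensor alg_add op_tensor_matrix cinner.add_right distrib_left\<close>)

lemma op_tensor_scale_left:
  assumes "j \<ge> 1" "m \<ge> 1" "A \<in> alg S j" "B \<in> alg S m"
  shows "op_tensor S j m (\<lambda>x. c *\<^sub>C A x) B = (\<lambda>x. c *\<^sub>C op_tensor S j m A B x)"
  by (rule alg_eqI[of "j + m"])
    (use assms in \<open>simp_all add: alg_tensor alg_scale op_tensor_matrix cinner_scaleC_right\<close>)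

lemma op_tensor_scale_right:
  assumes "j \<ge> 1" "m \<ge> 1" "A \<in> alg S j" "B \<in> alg S m"
  shows "op_tensor S j m A (\<lambda>x. c *\<^sub>C B x) = (\<lambda>x. c *\<^sub>C op_tensor S j m A B x)"
  by (rule alg_eqI[of "j + m"])
    (use assms in \<open>simp_all add: alg_tensor alg_scale op_tensor_matrix cinner_scaleC_right\<close>)

end

section \<open>The completed algebras and their marginals\<close>

context completed_algebras
begin

abbreviation X :: "nat \<Rightarrow> 'b set" where "X \<equiv> cspace S"
text \<open>All indices are constrained, not only those up to \<open>n\<close>, so that updates,
  shifts and permutations of a family are families without index bookkeeping.\<close>

abbreviation fam :: "(nat \<Rightarrow> 'b) \<Rightarrow> bool" where "fam a \<equiv> \<forall>i. a i \<in> X 1"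

lemma emb_zero: "n \<ge> 1 \<Longrightarrow> emb S n (\<lambda>x. 0) = 0"
  using emb_scale[of n "\<lambda>x. 0" 0] alg_zero[of n] by (simp add: scaleC.zero_left scaleC.zero_right)

lemma csub_emb: "n \<ge> 1 \<Longrightarrow> csub (emb S n ` alg S n)"
  unfolding csub_def
proof (intro conjI ballI allI)
  assume n: "n \<ge> 1"
  show "0 \<in> emb S n ` alg S n"
    using emb_zero[OF n] alg_zero[OF n] by (metis imageI)
  fix x y c assume "x \<in> emb S n ` alg S n" "y \<in> emb S n ` alg S n"
  then obtain A B where A: "A \<in> alg S n" "x = emb S n A" and B: "B \<in> alg S n" "y = emb S n B"
    by blast
  show "x + y \<in> emb S n ` alg S n"
    unfolding A(2) B(2) emb_add[OF n A(1) B(1), symmetric] by (rule imageI) (rule alg_add[OF n A(1) B(1)])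
  show "c *\<^sub>C x \<in> emb S n ` alg S n"
    unfolding A(2) emb_scale[OF n A(1), symmetric] by (rule imageI) (rule alg_scale[OF n A(1)])
qed

lemma csub_X: "n \<ge> 1 \<Longrightarrow> csub (X n)"
  unfolding cspace_def by (intro csub_closure csub_emb)

lemma closed_X: "closed (X n)"
  by (simp add: cspace_def)

lemma emb_X: "A \<in> alg S n \<Longrightarrow> emb S n A \<in> X n"
  unfolding cspace_def by (intro subsetD[OF closure_subset]) auto

lemma X_approx:
  assumes "x \<in> X n"
  obtains A where "\<And>k. A k \<in> alg S n" "(\<lambda>k. emb S n (A k)) \<longlonglongrightarrow> x"
proof -
  obtain f where f: "\<And>k. f k \<in> emb S n ` alg S n" "f \<longlonglongrightarrow> x"
    using assms unfolding cspace_def closure_sequential by blast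
  then have "\<forall>k. \<exists>A. A \<in> alg S n \<and> f k = emb S n A" by blast
  then obtain A where A: "\<And>k. A k \<in> alg S n" "\<And>k. f k = emb S n (A k)" by metis
  then have "f = (\<lambda>k. emb S n (A k))" by auto
  then show thesis using that[of A] A f by simp
qed

lemma X_tendsto:
  assumes "continuous_on (X n) f" "\<And>k. A k \<in> alg S n" "(\<lambda>k. emb S n (A k)) \<longlonglongrightarrow> x" "x \<in> X n"
  shows "(\<lambda>k. f (emb S n (A k))) \<longlonglongrightarrow> f x"
  by (rule continuous_on_tendsto_compose[OF assms(1,3,4)]) (simp add: emb_X assms(2))

text \<open>Transfer to the completion: continuous maps that agree on embedded operators agree.
  Every algebraic law of the extended operations comes from this, one argument at a time.\<close>

lemma X_eq:
  fixes f g :: "'b \<Rightarrow> 'z::t2_space"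
  assumes "x \<in> X n" "continuous_on (X n) f" "continuous_on (X n) g"
    "\<And>A. A \<in> alg S n \<Longrightarrow> f (emb S n A) = g (emb S n A)"
  shows "f x = g x"
proof -
  obtain A where A: "\<And>k. A k \<in> alg S n" "(\<lambda>k. emb S n (A k)) \<longlonglongrightarrow> x"
    using X_approx[OF assms(1)] by blast
  have "(\<lambda>k. f (emb S n (A k))) \<longlonglongrightarrow> f x" by (rule X_tendsto[OF assms(2) A assms(1)])
  moreover have "(\<lambda>k. f (emb S n (A k))) \<longlonglongrightarrow> g x"
    using X_tendsto[OF assms(3) A assms(1)] A by (simp add: assms(4))
  ultimately show ?thesis by (rule LIMSEQ_unique)
qed

lemma X_closed_mem:
  assumes "x \<in> X n" "continuous_on (X n) f" "closed C"
    "\<And>A. A \<in> alg S n \<Longrightarrow> f (emb S n A) \<in> C"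
  shows "f x \<in> C"
proof -
  obtain A where A: "\<And>k. A k \<in> alg S n" "(\<lambda>k. emb S n (A k)) \<longlonglongrightarrow> x"
    using X_approx[OF assms(1)] by blast
  have "(\<lambda>k. f (emb S n (A k))) \<longlonglongrightarrow> f x" by (rule X_tendsto[OF assms(2) A assms(1)])
  then show ?thesis by (rule closed_sequentially[OF assms(3), rotated]) (use A assms(4) in auto)
qed

lemma ell_add:
  assumes n: "n \<ge> 1" and x: "x \<in> X n" and y: "y \<in> X n"
  shows "ell S n (x + y) = ell S n x + ell S n y"
proof (rule X_eq[OF x])
  note c = ell_continuous[OF n]
  show "continuous_on (X n) (\<lambda>x. ell S n (x + y))"
    by (intro continuous_on_compose2[OF c] continuous_intros) (auto intro: csub_add csub_X n y)
  show "continuous_on (X n) (\<lambda>x. ell S n x + ell S n y)"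
    by (intro continuous_intros c)
  fix A assume A: "A \<in> alg S n"
  show "ell S n (emb S n A + y) = ell S n (emb S n A) + ell S n y"
  proof (rule X_eq[OF y])
    show "continuous_on (X n) (\<lambda>y. ell S n (emb S n A + y))"
      by (intro continuous_on_compose2[OF c] continuous_intros) (auto intro: csub_add csub_X n emb_X A)
    show "continuous_on (X n) (\<lambda>y. ell S n (emb S n A) + ell S n y)"
      by (intro continuous_intros c)
    show "ell S n (emb S n A + emb S n B) = ell S n (emb S n A) + ell S n (emb S n B)" if B: "B \<in> alg S n" for B
      using n A B by (simp add: emb_add[symmetric] ell_emb alg_add op_ell_add)
  qed
qed

lemma ell_scaleC:
  assumes n: "n \<ge> 1" and x: "x \<in> X n"
  shows "ell S n (c *\<^sub>C x) = c * ell S n x"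
proof (rule X_eq[OF x])
  note ec = ell_continuous[OF n]
  show "continuous_on (X n) (\<lambda>x. ell S n (c *\<^sub>C x))"
    by (intro continuous_on_compose2[OF ec] scaleC.continuous_on continuous_intros) (auto intro: csub_scaleC csub_X n)
  show "continuous_on (X n) (\<lambda>x. c * ell S n x)"
    by (intro continuous_intros ec)
  fix A assume A: "A \<in> alg S n"
  then show "ell S n (c *\<^sub>C emb S n A) = c * ell S n (emb S n A)"
    using n by (simp add: emb_scale[symmetric] ell_emb alg_scale op_ell_scale)
qed

lemma absv_X: "n \<ge> 1 \<Longrightarrow> x \<in> X n \<Longrightarrow> absv S n x \<in> X n"
  by (rule X_closed_mem[of x n]) (auto intro: absv_continuous closed_X simp: absv_emb emb_X alg_abs)

lemma norm_eq_ell_absv: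
  assumes n: "n \<ge> 1" and x: "x \<in> X n"
  shows "norm x = Re (ell S n (absv S n x))"
proof (rule X_eq[OF x])
  show "continuous_on (X n) (\<lambda>x. Re (ell S n (absv S n x)))"
    by (intro continuous_intros continuous_on_compose2[OF ell_continuous[OF n] absv_continuous[OF n]])
      (auto intro: absv_X n)
  show "continuous_on (X n) norm" by (intro continuous_intros)
qed (use n in \<open>simp add: absv_emb ell_emb alg_abs norm_emb op_norm1_def\<close>)

lemma ell_le_norm:
  assumes n: "n \<ge> 1" and x: "x \<in> X n" shows "cmod (ell S n x) \<le> norm x"
proof -
  have "norm x - cmod (ell S n x) \<in> {0..}"
    by (rule X_closed_mem[OF x])
      (use n in \<open>auto intro!: continuous_intros ell_continuous simp: norm_emb ell_emb op_ell_le\<close>)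
  then show ?thesis by simp
qed

text \<open>The functional is multiplied by a fixed vector so that it becomes a map to which
  \<open>bcl_ext\<close> applies.\<close>

lemma bcl_ell: "n \<ge> 1 \<Longrightarrow> bounded_clinear_on (X n) UNIV (\<lambda>x. ell S n x *\<^sub>C (y::'b))"
  by (rule bclI[of _ _ _ "norm y"])
    (auto simp: ell_add ell_scaleC scaleC_add_left scaleC_scaleC norm_scaleC mult.commute[of _ "norm y"]
      intro!: mult_left_mono ell_le_norm)

lemma pos_cone_X: "pos_cone S n \<subseteq> X n"
  unfolding pos_cone_def cspace_def by (intro closure_mono) auto

text \<open>A positive operator is its own absolute value, so norm and functional agree on it; both
  are continuous.\<close>

lemma ell_pos_cone:
  assumes n: "n \<ge> 1" and x: "x \<in> pos_cone S n"
  shows "ell S n x = of_real (norm x)"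
proof -
  obtain f where f: "\<And>k. f k \<in> emb S n ` {A \<in> alg S n. positive_op A}" "f \<longlonglongrightarrow> x"
    using x unfolding pos_cone_def closure_sequential by blast
  have "ell S n (f k) = of_real (norm (f k))" for k
  proof -
    obtain A where A: "A \<in> alg S n" "positive_op A" "f k = emb S n A" using f(1)[of k] by blast
    have "op_ell S n A \<in> \<real>" using op_ell_positive[OF n A(1,2)] nonneg_Reals_subset_Reals by blast
    then show ?thesis
      using n A by (simp add: norm_emb op_norm1_def abs_op_positive ell_emb)
  qed
  moreover have "(\<lambda>k. ell S n (f k)) \<longlonglongrightarrow> ell S n x"
  proof (rule continuous_on_tendsto_compose[OF ell_continuous[OF n] f(2)])
    show "x \<in> X n" using pos_cone_X x by blast
    have "f k \<in> X n" for k using f(1)[of k] by (auto intro: emb_X)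
    then show "\<forall>\<^sub>F k in sequentially. f k \<in> X n" by simp
  qed
  moreover have "(\<lambda>k. complex_of_real (norm (f k))) \<longlonglongrightarrow> of_real (norm x)"
    by (intro tendsto_intros f)
  ultimately show ?thesis using LIMSEQ_unique by auto
qed

lemma swap_conj_X: "k \<in> {1..n} \<Longrightarrow> s \<in> {1..n} \<Longrightarrow> x \<in> X n \<Longrightarrow> swap_conj S n k s x \<in> X n"
  by (rule X_closed_mem[of x n]) (auto intro!: swap_conj_continuous closed_X emb_X alg_swap simp: swap_conj_emb)

lemma op_swap_linear:
  assumes "k \<in> {1..n}" "s \<in> {1..n}"
  shows "op_swap S n k s (x + y) = op_swap S n k s x + op_swap S n k s y"
    and "op_swap S n k s (c *\<^sub>C x) = c *\<^sub>C op_swap S n k s x"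
  using bcl_add[OF ops_bcl[OF op_swap_ops[OF assms]], of x y] bcl_scaleC[OF ops_bcl[OF op_swap_ops[OF assms]], of x c]
  by auto

lemma
  assumes k: "k \<in> {1..n}" and s: "s \<in> {1..n}"
  shows bcl_swap: "bounded_clinear_on (X n) (X n) (swap_conj S n k s)"
    and norm_swap: "x \<in> X n \<Longrightarrow> norm (swap_conj S n k s x) = norm x"
proof -
  have n: "n \<ge> 1" using k by auto
  note c = swap_conj_continuous[OF k s]
  show norm: "norm (swap_conj S n k s x) = norm x" if x: "x \<in> X n" for x
    by (rule X_eq[OF x])
      (use k s n in \<open>auto intro!: continuous_intros c simp: swap_conj_emb norm_emb alg_swap op_norm1_swap simp del: o_apply\<close>)
  show "bounded_clinear_on (X n) (X n) (swap_conj S n k s)"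
  proof (rule bclI[of _ _ _ 1])
    fix x y assume x: "x \<in> X n" and y: "y \<in> X n"
    show "swap_conj S n k s (x + y) = swap_conj S n k s x + swap_conj S n k s y"
    proof (rule X_eq[OF x])
      show "continuous_on (X n) (\<lambda>x. swap_conj S n k s (x + y))"
        by (intro continuous_on_compose2[OF c] continuous_intros) (auto intro: csub_add csub_X n y)
      show "continuous_on (X n) (\<lambda>x. swap_conj S n k s x + swap_conj S n k s y)"
        by (intro continuous_intros c)
      fix A assume A: "A \<in> alg S n"
      show "swap_conj S n k s (emb S n A + y) = swap_conj S n k s (emb S n A) + swap_conj S n k s y"
      proof (rule X_eq[OF y])
        show "continuous_on (X n) (\<lambda>y. swap_conj S n k s (emb S n A + y))"
          by (intro continuous_on_compose2[OF c] continuous_intros) (auto intro: csub_add csub_X n emb_X A)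
        show "continuous_on (X n) (\<lambda>y. swap_conj S n k s (emb S n A) + swap_conj S n k s y)"
          by (intro continuous_intros c)
        fix B assume B: "B \<in> alg S n"
        have "op_swap S n k s \<circ> (\<lambda>x. A x + B x) \<circ> adjoint_op (op_swap S n k s) =
          (\<lambda>x. (op_swap S n k s \<circ> A \<circ> adjoint_op (op_swap S n k s)) x +
               (op_swap S n k s \<circ> B \<circ> adjoint_op (op_swap S n k s)) x)"
          by (simp add: fun_eq_iff op_swap_linear[OF k s])
        then show "swap_conj S n k s (emb S n A + emb S n B) =
            swap_conj S n k s (emb S n A) + swap_conj S n k s (emb S n B)"
          using n A B k s by (simp add: emb_add[symmetric] swap_conj_emb alg_add alg_swap del: o_apply)
      qed
    qed
  next
    fix x c' assume x: "x \<in> X n"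
    show "swap_conj S n k s (c' *\<^sub>C x) = c' *\<^sub>C swap_conj S n k s x"
    proof (rule X_eq[OF x])
      show "continuous_on (X n) (\<lambda>x. swap_conj S n k s (c' *\<^sub>C x))"
        by (intro continuous_on_compose2[OF c] scaleC.continuous_on continuous_intros) (auto intro: csub_scaleC csub_X n)
      show "continuous_on (X n) (\<lambda>x. c' *\<^sub>C swap_conj S n k s x)"
        by (intro scaleC.continuous_on continuous_intros c)
      fix A assume A: "A \<in> alg S n"
      have "op_swap S n k s \<circ> (\<lambda>x. c' *\<^sub>C A x) \<circ> adjoint_op (op_swap S n k s) =
        (\<lambda>x. c' *\<^sub>C (op_swap S n k s \<circ> A \<circ> adjoint_op (op_swap S n k s)) x)"
        by (simp add: fun_eq_iff op_swap_linear[OF k s])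
      then show "swap_conj S n k s (c' *\<^sub>C emb S n A) = c' *\<^sub>C swap_conj S n k s (emb S n A)"
        using n A k s by (simp add: emb_scale[symmetric] swap_conj_emb alg_scale alg_swap del: o_apply)
    qed
  qed (auto simp: norm swap_conj_X[OF k s])
qed

lemma tens_continuous_left:
  assumes "j \<ge> 1" "m \<ge> 1" "y \<in> X m" shows "continuous_on (X j) (\<lambda>x. tens S j m x y)"
  using continuous_on_compose2[OF tens_continuous[OF assms(1,2)], of "X j" "\<lambda>x. (x, y)"] assms(3)
  by (force intro: continuous_intros)

lemma tens_continuous_right:
  assumes "j \<ge> 1" "m \<ge> 1" "x \<in> X j" shows "continuous_on (X m) (\<lambda>y. tens S j m x y)"
  using continuous_on_compose2[OF tens_continuous[OF assms(1,2)], of "X m" "\<lambda>y. (x, y)"] assms(3)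
  by (force intro: continuous_intros)

lemma tens_X:
  assumes "j \<ge> 1" "m \<ge> 1" "x \<in> X j" "y \<in> X m" shows "tens S j m x y \<in> X (j + m)"
proof (rule X_closed_mem[OF assms(3) tens_continuous_left[OF assms(1,2,4)] closed_X])
  fix A assume A: "A \<in> alg S j"
  show "tens S j m (emb S j A) y \<in> X (j + m)"
    by (rule X_closed_mem[OF assms(4) tens_continuous_right[OF assms(1,2) emb_X[OF A]] closed_X])
      (use assms A in \<open>auto simp: tens_emb intro!: emb_X alg_tensor\<close>)
qed

lemma norm_tens:
  assumes "j \<ge> 1" "m \<ge> 1" "x \<in> X j" "y \<in> X m" shows "norm (tens S j m x y) = norm x * norm y"
proof (rule X_eq[OF assms(3)])
  show "continuous_on (X j) (\<lambda>x. norm (tens S j m x y))"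
    by (intro continuous_intros tens_continuous_left assms)
  show "continuous_on (X j) (\<lambda>x. norm x * norm y)"
    by (intro continuous_intros)
  fix A assume A: "A \<in> alg S j"
  show "norm (tens S j m (emb S j A) y) = norm (emb S j A) * norm y"
    by (rule X_eq[OF assms(4)])
      (use assms A in \<open>auto intro!: continuous_intros tens_continuous_right emb_X simp: tens_emb norm_emb alg_tensor op_norm1_tensor\<close>)
qed

lemma ell_tens:
  assumes "j \<ge> 1" "m \<ge> 1" "x \<in> X j" "y \<in> X m"
  shows "ell S (j + m) (tens S j m x y) = ell S j x * ell S m y"
proof (rule X_eq[OF assms(3)])
  have c: "continuous_on (X (j + m)) (ell S (j + m))" using assms by (intro ell_continuous) auto
  show "continuous_on (X j) (\<lambda>x. ell S (j + m) (tens S j m x y))"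
    by (intro continuous_on_compose2[OF c] tens_continuous_left assms) (auto intro: tens_X assms)
  show "continuous_on (X j) (\<lambda>x. ell S j x * ell S m y)"
    by (intro continuous_intros ell_continuous assms)
  fix A assume A: "A \<in> alg S j"
  show "ell S (j + m) (tens S j m (emb S j A) y) = ell S j (emb S j A) * ell S m y"
  proof (rule X_eq[OF assms(4)])
    show "continuous_on (X m) (\<lambda>y. ell S (j + m) (tens S j m (emb S j A) y))"
      by (intro continuous_on_compose2[OF c] tens_continuous_right assms emb_X A) (auto intro: tens_X assms emb_X A)
    show "continuous_on (X m) (\<lambda>y. ell S j (emb S j A) * ell S m y)"
      by (intro continuous_intros ell_continuous assms)
  qed (use assms A in \<open>simp add: tens_emb ell_emb alg_tensor op_ell_tensor\<close>)
qed

lemma bcl_tens_left: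
  assumes j: "j \<ge> 1" and m: "m \<ge> 1" and y: "y \<in> X m"
  shows "bounded_clinear_on (X j) (X (j + m)) (\<lambda>x. tens S j m x y)"
proof (rule bclI[of _ _ _ "norm y"])
  have yl: "continuous_on (X j) (\<lambda>x. tens S j m x y)" if "y \<in> X m" for y
    by (intro tens_continuous_left j m that)
  note cr = tens_continuous_right[OF j m]
  fix x assume x: "x \<in> X j"
  show "tens S j m x y \<in> X (j + m)" by (intro tens_X j m x y)
  show "norm (tens S j m x y) \<le> norm y * norm x" by (simp add: norm_tens[OF j m x y])
  fix c
  show "tens S j m (c *\<^sub>C x) y = c *\<^sub>C tens S j m x y"
  proof (rule X_eq[OF x])
    show "continuous_on (X j) (\<lambda>x. tens S j m (c *\<^sub>C x) y)"
      by (intro continuous_on_compose2[OF yl[OF y]] scaleC.continuous_on continuous_intros) (auto intro: csub_scaleC csub_X j)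
    show "continuous_on (X j) (\<lambda>x. c *\<^sub>C tens S j m x y)"
      by (intro scaleC.continuous_on continuous_intros yl y)
    fix A assume A: "A \<in> alg S j"
    show "tens S j m (c *\<^sub>C emb S j A) y = c *\<^sub>C tens S j m (emb S j A) y"
      by (rule X_eq[OF y])
        (use j m A in \<open>auto intro!: scaleC.continuous_on continuous_intros cr emb_X csub_scaleC csub_X
          simp: emb_scale[symmetric] tens_emb alg_scale op_tensor_scale_left alg_tensor\<close>)
  qed
  fix x' assume x': "x' \<in> X j"
  show "tens S j m (x + x') y = tens S j m x y + tens S j m x' y"
  proof (rule X_eq[OF y])
    show "continuous_on (X m) (\<lambda>y. tens S j m (x + x') y)"
      by (intro cr csub_add csub_X j x x')
    show "continuous_on (X m) (\<lambda>y. tens S j m x y + tens S j m x' y)"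
      by (intro continuous_intros cr x x')
    fix B assume B: "B \<in> alg S m"
    note y = emb_X[OF B]
    show "tens S j m (x + x') (emb S m B) = tens S j m x (emb S m B) + tens S j m x' (emb S m B)"
    proof (rule X_eq[OF x])
      show "continuous_on (X j) (\<lambda>x. tens S j m (x + x') (emb S m B))"
        by (intro continuous_on_compose2[OF yl[OF y]] continuous_intros) (auto intro: csub_add csub_X j x')
      show "continuous_on (X j) (\<lambda>x. tens S j m x (emb S m B) + tens S j m x' (emb S m B))"
        by (intro continuous_intros yl y)
      fix A assume A: "A \<in> alg S j"
      show "tens S j m (emb S j A + x') (emb S m B) = tens S j m (emb S j A) (emb S m B) + tens S j m x' (emb S m B)"
      proof (rule X_eq[OF x'])
        show "continuous_on (X j) (\<lambda>x'. tens S j m (emb S j A + x') (emb S m B))"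
          by (intro continuous_on_compose2[OF yl[OF y]] continuous_intros) (auto intro: csub_add csub_X j emb_X A)
        show "continuous_on (X j) (\<lambda>x'. tens S j m (emb S j A) (emb S m B) + tens S j m x' (emb S m B))"
          by (intro continuous_intros yl y)
      qed (use j m A B in \<open>simp add: emb_add[symmetric] tens_emb alg_add op_tensor_add_left alg_tensor\<close>)
    qed
  qed
qed

lemma bcl_tens_right:
  assumes j: "j \<ge> 1" and m: "m \<ge> 1" and x: "x \<in> X j"
  shows "bounded_clinear_on (X m) (X (j + m)) (\<lambda>y. tens S j m x y)"
proof (rule bclI[of _ _ _ "norm x"])
  note cl = tens_continuous_left[OF j m]
  have cr: "continuous_on (X m) (\<lambda>y. tens S j m x y)" if "x \<in> X j" for x
    by (intro tens_continuous_right j m that)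
  fix y assume y: "y \<in> X m"
  show "tens S j m x y \<in> X (j + m)" by (intro tens_X j m x y)
  show "norm (tens S j m x y) \<le> norm x * norm y" by (simp add: norm_tens[OF j m x y])
  fix c
  show "tens S j m x (c *\<^sub>C y) = c *\<^sub>C tens S j m x y"
  proof (rule X_eq[OF y])
    show "continuous_on (X m) (\<lambda>y. tens S j m x (c *\<^sub>C y))"
      by (intro continuous_on_compose2[OF cr[OF x]] scaleC.continuous_on continuous_intros) (auto intro: csub_scaleC csub_X m)
    show "continuous_on (X m) (\<lambda>y. c *\<^sub>C tens S j m x y)"
      by (intro scaleC.continuous_on continuous_intros cr x)
    fix B assume B: "B \<in> alg S m"
    show "tens S j m x (c *\<^sub>C emb S m B) = c *\<^sub>C tens S j m x (emb S m B)"
      by (rule X_eq[OF x])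
        (use j m B in \<open>auto intro!: scaleC.continuous_on continuous_intros cl emb_X csub_scaleC csub_X
          simp: emb_scale[symmetric] tens_emb alg_scale op_tensor_scale_right alg_tensor\<close>)
  qed
  fix y' assume y': "y' \<in> X m"
  show "tens S j m x (y + y') = tens S j m x y + tens S j m x y'"
  proof (rule X_eq[OF x])
    show "continuous_on (X j) (\<lambda>x. tens S j m x (y + y'))"
      by (intro cl csub_add csub_X m y y')
    show "continuous_on (X j) (\<lambda>x. tens S j m x y + tens S j m x y')"
      by (intro continuous_intros cl y y')
    fix A assume A: "A \<in> alg S j"
    note x = emb_X[OF A]
    show "tens S j m (emb S j A) (y + y') = tens S j m (emb S j A) y + tens S j m (emb S j A) y'"
    proof (rule X_eq[OF y])
      show "continuous_on (X m) (\<lambda>y. tens S j m (emb S j A) (y + y'))"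
        by (intro continuous_on_compose2[OF cr[OF x]] continuous_intros) (auto intro: csub_add csub_X m y')
      show "continuous_on (X m) (\<lambda>y. tens S j m (emb S j A) y + tens S j m (emb S j A) y')"
        by (intro continuous_intros cr x)
      fix B assume B: "B \<in> alg S m"
      show "tens S j m (emb S j A) (emb S m B + y') = tens S j m (emb S j A) (emb S m B) + tens S j m (emb S j A) y'"
      proof (rule X_eq[OF y'])
        show "continuous_on (X m) (\<lambda>y'. tens S j m (emb S j A) (emb S m B + y'))"
          by (intro continuous_on_compose2[OF cr[OF x]] continuous_intros) (auto intro: csub_add csub_X m emb_X B)
        show "continuous_on (X m) (\<lambda>y'. tens S j m (emb S j A) (emb S m B) + tens S j m (emb S j A) y')"
          by (intro continuous_intros cr x)
      qed (use j m A B in \<open>simp add: emb_add[symmetric] tens_emb alg_add op_tensor_add_right alg_tensor\<close>)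
    qed
  qed
qed

section \<open>Elementary tensors in the completion\<close>

lemma ptens_cong:
  assumes "\<And>i. i \<in> {1..n} \<Longrightarrow> a i = b i" shows "ptens S a n = ptens S b n"
proof (cases "n = 0")
  case False
  then have "n \<ge> 1" by simp
  then show ?thesis using assms by (induction n rule: ptens_induct) auto
qed simp

lemma ptens_X:
  assumes "n \<ge> 1" "\<And>i. i \<in> {1..n} \<Longrightarrow> a i \<in> X 1" shows "ptens S a n \<in> X n"
  using assms
proof (induction n rule: ptens_induct)
  case (Suc n)
  then show ?case using tens_X[of "Suc n" 1 "ptens S a (Suc n)" "a (Suc (Suc n))"] by simp
qed simp

lemma ptens_emb:
  assumes "n \<ge> 1" "\<And>i. A i \<in> alg S 1" shows "ptens S (\<lambda>i. emb S 1 (A i)) n = emb S n (op_ptens S A n)"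
  using assms(1)
proof (induction n rule: ptens_induct)
  case (Suc n)
  then show ?case
    using tens_emb[of "Suc n" 1 "op_ptens S A (Suc n)" "A (Suc (Suc n))"] op_ptens_alg[of "Suc n" A] assms(2) by simp
qed simp

lemma ptens_tendsto:
  assumes "n \<ge> 1" "\<And>i k. a k i \<in> X 1" "fam b" "\<And>i. (\<lambda>k. a k i) \<longlonglongrightarrow> b i"
  shows "(\<lambda>k. ptens S (a k) n) \<longlonglongrightarrow> ptens S b n"
  using assms(1)
proof (induction n rule: ptens_induct)
  case one
  show ?case using assms(4) by simp
next
  case (Suc n)
  have "(\<lambda>k. (\<lambda>(x, y). tens S (Suc n) 1 x y) (ptens S (a k) (Suc n), a k (Suc (Suc n)))) \<longlonglongrightarrow>
      (\<lambda>(x, y). tens S (Suc n) 1 x y) (ptens S b (Suc n), b (Suc (Suc n)))"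
    by (rule continuous_on_tendsto_compose[OF tens_continuous _ _ always_eventually])
      (use assms in \<open>auto intro!: tendsto_Pair Suc ptens_X simp del: ptens.simps\<close>)
  then show ?case by simp
qed

lemma fam_approx:
  assumes "fam a"
  obtains A where "\<And>i k. A k i \<in> alg S 1" "\<And>i. (\<lambda>k. emb S 1 (A k i)) \<longlonglongrightarrow> a i"
proof -
  have "\<forall>i. \<exists>A. (\<forall>k. A k \<in> alg S 1) \<and> (\<lambda>k. emb S 1 (A k)) \<longlonglongrightarrow> a i"
    using assms X_approx[of _ 1] by metis
  then obtain A where "\<And>i k. A i k \<in> alg S 1" "\<And>i. (\<lambda>k. emb S 1 (A i k)) \<longlonglongrightarrow> a i" by metis
  then show thesis using that[of "\<lambda>k i. A i k"] by blast
qed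

text \<open>Each factor is approximated by embedded operators, for which the identity is
  \<open>op_swap_conj_ptens\<close>; both sides are continuous in the factors.\<close>

lemma swap_ptens:
  assumes a: "fam a" and k: "k \<in> {1..n}" and s: "s \<in> {1..n}"
  shows "swap_conj S n k s (ptens S a n) = ptens S (\<lambda>i. a (swp k s i)) n"
proof -
  have n: "n \<ge> 1" using k by auto
  obtain A where A: "\<And>i k. A k i \<in> alg S 1" "\<And>i. (\<lambda>k. emb S 1 (A k i)) \<longlonglongrightarrow> a i"
    using fam_approx[OF a] by blast
  have p: "ptens S (\<lambda>i. emb S 1 (A p i)) n \<in> X n" for p by (intro ptens_X n emb_X A)
  have "(\<lambda>p. swap_conj S n k s (ptens S (\<lambda>i. emb S 1 (A p i)) n)) \<longlonglongrightarrow> swap_conj S n k s (ptens S a n)"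
    by (rule continuous_on_tendsto_compose[OF swap_conj_continuous[OF k s]])
      (use p a A n in \<open>auto intro!: ptens_tendsto ptens_X emb_X\<close>)
  moreover have "swap_conj S n k s (ptens S (\<lambda>i. emb S 1 (A p i)) n) = ptens S (\<lambda>i. emb S 1 (A p (swp k s i))) n" for p
  proof -
    have 1: "op_ptens S (A p) n \<in> alg S n" by (intro op_ptens_alg n A)
    have 2: "op_swap S n k s \<circ> op_ptens S (A p) n \<circ> adjoint_op (op_swap S n k s) =
        op_ptens S (\<lambda>i. A p (swp k s i)) n"
      by (intro op_swap_conj_ptens n A k s)
    show ?thesis
      unfolding ptens_emb[OF n, of "A p", OF A(1)] ptens_emb[OF n, of "\<lambda>i. A p (swp k s i)", OF A(1)]
        swap_conj_emb[OF 1 k s] 2 ..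
  qed
  moreover have "(\<lambda>p. ptens S (\<lambda>i. emb S 1 (A p (swp k s i))) n) \<longlonglongrightarrow> ptens S (\<lambda>i. a (swp k s i)) n"
    using a A n by (intro ptens_tendsto) (auto intro: emb_X)
  ultimately show ?thesis using LIMSEQ_unique by auto
qed

lemma tens_ptens:
  assumes a: "fam a" and j: "j \<ge> 1" and m: "m \<ge> 1"
  shows "tens S j m (ptens S a j) (ptens S (\<lambda>i. a (i + j)) m) = ptens S a (j + m)"
proof -
  obtain A where A: "\<And>i k. A k i \<in> alg S 1" "\<And>i. (\<lambda>k. emb S 1 (A k i)) \<longlonglongrightarrow> a i"
    using fam_approx[OF a] by blast
  let ?a = "\<lambda>p i. emb S 1 (A p i)"
  have "(\<lambda>p. (\<lambda>(x, y). tens S j m x y) (ptens S (?a p) j, ptens S (\<lambda>i. ?a p (i + j)) m)) \<longlonglongrightarrow>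
      (\<lambda>(x, y). tens S j m x y) (ptens S a j, ptens S (\<lambda>i. a (i + j)) m)"
    by (rule continuous_on_tendsto_compose[OF tens_continuous _ _ always_eventually])
      (use a A j m in \<open>auto intro!: tendsto_Pair ptens_tendsto ptens_X emb_X\<close>)
  moreover have "tens S j m (ptens S (?a p) j) (ptens S (\<lambda>i. ?a p (i + j)) m) = ptens S (?a p) (j + m)" for p
  proof -
    have jm: "j + m \<ge> 1" using j by simp
    have 1: "op_ptens S (A p) j \<in> alg S j" "op_ptens S (\<lambda>i. A p (i + j)) m \<in> alg S m"
      by (intro op_ptens_alg j m A)+
    have 2: "op_tensor S j m (op_ptens S (A p) j) (op_ptens S (\<lambda>i. A p (i + j)) m) = op_ptens S (A p) (j + m)"
      by (intro op_tensor_ptens j m A)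
    show ?thesis
      unfolding ptens_emb[OF j, of "A p", OF A(1)] ptens_emb[OF jm, of "A p", OF A(1)]
        ptens_emb[OF m, of "\<lambda>i. A p (i + j)", OF A(1)] tens_emb[OF j m 1] 2 ..
  qed
  moreover have "(\<lambda>p. ptens S (?a p) (j + m)) \<longlonglongrightarrow> ptens S a (j + m)"
    using a A j by (intro ptens_tendsto) (auto intro: emb_X)
  ultimately show ?thesis using LIMSEQ_unique by auto
qed

lemma X_ptens_induct [consumes 2, case_names ptens csub closed]:
  assumes n: "n \<ge> 1" and x: "x \<in> X n" and base: "\<And>a. fam a \<Longrightarrow> P (ptens S a n)"
    and sub: "csub {x \<in> X n. P x}" and cl: "closed {x \<in> X n. P x}"
  shows "P x"
proof -
  let ?Z = "{ptens S a n | a. \<forall>i\<in>{1..n}. a i \<in> X 1}"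
  have eq: "closure (cspan ?Z) = X n" by (rule ptens_dense[OF n])
  have "x \<in> closure (cspan ?Z)" using x eq by simp
  then show ?thesis
  proof (rule closure_cspan_induct)
    fix x assume "x \<in> ?Z"
    then obtain a where a: "x = ptens S a n" "\<forall>i\<in>{1..n}. a i \<in> X 1" by blast
    \<comment> \<open>Entries beyond \<open>n\<close> do not influence the tensor; setting them to 0
      makes the family total.\<close>
    define b where "b i = (if i \<in> {1..n} then a i else 0)" for i
    have "x = ptens S b n" unfolding a by (rule ptens_cong) (simp add: b_def)
    moreover have "fam b" using a(2) by (auto simp: b_def csub_zero csub_X)
    ultimately show "P x" using base by simp
  qed (simp_all only: eq sub cl)
qed

text \<open>The workhorse for slot identities: bounded maps need only be compared on elementary
  tensors, where every claim becomes a statement about updated or permuted families.\<close>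

lemma bcl_ext:
  assumes n: "n \<ge> 1" and f: "bounded_clinear_on (X n) Y f" and g: "bounded_clinear_on (X n) Z g"
    and eq: "\<And>a. fam a \<Longrightarrow> f (ptens S a n) = (g (ptens S a n) :: 'c::complex_normed_vector)" and x: "x \<in> X n"
  shows "f x = g x"
  using n x
proof (induction rule: X_ptens_induct)
  case csub
  show ?case using csub_X[OF n] f g
    by (auto simp: csub_def bcl_add bcl_scaleC bcl_zero csub_X n)
next
  case closed
  have "closed (X n \<inter> (\<lambda>x. f x - g x) -` {0})"
    by (intro continuous_closed_preimage continuous_on_diff bcl_continuous_on[OF f] bcl_continuous_on[OF g]
        csub_X n closed_X) simp
  also have "X n \<inter> (\<lambda>x. f x - g x) -` {0} = {x \<in> X n. f x = g x}" by auto
  finally show ?case .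
qed (rule eq)

lemma marg_ptens': "n \<ge> 2 \<Longrightarrow> fam a \<Longrightarrow> marg S n (ptens S a n) = ell S 1 (a n) *\<^sub>C ptens S a (n - 1)"
  by (rule marg_ptens) auto

lemma ell_ptens: "n \<ge> 1 \<Longrightarrow> fam a \<Longrightarrow> ell S n (ptens S a n) = (\<Prod>i=1..n. ell S 1 (a i))"
proof (induction n rule: ptens_induct)
  case (Suc n)
  then show ?case
    using ell_tens[of "Suc n" 1 "ptens S a (Suc n)" "a (Suc (Suc n))"] ptens_X[of "Suc n" a] by simp
qed simp

text \<open>Compared on elementary tensors after multiplication by a fixed nonzero vector, which
  turns the functionals into vector-valued maps. In the zero space both sides vanish.\<close>

lemma ell_marg:
  assumes n: "n \<ge> 2" and x: "x \<in> X n" shows "ell S (n - 1) (marg S n x) = ell S n x"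
proof (cases "\<exists>y::'b. y \<noteq> 0")
  case True
  then obtain y :: 'b where y: "y \<noteq> 0" by blast
  have "ell S (n - 1) (marg S n x) *\<^sub>C y = ell S n x *\<^sub>C y"
  proof (rule bcl_ext[OF _ _ _ _ x])
    show "bounded_clinear_on (X n) UNIV (\<lambda>x. ell S (n - 1) (marg S n x) *\<^sub>C y)"
      using n by (intro bcl_compose[OF marg_linear[OF n] bcl_ell]) auto
    show "bounded_clinear_on (X n) UNIV (\<lambda>x. ell S n x *\<^sub>C y)"
      using n by (intro bcl_ell) auto
    fix a assume a: "fam a"
    obtain m where m: "n = Suc (Suc m)" using n by (metis Suc_diff_le add_2_eq_Suc le_add_diff_inverse)
    show "ell S (n - 1) (marg S n (ptens S a n)) *\<^sub>C y = ell S n (ptens S a n) *\<^sub>C y"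
      using marg_ptens'[OF n a] ell_ptens[of n a] ell_ptens[of "n - 1" a] a ptens_X[of "n - 1" a]
      by (simp add: m ell_scaleC mult.commute del: ptens.simps)
  qed (use n in auto)
  then show ?thesis using y by (rule scaleC_cancel)
next
  case False
  then have "x = 0" "marg S n x = 0" by auto
  then show ?thesis using ell_scaleC[of "n - 1" 0 0] ell_scaleC[of n 0 0] n csub_zero[OF csub_X]
    by (simp add: scaleC.zero_left)
qed

text \<open>The norm is the trace of the absolute value, marginals preserve the trace, and
  \<open>abs_marg_le\<close> leaves a positive remainder, whose trace is nonnegative.\<close>

lemma norm_marg_le:
  assumes n: "n \<ge> 2" and x: "x \<in> X n" shows "norm (marg S n x) \<le> norm x"
proof -
  have n1: "n \<ge> 1" "n - 1 \<ge> 1" using n by auto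
  note mX = bcl_mem[OF marg_linear[OF n]]
  let ?u = "marg S n (absv S n x)" and ?v = "absv S (n - 1) (marg S n x)"
  have u: "?u \<in> X (n - 1)" and v: "?v \<in> X (n - 1)" by (intro mX absv_X n1 x)+
  have "Re (ell S (n - 1) (?u - ?v)) \<ge> 0"
    using ell_pos_cone[OF n1(2) abs_marg_le[OF n x]] by simp
  moreover have "ell S (n - 1) (?u - ?v) + ell S (n - 1) ?v = ell S (n - 1) ?u"
    using ell_add[OF n1(2) csub_diff[OF csub_X[OF n1(2)] u v] v] by simp
  moreover have "ell S (n - 1) ?u = ell S n (absv S n x)"
    by (intro ell_marg n absv_X n1 x)
  moreover have "norm x = Re (ell S n (absv S n x))" by (rule norm_eq_ell_absv[OF n1(1) x])
  moreover have "norm (marg S n x) = Re (ell S (n - 1) ?v)" by (rule norm_eq_ell_absv[OF n1(2) mX[OF x]])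
  ultimately show ?thesis by (metis add_increasing plus_complex.sel(1) order_refl)
qed

lemma marginal_same [simp]: "marginal S n n x = x"
  by (cases n) auto

lemma bcl_marginal:
  assumes "1 \<le> j" "j \<le> n" shows "bounded_clinear_on (X n) (X j) (marginal S j n)"
  using assms(2)
proof (induction n rule: dec_induct)
  case base
  show ?case using bcl_id by simp
next
  case (step n)
  have "bounded_clinear_on (X (Suc n)) (X j) (\<lambda>x. marginal S j n (marg S (Suc n) x))"
    using marg_linear[of "Suc n"] step assms by (intro bcl_compose[OF _ step.IH]) auto
  then show ?case using step by (simp add: fun_eq_iff bounded_clinear_on_def clinear_on_def)
qed

lemma norm_marginal_le:
  assumes "1 \<le> j" "j \<le> n" "x \<in> X n" shows "norm (marginal S j n x) \<le> norm x"
  using assms(2,3)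
proof (induction n arbitrary: x rule: dec_induct)
  case (step n)
  have "marg S (Suc n) x \<in> X n"
    using bcl_mem[OF marg_linear[of "Suc n"]] step assms by simp
  then have "norm (marginal S j n (marg S (Suc n) x)) \<le> norm (marg S (Suc n) x)"
    by (rule step.IH)
  also have "\<dots> \<le> norm x" using step assms by (intro norm_marg_le) auto
  finally show ?case using step by simp
qed simp

lemma ell_marginal:
  assumes "1 \<le> j" "j \<le> n" "x \<in> X n" shows "ell S j (marginal S j n x) = ell S n x"
  using assms(2,3)
proof (induction n arbitrary: x rule: dec_induct)
  case (step n)
  have "marg S (Suc n) x \<in> X n"
    using bcl_mem[OF marg_linear[of "Suc n"]] step assms by simp
  then show ?case using step ell_marg[of "Suc n" x] assms by simp
qed simp

lemma marginal_ptens: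
  assumes "1 \<le> j" "j \<le> n" "fam a"
  shows "marginal S j n (ptens S a n) = (\<Prod>i=j+1..n. ell S 1 (a i)) *\<^sub>C ptens S a j"
  using assms(2)
proof (induction n rule: dec_induct)
  case (step n)
  have "marg S (Suc n) (ptens S a (Suc n)) = ell S 1 (a (Suc n)) *\<^sub>C ptens S a n"
    using marg_ptens'[of "Suc n" a] assms step by simp
  then show ?case
    using step assms bcl_scaleC[OF bcl_marginal[of j n]] ptens_X[of n a]
    by (simp add: scaleC_scaleC mult.commute)
qed simp

end

section \<open>Replacing one tensor factor\<close>

text \<open>Generators are handled as graphs, which are closed complex subspaces of a product; the
  span and closure arguments above are to be applied there.\<close>

instantiation prod :: (complex_normed_vector, complex_normed_vector) complex_normed_vector
begin

definition scaleC_prod :: "complex \<Rightarrow> 'a \<times> 'b \<Rightarrow> 'a \<times> 'b" where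
  "scaleC_prod c z = (c *\<^sub>C fst z, c *\<^sub>C snd z)"

instance
  by standard (auto simp: scaleC_prod_def scaleC_add_left scaleC_add_right scaleC_scaleC scaleC_of_real
    norm_scaleC norm_prod_def power_mult_distrib real_sqrt_mult prod_eq_iff simp flip: distrib_left)

end

lemma csub_Times: "csub A \<Longrightarrow> csub B \<Longrightarrow> csub (A \<times> B)"
  by (auto simp: csub_def scaleC_prod_def zero_prod_def)

lemma bcl_fst: "bounded_clinear_on (A \<times> B) A fst"
  by (rule bclI[of _ _ _ 1]) (auto simp: scaleC_prod_def norm_fst_le)

lemma bcl_snd: "bounded_clinear_on (A \<times> B) B snd"
  by (rule bclI[of _ _ _ 1]) (auto simp: scaleC_prod_def norm_snd_le)

lemma bcl_Pair:
  assumes f: "bounded_clinear_on X A f" and g: "bounded_clinear_on X B g"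
  shows "bounded_clinear_on X (A \<times> B) (\<lambda>x. (f x, g x))"
proof -
  obtain C where C: "C \<ge> 0" "\<And>x. x \<in> X \<Longrightarrow> norm (f x) \<le> C * norm x" using bcl_bound[OF f] by blast
  obtain D where D: "D \<ge> 0" "\<And>x. x \<in> X \<Longrightarrow> norm (g x) \<le> D * norm x" using bcl_bound[OF g] by blast
  show ?thesis
  proof (rule bclI[of _ _ _ "C + D"])
    fix x assume x: "x \<in> X"
    have "norm (f x, g x) \<le> norm (f x) + norm (g x)" by (rule norm_Pair_le)
    then show "norm (f x, g x) \<le> (C + D) * norm x"
      using C(2)[OF x] D(2)[OF x] by (simp add: algebra_simps)
  qed (use f g in \<open>simp_all add: bcl_mem bcl_add bcl_scaleC scaleC_prod_def\<close>)
qed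

lemma bcl_preimage_csub:
  assumes f: "bounded_clinear_on X Y f" and X: "csub X" and C: "csub C"
  shows "csub {x \<in> X. f x \<in> C}"
  using X C unfolding csub_def by (auto simp: bcl_add[OF f] bcl_scaleC[OF f] bcl_zero[OF f X])

lemma bcl_preimage_closed:
  assumes f: "bounded_clinear_on X Y f" and X: "csub X" "closed X" and C: "closed C"
  shows "closed {x \<in> X. f x \<in> C}"
proof -
  have "closed (X \<inter> f -` C)"
    by (intro continuous_closed_preimage bcl_continuous_on[OF f] X C)
  also have "X \<inter> f -` C = {x \<in> X. f x \<in> C}" by auto
  finally show ?thesis .
qed

text \<open>\<open>R_l\<close> of the overview, with \<open>y\<close> as the inserted element: slot
  \<open>l\<close> is moved to the end, traced out, refilled and moved back. One particle is
  separate because marginals start at two. The value 0 outside the space makes different slots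
  commute at every argument, as the folds below require.\<close>

definition repl ::
    "('h, 'f, 'b::complex_banach) mean_field_data \<Rightarrow> nat \<Rightarrow> nat \<Rightarrow> 'b \<Rightarrow> 'b \<Rightarrow> 'b" where
  "repl S n l y x = (if x \<notin> cspace S n then 0 else if n = 1 then ell S 1 x *\<^sub>C y
     else swap_conj S n l n (tens S (n - 1) 1 (marg S n (swap_conj S n l n x)) y))"

context completed_algebras
begin

lemma fam_upd: "fam a \<Longrightarrow> y \<in> X 1 \<Longrightarrow> fam (a(l := y))"
  by simp

lemma tens_ptens_last:
  assumes n: "n \<ge> 2" shows "tens S (n - 1) 1 (ptens S a (n - 1)) (a n) = ptens S a n"
proof -
  obtain m where m: "n = Suc (Suc m)" using n by (metis Suc_diff_le add_2_eq_Suc le_add_diff_inverse)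
  then show ?thesis by simp
qed

lemma repl_1: "x \<in> X 1 \<Longrightarrow> repl S 1 l y x = ell S 1 x *\<^sub>C y"
  by (simp add: repl_def)

lemma repl_ge2: "n \<ge> 2 \<Longrightarrow> x \<in> X n \<Longrightarrow>
    repl S n l y x = swap_conj S n l n (tens S (n - 1) 1 (marg S n (swap_conj S n l n x)) y)"
  by (simp add: repl_def)

lemma
  assumes l: "l \<in> {1..n}"
  shows bcl_repl: "y \<in> X 1 \<Longrightarrow> bounded_clinear_on (X n) (X n) (repl S n l y)"
    and bcl_repl_arg: "x \<in> X n \<Longrightarrow> bounded_clinear_on (X 1) (X n) (\<lambda>y. repl S n l y x)"
    and norm_repl: "y \<in> X 1 \<Longrightarrow> x \<in> X n \<Longrightarrow> norm (repl S n l y x) \<le> norm y * norm x"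
    and repl_ptens: "fam a \<Longrightarrow> y \<in> X 1 \<Longrightarrow> repl S n l y (ptens S a n) = ell S 1 (a l) *\<^sub>C ptens S (a(l := y)) n"
proof -
  have n: "n \<ge> 1" using l by auto
  consider "n = 1" "l = 1" | "n \<ge> 2" using l by fastforce
  then have "(y \<in> X 1 \<longrightarrow> bounded_clinear_on (X n) (X n) (repl S n l y)) \<and>
    (x \<in> X n \<longrightarrow> bounded_clinear_on (X 1) (X n) (\<lambda>y. repl S n l y x)) \<and>
    (y \<in> X 1 \<longrightarrow> x \<in> X n \<longrightarrow> norm (repl S n l y x) \<le> norm y * norm x) \<and>
    (fam a \<longrightarrow> y \<in> X 1 \<longrightarrow> repl S n l y (ptens S a n) = ell S 1 (a l) *\<^sub>C ptens S (a(l := y)) n)"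
    for y x a
  proof cases
    case 1
    have bd: "norm (ell S 1 x *\<^sub>C y) \<le> norm y * norm x" if "x \<in> X 1" for x y
      using ell_le_norm[of 1 x] that by (simp add: norm_scaleC mult.commute[of _ "norm y"] mult_left_mono)
    have "bounded_clinear_on (X 1) (X 1) (repl S 1 1 y)" if y: "y \<in> X 1"
      by (rule bclI[of _ _ _ "norm y"])
        (use y csub_X[OF order_refl] in \<open>simp_all only: repl_1 csub_add csub_scaleC ell_add[OF order_refl]
          ell_scaleC[OF order_refl] scaleC_add_left scaleC_scaleC bd\<close>)
    moreover have "bounded_clinear_on (X 1) (X 1) (\<lambda>y. repl S 1 1 y x)" if x: "x \<in> X 1"
      by (rule bclI[of _ _ _ "norm x"])
        (use bd[OF x] x csub_X[OF order_refl] in \<open>simp_all only: repl_1[OF x] csub_scaleC scaleC_add_right scaleC_scaleC mult.commute\<close>)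
    ultimately show ?thesis
      using 1 bd repl_1 by auto
  next
    case 2
    have n1: "n - 1 \<ge> 1" "n \<ge> 1" "n - 1 + 1 = n" and nn: "n \<in> {1..n}" using 2 by auto
    note sw = bcl_swap[OF l nn]
    note mX = bcl_mem[OF marg_linear[OF 2]] and sX = bcl_mem[OF sw]
    have t: "bounded_clinear_on (X (n - 1)) (X n) (\<lambda>x. tens S (n - 1) 1 x y)" if "y \<in> X 1" for y
      using bcl_tens_left[OF n1(1) order_refl that] n1(3) by simp
    have b: "bounded_clinear_on (X n) (X n)
        (\<lambda>x. swap_conj S n l n (tens S (n - 1) 1 (marg S n (swap_conj S n l n x)) y))" if "y \<in> X 1"
      by (intro bcl_compose[OF sw] bcl_compose[OF _ sw] bcl_compose[OF marg_linear[OF 2] t[OF that]])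
    have b1: "bounded_clinear_on (X n) (X n) (repl S n l y)" if y: "y \<in> X 1"
      using b[OF y] csub_X[OF n1(2)] unfolding bounded_clinear_on_def clinear_on_def
      by (simp add: repl_ge2[OF 2] csub_add csub_scaleC)
    have "bounded_clinear_on (X 1) (X (n - 1 + 1)) (tens S (n - 1) 1 (marg S n (swap_conj S n l n x)))"
      if x: "x \<in> X n"
      by (intro bcl_tens_right n1 mX sX x order_refl)
    then have b2: "bounded_clinear_on (X 1) (X n) (\<lambda>y. repl S n l y x)" if x: "x \<in> X n"
      unfolding repl_ge2[OF 2 x] using bcl_compose[OF _ sw] x n1(3) by simp
    have "norm (repl S n l y x) \<le> norm y * norm x" if x: "x \<in> X n" and y: "y \<in> X 1"
    proof -
      let ?z = "marg S n (swap_conj S n l n x)"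
      have z: "?z \<in> X (n - 1)" by (intro mX sX x)
      have "norm (repl S n l y x) = norm (tens S (n - 1) 1 ?z y)"
        unfolding repl_ge2[OF 2 x] using bcl_mem[OF t[OF y] z] by (intro norm_swap l nn)
      also have "\<dots> = norm ?z * norm y" by (intro norm_tens n1 z y order_refl)
      also have "norm ?z \<le> norm (swap_conj S n l n x)" by (intro norm_marg_le 2 sX x)
      also have "\<dots> = norm x" by (intro norm_swap l nn x)
      finally show ?thesis by (simp add: mult.commute mult_right_mono)
    qed
    moreover have "repl S n l y (ptens S a n) = ell S 1 (a l) *\<^sub>C ptens S (a(l := y)) n"
      if a: "fam a" and y: "y \<in> X 1"
    proof -
      \<comment> \<open>The family after slot \<open>l\<close> has been exchanged with the last one;
        putting \<open>y\<close> at \<open>n\<close> and exchanging back amounts to putting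
        \<open>y\<close> at \<open>l\<close>.\<close>
      define c where "c = (\<lambda>i. a (swp l n i))"
      have c: "fam c" using a by (simp add: c_def)
      have p: "ptens S a n \<in> X n" using a by (intro ptens_X n1) auto
      have pc: "ptens S c (n - 1) \<in> X (n - 1)" using c by (intro ptens_X n1) auto
      have pc': "ptens S (c(n := y)) n \<in> X n" using c y by (intro ptens_X n1) auto
      have "marg S n (swap_conj S n l n (ptens S a n)) = marg S n (ptens S c n)"
        by (simp add: swap_ptens[OF a l nn] c_def)
      also have "\<dots> = ell S 1 (c n) *\<^sub>C ptens S c (n - 1)"
        by (rule marg_ptens'[OF 2 c])
      also have "c n = a l" by (simp add: c_def swp_def)
      finally have m: "marg S n (swap_conj S n l n (ptens S a n)) = ell S 1 (a l) *\<^sub>C ptens S c (n - 1)" .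
      have "tens S (n - 1) 1 (ptens S c (n - 1)) y = tens S (n - 1) 1 (ptens S (c(n := y)) (n - 1)) ((c(n := y)) n)"
      proof -
        have "ptens S c (n - 1) = ptens S (c(n := y)) (n - 1)" using 2 by (intro ptens_cong) auto
        then show ?thesis by simp
      qed
      also have "\<dots> = ptens S (c(n := y)) n" by (rule tens_ptens_last[OF 2])
      finally have "repl S n l y (ptens S a n) = ell S 1 (a l) *\<^sub>C swap_conj S n l n (ptens S (c(n := y)) n)"
        unfolding repl_ge2[OF 2 p] m using bcl_scaleC[OF t[OF y] pc] bcl_scaleC[OF sw pc'] by simp
      also have "swap_conj S n l n (ptens S (c(n := y)) n) = ptens S (\<lambda>i. (c(n := y)) (swp l n i)) n"
        using c y by (intro swap_ptens l nn) simp
      also have "(\<lambda>i. (c(n := y)) (swp l n i)) = a(l := y)"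
        by (auto simp: c_def swp_def fun_eq_iff)
      finally show ?thesis .
    qed
    ultimately show ?thesis using b1 b2 by blast
  qed
  then show "y \<in> X 1 \<Longrightarrow> bounded_clinear_on (X n) (X n) (repl S n l y)"
    "x \<in> X n \<Longrightarrow> bounded_clinear_on (X 1) (X n) (\<lambda>y. repl S n l y x)"
    "y \<in> X 1 \<Longrightarrow> x \<in> X n \<Longrightarrow> norm (repl S n l y x) \<le> norm y * norm x"
    "fam a \<Longrightarrow> y \<in> X 1 \<Longrightarrow> repl S n l y (ptens S a n) = ell S 1 (a l) *\<^sub>C ptens S (a(l := y)) n"
    by blast+
qed

lemma repl_X:
  assumes "l \<in> {1..n}" "y \<in> X 1" shows "repl S n l y x \<in> X n"
proof (cases "x \<in> X n")
  case False
  have "n \<ge> 1" using assms by auto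
  then show ?thesis using False csub_zero[OF csub_X[of n]] by (simp add: repl_def[of S n l y x])
qed (rule bcl_mem[OF bcl_repl[OF assms]])

lemma ptens_X': "n \<ge> 1 \<Longrightarrow> fam a \<Longrightarrow> ptens S a n \<in> X n"
  by (simp add: ptens_X)

text \<open>There is no membership condition on \<open>x\<close>: commuting functions are needed on
  the whole type in order to form products over sets of slots.\<close>

lemma repl_comm:
  assumes l: "l \<in> {1..n}" and k: "k \<in> {1..n}" and lk: "l \<noteq> k" and y: "y \<in> X 1" and y': "y' \<in> X 1"
  shows "repl S n l y (repl S n k y' x) = repl S n k y' (repl S n l y x)"
proof (cases "x \<in> X n")
  case True
  have n: "n \<ge> 1" using l by auto
  note b = bcl_repl[OF l y] bcl_repl[OF k y']
  show ?thesis
  proof (rule bcl_ext[OF n bcl_compose[OF b(2,1)] bcl_compose[OF b] _ True])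
    fix a assume a: "fam a"
    show "repl S n l y (repl S n k y' (ptens S a n)) = repl S n k y' (repl S n l y (ptens S a n))"
      unfolding repl_ptens[OF k a y'] repl_ptens[OF l a y]
        bcl_scaleC[OF b(1) ptens_X'[OF n fam_upd[OF a y']]] bcl_scaleC[OF b(2) ptens_X'[OF n fam_upd[OF a y]]]
        repl_ptens[OF l fam_upd[OF a y'] y] repl_ptens[OF k fam_upd[OF a y] y']
      using lk by (simp add: scaleC_scaleC mult.commute fun_upd_twist)
  qed
next
  case False
  then show ?thesis
    using bcl_zero[OF bcl_repl[OF l y]] bcl_zero[OF bcl_repl[OF k y']] l
    by (simp add: repl_def[of S n _ _ x] csub_X)
qed

lemma repl_swap:
  assumes l: "l \<in> {1..n}" and k: "k \<in> {1..n}" and s: "s \<in> {1..n}" and y: "y \<in> X 1" and x: "x \<in> X n"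
  shows "swap_conj S n k s (repl S n l y x) = repl S n (swp k s l) y (swap_conj S n k s x)"
proof -
  have n: "n \<ge> 1" using l by auto
  have l': "swp k s l \<in> {1..n}" using l k s by (auto simp: swp_def)
  note b = bcl_repl[OF l y] bcl_repl[OF l' y] bcl_swap[OF k s]
  show ?thesis
  proof (rule bcl_ext[OF n bcl_compose[OF b(1,3)] bcl_compose[OF b(3,2)] _ x])
    fix a assume a: "fam a"
    have "(\<lambda>i. (a(l := y)) (swp k s i)) = (\<lambda>i. a (swp k s i))(swp k s l := y)"
      by (auto simp: fun_eq_iff)
    moreover have fs: "fam (\<lambda>i. a (swp k s i))" using a by simp
    ultimately show "swap_conj S n k s (repl S n l y (ptens S a n)) =
        repl S n (swp k s l) y (swap_conj S n k s (ptens S a n))"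
      unfolding repl_ptens[OF l a y] swap_ptens[OF a k s] bcl_scaleC[OF b(3) ptens_X'[OF n fam_upd[OF a y]]]
        swap_ptens[OF fam_upd[OF a y] k s] repl_ptens[OF l' fs y] by simp
  qed
qed

lemma marg_repl:
  assumes n: "n \<ge> 2" and l: "l \<in> {1..n - 1}" and y: "y \<in> X 1" and x: "x \<in> X n"
  shows "marg S n (repl S n l y x) = repl S (n - 1) l y (marg S n x)"
proof -
  have n1: "n \<ge> 1" "n - 1 \<ge> 1" and l': "l \<in> {1..n}" using n l by auto
  note b = bcl_repl[OF l y] bcl_repl[OF l' y] marg_linear[OF n]
  show ?thesis
  proof (rule bcl_ext[OF n1(1) bcl_compose[OF b(2,3)] bcl_compose[OF b(3,1)] _ x])
    fix a assume a: "fam a"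
    show "marg S n (repl S n l y (ptens S a n)) = repl S (n - 1) l y (marg S n (ptens S a n))"
      unfolding repl_ptens[OF l' a y] marg_ptens'[OF n a] bcl_scaleC[OF b(3) ptens_X'[OF n1(1) fam_upd[OF a y]]]
        bcl_scaleC[OF b(1) ptens_X'[OF n1(2) a]] repl_ptens[OF l a y] marg_ptens'[OF n fam_upd[OF a y]]
      using l by (auto simp: scaleC_scaleC mult.commute)
  qed
qed

text \<open>In the last slot an inserted element is visibly a tensor factor. Norms of elements with
  inserted factors are reduced to fewer particles this way.\<close>

lemma repl_last:
  assumes n: "n \<ge> 2" and y: "y \<in> X 1" and x: "x \<in> X n"
  shows "repl S n n y x = tens S (n - 1) 1 (marg S n x) y"
proof -
  have n1: "n \<ge> 1" "n - 1 \<ge> 1" "n - 1 + 1 = n" and l: "n \<in> {1..n}" using n by auto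
  have t: "bounded_clinear_on (X (n - 1)) (X n) (\<lambda>x. tens S (n - 1) 1 x y)"
    using bcl_tens_left[OF n1(2) order_refl y] n1(3) by simp
  show ?thesis
  proof (rule bcl_ext[OF n1(1) bcl_repl[OF l y] bcl_compose[OF marg_linear[OF n] t] _ x])
    fix a assume a: "fam a"
    have "tens S (n - 1) 1 (ptens S a (n - 1)) y = ptens S (a(n := y)) n"
      using tens_ptens_last[OF n, of "a(n := y)"] ptens_cong[of "n - 1" a "a(n := y)"] n by force
    then show "repl S n n y (ptens S a n) = tens S (n - 1) 1 (marg S n (ptens S a n)) y"
      using repl_ptens[OF l a y] marg_ptens'[OF n a] bcl_scaleC[OF t ptens_X'[OF n1(2) a]] by simp
  qed
qed

end

section \<open>Slot operations on the graph of the free generator\<close>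

context mean_field_system
begin

lemma dom0_X: "y \<in> dom0 S \<Longrightarrow> y \<in> X 1"
  using dom0_subset by blast

lemma kin0_X: "y \<in> dom0 S \<Longrightarrow> kin0 S y \<in> X 1"
  using kin0_linear by (simp add: clinear_on_def)

definition kin_sum :: "(nat \<Rightarrow> 'b) \<Rightarrow> nat \<Rightarrow> 'b" where
  "kin_sum a n = (\<Sum>i=1..n. ptens S (a(i := kin0 S (a i))) n)"

text \<open>Here every entry of the family lies in the domain, not only the first \<open>n\<close>;
  \<open>kin_coreI\<close> shows that nothing is lost, since other entries may be replaced by
  0.\<close>

definition kin_core :: "nat \<Rightarrow> ('b \<times> 'b) set" where
  "kin_core n = {(ptens S a n, kin_sum a n) | a. \<forall>i. a i \<in> dom0 S}"

lemma kin_coreI: "\<forall>i\<in>{1..n}. a i \<in> dom0 S \<Longrightarrow> (ptens S a n, kin_sum a n) \<in> kin_core n"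
proof -
  assume a: "\<forall>i\<in>{1..n}. a i \<in> dom0 S"
  define b where "b i = (if i \<in> {1..n} then a i else 0)" for i
  have "\<forall>i. b i \<in> dom0 S" using a dom0_zero by (auto simp: b_def)
  moreover have "ptens S a n = ptens S b n" by (rule ptens_cong) (simp add: b_def)
  moreover have "kin_sum a n = kin_sum b n"
    unfolding kin_sum_def by (intro sum.cong ptens_cong) (auto simp: b_def)
  ultimately show ?thesis unfolding kin_core_def by blast
qed

text \<open>Read as a closed span in the product space, the graph can be treated by checking closed
  linear conditions on the core alone.\<close>

lemma kin_graph_eq: "kin_graph S n = closure (cspan (kin_core n))"
proof -
  have "{(\<Sum>p<m. c p *\<^sub>C ptens S (a p) n,
       \<Sum>p<m. c p *\<^sub>C (\<Sum>i=1..n. ptens S ((a p)(i := kin0 S (a p i))) n))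
      | (m::nat) c a. \<forall>p<m. \<forall>i\<in>{1..n}. a p i \<in> dom0 S} = cspan (kin_core n)" (is "?A = _")
  proof (intro subset_antisym subsetI)
    fix z assume "z \<in> ?A"
    then obtain m :: nat and c a where z: "z = (\<Sum>p<m. c p *\<^sub>C ptens S (a p) n, \<Sum>p<m. c p *\<^sub>C kin_sum (a p) n)"
      and a: "\<forall>p<m. \<forall>i\<in>{1..n}. a p i \<in> dom0 S"
      unfolding kin_sum_def by blast
    have "z = (\<Sum>p<m. c p *\<^sub>C (ptens S (a p) n, kin_sum (a p) n))"
      by (simp add: z scaleC_prod_def sum_prod)
    moreover have "\<forall>p<m. (ptens S (a p) n, kin_sum (a p) n) \<in> kin_core n"
      using a by (intro allI impI kin_coreI) auto
    ultimately show "z \<in> cspan (kin_core n)"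
      unfolding cspan_def mem_Collect_eq
      by (intro exI[of _ m] exI[of _ c] exI[of _ "\<lambda>p. (ptens S (a p) n, kin_sum (a p) n)"] conjI)
  next
    fix z assume "z \<in> cspan (kin_core n)"
    then obtain m :: nat and c w where z: "z = (\<Sum>p<m. c p *\<^sub>C w p)" and "\<forall>p<m. w p \<in> kin_core n"
      unfolding cspan_def by blast
    then have "\<forall>p. \<exists>a. p < m \<longrightarrow> w p = (ptens S a n, kin_sum a n) \<and> (\<forall>i. a i \<in> dom0 S)"
      unfolding kin_core_def by blast
    then obtain a where a: "\<And>p. p < m \<Longrightarrow> w p = (ptens S (a p) n, kin_sum (a p) n) \<and> (\<forall>i. a p i \<in> dom0 S)"
      by metis
    have "z = (\<Sum>p<m. c p *\<^sub>C (ptens S (a p) n, kin_sum (a p) n))"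
      unfolding z using a by (intro sum.cong) auto
    also have "\<dots> = (\<Sum>p<m. c p *\<^sub>C ptens S (a p) n, \<Sum>p<m. c p *\<^sub>C kin_sum (a p) n)"
      by (simp add: scaleC_prod_def sum_prod)
    finally show "z \<in> ?A"
      using a unfolding kin_sum_def by blast
  qed
  then show ?thesis unfolding kin_graph_def by simp
qed

lemma csub_kin: "csub (kin_graph S n)"
  unfolding kin_graph_eq by (intro csub_closure csub_cspan)

lemma closed_kin: "closed (kin_graph S n)"
  by (simp add: kin_graph_def)

lemma kin_core_kin: "(\<forall>i. a i \<in> dom0 S) \<Longrightarrow> (ptens S a n, kin_sum a n) \<in> kin_graph S n"
  unfolding kin_graph_eq
  by (intro subsetD[OF closure_subset] subsetD[OF cspan_superset] kin_coreI) simp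

lemma kin_sum_X:
  assumes n: "n \<ge> 1" and a: "\<forall>i. a i \<in> dom0 S" shows "kin_sum a n \<in> X n"
  unfolding kin_sum_def using a n
  by (intro csub_sum csub_X ptens_X') (auto intro: dom0_X[unfolded One_nat_def] kin0_X[unfolded One_nat_def])

lemma kin_subset: "n \<ge> 1 \<Longrightarrow> kin_graph S n \<subseteq> X n \<times> X n"
  unfolding kin_graph_eq
  by (intro closure_minimal cspan_subset csub_Times csub_X closed_Times closed_X)
    (auto simp: kin_core_def intro!: ptens_X' kin_sum_X dom0_X[unfolded One_nat_def])

text \<open>The conclusion is a closed linear condition on the pair \<open>(x, g)\<close>, so
  elementary tensors suffice. The second map \<open>B\<close> accounts for the motion of an element
  that \<open>A\<close> inserts.\<close>

lemma kin_map:
  assumes n: "n \<ge> 1" and m: "m \<ge> 1"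
    and A: "bounded_clinear_on (X n) (X m) A" and B: "bounded_clinear_on (X n) (X m) B"
    and base: "\<And>a. \<forall>i. a i \<in> dom0 S \<Longrightarrow> (A (ptens S a n), A (kin_sum a n) + B (ptens S a n)) \<in> kin_graph S m"
    and xg: "(x, g) \<in> kin_graph S n"
  shows "(A x, A g + B x) \<in> kin_graph S m"
proof -
  let ?f = "\<lambda>z. (A (fst z), A (snd z) + B (fst z))"
  have bf: "bounded_clinear_on (X n \<times> X n) (X m \<times> X m) ?f"
    by (intro bcl_Pair bcl_plus bcl_compose[OF bcl_fst A] bcl_compose[OF bcl_snd A] bcl_compose[OF bcl_fst B] csub_X m)
  have XX: "csub (X n \<times> X n)" "closed (X n \<times> X n)" by (intro csub_Times csub_X n closed_Times closed_X)+
  let ?Z = "{z \<in> X n \<times> X n. ?f z \<in> kin_graph S m}"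
  have "closure (cspan (kin_core n)) \<subseteq> ?Z"
  proof (intro closure_minimal cspan_subset)
    show "csub ?Z" by (rule bcl_preimage_csub[OF bf XX(1) csub_kin])
    show "closed ?Z" by (rule bcl_preimage_closed[OF bf XX closed_kin])
    show "kin_core n \<subseteq> ?Z"
      unfolding kin_core_def using base dom0_X n
      by (auto intro!: ptens_X' kin_sum_X)
  qed
  then have "?f (x, g) \<in> kin_graph S m" using xg unfolding kin_graph_eq[of n] by blast
  then show ?thesis by simp
qed

text \<open>Tracing out the last slot kills the summand in which \<open>K_0\<close> acts there,
  because \<open>ell\<close> vanishes on the range of \<open>K_0\<close>.\<close>

lemma kin_marg:
  assumes n: "n \<ge> 2" and xg: "(x, g) \<in> kin_graph S n"
  shows "(marg S n x, marg S n g) \<in> kin_graph S (n - 1)"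
proof -
  have n1: "n \<ge> 1" "n - 1 \<ge> 1" using n by auto
  note m = marg_linear[OF n]
  have "(marg S n x, marg S n g + 0) \<in> kin_graph S (n - 1)"
  proof (rule kin_map[OF n1 m bcl_zero_fun[OF csub_X[OF n1(2)]] _ xg])
    fix a :: "nat \<Rightarrow> 'b" assume a: "\<forall>i. a i \<in> dom0 S"
    then have fa: "fam a" using dom0_X by blast
    have "marg S n (kin_sum a n) = (\<Sum>i=1..n. marg S n (ptens S (a(i := kin0 S (a i))) n))"
      unfolding kin_sum_def using a fa kin0_X by (intro bcl_sum[OF m] csub_X n1 ptens_X') auto
    also have "\<dots> = (\<Sum>i=1..n. ell S 1 ((a(i := kin0 S (a i))) n) *\<^sub>C ptens S (a(i := kin0 S (a i))) (n - 1))"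
      using a fa kin0_X by (intro sum.cong refl marg_ptens' n) auto
    also have "\<dots> = (\<Sum>i=1..n - 1. ell S 1 (a n) *\<^sub>C ptens S (a(i := kin0 S (a i))) (n - 1))"
      using n ell_kin0 a by (intro sum.mono_neutral_cong_right) (auto simp: scaleC.zero_left)
    also have "\<dots> = ell S 1 (a n) *\<^sub>C kin_sum a (n - 1)"
      by (simp add: kin_sum_def scaleC.sum_right)
    finally have "(marg S n (ptens S a n), marg S n (kin_sum a n) + 0) =
        ell S 1 (a n) *\<^sub>C (ptens S a (n - 1), kin_sum a (n - 1))"
      by (simp add: marg_ptens'[OF n fa] scaleC_prod_def)
    then show "(marg S n (ptens S a n), marg S n (kin_sum a n) + 0) \<in> kin_graph S (n - 1)"
      by (simp only:) (intro csub_scaleC csub_kin kin_core_kin a)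
  qed
  then show ?thesis by simp
qed

lemma kin_swap:
  assumes k: "k \<in> {1..n}" and s: "s \<in> {1..n}" and xg: "(x, g) \<in> kin_graph S n"
  shows "(swap_conj S n k s x, swap_conj S n k s g) \<in> kin_graph S n"
proof -
  have n: "n \<ge> 1" using k by auto
  note b = bcl_swap[OF k s]
  have "(swap_conj S n k s x, swap_conj S n k s g + 0) \<in> kin_graph S n"
  proof (rule kin_map[OF n n b bcl_zero_fun[OF csub_X[OF n]] _ xg])
    fix a :: "nat \<Rightarrow> 'b" assume a: "\<forall>i. a i \<in> dom0 S"
    then have fa: "fam a" using dom0_X by blast
    define c where "c = (\<lambda>i. a (swp k s i))"
    have c: "\<forall>i. c i \<in> dom0 S" using a by (simp add: c_def)
    have "swap_conj S n k s (kin_sum a n) = (\<Sum>i=1..n. swap_conj S n k s (ptens S (a(i := kin0 S (a i))) n))"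
      unfolding kin_sum_def using a fa kin0_X by (intro bcl_sum[OF b] csub_X n ptens_X') auto
    also have "\<dots> = (\<Sum>i=1..n. ptens S (\<lambda>p. (a(i := kin0 S (a i))) (swp k s p)) n)"
      using a fa kin0_X by (intro sum.cong refl swap_ptens k s) auto
    also have "\<dots> = (\<Sum>i=1..n. ptens S (c(i := kin0 S (c i))) n)"
    proof (rule sum.reindex_bij_witness[of _ "swp k s" "swp k s"])
      fix i assume "i \<in> {1..n}"
      have "c(swp k s i := kin0 S (c (swp k s i))) = (\<lambda>p. (a(i := kin0 S (a i))) (swp k s p))"
        by (auto simp: c_def fun_eq_iff)
      then show "ptens S (c(swp k s i := kin0 S (c (swp k s i)))) n = ptens S (\<lambda>p. (a(i := kin0 S (a i))) (swp k s p)) n"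
        by simp
    qed (use k s in \<open>auto simp: swp_def split: if_splits\<close>)
    finally have "(swap_conj S n k s (ptens S a n), swap_conj S n k s (kin_sum a n) + 0) = (ptens S c n, kin_sum c n)"
      by (simp add: swap_ptens[OF fa k s] c_def kin_sum_def)
    then show "(swap_conj S n k s (ptens S a n), swap_conj S n k s (kin_sum a n) + 0) \<in> kin_graph S n"
      by (simp only:) (intro kin_core_kin c)
  qed
  then show ?thesis by simp
qed

text \<open>The summand acting in slot \<open>l\<close> is traced out to zero, so \<open>K_0\<close>
  is missing exactly in that slot; inserting \<open>kin0 S y\<close> instead of \<open>y\<close>
  supplies it. Thus \<open>R_l\<close> commutes with the free evolution if the inserted element
  evolves too.\<close>

lemma kin_repl:
  assumes l: "l \<in> {1..n}" and y: "y \<in> dom0 S" and xg: "(x, g) \<in> kin_graph S n"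
  shows "(repl S n l y x, repl S n l y g + repl S n l (kin0 S y) x) \<in> kin_graph S n"
proof -
  have n: "n \<ge> 1" using l by auto
  note yX = dom0_X[OF y] kin0_X[OF y]
  note b = bcl_repl[OF l yX(1)]
  show ?thesis
  proof (rule kin_map[OF n n b bcl_repl[OF l yX(2)] _ xg])
    fix a :: "nat \<Rightarrow> 'b" assume a: "\<forall>i. a i \<in> dom0 S"
    then have fa: "fam a" using dom0_X by blast
    define c where "c = a(l := y)"
    have c: "\<forall>i. c i \<in> dom0 S" using a y by (simp add: c_def)
    have fi: "fam (a(i := kin0 S (a i)))" for i using a fa kin0_X by auto
    have "repl S n l y (kin_sum a n) = (\<Sum>i=1..n. repl S n l y (ptens S (a(i := kin0 S (a i))) n))"
      unfolding kin_sum_def by (intro bcl_sum[OF b] csub_X n ptens_X' fi)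
    also have "\<dots> = (\<Sum>i=1..n. ell S 1 ((a(i := kin0 S (a i))) l) *\<^sub>C ptens S (a(i := kin0 S (a i), l := y)) n)"
      by (intro sum.cong refl repl_ptens l fi yX)
    also have "\<dots> = (\<Sum>i\<in>{1..n} - {l}. ell S 1 (a l) *\<^sub>C ptens S (c(i := kin0 S (c i))) n)"
    proof (rule sum.mono_neutral_cong_right)
      show "\<forall>i\<in>{1..n} - ({1..n} - {l}). ell S 1 ((a(i := kin0 S (a i))) l) *\<^sub>C ptens S (a(i := kin0 S (a i), l := y)) n = 0"
        using ell_kin0 a by (auto simp: scaleC.zero_left)
      fix i assume i: "i \<in> {1..n} - {l}"
      then have "a(i := kin0 S (a i), l := y) = c(i := kin0 S (c i))" by (auto simp: c_def)
      then show "ell S 1 ((a(i := kin0 S (a i))) l) *\<^sub>C ptens S (a(i := kin0 S (a i), l := y)) n =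
          ell S 1 (a l) *\<^sub>C ptens S (c(i := kin0 S (c i))) n" using i by auto
    qed auto
    finally have 1: "repl S n l y (kin_sum a n) = (\<Sum>i\<in>{1..n} - {l}. ell S 1 (a l) *\<^sub>C ptens S (c(i := kin0 S (c i))) n)" .
    have "repl S n l (kin0 S y) (ptens S a n) = ell S 1 (a l) *\<^sub>C ptens S (c(l := kin0 S (c l))) n"
      using repl_ptens[OF l fa yX(2)] by (simp add: c_def)
    then have "repl S n l y (kin_sum a n) + repl S n l (kin0 S y) (ptens S a n) = ell S 1 (a l) *\<^sub>C kin_sum c n"
      unfolding 1 kin_sum_def[of c] sum.remove[OF finite_atLeastAtMost l]
      by (simp add: add.commute scaleC_add_right scaleC.sum_right)
    then have "(repl S n l y (ptens S a n), repl S n l y (kin_sum a n) + repl S n l (kin0 S y) (ptens S a n)) =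
        ell S 1 (a l) *\<^sub>C (ptens S c n, kin_sum c n)"
      using repl_ptens[OF l fa yX(1)] by (simp add: c_def scaleC_prod_def)
    then show "(repl S n l y (ptens S a n), repl S n l y (kin_sum a n) + repl S n l (kin0 S y) (ptens S a n)) \<in> kin_graph S n"
      by (simp only:) (intro csub_scaleC csub_kin kin_core_kin c)
  qed
qed

section \<open>Pair interactions\<close>

abbreviation T :: "nat \<Rightarrow> nat \<Rightarrow> nat \<Rightarrow> 'b \<Rightarrow> 'b" where "T \<equiv> pair_op S"

lemma bcl_ext2:
  assumes f: "bounded_clinear_on (X 2) Y f" and g: "bounded_clinear_on (X 2) Z g"
    and eq: "\<And>b1 b2. b1 \<in> X 1 \<Longrightarrow> b2 \<in> X 1 \<Longrightarrow> f (tens S 1 1 b1 b2) = (g (tens S 1 1 b1 b2) :: 'c::complex_normed_vector)"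
    and x: "x \<in> X 2"
  shows "f x = g x"
proof (rule bcl_ext[OF _ f g _ x])
  fix a assume "fam a"
  then show "f (ptens S a 2) = g (ptens S a 2)"
    using eq[of "a 1" "a 2"] by (simp add: numeral_2_eq_2)
qed simp

lemma tens_11_X: "b1 \<in> X 1 \<Longrightarrow> b2 \<in> X 1 \<Longrightarrow> tens S 1 1 b1 b2 \<in> X 2"
  using tens_X[of 1 1 b1 b2] by (simp add: numeral_2_eq_2)

lemma bcl_T: "1 \<le> i \<Longrightarrow> i < r \<Longrightarrow> r \<le> n \<Longrightarrow> bounded_clinear_on (X n) (X n) (T n i r)"
  using pair_op_bounded by blast

lemma place_2:
  assumes "n > 2"
  shows "place S n [i, r] x y = swap_conj S n i 1 (swap_conj S n r 2 (tens S 2 (n - 2) x y))"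
  using assms by (simp add: place_def numeral_2_eq_2 upt_rec)

text \<open>Freezing all factors except those in slots \<open>i\<close> and \<open>r\<close> gives a
  map from two particles to \<open>n\<close> under which \<open>T\<close> becomes
  \<open>pot\<close>. Every property of \<open>T\<close> is derived through such maps, which also
  hide the separate treatment of \<open>n = 2\<close>.\<close>

lemma pair_slot:
  assumes i: "1 \<le> i" "i < r" "r \<le> n" and a: "fam a"
  shows "\<exists>\<phi>. bounded_clinear_on (X 2) (X n) \<phi> \<and>
    (\<forall>b1\<in>X 1. \<forall>b2\<in>X 1. \<phi> (tens S 1 1 b1 b2) = ptens S (a(i := b1, r := b2)) n) \<and>
    (\<forall>x\<in>X 2. T n i r (\<phi> x) = \<phi> (pot S x))"
proof (cases "n = 2")
  case True
  then have "i = 1" "r = 2" using i by auto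
  then show ?thesis
    using True bcl_id[of "X 2"] pair_op_2 by (intro exI[of _ "\<lambda>x. x"]) (auto simp: numeral_2_eq_2)
next
  case False
  then have n: "n > 2" "n \<ge> 1" "n - 2 \<ge> 1" "2 + (n - 2) = n" using i by auto
  define c where "c = (\<lambda>p. a (swp i 1 (swp r 2 p)))"
  define y where "y = ptens S (\<lambda>p. c (p + 2)) (n - 2)"
  have fc: "fam c" using a by (simp add: c_def)
  have y: "y \<in> X (n - 2)" unfolding y_def using fc n by (intro ptens_X') auto
  have mem: "i \<in> {1..n}" "1 \<in> {1..n}" "r \<in> {1..n}" "2 \<in> {1..n}" using i n by auto
  note sw1 = bcl_swap[OF mem(1,2)] and sw2 = bcl_swap[OF mem(3,4)]
  have t: "bounded_clinear_on (X 2) (X n) (\<lambda>x. tens S 2 (n - 2) x y)"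
    using bcl_tens_left[of 2 "n - 2", OF _ n(3) y] n(4) by simp
  have b: "bounded_clinear_on (X 2) (X n) (\<lambda>x. place S n [i, r] x y)"
    unfolding place_2[OF n(1)] by (intro bcl_compose[OF _ sw1] bcl_compose[OF _ sw2] t)
  moreover have "place S n [i, r] (tens S 1 1 b1 b2) y = ptens S (a(i := b1, r := b2)) n"
    if b1: "b1 \<in> X 1" and b2: "b2 \<in> X 1" for b1 b2
  proof -
    define d where "d = c(1 := b1, 2 := b2)"
    have fd: "fam d" using fc b1 b2 by (simp add: d_def)
    have "tens S 1 1 b1 b2 = ptens S d 2" by (simp add: d_def numeral_2_eq_2)
    moreover have "y = ptens S (\<lambda>p. d (p + 2)) (n - 2)"
      unfolding y_def by (rule ptens_cong) (simp add: d_def)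
    moreover have "tens S 2 (n - 2) (ptens S d 2) (ptens S (\<lambda>p. d (p + 2)) (n - 2)) = ptens S d n"
      using tens_ptens[OF fd one_le_numeral n(3)] n(4) by (simp only:)
    ultimately have "tens S 2 (n - 2) (tens S 1 1 b1 b2) y = ptens S d n"
      by (simp only:)
    then have "place S n [i, r] (tens S 1 1 b1 b2) y = swap_conj S n i 1 (swap_conj S n r 2 (ptens S d n))"
      by (simp add: place_2[OF n(1)])
    also have "\<dots> = ptens S (\<lambda>p. d (swp r 2 (swp i 1 p))) n"
      using fd by (subst swap_ptens[OF _ mem(3,4)], simp, subst swap_ptens[OF _ mem(1,2)]) simp_all
    also have "(\<lambda>p. d (swp r 2 (swp i 1 p))) = a(i := b1, r := b2)"
    proof
      fix p
      have "swp r 2 (swp i 1 p) = 1 \<longleftrightarrow> p = i" "swp r 2 (swp i 1 p) = 2 \<longleftrightarrow> p = r"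
        using i by (auto simp: swp_def)
      then show "d (swp r 2 (swp i 1 p)) = (a(i := b1, r := b2)) p"
        by (simp only: d_def c_def fun_upd_apply swp_swp)
    qed
    finally show ?thesis .
  qed
  moreover have "T n i r (place S n [i, r] x y) = place S n [i, r] (pot S x) y" if "x \<in> X 2" for x
    using pair_op_place[OF i n(1) that y] .
  ultimately show ?thesis by blast
qed

text \<open>If \<open>L\<close> carries the two free factors unchanged from slots
  \<open>i, r\<close> to \<open>i', r'\<close>, then on the range of the map from
  \<open>pair_slot\<close> it is a multiple of another such map, and both turn the interaction into
  \<open>pot\<close>.\<close>

lemma T_natural:
  assumes L: "bounded_clinear_on (X n) (X m) L" and i: "1 \<le> i" "i < r" "r \<le> n" and i': "1 \<le> i'" "i' < r'" "r' \<le> m"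
    and a: "fam a" and a': "fam a'"
    and eq: "\<And>b1 b2. b1 \<in> X 1 \<Longrightarrow> b2 \<in> X 1 \<Longrightarrow>
      L (ptens S (a(i := b1, r := b2)) n) = c *\<^sub>C ptens S (a'(i' := b1, r' := b2)) m"
  shows "L (T n i r (ptens S a n)) = T m i' r' (L (ptens S a n))"
proof -
  obtain f where f: "bounded_clinear_on (X 2) (X n) f"
    "\<And>b1 b2. b1 \<in> X 1 \<Longrightarrow> b2 \<in> X 1 \<Longrightarrow> f (tens S 1 1 b1 b2) = ptens S (a(i := b1, r := b2)) n"
    "\<And>x. x \<in> X 2 \<Longrightarrow> T n i r (f x) = f (pot S x)"
    using pair_slot[OF i a] by blast
  obtain g where g: "bounded_clinear_on (X 2) (X m) g"
    "\<And>b1 b2. b1 \<in> X 1 \<Longrightarrow> b2 \<in> X 1 \<Longrightarrow> g (tens S 1 1 b1 b2) = ptens S (a'(i' := b1, r' := b2)) m"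
    "\<And>x. x \<in> X 2 \<Longrightarrow> T m i' r' (g x) = g (pot S x)"
    using pair_slot[OF i' a'] by blast
  have m: "m \<ge> 1" using i' by simp
  have cg: "bounded_clinear_on (X 2) (X m) (\<lambda>x. c *\<^sub>C g x)" by (intro bcl_scale g csub_X m)
  have Lf: "L (f x) = c *\<^sub>C g x" if "x \<in> X 2" for x
    by (rule bcl_ext2[OF bcl_compose[OF f(1) L] cg _ that]) (simp only: f(2) g(2) eq)
  define w where "w = tens S 1 1 (a i) (a r)"
  have w: "w \<in> X 2" unfolding w_def using a by (intro tens_11_X) auto
  note V = bcl_mem[OF pot_bounded w]
  have "f w = ptens S (a(i := a i, r := a r)) n" unfolding w_def using a by (intro f) auto
  then have pa: "ptens S a n = f w" by simp
  have "L (T n i r (f w)) = c *\<^sub>C g (pot S w)" using f(3)[OF w] Lf[OF V] by simp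
  also have "\<dots> = T m i' r' (c *\<^sub>C g w)"
    using bcl_scaleC[OF bcl_T[OF i'] bcl_mem[OF g(1) w]] g(3)[OF w] by simp
  also have "c *\<^sub>C g w = L (f w)" using Lf[OF w] by simp
  finally show ?thesis unfolding pa .
qed

lemma T_comm:
  assumes L: "bounded_clinear_on (X n) (X m) L" and i: "1 \<le> i" "i < r" "r \<le> n" and i': "1 \<le> i'" "i' < r'" "r' \<le> m"
    and eq: "\<And>a. fam a \<Longrightarrow> \<exists>c a'. fam a' \<and> (\<forall>b1\<in>X 1. \<forall>b2\<in>X 1.
      L (ptens S (a(i := b1, r := b2)) n) = c *\<^sub>C ptens S (a'(i' := b1, r' := b2)) m)"
    and x: "x \<in> X n"
  shows "L (T n i r x) = T m i' r' (L x)"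
proof (rule bcl_ext[OF _ bcl_compose[OF bcl_T[OF i] L] bcl_compose[OF L bcl_T[OF i']] _ x])
  fix a assume a: "fam a"
  obtain c a' where "fam a'" "\<forall>b1\<in>X 1. \<forall>b2\<in>X 1.
      L (ptens S (a(i := b1, r := b2)) n) = c *\<^sub>C ptens S (a'(i' := b1, r' := b2)) m"
    using eq[OF a] by blast
  then show "L (T n i r (ptens S a n)) = T m i' r' (L (ptens S a n))"
    by (intro T_natural[OF L i i' a]) auto
qed (use i in simp)

lemma T_repl:
  assumes i: "1 \<le> i" "i < r" "r \<le> n" and l: "l \<in> {1..n}" "l \<noteq> i" "l \<noteq> r" and y: "y \<in> X 1" and x: "x \<in> X n"
  shows "repl S n l y (T n i r x) = T n i r (repl S n l y x)"
proof (rule T_comm[OF bcl_repl[OF l(1) y] i i _ x])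
  fix a assume a: "fam a"
  have "repl S n l y (ptens S (a(i := b1, r := b2)) n) = ell S 1 (a l) *\<^sub>C ptens S (a(l := y, i := b1, r := b2)) n"
    if b: "b1 \<in> X 1" "b2 \<in> X 1" for b1 b2
  proof -
    have "a(i := b1, r := b2, l := y) = a(l := y, i := b1, r := b2)"
      using l by (auto simp: fun_eq_iff)
    then show ?thesis
      unfolding repl_ptens[OF l(1) fam_upd[OF fam_upd[OF a b(1)] b(2)] y] using l by simp
  qed
  then show "\<exists>c a'. fam a' \<and> (\<forall>b1\<in>X 1. \<forall>b2\<in>X 1.
      repl S n l y (ptens S (a(i := b1, r := b2)) n) = c *\<^sub>C ptens S (a'(i := b1, r := b2)) n)"
    using fam_upd[OF a y, of l] by blast
qed

lemma T_marg:
  assumes i: "1 \<le> i" "i < r" "r < n" and x: "x \<in> X n"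
  shows "marg S n (T n i r x) = T (n - 1) i r (marg S n x)"
proof -
  have n: "n \<ge> 2" and r: "r \<le> n" "r \<le> n - 1" using i by auto
  show ?thesis
  proof (rule T_comm[OF marg_linear[OF n] i(1,2) r(1) i(1,2) r(2) _ x])
    fix a assume a: "fam a"
    have "marg S n (ptens S (a(i := b1, r := b2)) n) = ell S 1 (a n) *\<^sub>C ptens S (a(i := b1, r := b2)) (n - 1)"
      if b: "b1 \<in> X 1" "b2 \<in> X 1" for b1 b2
      unfolding marg_ptens'[OF n fam_upd[OF fam_upd[OF a b(1)] b(2)]] using i by simp
    then show "\<exists>c a'. fam a' \<and> (\<forall>b1\<in>X 1. \<forall>b2\<in>X 1.
        marg S n (ptens S (a(i := b1, r := b2)) n) = c *\<^sub>C ptens S (a'(i := b1, r := b2)) (n - 1))"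
      using a by blast
  qed
qed

text \<open>The order of the two slots has to survive: \<open>T\<close> treats its slots as an
  ordered pair, and \<open>pot\<close> is not assumed to commute with exchanging them.\<close>

lemma T_swap:
  assumes i: "1 \<le> i" "i < r" "r \<le> n" and k: "k \<in> {1..n}" and s: "s \<in> {1..n}"
    and lt: "swp k s i < swp k s r" and x: "x \<in> X n"
  shows "swap_conj S n k s (T n i r x) = T n (swp k s i) (swp k s r) (swap_conj S n k s x)"
proof -
  have i': "1 \<le> swp k s i" "swp k s r \<le> n" using i k s by (auto simp: swp_def)
  show ?thesis
  proof (rule T_comm[OF bcl_swap[OF k s] i i'(1) lt i'(2) _ x])
    fix a assume a: "fam a"
    have "swap_conj S n k s (ptens S (a(i := b1, r := b2)) n) =
        1 *\<^sub>C ptens S ((\<lambda>p. a (swp k s p))(swp k s i := b1, swp k s r := b2)) n"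
      if b: "b1 \<in> X 1" "b2 \<in> X 1" for b1 b2
    proof -
      have "(\<lambda>p. (a(i := b1, r := b2)) (swp k s p)) = (\<lambda>p. a (swp k s p))(swp k s i := b1, swp k s r := b2)"
        by (auto simp: fun_eq_iff)
      then show ?thesis
        unfolding swap_ptens[OF fam_upd[OF fam_upd[OF a b(1)] b(2)] k s] by simp
    qed
    then show "\<exists>c a'. fam a' \<and> (\<forall>b1\<in>X 1. \<forall>b2\<in>X 1.
        swap_conj S n k s (ptens S (a(i := b1, r := b2)) n) = c *\<^sub>C ptens S (a'(swp k s i := b1, swp k s r := b2)) n)"
      using a by (intro exI[of _ 1] exI[of _ "\<lambda>p. a (swp k s p)"]) simp
  qed
qed

text \<open>The form in which preservation of symmetry is usable: the flip of the two slots can be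
  ignored after symmetrisation. The sum of a pair and its flip is a symmetric two-particle element,
  so \<open>pot_symmetric\<close> applies to it.\<close>

lemma T_symmetric:
  assumes i: "1 \<le> i" "i < r" "r \<le> n" and x: "x \<in> X n"
  shows "swap_conj S n i r (T n i r (x + swap_conj S n i r x)) = T n i r (x + swap_conj S n i r x)"
proof -
  have n: "n \<ge> 1" and m: "i \<in> {1..n}" "r \<in> {1..n}" and m2: "1 \<in> {1..2::nat}" "2 \<in> {1..2::nat}" using i by auto
  note sw = bcl_swap[OF m] and Tb = bcl_T[OF i] and sw2 = bcl_swap[OF m2] norm_swap[OF m2]
  have b: "bounded_clinear_on (X n) (X n) (\<lambda>x. x + swap_conj S n i r x)"
    by (intro bcl_plus bcl_id sw csub_X n)
  show ?thesis
  proof (rule bcl_ext[OF n bcl_compose[OF bcl_compose[OF b Tb] sw] bcl_compose[OF b Tb] _ x])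
    fix a assume a: "fam a"
    obtain f where f: "bounded_clinear_on (X 2) (X n) f"
      "\<And>b1 b2. b1 \<in> X 1 \<Longrightarrow> b2 \<in> X 1 \<Longrightarrow> f (tens S 1 1 b1 b2) = ptens S (a(i := b1, r := b2)) n"
      "\<And>x. x \<in> X 2 \<Longrightarrow> T n i r (f x) = f (pot S x)"
      using pair_slot[OF i a] by blast
    have s2: "swap_conj S 2 1 2 (tens S 1 1 b1 b2) = tens S 1 1 b2 b1" if b: "b1 \<in> X 1" "b2 \<in> X 1" for b1 b2
      using swap_ptens[of "\<lambda>i. if i = 1 then b1 else b2", OF _ m2] b by (simp add: numeral_2_eq_2 swp_def)
    have fs: "swap_conj S n i r (f z) = f (swap_conj S 2 1 2 z)" if z: "z \<in> X 2" for z
    proof (rule bcl_ext2[OF bcl_compose[OF f(1) sw] bcl_compose[OF sw2(1) f(1)] _ z])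
      fix b1 b2 assume b: "b1 \<in> X 1" "b2 \<in> X 1"
      have "(\<lambda>p. (a(i := b1, r := b2)) (swp i r p)) = a(i := b2, r := b1)"
        using i by (auto simp: fun_eq_iff swp_def)
      then show "swap_conj S n i r (f (tens S 1 1 b1 b2)) = f (swap_conj S 2 1 2 (tens S 1 1 b1 b2))"
        unfolding s2[OF b] f(2)[OF b] f(2)[OF b(2,1)] swap_ptens[OF fam_upd[OF fam_upd[OF a b(1)] b(2)] m] by simp
    qed
    define w where "w = tens S 1 1 (a i) (a r)"
    have w: "w \<in> X 2" unfolding w_def using a by (intro tens_11_X) auto
    note w' = bcl_mem[OF sw2(1) w]
    have "f w = ptens S (a(i := a i, r := a r)) n" unfolding w_def using a by (intro f) auto
    then have pa: "ptens S a n = f w" by simp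
    define u where "u = w + swap_conj S 2 1 2 w"
    have u: "u \<in> X 2" unfolding u_def by (intro csub_add csub_X w w') simp
    \<comment> \<open>\<open>symmetric\<close> quantifies over all ordered pairs of slots, so the
      reversed and the degenerate transpositions have to be identified as well.\<close>
    have 21: "swap_conj S 2 2 1 z = swap_conj S 2 1 2 z" and 11: "swap_conj S 2 k k z = z"
      if "z \<in> X 2" "k \<in> {1..2}" for z k
    proof -
      show "swap_conj S 2 2 1 z = swap_conj S 2 1 2 z"
      proof (rule bcl_ext[OF _ bcl_swap[OF m2(2,1)] sw2(1) _ that(1)])
        fix a assume a: "fam a"
        show "swap_conj S 2 2 1 (ptens S a 2) = swap_conj S 2 1 2 (ptens S a 2)"
          unfolding swap_ptens[OF a m2] swap_ptens[OF a m2(2,1)] by (rule ptens_cong) (auto simp: swp_def)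
      qed simp
      show "swap_conj S 2 k k z = z"
        by (rule bcl_ext[OF _ bcl_swap[OF that(2,2)] bcl_id _ that(1)]) (simp_all add: swap_ptens[OF _ that(2,2)])
    qed
    have ww: "swap_conj S 2 1 2 (swap_conj S 2 1 2 w) = w"
      unfolding w_def using s2 a by simp
    have us: "swap_conj S 2 1 2 u = u"
      unfolding u_def using bcl_add[OF sw2(1) w w'] ww by (simp add: add.commute)
    have "symmetric S 2 u"
      unfolding symmetric_def
    proof (intro ballI)
      fix k s assume "k \<in> {1..2::nat}" "s \<in> {1..2::nat}"
      then consider "k = s" | "k = 1" "s = 2" | "k = 2" "s = 1" by fastforce
      then show "swap_conj S 2 k s u = u"
        using 11[OF u \<open>k \<in> {1..2}\<close>] 21[OF u m2(1)] us by cases auto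
    qed
    then have "symmetric S 2 (pot S u)" by (rule pot_symmetric[OF u])
    then have Vs: "swap_conj S 2 1 2 (pot S u) = pot S u" using m2 by (simp add: symmetric_def)
    have "ptens S a n + swap_conj S n i r (ptens S a n) = f u"
      unfolding pa u_def fs[OF w] using bcl_add[OF f(1) w w'] by simp
    then show "swap_conj S n i r (T n i r (ptens S a n + swap_conj S n i r (ptens S a n))) =
        T n i r (ptens S a n + swap_conj S n i r (ptens S a n))"
      using fs[OF bcl_mem[OF pot_bounded u]] Vs f(3)[OF u] by simp
  qed
qed

text \<open>The interaction of two traced-out particles is invisible to the others by
  \<open>marginal_pair_op\<close>. Applied to particles 2 and 3 and the marginal of particle 1, this
  says that \<open>pot\<close> produces trace zero; it is the source of the condition
  \<open>npart S \<ge> 3\<close>.\<close>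

lemma ell_pot:
  assumes N: "npart S \<ge> 3" and y: "y \<in> X 1" "ell S 1 y = 1" and x: "x \<in> X 2"
  shows "ell S 2 (pot S x) = 0"
proof -
  let ?N = "npart S"
  have i: "1 \<le> (2::nat)" "2 < (3::nat)" "3 \<le> ?N" using N by auto
  have N1: "1 \<le> ?N" using N by simp
  \<comment> \<open>The spectators all carry \<open>y\<close>, of trace one, so tracing out
    everything but slot 1 leaves just the two-particle trace times \<open>y\<close>.\<close>
  obtain f where f: "bounded_clinear_on (X 2) (X ?N) f"
    "\<And>b1 b2. b1 \<in> X 1 \<Longrightarrow> b2 \<in> X 1 \<Longrightarrow> f (tens S 1 1 b1 b2) = ptens S ((\<lambda>_. y)(2 := b1, 3 := b2)) ?N"
    "\<And>x. x \<in> X 2 \<Longrightarrow> T ?N 2 3 (f x) = f (pot S x)"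
    using pair_slot[OF i, of "\<lambda>_. y"] y by auto
  have m: "bounded_clinear_on (X ?N) (X 1) (marginal S 1 ?N)" using N by (intro bcl_marginal) auto
  have eq: "marginal S 1 ?N (f z) = ell S 2 z *\<^sub>C y" if z: "z \<in> X 2" for z
  proof (rule bcl_ext2[OF bcl_compose[OF f(1) m] bcl_ell _ z])
    fix b1 b2 assume b: "b1 \<in> X 1" "b2 \<in> X 1"
    have fa: "fam ((\<lambda>_. y)(2 := b1, 3 := b2))" using y b by simp
    have "(\<Prod>i=1+1..?N. ell S 1 (((\<lambda>_. y)(2 := b1, 3 := b2)) i)) =
        (\<Prod>i\<in>{2, 3::nat}. ell S 1 (((\<lambda>_. y)(2 := b1, 3 := b2)) i))"
      using N y by (intro prod.mono_neutral_right) auto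
    also have "\<dots> = ell S 1 b1 * ell S 1 b2" by simp
    also have "\<dots> = ell S 2 (tens S 1 1 b1 b2)"
      using ell_tens[of 1 1 b1 b2] b by (simp add: numeral_2_eq_2)
    finally have P: "(\<Prod>i=1+1..?N. ell S 1 (((\<lambda>_. y)(2 := b1, 3 := b2)) i)) = ell S 2 (tens S 1 1 b1 b2)" .
    show "marginal S 1 ?N (f (tens S 1 1 b1 b2)) = ell S 2 (tens S 1 1 b1 b2) *\<^sub>C y"
      unfolding f(2)[OF b] marginal_ptens[OF order_refl N1 fa] P by simp
  qed simp
  have "ell S 2 (pot S x) *\<^sub>C y = marginal S 1 ?N (T ?N 2 3 (f x))"
    using eq[OF bcl_mem[OF pot_bounded x]] f(3)[OF x] by simp
  also have "\<dots> = 0"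
    using bcl_mem[OF f(1) x] N by (intro marginal_pair_op) auto
  finally have "ell S 2 (pot S x) *\<^sub>C y = 0 *\<^sub>C y" by (simp add: scaleC.zero_left)
  moreover have "y \<noteq> 0" using y(2) ell_scaleC[of 1 0 0] csub_zero[OF csub_X[of 1]] by (auto simp: scaleC.zero_left)
  ultimately show ?thesis by (rule scaleC_cancel)
qed

text \<open>\<open>C j i\<close> is \<open>\<ell>\<^bsub>j+1\<^esub> T\<^bsub>i,j+1\<^esub>\<close>.\<close>

definition C :: "nat \<Rightarrow> nat \<Rightarrow> 'b \<Rightarrow> 'b" where
  "C j i x = marg S (Suc j) (T (Suc j) i (Suc j) x)"

lemma bcl_C: "i \<in> {1..j} \<Longrightarrow> bounded_clinear_on (X (Suc j)) (X j) (C j i)"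
  unfolding C_def using bcl_compose[OF bcl_T[of i "Suc j" "Suc j"] marg_linear[of "Suc j"]] by simp

lemma repl_C:
  assumes i: "i \<in> {1..j}" and l: "l \<in> {1..j}" "l \<noteq> i" and y: "y \<in> X 1" and x: "x \<in> X (Suc j)"
  shows "repl S j l y (C j i x) = C j i (repl S (Suc j) l y x)"
  unfolding C_def using i l y x T_repl[of i "Suc j" "Suc j" l y x] marg_repl[of "Suc j" l y "T (Suc j) i (Suc j) x"]
    bcl_mem[OF bcl_T[of i "Suc j" "Suc j"]] by simp

text \<open>On tensors with free factors in slots \<open>i\<close> and \<open>j+1\<close>, the
  collision operator inserts the one-particle marginal of \<open>pot x\<close> into slot
  \<open>i\<close>. The element \<open>y\<close> is a placeholder there: its trace one keeps the
  insertion free of a scalar factor.\<close>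

lemma C_slot:
  assumes i: "i \<in> {1..j}" and y: "y \<in> X 1" "ell S 1 y = 1" and a: "fam a"
  shows "\<exists>f. bounded_clinear_on (X 2) (X (Suc j)) f \<and>
    (\<forall>b1\<in>X 1. \<forall>b2\<in>X 1. f (tens S 1 1 b1 b2) = ptens S (a(i := b1, Suc j := b2)) (Suc j)) \<and>
    (\<forall>x\<in>X 2. C j i (f x) = repl S j i (marg S 2 (pot S x)) (ptens S (a(i := y)) j))"
proof -
  have ij: "1 \<le> i" "i < Suc j" "Suc j \<le> Suc j" using i by auto
  have j: "j \<ge> 1" "Suc j \<ge> 2" using i by auto
  obtain f where f: "bounded_clinear_on (X 2) (X (Suc j)) f"
    "\<And>b1 b2. b1 \<in> X 1 \<Longrightarrow> b2 \<in> X 1 \<Longrightarrow> f (tens S 1 1 b1 b2) = ptens S (a(i := b1, Suc j := b2)) (Suc j)"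
    "\<And>x. x \<in> X 2 \<Longrightarrow> T (Suc j) i (Suc j) (f x) = f (pot S x)"
    using pair_slot[OF ij a] by blast
  have fy: "fam (a(i := y))" using a y by simp
  have p: "ptens S (a(i := y)) j \<in> X j" by (intro ptens_X' j fy)
  have m: "bounded_clinear_on (X (Suc j)) (X j) (marg S (Suc j))" using marg_linear[OF j(2)] by simp
  have m2: "bounded_clinear_on (X 2) (X 1) (marg S 2)" using marg_linear[of 2] by simp
  have eq: "marg S (Suc j) (f z) = repl S j i (marg S 2 z) (ptens S (a(i := y)) j)" if z: "z \<in> X 2" for z
  proof (rule bcl_ext2[OF bcl_compose[OF f(1) m] bcl_compose[OF m2 bcl_repl_arg[OF i p]] _ z])
    fix b1 b2 assume b: "b1 \<in> X 1" "b2 \<in> X 1"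
    have fb: "fam (a(i := b1, Suc j := b2))" using a b by simp
    have m2b: "marg S 2 (tens S 1 1 b1 b2) = ell S 1 b2 *\<^sub>C b1"
      using marg_ptens'[of 2 "(\<lambda>_. b2)(1 := b1)"] b by (simp add: numeral_2_eq_2)
    have "marg S (Suc j) (f (tens S 1 1 b1 b2)) = ell S 1 b2 *\<^sub>C ptens S (a(i := b1, Suc j := b2)) j"
      unfolding f(2)[OF b] marg_ptens'[OF j(2) fb] by simp
    also have "ptens S (a(i := b1, Suc j := b2)) j = ptens S (a(i := b1)) j"
      by (rule ptens_cong) auto
    also have "\<dots> = repl S j i b1 (ptens S (a(i := y)) j)"
      unfolding repl_ptens[OF i fy b(1)] using y by simp
    also have "ell S 1 b2 *\<^sub>C \<dots> = repl S j i (ell S 1 b2 *\<^sub>C b1) (ptens S (a(i := y)) j)"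
      using bcl_scaleC[OF bcl_repl_arg[OF i p] b(1)] by simp
    finally show "marg S (Suc j) (f (tens S 1 1 b1 b2)) = repl S j i (marg S 2 (tens S 1 1 b1 b2)) (ptens S (a(i := y)) j)"
      by (simp only: m2b)
  qed
  show ?thesis
    using f eq[OF bcl_mem[OF pot_bounded]] by (intro exI[of _ f]) (auto simp: C_def)
qed

text \<open>The element that a collision leaves in slot \<open>i\<close> has the trace of
  \<open>pot\<close> applied to a pair, which is zero by \<open>ell_pot\<close>; hence tracing out
  slot \<open>i\<close> annihilates it.\<close>

lemma repl_C_same:
  assumes N: "npart S \<ge> 3" and i: "i \<in> {1..j}" and y: "y \<in> X 1" "ell S 1 y = 1" and x: "x \<in> X (Suc j)"
  shows "repl S j i y (C j i x) = 0"
proof -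
  have j: "j \<ge> 1" using i by auto
  note R = bcl_repl[OF i y(1)]
  show ?thesis
  proof (rule bcl_ext[OF _ bcl_compose[OF bcl_C[OF i] R] bcl_zero_fun[OF csub_X[OF j]] _ x])
    fix a assume a: "fam a"
    obtain f where f: "\<And>b1 b2. b1 \<in> X 1 \<Longrightarrow> b2 \<in> X 1 \<Longrightarrow> f (tens S 1 1 b1 b2) = ptens S (a(i := b1, Suc j := b2)) (Suc j)"
      "\<And>x. x \<in> X 2 \<Longrightarrow> C j i (f x) = repl S j i (marg S 2 (pot S x)) (ptens S (a(i := y)) j)"
      using C_slot[OF i y a] by blast
    have w: "tens S 1 1 (a i) (a (Suc j)) \<in> X 2" using a by (intro tens_11_X) auto
    define q where "q = marg S 2 (pot S (tens S 1 1 (a i) (a (Suc j))))"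
    have q: "q \<in> X 1" unfolding q_def using bcl_mem[OF marg_linear[of 2] bcl_mem[OF pot_bounded w]] by simp
    have eq: "ell S 1 q = 0"
      unfolding q_def using ell_marg[of 2, OF _ bcl_mem[OF pot_bounded w]] ell_pot[OF N y w] by simp
    have fy: "fam (a(i := y))" using a y by simp
    have fq: "fam (a(i := y, i := q))" using a y q by simp
    have "C j i (ptens S a (Suc j)) = repl S j i q (ptens S (a(i := y)) j)"
      using f(1)[of "a i" "a (Suc j)"] f(2)[OF w] a by (simp add: q_def)
    then have Ceq: "C j i (ptens S a (Suc j)) = ell S 1 ((a(i := y)) i) *\<^sub>C ptens S (a(i := y, i := q)) j"
      unfolding repl_ptens[OF i fy q] .
    show "repl S j i y (C j i (ptens S a (Suc j))) = 0"
      unfolding Ceq bcl_scaleC[OF R ptens_X'[OF j fq]] repl_ptens[OF i fq y(1)] using eq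
      by (simp add: scaleC.zero_left scaleC.zero_right)
  qed simp
qed

text \<open>With \<open>y\<close> in both interacting slots the collision operator inserts
  \<open>Q(y, y)\<close>. This rewrites the mean field source as a collision term, so that the two
  can be subtracted.\<close>

lemma repl_mf_op:
  assumes i: "i \<in> {1..j}" and y: "y \<in> X 1" "ell S 1 y = 1" and x: "x \<in> X (Suc j)"
  shows "C j i (repl S (Suc j) i y (repl S (Suc j) (Suc j) y x)) = repl S j i (mf_op S y y) (marg S (Suc j) x)"
proof -
  have j: "j \<ge> 1" "Suc j \<ge> 1" "Suc j \<ge> 2" and m: "i \<in> {1..Suc j}" "Suc j \<in> {1..Suc j}" and ne: "i \<noteq> Suc j" using i by auto
  note R = bcl_repl[OF m(1) y(1)] bcl_repl[OF m(2) y(1)]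
  have w: "tens S 1 1 y y \<in> X 2" by (intro tens_11_X y)
  have q: "mf_op S y y \<in> X 1"
    unfolding mf_op_def using bcl_mem[OF marg_linear[of 2] bcl_mem[OF pot_bounded w]] by simp
  have mg: "bounded_clinear_on (X (Suc j)) (X j) (marg S (Suc j))" using marg_linear[OF j(3)] by simp
  note Rq = bcl_repl[OF i q]
  show ?thesis
  proof (rule bcl_ext[OF j(2) bcl_compose[OF bcl_compose[OF R(2,1)] bcl_C[OF i]] bcl_compose[OF mg Rq] _ x])
    fix a assume a: "fam a"
    define b where "b = a(i := y, Suc j := y)"
    have b: "fam b" using a y by (simp add: b_def)
    have fq: "fam (a(i := mf_op S y y))" using a q by simp
    obtain f where f: "\<And>b1 b2. b1 \<in> X 1 \<Longrightarrow> b2 \<in> X 1 \<Longrightarrow> f (tens S 1 1 b1 b2) = ptens S (b(i := b1, Suc j := b2)) (Suc j)"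
      "\<And>x. x \<in> X 2 \<Longrightarrow> C j i (f x) = repl S j i (marg S 2 (pot S x)) (ptens S (b(i := y)) j)"
      using C_slot[OF i y b] by blast
    have fy: "fam (a(Suc j := y))" using a y by simp
    have "repl S (Suc j) i y (repl S (Suc j) (Suc j) y (ptens S a (Suc j))) =
        (ell S 1 (a (Suc j)) * ell S 1 (a i)) *\<^sub>C ptens S b (Suc j)"
      unfolding repl_ptens[OF m(2) a y(1)] bcl_scaleC[OF R(1) ptens_X'[OF j(2) fy]] repl_ptens[OF m(1) fy y(1)]
      using ne by (simp add: b_def scaleC_scaleC fun_upd_twist)
    moreover have "C j i (ptens S b (Suc j)) = repl S j i (mf_op S y y) (ptens S (b(i := y)) j)"
    proof -
      have "f (tens S 1 1 y y) = ptens S (b(i := y, Suc j := y)) (Suc j)" by (intro f y)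
      also have "b(i := y, Suc j := y) = b" by (auto simp: b_def fun_eq_iff)
      finally show ?thesis using f(2)[OF w] by (simp add: mf_op_def)
    qed
    moreover have "ptens S (b(i := y)) j = ptens S (a(i := y)) j"
      by (rule ptens_cong) (auto simp: b_def)
    ultimately have "C j i (repl S (Suc j) i y (repl S (Suc j) (Suc j) y (ptens S a (Suc j)))) =
        (ell S 1 (a (Suc j)) * ell S 1 (a i)) *\<^sub>C repl S j i (mf_op S y y) (ptens S (a(i := y)) j)"
      using bcl_scaleC[OF bcl_C[OF i] ptens_X'[OF j(2) b]] by simp
    also have "\<dots> = (ell S 1 (a (Suc j)) * ell S 1 (a i)) *\<^sub>C ptens S (a(i := mf_op S y y)) j"
      unfolding repl_ptens[OF i fam_upd[OF a y(1)] q] using y by simp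
    also have "\<dots> = repl S j i (mf_op S y y) (marg S (Suc j) (ptens S a (Suc j)))"
      unfolding marg_ptens'[OF j(3) a] diff_Suc_1 bcl_scaleC[OF Rq ptens_X'[OF j(1) a]] repl_ptens[OF i a q]
      by (simp add: scaleC_scaleC)
    finally show "C j i (repl S (Suc j) i y (repl S (Suc j) (Suc j) y (ptens S a (Suc j)))) =
        repl S j i (mf_op S y y) (marg S (Suc j) (ptens S a (Suc j)))" .
  qed
qed

end

section \<open>Correlation errors as products of projections\<close>

text \<open>The fold makes sense because replacements in distinct slots commute.\<close>

definition repls ::
    "('h, 'f, 'b::complex_banach) mean_field_data \<Rightarrow> nat \<Rightarrow> 'b \<Rightarrow> nat set \<Rightarrow> 'b \<Rightarrow> 'b" where
  "repls S n y K x = Finite_Set.fold (\<lambda>l. repl S n l y) x K"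

text \<open>The product of \<open>1 - R_l\<close> over \<open>J\<close>; for \<open>y\<close> of
  trace one each factor is idempotent.\<close>

definition proj ::
    "('h, 'f, 'b::complex_banach) mean_field_data \<Rightarrow> nat \<Rightarrow> 'b \<Rightarrow> nat set \<Rightarrow> 'b \<Rightarrow> 'b" where
  "proj S n y J x = Finite_Set.fold (\<lambda>l x. x - repl S n l y x) x J"

text \<open>The permutation of slots performed by the iterated conjugation in
  \<open>place\<close>.\<close>

definition swaps :: "(nat \<times> nat) list \<Rightarrow> nat \<Rightarrow> nat" where
  "swaps ps q = foldr (\<lambda>(i, p). swp i p) ps q"

lemma swaps_Nil [simp]: "swaps [] q = q"
  and swaps_Cons [simp]: "swaps ((i, p) # ps) q = swp i p (swaps ps q)"
  by (simp_all add: swaps_def)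

lemma inj_swaps: "inj (swaps ps)"
proof (induction ps)
  case (Cons a ps)
  obtain i p where a: "a = (i, p)" by fastforce
  show ?case unfolding a inj_def swaps_Cons
    by (metis Cons injD swp_swp)
qed (simp add: inj_def)

text \<open>The start \<open>s\<close> is general so that the induction can move it. The outermost
  transposition exchanges \<open>x\<close> and \<open>s\<close> with \<open>s \<le> x\<close>, and
  cannot disturb the later targets because these exceed \<open>x\<close>.\<close>

lemma swaps_sorted:
  assumes "sorted_wrt (<) xs" "\<forall>x\<in>set xs. s \<le> x"
  shows "(\<forall>q<s. swaps (zip xs [s..<s + length xs]) q = q) \<and>
    (\<forall>t<length xs. swaps (zip xs [s..<s + length xs]) (s + t) = xs ! t)"
  using assms
proof (induction xs arbitrary: s)
  case (Cons x xs)
  have IH: "(\<forall>q<Suc s. swaps (zip xs [Suc s..<Suc s + length xs]) q = q) \<and>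
    (\<forall>t<length xs. swaps (zip xs [Suc s..<Suc s + length xs]) (Suc s + t) = xs ! t)"
    using Cons.prems by (intro Cons.IH) fastforce+
  have z: "zip (x # xs) [s..<s + length (x # xs)] = (x, s) # zip xs [Suc s..<Suc s + length xs]"
    using upt_conv_Cons[of s "s + length (x # xs)"] by simp
  show ?case
    unfolding z swaps_Cons
  proof (intro conjI allI impI)
    fix q assume "q < s"
    then show "swp x s (swaps (zip xs [Suc s..<Suc s + length xs]) q) = q"
      using IH Cons.prems by (auto simp: swp_def)
  next
    fix t assume t: "t < length (x # xs)"
    show "swp x s (swaps (zip xs [Suc s..<Suc s + length xs]) (s + t)) = (x # xs) ! t"
    proof (cases t)
      case 0
      then show ?thesis using IH by (auto simp: swp_def)
    next
      case (Suc t')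
      then have "xs ! t' \<in> set xs" using t by simp
      then have "x < xs ! t'" using Cons.prems by simp
      moreover have "s \<le> x" using Cons.prems by simp
      moreover have "swaps (zip xs [Suc s..<Suc s + length xs]) (s + t) = xs ! t'"
        using IH t Suc by simp
      ultimately show ?thesis using Suc by (simp add: swp_def)
    qed
  qed
qed simp

lemma subset_Icc_induct [consumes 1, case_names empty insert]:
  fixes K :: "nat set"
  assumes "K \<subseteq> {1..n}" "P {}" "\<And>l K. l \<in> {1..n} \<Longrightarrow> K \<subseteq> {1..n} \<Longrightarrow> l \<notin> K \<Longrightarrow> P K \<Longrightarrow> P (insert l K)"
  shows "P K"
  using finite_subset[OF assms(1) finite_atLeastAtMost] assms(1)
  by (induction K rule: finite_induct) (use assms in auto)

context mean_field_system
begin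

lemma comp_fun_commute_repl:
  assumes y: "y \<in> X 1" shows "comp_fun_commute_on {1..n} (\<lambda>l. repl S n l y)"
proof
  fix l k assume "l \<in> {1..n}" "k \<in> {1..n}"
  then show "repl S n k y \<circ> repl S n l y = repl S n l y \<circ> repl S n k y"
    using repl_comm[of l n k y y] y by (cases "l = k") auto
qed

lemma comp_fun_commute_proj:
  assumes y: "y \<in> X 1" shows "comp_fun_commute_on {1..n} (\<lambda>l x. x - repl S n l y x)"
proof
  fix l k assume l: "l \<in> {1..n}" and k: "k \<in> {1..n}"
  have n: "n \<ge> 1" using l by auto
  have d: "repl S n l y (x - repl S n k y x) = repl S n l y x - repl S n l y (repl S n k y x)"
    if l: "l \<in> {1..n}" and k: "k \<in> {1..n}" for x l k
  proof (cases "x \<in> X n")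
    case True
    then show ?thesis by (intro bcl_diff[OF bcl_repl[OF l y]] csub_X n repl_X k y)
  next
    case False
    then show ?thesis using bcl_zero[OF bcl_repl[OF l y] csub_X[OF n]] by (simp add: repl_def[of S n _ _ x])
  qed
  show "(\<lambda>x. x - repl S n k y x) \<circ> (\<lambda>x. x - repl S n l y x) = (\<lambda>x. x - repl S n l y x) \<circ> (\<lambda>x. x - repl S n k y x)"
    using repl_comm[OF l k _ y y] by (cases "l = k") (auto simp: fun_eq_iff d[OF l k] d[OF k l])
qed

lemma repls_empty [simp]: "repls S n y {} x = x"
  and proj_empty [simp]: "proj S n y {} x = x"
  by (simp_all add: repls_def proj_def)

context
  fixes n :: nat and y :: 'b
  assumes n: "n \<ge> 1" and y: "y \<in> X 1"
begin

lemma repls_insert: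
  assumes "l \<in> {1..n}" "K \<subseteq> {1..n}" "l \<notin> K"
  shows "repls S n y (insert l K) x = repl S n l y (repls S n y K x)"
  unfolding repls_def using assms finite_subset[OF assms(2)]
  by (intro comp_fun_commute_on.fold_insert[OF comp_fun_commute_repl[OF y]]) auto

lemma proj_insert:
  assumes "l \<in> {1..n}" "J \<subseteq> {1..n}" "l \<notin> J"
  shows "proj S n y (insert l J) x = proj S n y J x - repl S n l y (proj S n y J x)"
  unfolding proj_def using assms finite_subset[OF assms(2)]
  by (intro comp_fun_commute_on.fold_insert[OF comp_fun_commute_proj[OF y]]) auto

lemma bcl_repls: "K \<subseteq> {1..n} \<Longrightarrow> bounded_clinear_on (X n) (X n) (repls S n y K)"
proof (induction K rule: subset_Icc_induct)
  case empty
  show ?case using bcl_id by simp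
next
  case (insert l K)
  then show ?case
    using bcl_compose[OF insert.IH bcl_repl[OF insert.hyps(1) y]] repls_insert[OF insert.hyps(1-3)]
    by (simp add: fun_eq_iff[symmetric] ext)
qed

lemma bcl_proj: "J \<subseteq> {1..n} \<Longrightarrow> bounded_clinear_on (X n) (X n) (proj S n y J)"
proof (induction J rule: subset_Icc_induct)
  case empty
  show ?case using bcl_id by simp
next
  case (insert l J)
  have "proj S n y (insert l J) = (\<lambda>x. proj S n y J x - repl S n l y (proj S n y J x))"
    using proj_insert[OF insert.hyps(1-3)] by auto
  then show ?case
    using bcl_minus[OF insert.IH bcl_compose[OF insert.IH bcl_repl[OF insert.hyps(1) y]] csub_X[OF n]] by simp
qed

lemma proj_X: "J \<subseteq> {1..n} \<Longrightarrow> x \<in> X n \<Longrightarrow> proj S n y J x \<in> X n"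
  by (rule bcl_mem[OF bcl_proj])

lemma repls_X: "J \<subseteq> {1..n} \<Longrightarrow> x \<in> X n \<Longrightarrow> repls S n y J x \<in> X n"
  by (rule bcl_mem[OF bcl_repls])

lemma norm_repls:
  assumes "norm y = 1" "K \<subseteq> {1..n}" "x \<in> X n" shows "norm (repls S n y K x) \<le> norm x"
  using assms(2)
proof (induction K rule: subset_Icc_induct)
  case (insert l K)
  have "norm (repl S n l y (repls S n y K x)) \<le> norm (repls S n y K x)"
    using norm_repl[OF insert.hyps(1) y repls_X[OF insert.hyps(2) assms(3)]] assms(1) by simp
  then show ?case using insert by (simp add: repls_insert)
qed simp

lemma norm_proj:
  assumes "norm y = 1" "J \<subseteq> {1..n}" "x \<in> X n" shows "norm (proj S n y J x) \<le> 2 ^ card J * norm x"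
  using assms(2)
proof (induction J rule: subset_Icc_induct)
  case (insert l J)
  let ?z = "proj S n y J x"
  have "norm (?z - repl S n l y ?z) \<le> norm ?z + norm (repl S n l y ?z)" by (rule norm_triangle_ineq4)
  also have "\<dots> \<le> 2 * norm ?z"
    using norm_repl[OF insert.hyps(1) y proj_X[OF insert.hyps(2) assms(3)]] assms(1) by simp
  also have "\<dots> \<le> 2 * (2 ^ card J * norm x)" using insert.IH by simp
  finally show ?case
    using insert finite_subset[OF insert.hyps(2)] by (simp add: proj_insert)
qed simp

lemma repls_ptens:
  assumes "fam a" "K \<subseteq> {1..n}"
  shows "repls S n y K (ptens S a n) = (\<Prod>l\<in>K. ell S 1 (a l)) *\<^sub>C ptens S (\<lambda>i. if i \<in> K then y else a i) n"
  using assms(2)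
proof (induction K rule: subset_Icc_induct)
  case (insert l K)
  have f: "fam (\<lambda>i. if i \<in> K then y else a i)" using assms y by simp
  have "(\<lambda>i. if i \<in> K then y else a i)(l := y) = (\<lambda>i. if i \<in> insert l K then y else a i)" by auto
  then have "repl S n l y (ptens S (\<lambda>i. if i \<in> K then y else a i) n) =
      ell S 1 (a l) *\<^sub>C ptens S (\<lambda>i. if i \<in> insert l K then y else a i) n"
    unfolding repl_ptens[OF insert.hyps(1) f y] using insert.hyps by simp
  then show ?case
    using insert bcl_scaleC[OF bcl_repl[OF insert.hyps(1) y] ptens_X'[OF n f]] finite_subset[OF insert.hyps(2)]
    by (simp add: repls_insert scaleC_scaleC mult.commute)
qed simp

text \<open>Refilling every slot leaves only the trace of \<open>x\<close>; for a state this is the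
  term with all slots occupied by \<open>F\<close>.\<close>

lemma repls_all:
  assumes "x \<in> X n" shows "repls S n y {1..n} x = ell S n x *\<^sub>C tpower S y n"
proof (rule bcl_ext[OF n bcl_repls[OF order_refl] bcl_ell[OF n] _ assms])
  fix a assume a: "fam a"
  show "repls S n y {1..n} (ptens S a n) = ell S n (ptens S a n) *\<^sub>C tpower S y n"
    unfolding repls_ptens[OF a order_refl] ell_ptens[OF n a]
    by (rule arg_cong[of _ _ "\<lambda>z. _ *\<^sub>C z"], rule ptens_cong) simp
qed

text \<open>If \<open>L\<close> turns the replacement in slot \<open>l\<close> into that in slot
  \<open>\<pi> l\<close>, it does so for whole products. It is used with \<open>\<pi>\<close> a
  transposition for swaps, and with the identity for marginals, interactions and collision
  operators.\<close>

lemma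
  assumes m: "m \<ge> 1" and L: "bounded_clinear_on (X n) (X m) L"
    and comm: "\<And>l x. l \<in> J \<Longrightarrow> x \<in> X n \<Longrightarrow> L (repl S n l y x) = repl S m (\<pi> l) y (L x)"
    and J: "J \<subseteq> {1..n}" and \<pi>: "inj_on \<pi> J" "\<pi> ` J \<subseteq> {1..m}" and x: "x \<in> X n"
  shows proj_comm: "L (proj S n y J x) = proj S m y (\<pi> ` J) (L x)"
    and repls_comm: "L (repls S n y J x) = repls S m y (\<pi> ` J) (L x)"
proof -
  have "K \<subseteq> J \<Longrightarrow>
    L (proj S n y K x) = proj S m y (\<pi> ` K) (L x) \<and> L (repls S n y K x) = repls S m y (\<pi> ` K) (L x)"
    if "K \<subseteq> {1..n}" for K
    using that
  proof (induction K rule: subset_Icc_induct)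
    case (insert l J')
    then have lJ: "l \<in> J" "J' \<subseteq> J" by auto
    have ins: "\<pi> l \<in> {1..m}" "\<pi> ` J' \<subseteq> {1..m}" "\<pi> l \<notin> \<pi> ` J'"
      using \<pi>(2) lJ(1) image_mono[OF lJ(2), of \<pi>] insert.hyps(3) lJ(2) inj_on_image_mem_iff[OF \<pi>(1) lJ]
      by blast+
    note IH = conjunct1[OF insert.IH[OF lJ(2)]] conjunct2[OF insert.IH[OF lJ(2)]]
    have z: "proj S n y J' x \<in> X n" "repls S n y J' x \<in> X n"
      by (intro proj_X repls_X insert.hyps x)+
    \<comment> \<open>The particle number is fixed to \<open>n\<close> in this context, so the
      recursion for \<open>m\<close> particles is taken from the fold directly.\<close>
    have Fm: "Finite_Set.fold (\<lambda>l. repl S m l y) (L x) (insert (\<pi> l) (\<pi> ` J')) = repl S m (\<pi> l) y (repls S m y (\<pi> ` J') (L x))"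
      unfolding repls_def using ins finite_subset[OF ins(2)]
      by (intro comp_fun_commute_on.fold_insert[OF comp_fun_commute_repl[OF y]]) auto
    have Fp: "Finite_Set.fold (\<lambda>l x. x - repl S m l y x) (L x) (insert (\<pi> l) (\<pi> ` J')) =
        proj S m y (\<pi> ` J') (L x) - repl S m (\<pi> l) y (proj S m y (\<pi> ` J') (L x))"
      unfolding proj_def using ins finite_subset[OF ins(2)]
      by (intro comp_fun_commute_on.fold_insert[OF comp_fun_commute_proj[OF y]]) auto
    show ?case
      unfolding proj_insert[OF insert.hyps(1-3)] repls_insert[OF insert.hyps(1-3)] image_insert
        repls_def[of S m y "insert _ _"] proj_def[of S m y "insert _ _"] Fm Fp
        bcl_diff[OF L csub_X[OF n] z(1) repl_X[OF insert.hyps(1) y]]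
        comm[OF lJ(1) z(1)] comm[OF lJ(1) z(2)] IH by simp
  qed simp
  from this[OF J order_refl]
  show "L (proj S n y J x) = proj S m y (\<pi> ` J) (L x)" "L (repls S n y J x) = repls S m y (\<pi> ` J) (L x)"
    by auto
qed

lemma repl_repls:
  assumes l: "l \<in> {1..n}" and J: "J \<subseteq> {1..n}" "l \<notin> J" and x: "x \<in> X n"
  shows "repl S n l y (repls S n y J x) = repls S n y J (repl S n l y x)"
  using repls_comm[OF n bcl_repl[OF l y] _ J(1), of "\<lambda>l. l" x] repl_comm[OF l _ _ y y] J x by force

lemma sum_Pow_insert:
  assumes "finite J" "l \<notin> J"
  shows "(\<Sum>K\<in>Pow (insert l J). f K) = (\<Sum>K\<in>Pow J. f K) + (\<Sum>K\<in>Pow J. (f (insert l K) :: 'z::comm_monoid_add))"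
proof -
  have "inj_on (insert l) (Pow J)"
  proof (rule inj_onI)
    fix A B assume "A \<in> Pow J" "B \<in> Pow J" and eq: "insert l A = insert l B"
    then have "l \<notin> A" "l \<notin> B" using assms(2) by auto
    then show "A = B" using eq by (simp add: insert_ident)
  qed
  then show ?thesis
    unfolding Pow_insert using assms
    by (subst sum.union_disjoint) (auto simp: sum.reindex)
qed

text \<open>Expanding the product of \<open>1 - R_l\<close> yields the alternating sum over subsets
  that defines the correlation error.\<close>

lemma proj_expand:
  assumes "J \<subseteq> {1..n}" "x \<in> X n"
  shows "proj S n y J x = (\<Sum>K\<in>Pow J. (-1) ^ card K *\<^sub>R repls S n y K x)"
  using assms(1)
proof (induction J rule: subset_Icc_induct)
  case (insert l J)
  note R = bcl_repl[OF insert.hyps(1) y]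
  have K: "finite K" "K \<subseteq> {1..n}" "l \<notin> K" if "K \<in> Pow J" for K
    using that insert.hyps finite_subset[of K "{1..n}"] by auto
  have "repl S n l y (proj S n y J x) = (\<Sum>K\<in>Pow J. repl S n l y ((-1) ^ card K *\<^sub>R repls S n y K x))"
    unfolding insert.IH using K assms(2) by (intro bcl_sum[OF R] csub_X n csub_scaleR repls_X) auto
  also have "\<dots> = (\<Sum>K\<in>Pow J. - ((-1) ^ card (insert l K) *\<^sub>R repls S n y (insert l K) x))"
    using K assms(2) insert.hyps(1)
    by (intro sum.cong refl) (simp add: bcl_scaleR[OF R] repls_X repls_insert)
  finally show ?case
    using insert finite_subset[OF insert.hyps(2)]
    by (simp add: proj_insert sum_Pow_insert sum_negf)
qed simp

text \<open>Expansion of \<open>1 = \<Prod>l\<in>J. R_l + (1 - R_l)\<close>. It is the inverse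
  relation: marginals in terms of correlation errors.\<close>

lemma proj_resolution:
  assumes "J \<subseteq> {1..n}" "x \<in> X n"
  shows "x = (\<Sum>K\<in>Pow J. repls S n y K (proj S n y (J - K) x))"
  using assms(1)
proof (induction J rule: subset_Icc_induct)
  case (insert l J)
  have fJ: "finite J" using finite_subset[OF insert.hyps(2)] by simp
  have "(\<Sum>K\<in>Pow (insert l J). repls S n y K (proj S n y (insert l J - K) x)) =
    (\<Sum>K\<in>Pow J. repls S n y K (proj S n y (insert l J - K) x) +
      repls S n y (insert l K) (proj S n y (insert l J - insert l K) x))"
    unfolding sum_Pow_insert[OF fJ insert.hyps(3)] by (simp add: sum.distrib)
  also have "\<dots> = (\<Sum>K\<in>Pow J. repls S n y K (proj S n y (J - K) x))"
  proof (rule sum.cong[OF refl])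
    fix K assume "K \<in> Pow J"
    then have K: "K \<subseteq> J" "K \<subseteq> {1..n}" "l \<notin> K" "J - K \<subseteq> {1..n}" "l \<notin> J - K"
      and e: "insert l J - K = insert l (J - K)" "insert l J - insert l K = J - K"
      using insert.hyps by auto
    let ?z = "proj S n y (J - K) x"
    have z: "?z \<in> X n" by (intro proj_X K assms)
    show "repls S n y K (proj S n y (insert l J - K) x) +
      repls S n y (insert l K) (proj S n y (insert l J - insert l K) x) = repls S n y K ?z"
      unfolding e proj_insert[OF insert.hyps(1) K(4,5)] repls_insert[OF insert.hyps(1) K(2,3)]
        repl_repls[OF insert.hyps(1) K(2,3) z]
      using bcl_diff[OF bcl_repls[OF K(2)] csub_X[OF n] z repl_X[OF insert.hyps(1) y]] by simp
  qed
  finally show ?case using insert.IH by simp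
qed simp

end

lemma marginal_comp:
  assumes "1 \<le> j" "j \<le> m" "m \<le> n" shows "marginal S j n x = marginal S j m (marginal S m n x)"
  using assms(3)
proof (induction n arbitrary: x rule: dec_induct)
  case (step n)
  then show ?case using assms by simp
qed simp

lemma marginal_Suc_self: "1 \<le> j \<Longrightarrow> Suc j \<le> n \<Longrightarrow> marg S (Suc j) (marginal S (Suc j) n x) = marginal S j n x"
  using marginal_comp[of j "Suc j" n x] by simp

lemma swap_marginal:
  assumes j: "j \<le> n" and k: "k \<in> {1..j}" and s: "s \<in> {1..j}" and x: "x \<in> X n"
  shows "swap_conj S j k s (marginal S j n x) = marginal S j n (swap_conj S n k s x)"
proof -
  have j1: "1 \<le> j" "1 \<le> n" and ks: "k \<in> {1..n}" "s \<in> {1..n}" using j k s by auto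
  note m = bcl_marginal[OF j1(1) j]
  show ?thesis
  proof (rule bcl_ext[OF j1(2) bcl_compose[OF m bcl_swap[OF k s]] bcl_compose[OF bcl_swap[OF ks] m] _ x])
    fix a assume a: "fam a"
    have fs: "fam (\<lambda>i. a (swp k s i))" using a by simp
    have "(\<Prod>i=j+1..n. ell S 1 (a (swp k s i))) = (\<Prod>i=j+1..n. ell S 1 (a i))"
      using k s by (intro prod.cong) (auto simp: swp_def)
    then show "swap_conj S j k s (marginal S j n (ptens S a n)) = marginal S j n (swap_conj S n k s (ptens S a n))"
      unfolding marginal_ptens[OF j1(1) j a] swap_ptens[OF a ks] marginal_ptens[OF j1(1) j fs]
        bcl_scaleC[OF bcl_swap[OF k s] ptens_X'[OF j1(1) a]] swap_ptens[OF a k s] by simp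
  qed
qed

lemma symmetric_marginal:
  assumes "symmetric S n z" "z \<in> X n" "j \<le> n" "k \<in> {1..j}" "s \<in> {1..j}"
  shows "swap_conj S j k s (marginal S j n z) = marginal S j n z"
  using assms swap_marginal[of j n k s z] by (auto simp: symmetric_def)

lemma proj_swap:
  assumes k: "k \<in> {1..n}" and s: "s \<in> {1..n}" and y: "y \<in> X 1" and J: "J \<subseteq> {1..n}" and x: "x \<in> X n"
  shows "swap_conj S n k s (proj S n y J x) = proj S n y (swp k s ` J) (swap_conj S n k s x)"
    and "swap_conj S n k s (repls S n y J x) = repls S n y (swp k s ` J) (swap_conj S n k s x)"
proof -
  have n: "n \<ge> 1" using k by auto
  have J': "\<And>l. l \<in> J \<Longrightarrow> l \<in> {1..n}" using J by auto
  have inj: "inj_on (swp k s) J" by (metis inj_on_def swp_swp)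
  have im: "swp k s ` J \<subseteq> {1..n}" using J k s by (auto simp: swp_def)
  note c = repl_swap[OF J' k s y]
  show "swap_conj S n k s (proj S n y J x) = proj S n y (swp k s ` J) (swap_conj S n k s x)"
    by (rule proj_comm[OF n y n bcl_swap[OF k s] c J inj im x])
  show "swap_conj S n k s (repls S n y J x) = repls S n y (swp k s ` J) (swap_conj S n k s x)"
    by (rule repls_comm[OF n y n bcl_swap[OF k s] c J inj im x])
qed

lemma marg_proj:
  assumes n: "n \<ge> 1" and y: "y \<in> X 1" and J: "J \<subseteq> {1..n}" and x: "x \<in> X (Suc n)"
  shows "marg S (Suc n) (proj S (Suc n) y J x) = proj S n y J (marg S (Suc n) x)"
    and "marg S (Suc n) (repls S (Suc n) y J x) = repls S n y J (marg S (Suc n) x)"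
proof -
  have n2: "Suc n \<ge> 1" "Suc n \<ge> 2" using n by auto
  have mg: "bounded_clinear_on (X (Suc n)) (X n) (marg S (Suc n))" using marg_linear[OF n2(2)] by simp
  have c: "marg S (Suc n) (repl S (Suc n) l y x) = repl S n l y (marg S (Suc n) x)"
    if "l \<in> J" "x \<in> X (Suc n)" for l x
    using marg_repl[OF n2(2) _ y that(2), of l] that J by auto
  have J': "J \<subseteq> {1..Suc n}" using J by auto
  show "marg S (Suc n) (proj S (Suc n) y J x) = proj S n y J (marg S (Suc n) x)"
    using proj_comm[OF n2(1) y n mg, of J "\<lambda>l. l" x] c J' J x by simp
  show "marg S (Suc n) (repls S (Suc n) y J x) = repls S n y J (marg S (Suc n) x)"
    using repls_comm[OF n2(1) y n mg, of J "\<lambda>l. l" x] c J' J x by simp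
qed

lemma norm_repls_proj:
  assumes y: "y \<in> X 1" "norm y = 1" and z: "z \<in> X N" "symmetric S N z"
    and "J \<subseteq> {1..n}" "J \<noteq> {}" "n \<le> N"
  shows "norm (repls S n y ({1..n} - J) (proj S n y J (marginal S n N z)))
    \<le> norm (proj S (card J) y {1..card J} (marginal S (card J) N z))"
  using assms(5-7)
proof (induction n arbitrary: J)
  case (Suc n)
  let ?F = "\<lambda>n. marginal S n N z"
  have F: "?F m \<in> X m" if "1 \<le> m" "m \<le> N" for m
    using bcl_mem[OF bcl_marginal[OF that] z(1)] .
  show ?case
  proof (cases "J = {1..Suc n}")
    case True
    then show ?thesis by simp
  next
    case False
    then obtain i where i: "i \<in> {1..Suc n}" "i \<notin> J" using Suc.prems(1) by blast
    have n: "n \<ge> 1" using Suc.prems i by (cases n) auto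
    have n2: "Suc n \<ge> 1" "Suc n \<ge> 2" and last: "Suc n \<in> {1..Suc n}" using n by auto
    let ?J = "swp i (Suc n) ` J"
    have J1: "?J \<subseteq> {1..Suc n}" using Suc.prems(1) i by (auto simp: swp_def)
    have "Suc n \<notin> ?J" using i by (auto simp: swp_def split: if_splits)
    have "?J \<subseteq> {1..n}"
    proof
      fix p assume "p \<in> ?J"
      then have "p \<in> {1..Suc n}" "p \<noteq> Suc n" using J1 \<open>Suc n \<notin> ?J\<close> by blast+
      then show "p \<in> {1..n}" by auto
    qed
    note J2 = this
    have inj: "inj (swp i (Suc n))" by (metis inj_def swp_swp)
    have im: "swp i (Suc n) ` {1..Suc n} = {1..Suc n}"
      by (rule endo_inj_surj) (use i in \<open>auto simp: swp_def intro: inj_on_subset[OF inj]\<close>)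
    have K: "swp i (Suc n) ` ({1..Suc n} - J) = insert (Suc n) ({1..n} - ?J)"
      unfolding image_set_diff[OF inj] im using \<open>Suc n \<notin> ?J\<close> by auto
    have sub: "{1..Suc n} - J \<subseteq> {1..Suc n}" "{1..n} - ?J \<subseteq> {1..Suc n}" "Suc n \<notin> {1..n} - ?J" by auto
    have P: "proj S (Suc n) y J (?F (Suc n)) \<in> X (Suc n)" "proj S (Suc n) y ?J (?F (Suc n)) \<in> X (Suc n)"
      using Suc.prems J1 by (auto intro!: proj_X n2 y F)
    let ?Z = "repls S (Suc n) y ({1..n} - ?J) (proj S (Suc n) y ?J (?F (Suc n)))"
    have Z: "?Z \<in> X (Suc n)" by (intro repls_X n2 y sub P)
    have "norm (repls S (Suc n) y ({1..Suc n} - J) (proj S (Suc n) y J (?F (Suc n)))) =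
      norm (swap_conj S (Suc n) i (Suc n) (repls S (Suc n) y ({1..Suc n} - J) (proj S (Suc n) y J (?F (Suc n)))))"
      using i last by (intro norm_swap[symmetric] repls_X n2 y P sub) auto
    also have "\<dots> = norm (repl S (Suc n) (Suc n) y ?Z)"
      unfolding proj_swap(2)[OF i(1) last y(1) sub(1) P(1)] K
        proj_swap(1)[OF i(1) last y(1) Suc.prems(1) F[OF n2(1) Suc.prems(3)]]
        symmetric_marginal[OF z(2,1) Suc.prems(3) i(1) last] repls_insert[OF n2(1) y(1) last sub(2,3)] ..
    also have "repl S (Suc n) (Suc n) y ?Z = tens S n 1 (marg S (Suc n) ?Z) y"
      using repl_last[OF n2(2) y(1) Z] by simp
    also have "marg S (Suc n) ?Z = repls S n y ({1..n} - ?J) (proj S n y ?J (?F n))"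
      using marg_proj(2)[OF n y(1) _ P(2), of "{1..n} - ?J"] marg_proj(1)[OF n y(1) J2 F[OF n2(1) Suc.prems(3)]]
        marginal_Suc_self[OF n Suc.prems(3)] by simp
    also have "norm (tens S n 1 (repls S n y ({1..n} - ?J) (proj S n y ?J (?F n))) y) =
        norm (repls S n y ({1..n} - ?J) (proj S n y ?J (?F n)))"
      using Suc.prems J2 n y by (subst norm_tens) (auto intro!: repls_X proj_X F)
    also have "\<dots> \<le> norm (proj S (card ?J) y {1..card ?J} (?F (card ?J)))"
      using Suc.prems J2 by (intro Suc.IH) auto
    also have "card ?J = card J" using inj by (intro card_image inj_on_subset[OF inj]) auto
    finally show ?thesis .
  qed
qed simp

text \<open>Before conjugation the summand is the marginal with \<open>y\<close> refilled in the
  last slots. Since the full marginal is symmetric, conjugation merely moves the set of refilled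
  slots, and that set becomes \<open>K\<close>.\<close>

lemma place_eq_repls:
  assumes y: "y \<in> X 1" and z: "z \<in> X N" "symmetric S N z" "ell S N z = 1"
    and j: "1 \<le> j" "j \<le> N" and K: "K \<subseteq> {1..j}"
  shows "place S j (sorted_list_of_set ({1..j} - K)) (marginal S (j - card K) N z) (tpower S y (card K)) =
    repls S j y K (marginal S j N z)"
proof -
  define F where "F = marginal S j N z"
  have F: "F \<in> X j" unfolding F_def by (rule bcl_mem[OF bcl_marginal[OF j] z(1)])
  have fK: "finite K" using K finite_subset by auto
  define xs where "xs = sorted_list_of_set ({1..j} - K)"
  define m where "m = j - card K"
  have "card K \<le> j" using card_mono[OF _ K] by simp
  then have mk: "card K = j - m" "m \<le> j" by (auto simp: m_def)
  have len: "length xs = m" using K fK by (simp add: xs_def m_def card_Diff_subset)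
  have set: "set xs = {1..j} - K" by (simp add: xs_def)
  have srt: "sorted_wrt (<) xs" by (simp add: xs_def)
  show ?thesis
  proof (cases "m = 0")
    case True
    then have "K = {1..j}" using set K len by auto
    moreover have "ell S j F = 1" unfolding F_def using ell_marginal[OF j z(1)] z(3) by simp
    ultimately show ?thesis
      using repls_all[OF j(1) y F] by (simp add: place_def F_def)
  next
    case False
    define ps where "ps = zip xs [1..<Suc m]"
    \<comment> \<open>The convention for empty factors in \<open>place\<close> enters here: with no
      \<open>y\<close> present the expression is the marginal itself.\<close>
    have inner: "(if length xs = 0 then tpower S y (card K) else if length xs = j then marginal S m N z
        else tens S (length xs) (j - length xs) (marginal S m N z) (tpower S y (card K))) = repls S j y {m+1..j} F"
    proof (cases "m = j")
      case True
      then show ?thesis using False len by (simp add: F_def)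
    next
      case mj: False
      have m: "1 \<le> m" "1 \<le> j - m" "m + (j - m) = j" and sub: "{m+1..j} \<subseteq> {1..j}" using mj mk False by auto
      have tp: "tpower S y (j - m) \<in> X (j - m)" using y m by (intro ptens_X') auto
      have t: "bounded_clinear_on (X m) (X j) (\<lambda>x. tens S m (j - m) x (tpower S y (j - m)))"
        using bcl_tens_left[OF m(1,2) tp] m(3) by simp
      have "tens S m (j - m) (marginal S m j F) (tpower S y (j - m)) = repls S j y {m+1..j} F"
      proof (rule bcl_ext[OF j(1) bcl_compose[OF bcl_marginal[OF m(1) mk(2)] t] bcl_repls[OF j(1) y sub] _ F])
        fix a assume a: "fam a"
        define b where "b = (\<lambda>i. if i \<in> {m+1..j} then y else a i)"
        have b: "fam b" using a y by (simp add: b_def)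
        have 1: "ptens S a m = ptens S b m" and 2: "tpower S y (j - m) = ptens S (\<lambda>i. b (i + m)) (j - m)"
          by (rule ptens_cong, use mk in \<open>auto simp: b_def\<close>)+
        have "tens S m (j - m) (ptens S a m) (tpower S y (j - m)) = ptens S b j"
          unfolding 1 2 tens_ptens[OF b m(1,2)] m(3) ..
        then show "tens S m (j - m) (marginal S m j (ptens S a j)) (tpower S y (j - m)) = repls S j y {m+1..j} (ptens S a j)"
          unfolding marginal_ptens[OF m(1) mk(2) a] bcl_scaleC[OF t ptens_X'[OF m(1) a]] repls_ptens[OF j(1) y a sub]
          by (simp add: b_def)
      qed
      then show ?thesis
        using mj False len mk marginal_comp[OF m(1) mk(2) j(2), of z] by (simp add: F_def)
    qed
    have mem: "i \<in> {1..j} \<and> p \<in> {1..j}" if "(i, p) \<in> set ps" for i p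
      using that set mk set_zip_leftD[of i p xs] set_zip_rightD[of i p xs "[1..<Suc m]"] by (auto simp: ps_def)
    \<comment> \<open>Symmetry of \<open>F\<close> absorbs every transposition, so only the index
      set is transported.\<close>
    have perm: "foldr (\<lambda>(i, p). swap_conj S j i p) qs (repls S j y L F) = repls S j y (swaps qs ` L) F \<and> swaps qs ` L \<subseteq> {1..j}"
      if "set qs \<subseteq> {1..j} \<times> {1..j}" "L \<subseteq> {1..j}" for qs L
      using that
    proof (induction qs)
      case (Cons ip qs)
      obtain i p where ip: "ip = (i, p)" "i \<in> {1..j}" "p \<in> {1..j}" using Cons.prems by auto
      have IH: "foldr (\<lambda>(i, p). swap_conj S j i p) qs (repls S j y L F) = repls S j y (swaps qs ` L) F"
        "swaps qs ` L \<subseteq> {1..j}"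
        using Cons by auto
      have "swap_conj S j i p (repls S j y (swaps qs ` L) F) = repls S j y (swp i p ` swaps qs ` L) F"
        using proj_swap(2)[OF ip(2,3) y IH(2) F] symmetric_marginal[OF z(2,1) j(2) ip(2,3)] by (simp add: F_def)
      moreover have "swp i p ` swaps qs ` L \<subseteq> {1..j}" using IH(2) ip by (auto simp: swp_def)
      ultimately show ?case using IH(1) ip by (simp add: image_image)
    qed simp
    have psj: "set ps \<subseteq> {1..j} \<times> {1..j}" using mem by auto
    have nth: "swaps ps (1 + t) = xs ! t" if "t < m" for t
      using swaps_sorted[OF srt, of 1] set len that by (auto simp: ps_def)
    have "swaps ps ` {1..m} = (\<lambda>t. swaps ps (1 + t)) ` {..<m}"
      by (metis image_Suc_lessThan image_image plus_1_eq_Suc)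
    also have "\<dots> = (\<lambda>t. xs ! t) ` {..<m}"
      by (intro image_cong refl nth) simp
    also have "\<dots> = set xs"
      using len by (auto simp: set_conv_nth)
    finally have "swaps ps ` {1..m} = {1..j} - K"
      using set by simp
    \<comment> \<open>The permutation sends the first \<open>m\<close> slots onto the complement of
      \<open>K\<close>; being a bijection of \<open>{1..j}\<close> it sends the remaining ones onto
      \<open>K\<close>.\<close>
    moreover have "swaps ps ` {1..j} = {1..j}"
      using perm[OF psj order_refl] by (intro endo_inj_surj) (auto intro: inj_on_subset[OF inj_swaps])
    moreover have "{m+1..j} = {1..j} - {1..m}" using mk by auto
    ultimately have "swaps ps ` {m+1..j} = K"
      using K by (simp add: image_set_diff[OF inj_swaps] double_diff)
    then have "foldr (\<lambda>(i, p). swap_conj S j i p) ps (repls S j y {m+1..j} F) = repls S j y K F"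
      using perm[OF psj, of "{m+1..j}"] by auto
    then show ?thesis
      unfolding place_def xs_def[symmetric] m_def[symmetric] inner F_def[symmetric]
      by (simp add: ps_def len)
  qed
qed

lemma corr_error_eq_proj:
  assumes "y \<in> X 1" "z \<in> X (npart S)" "symmetric S (npart S) z" "ell S (npart S) z = 1"
    and j: "1 \<le> j" "j \<le> npart S"
  shows "corr_error S j z y = proj S j y {1..j} (marginal S j (npart S) z)"
  unfolding corr_error_def
  by (subst proj_expand[OF j(1) assms(1) order_refl bcl_mem[OF bcl_marginal[OF j] assms(2)]])
    (use assms in \<open>intro sum.cong refl arg_cong[of _ _ "\<lambda>x. _ *\<^sub>R x"] place_eq_repls, auto\<close>)

end

section \<open>Semigroups and a Gronwall lemma for Dini derivatives\<close>

text \<open>Comparison with the strict supersolution \<open>u\<close>. After the last time before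
  \<open>t1\<close> at which \<open>f \<le> u\<close>, the function would have to stay above
  \<open>u\<close>, but at that time equality holds and \<open>f\<close> grows more slowly.\<close>

lemma gronwall_dini:
  fixes f :: "real \<Rightarrow> real"
  assumes cont: "continuous_on {0..T} f" and f0: "f 0 \<le> 0" and c: "c \<ge> 0"
    and dini: "\<And>t e. 0 \<le> t \<Longrightarrow> t < T \<Longrightarrow> f t > 0 \<Longrightarrow> e > 0 \<Longrightarrow>
      \<forall>\<^sub>F h in at_right 0. f (t + h) \<le> f t + h * (c * f t + e)"
    and t1: "t1 \<in> {0..T}"
  shows "f t1 \<le> 0"
proof (rule ccontr)
  assume "\<not> ?thesis"
  then have pos: "f t1 > 0" by simp
  \<comment> \<open>Small enough that \<open>u\<close> is still only half of \<open>f\<close> at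
    \<open>t1\<close>.\<close>
  define \<eta> where "\<eta> = f t1 / (2 * exp ((c + 1) * t1))"
  have \<eta>: "\<eta> > 0" using pos by (simp add: \<eta>_def)
  define u where "u t = \<eta> * exp ((c + 1) * t)" for t
  define g where "g t = f t - u t" for t
  have u0: "u t > 0" for t using \<eta> by (simp add: u_def)
  have "u t1 = f t1 / 2" by (simp add: u_def \<eta>_def)
  then have g1: "g t1 > 0" using pos by (simp add: g_def)
  have cg: "continuous_on {0..t1} g"
    unfolding g_def u_def using t1
    by (intro continuous_intros continuous_on_subset[OF cont]) auto
  let ?A = "{0..t1} \<inter> g -` {..0}"
  have "compact ?A"
    unfolding compact_eq_bounded_closed
    by (auto intro!: continuous_closed_preimage cg bounded_Int)
  moreover have "0 \<in> ?A" using f0 u0[of 0] t1 by (simp add: g_def)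
  ultimately obtain t0 where t0: "t0 \<in> ?A" "\<forall>t\<in>?A. t \<le> t0"
    using compact_attains_sup[of ?A] by blast
  have lt: "t0 < t1" using t0 g1 by (cases "t0 = t1") auto
  have gpos: "g t > 0" if "t0 < t" "t \<le> t1" for t
  proof (rule ccontr)
    assume "\<not> g t > 0"
    then have "t \<in> ?A" using t0(1) that by simp
    then have "t \<le> t0" using t0(2) by blast
    then show False using that by simp
  qed
  have "g t0 = 0"
  proof (rule ccontr)
    assume "g t0 \<noteq> 0"
    then have "g t0 < 0" using t0(1) by auto
    moreover have "continuous_on {t0..t1} g" using cg by (rule continuous_on_subset) (use t0(1) in auto)
    ultimately obtain s where "t0 \<le> s" "s \<le> t1" "g s = 0"
      using IVT'[of g t0 0 t1] g1 lt by auto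
    then show False using gpos[of s] \<open>g t0 < 0\<close> by (cases "s = t0") auto
  qed
  then have ft0: "f t0 = u t0" by (simp add: g_def)
  \<comment> \<open>The error allowance is half of \<open>u t0\<close>, so \<open>f\<close> grows at
    rate at most \<open>(c + 1/2) u\<close>, below the rate \<open>(c + 1) u\<close> of the
    comparison function.\<close>
  have "\<forall>\<^sub>F h in at_right 0. f (t0 + h) \<le> f t0 + h * (c * f t0 + u t0 / 2)"
    using t0(1) lt t1 u0[of t0] ft0 by (intro dini) auto
  moreover have "\<forall>\<^sub>F h in at_right (0::real). h > 0 \<and> h < t1 - t0"
    using lt eventually_at_right_less[of 0] eventually_at_right_real[of 0 "t1 - t0"]
    by (auto elim: eventually_mono)
  ultimately obtain h where elim: "f (t0 + h) \<le> f t0 + h * (c * f t0 + u t0 / 2)" "h > 0 \<and> h < t1 - t0"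
    using eventually_happens'[OF trivial_limit_at_right_real eventually_conj] by blast
    have "u (t0 + h) = u t0 * exp ((c + 1) * h)"
      by (simp add: u_def distrib_left exp_add)
    also have "\<dots> \<ge> u t0 * (1 + (c + 1) * h)"
      using u0[of t0] by (intro mult_left_mono) auto
    finally have "g (t0 + h) \<le> h * (u t0 / 2 - u t0)"
      using elim ft0 by (simp add: g_def algebra_simps)
    also have "\<dots> < 0" using elim u0[of t0] by (intro mult_pos_neg) auto
  finally show False using gpos[of "t0 + h"] elim by simp
qed

text \<open>A mean value inequality that uses only right difference quotients; it integrates the
  increment in the Duhamel argument of \<open>intertwining\<close>.\<close>

lemma right_mean_value:
  fixes \<phi> :: "real \<Rightarrow> 'a::real_normed_vector"
  assumes cont: "continuous_on {0..T} \<phi>" and T: "T \<ge> 0"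
    and dini: "\<And>t e. 0 \<le> t \<Longrightarrow> t < T \<Longrightarrow> e > 0 \<Longrightarrow>
      \<forall>\<^sub>F h in at_right 0. norm (\<phi> (t + h) - \<phi> t) \<le> h * (M + e)"
  shows "norm (\<phi> T - \<phi> 0) \<le> M * T"
proof -
  define f where "f t = norm (\<phi> t - \<phi> 0) - M * t" for t
  have "f T \<le> 0"
  proof (rule gronwall_dini[of T f 0])
    show "continuous_on {0..T} f" unfolding f_def by (intro continuous_intros cont)
    fix t e :: real assume t: "0 \<le> t" "t < T" "e > 0"
    show "\<forall>\<^sub>F h in at_right 0. f (t + h) \<le> f t + h * (0 * f t + e)"
      using dini[OF t]
    proof eventually_elim
      case (elim h)
      have "norm (\<phi> (t + h) - \<phi> 0) \<le> norm (\<phi> (t + h) - \<phi> t) + norm (\<phi> t - \<phi> 0)"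
        using norm_triangle_ineq[of "\<phi> (t + h) - \<phi> t" "\<phi> t - \<phi> 0"] by simp
      then show ?case using elim by (simp add: f_def algebra_simps)
    qed
  qed (use T in \<open>auto simp: f_def\<close>)
  then show ?thesis by (simp add: f_def)
qed

text \<open>Since \<open>L\<close> is linear only on \<open>X\<close>, the exchange goes through
  Riemann sums: these are finite combinations of elements of \<open>X\<close>, and one tagged
  division approximates both integrals.\<close>

lemma bcl_integral:
  fixes L :: "'a::complex_banach \<Rightarrow> 'c::complex_banach" and f :: "real \<Rightarrow> 'a"
  assumes L: "bounded_clinear_on X Y L" and X: "csub X" "closed X"
    and f: "continuous_on {a..b} f" "\<And>t. t \<in> {a..b} \<Longrightarrow> f t \<in> X" and ab: "a \<le> b"
  shows "integral {a..b} f \<in> X" and "L (integral {a..b} f) = integral {a..b} (\<lambda>t. L (f t))"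
proof -
  obtain C where C: "C \<ge> 0" "\<And>x. x \<in> X \<Longrightarrow> norm (L x) \<le> C * norm x" using bcl_bound[OF L] by blast
  have Lf: "continuous_on {a..b} (\<lambda>t. L (f t))"
    by (rule continuous_on_compose2[OF bcl_continuous_on[OF L X(1)] f(1)]) (use f(2) in auto)
  let ?I = "integral {a..b} f" and ?J = "integral {a..b} (\<lambda>t. L (f t))"
  have hI: "(f has_integral ?I) (cbox a b)" and hJ: "((\<lambda>t. L (f t)) has_integral ?J) (cbox a b)"
    using integrable_integral[OF integrable_continuous_real[OF f(1)]]
      integrable_integral[OF integrable_continuous_real[OF Lf]] by auto
  have approx: "\<exists>x\<in>X. norm (x - ?I) < e \<and> norm (L x - ?J) < e" if e: "e > 0" for e
  proof -
    obtain g1 where g1: "gauge g1" and g1': "\<forall>D. D tagged_division_of cbox a b \<and> g1 fine D \<longrightarrow>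
        norm ((\<Sum>(x, k)\<in>D. measure lborel k *\<^sub>R f x) - ?I) < e"
      using hI[unfolded has_integral, rule_format, OF e] by (elim exE conjE) (rule that)
    obtain g2 where g2: "gauge g2" and g2': "\<forall>D. D tagged_division_of cbox a b \<and> g2 fine D \<longrightarrow>
        norm ((\<Sum>(x, k)\<in>D. measure lborel k *\<^sub>R L (f x)) - ?J) < e"
      using hJ[unfolded has_integral, rule_format, OF e] by (elim exE conjE) (rule that)
    \<comment> \<open>The intersection of the two gauges provides a division fine for both
      integrals.\<close>
    obtain p where p: "p tagged_division_of cbox a b" "(\<lambda>x. g1 x \<inter> g2 x) fine p"
      using fine_division_exists[OF gauge_Int[OF g1 g2]] by blast
    have fp: "g1 fine p" "g2 fine p" using p(2) by (auto simp: fine_def)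
    have tag: "f x \<in> X" if "(x, k) \<in> p" for x k
      using tagged_division_ofD(2,3)[OF p(1) that] f(2) by auto
    let ?x = "\<Sum>(x, k)\<in>p. measure lborel k *\<^sub>R f x"
    have "?x \<in> X" by (intro csub_sum X) (auto intro: csub_scaleR X tag)
    moreover have "L ?x = (\<Sum>z\<in>p. L (case z of (x, k) \<Rightarrow> measure lborel k *\<^sub>R f x))"
      by (intro bcl_sum[OF L X(1)]) (auto intro: csub_scaleR X tag)
    then have "L ?x = (\<Sum>(x, k)\<in>p. measure lborel k *\<^sub>R L (f x))"
      using bcl_scaleR[OF L tag] by (auto intro!: sum.cong)
    ultimately show ?thesis using g1'[rule_format, OF conjI[OF p(1) fp(1)]] g2'[rule_format, OF conjI[OF p(1) fp(2)]] by auto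
  qed
  show I: "?I \<in> X"
  proof -
    have "?I \<in> closure X"
      unfolding closure_approachable dist_norm using approx by blast
    then show ?thesis using closure_closed[OF X(2)] by simp
  qed
  have "norm (L ?I - ?J) \<le> e" if e: "e > 0" for e
  proof -
    define d where "d = e / (C + 1)"
    have d: "d > 0" using e C by (simp add: d_def)
    obtain x where x: "x \<in> X" "norm (x - ?I) < d" "norm (L x - ?J) < d" using approx[OF d] by blast
    have "norm (L ?I - ?J) \<le> norm (L (x - ?I)) + norm (L x - ?J)"
      unfolding bcl_diff[OF L X(1) x(1) I]
      using norm_triangle_ineq4[of "L x - ?J" "L x - L ?I"] by (simp add: add.commute)
    also have "\<dots> \<le> C * d + d"
      using C(2)[OF csub_diff[OF X(1) x(1) I]] x C(1) mult_left_mono[of "norm (x - ?I)" d C] by linarith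
    also have "\<dots> = (C + 1) * d" by (simp add: algebra_simps)
    also have "\<dots> = e" using C(1) by (simp add: d_def)
    finally show ?thesis .
  qed
  then have "norm (L ?I - ?J) \<le> 0" by (rule field_le_epsilon) simp
  then show "L ?I = ?J" by simp
qed

text \<open>The integrand may depend on the window length \<open>h\<close>, as it does in the
  Duhamel integral over \<open>[t, t + h]\<close>.\<close>

lemma right_average_tendsto:
  fixes g :: "real \<Rightarrow> real \<Rightarrow> 'a::banach"
  assumes cont: "\<And>h. h > 0 \<Longrightarrow> continuous_on {t..t + h} (g h)"
    and lim: "\<And>e. e > 0 \<Longrightarrow> \<forall>\<^sub>F h in at_right 0. \<forall>s\<in>{t..t + h}. norm (g h s - d) \<le> e"
  shows "((\<lambda>h. integral {t..t + h} (g h) /\<^sub>R h) \<longlongrightarrow> d) (at_right 0)"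
proof (rule tendstoI)
  fix e :: real assume e: "e > 0"
  show "\<forall>\<^sub>F h in at_right 0. dist (integral {t..t + h} (g h) /\<^sub>R h) d < e"
    using lim[OF half_gt_zero[OF e]] eventually_at_right_less[of 0]
  proof eventually_elim
    case (elim h)
    have "integral {t..t + h} (\<lambda>s. g h s - d) = integral {t..t + h} (g h) - h *\<^sub>R d"
      using elim cont by (subst integral_diff) (auto intro: integrable_continuous_real)
    moreover have "norm (integral {t..t + h} (\<lambda>s. g h s - d)) \<le> e / 2 * (t + h - t)"
      using elim cont by (intro integral_bound continuous_intros) auto
    ultimately have bd: "norm (integral {t..t + h} (g h) - h *\<^sub>R d) \<le> e / 2 * h"
      by simp
    have "integral {t..t + h} (g h) /\<^sub>R h - d = inverse h *\<^sub>R (integral {t..t + h} (g h) - h *\<^sub>R d)"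
      using elim by (simp add: scaleR_diff_right)
    then have "norm (integral {t..t + h} (g h) /\<^sub>R h - d) = norm (integral {t..t + h} (g h) - h *\<^sub>R d) / h"
      using elim(2) by (simp only: norm_scaleR abs_inverse abs_of_pos divide_inverse_commute)
    also have "\<dots> \<le> e / 2" using bd elim(2) by (simp only: pos_divide_le_eq)
    finally have "norm (integral {t..t + h} (g h) /\<^sub>R h - d) \<le> e / 2" .
    then show ?case using elim e by (simp add: dist_norm)
  qed
qed

lemma integral_right_derivative:
  fixes f :: "real \<Rightarrow> 'a::banach"
  assumes f: "continuous_on {0..} f" and t: "t \<ge> 0"
  shows "((\<lambda>h. (integral {0..t + h} f - integral {0..t} f) /\<^sub>R h) \<longlongrightarrow> f t) (at_right 0)"
proof -
  have "((\<lambda>h. integral {t..t + h} f /\<^sub>R h) \<longlongrightarrow> f t) (at_right 0)"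
  proof (rule right_average_tendsto)
    fix h :: real assume "h > 0"
    then show "continuous_on {t..t + h} f" by (intro continuous_on_subset[OF f]) (use t in auto)
  next
    fix e :: real assume e: "e > 0"
    obtain d where d: "d > 0" "\<And>s. s \<ge> 0 \<Longrightarrow> dist s t < d \<Longrightarrow> dist (f s) (f t) < e"
      using f t e unfolding continuous_on_iff by (metis atLeast_iff)
    have "\<forall>\<^sub>F h in at_right (0::real). h < d" using d(1) by (rule eventually_at_right_real[THEN eventually_mono]) auto
    then show "\<forall>\<^sub>F h in at_right 0. \<forall>s\<in>{t..t + h}. norm (f s - f t) \<le> e"
    proof eventually_elim
      case (elim h)
      then show ?case using d(2) t by (auto simp: dist_norm intro!: less_imp_le)
    qed
  qed
  moreover have "\<forall>\<^sub>F h in at_right (0::real). integral {t..t + h} f /\<^sub>R h = (integral {0..t + h} f - integral {0..t} f) /\<^sub>R h"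
    using eventually_at_right_less[of 0]
  proof eventually_elim
    case (elim h)
    have "f integrable_on {0..t + h}" using t elim by (intro integrable_continuous_real continuous_on_subset[OF f]) auto
    then have "integral {0..t} f + integral {t..t + h} f = integral {0..t + h} f"
      using t elim by (intro Henstock_Kurzweil_Integration.integral_combine) auto
    then have "integral {t..t + h} f = integral {0..t + h} f - integral {0..t} f"
      by (simp add: algebra_simps)
    then show ?case by simp
  qed
  ultimately show ?thesis by (rule Lim_transform_eventually)
qed

lemma bcl_tendsto:
  assumes L: "bounded_clinear_on X Y L" and X: "csub X" and f: "(f \<longlongrightarrow> a) F" "\<forall>\<^sub>F h in F. f h \<in> X" and a: "a \<in> X"
  shows "((\<lambda>h. L (f h)) \<longlongrightarrow> L a) F"
  by (rule continuous_on_tendsto_compose[OF bcl_continuous_on[OF L X] f(1) a f(2)])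

section \<open>Strongly continuous semigroups on a closed subspace\<close>

locale c0_semigroup_on =
  fixes X :: "'b::complex_banach set" and U :: "real \<Rightarrow> 'b \<Rightarrow> 'b"
  assumes csub: "csub X" and closed: "closed X" and semigroup: "c0_semigroup X U"
begin

lemma bcl_U: "t \<ge> 0 \<Longrightarrow> bounded_clinear_on X X (U t)"
  and U_0: "x \<in> X \<Longrightarrow> U 0 x = x"
  and U_add: "s \<ge> 0 \<Longrightarrow> t \<ge> 0 \<Longrightarrow> x \<in> X \<Longrightarrow> U (s + t) x = U s (U t x)"
  and U_cont: "x \<in> X \<Longrightarrow> continuous_on {0..} (\<lambda>t. U t x)"
  using semigroup by (auto simp: c0_semigroup_def)

lemma U_mem: "t \<ge> 0 \<Longrightarrow> x \<in> X \<Longrightarrow> U t x \<in> X"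
  using bcl_mem[OF bcl_U] by blast

lemma U_integral:
  assumes x: "x \<in> X" and t: "t \<ge> 0" and h: "h \<ge> 0"
  shows "integral {0..t} (\<lambda>s. U s x) \<in> X"
    and "U h (integral {0..t} (\<lambda>s. U s x)) = integral {0..t + h} (\<lambda>s. U s x) - integral {0..h} (\<lambda>s. U s x)"
proof -
  have c: "continuous_on {0..t} (\<lambda>s. U s x)" using U_cont[OF x] by (rule continuous_on_subset) auto
  note I = bcl_integral[OF bcl_U[OF h] csub closed c U_mem[OF _ x] t]
  show "integral {0..t} (\<lambda>s. U s x) \<in> X" using I(1) by auto
  have "U h (integral {0..t} (\<lambda>s. U s x)) = integral {0..t} (\<lambda>s. U h (U s x))" using I(2) by auto
  also have "\<dots> = integral {0..t} (\<lambda>s. U (s + h) x)"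
    using h x by (intro Henstock_Kurzweil_Integration.integral_cong) (metis U_add add.commute atLeastAtMost_iff)
  also have "\<dots> = integral {h..t + h} (\<lambda>s. U s x)"
    using integral_shift_Icc_real[of 0 t "\<lambda>s. U s x" h] by (simp add: o_def add.commute)
  also have "\<dots> = integral {0..t + h} (\<lambda>s. U s x) - integral {0..h} (\<lambda>s. U s x)"
  proof -
    have "(\<lambda>s. U s x) integrable_on {0..t + h}"
      by (intro integrable_continuous_real continuous_on_subset[OF U_cont[OF x]]) auto
    then have "integral {0..h} (\<lambda>s. U s x) + integral {h..t + h} (\<lambda>s. U s x) = integral {0..t + h} (\<lambda>s. U s x)"
      using t h by (intro Henstock_Kurzweil_Integration.integral_combine) auto
    then show ?thesis by (simp add: algebra_simps)
  qed
  finally show "U h (integral {0..t} (\<lambda>s. U s x)) = integral {0..t + h} (\<lambda>s. U s x) - integral {0..h} (\<lambda>s. U s x)" .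
qed

text \<open>Orbits are mild solutions. Together with the assumed uniqueness this identifies the
  given particle solution with an orbit.\<close>

lemma orbit_integral:
  assumes x: "x \<in> X" and t: "t \<ge> 0"
  shows "(integral {0..t} (\<lambda>s. U s x), U t x - x) \<in> generator_graph X U"
  unfolding generator_graph_def
proof (intro CollectI case_prodI conjI)
  show "integral {0..t} (\<lambda>s. U s x) \<in> X" by (rule U_integral(1)[OF x t order_refl])
  let ?I = "\<lambda>t. integral {0..t} (\<lambda>s. U s x)"
  have "((\<lambda>h. (?I (t + h) - ?I t) /\<^sub>R h - (?I (0 + h) - ?I 0) /\<^sub>R h) \<longlongrightarrow> U t x - U 0 x) (at_right 0)"
    by (intro tendsto_diff integral_right_derivative U_cont x t order_refl)
  moreover have "\<forall>\<^sub>F h in at_right (0::real). (?I (t + h) - ?I t) /\<^sub>R h - (?I (0 + h) - ?I 0) /\<^sub>R h = (U h (?I t) - ?I t) /\<^sub>R h"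
    using eventually_at_right_less[of 0]
  proof eventually_elim
    case (elim h)
    then have "U h (?I t) - ?I t = (?I (t + h) - ?I t) - (?I (0 + h) - ?I 0)"
      using U_integral(2)[OF x t, of h] by simp
    then show ?case by (simp only: scaleR_diff_right)
  qed
  ultimately show "((\<lambda>h. (U h (?I t) - ?I t) /\<^sub>R h) \<longlongrightarrow> U t x - x) (at_right 0)"
    unfolding U_0[OF x] by (rule Lim_transform_eventually)
qed

text \<open>Time averages of an orbit lie in the domain and tend to the starting point as the window
  shrinks.\<close>

lemma generator_dense:
  assumes x: "x \<in> X" shows "x \<in> closure {z. \<exists>w. (z, w) \<in> generator_graph X U}"
proof -
  let ?D = "{z. \<exists>w. (z, w) \<in> generator_graph X U}"
  let ?f = "\<lambda>h. (integral {0..0 + h} (\<lambda>s. U s x) - integral {0..0} (\<lambda>s. U s x)) /\<^sub>R h"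
  have "(?f \<longlongrightarrow> U 0 x) (at_right 0)" by (intro integral_right_derivative U_cont x order_refl)
  moreover have "\<forall>\<^sub>F h in at_right (0::real). ?f h \<in> closure ?D"
    using eventually_at_right_less[of 0]
  proof eventually_elim
    case (elim h)
    let ?I = "integral {0..h} (\<lambda>s. U s x)" and ?c = "inverse h"
    have g: "?I \<in> X" "((\<lambda>k. (U k ?I - ?I) /\<^sub>R k) \<longlongrightarrow> U h x - x) (at_right 0)"
      using orbit_integral[OF x, of h] elim by (auto simp: generator_graph_def)
    have "((\<lambda>k. ?c *\<^sub>R ((U k ?I - ?I) /\<^sub>R k)) \<longlongrightarrow> ?c *\<^sub>R (U h x - x)) (at_right 0)"
      by (intro tendsto_intros g)
    moreover have "\<forall>\<^sub>F k in at_right (0::real). ?c *\<^sub>R ((U k ?I - ?I) /\<^sub>R k) = (U k (?c *\<^sub>R ?I) - ?c *\<^sub>R ?I) /\<^sub>R k"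
      using eventually_at_right_less[of 0]
    proof eventually_elim
      case (elim k)
      then show ?case
        using bcl_scaleR[OF bcl_U g(1), of k ?c] by (simp add: scaleR_diff_right mult.commute)
    qed
    ultimately have "((\<lambda>k. (U k (?c *\<^sub>R ?I) - ?c *\<^sub>R ?I) /\<^sub>R k) \<longlongrightarrow> ?c *\<^sub>R (U h x - x)) (at_right 0)"
      by (rule Lim_transform_eventually)
    then have "(?c *\<^sub>R ?I, ?c *\<^sub>R (U h x - x)) \<in> generator_graph X U"
      using csub_scaleR[OF csub g(1)] by (auto simp: generator_graph_def)
    then show ?case by (intro subsetD[OF closure_subset]) auto
  qed
  ultimately have "U 0 x \<in> closure ?D"
    by (intro Lim_in_closed_set[of "closure ?D" ?f "at_right 0"]) auto
  then show ?thesis by (simp add: U_0 x)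
qed

lemma generator_orbit:
  assumes xy: "(x, y) \<in> generator_graph X U" and s: "s \<ge> 0"
  shows "(U s x, U s y) \<in> generator_graph X U"
    and "x \<in> X" and "y \<in> X"
proof -
  show x: "x \<in> X" using xy by (simp add: generator_graph_def)
  have lim: "((\<lambda>h. (U h x - x) /\<^sub>R h) \<longlongrightarrow> y) (at_right 0)" using xy by (simp add: generator_graph_def)
  have mem: "\<forall>\<^sub>F h in at_right (0::real). (U h x - x) /\<^sub>R h \<in> X"
    using eventually_at_right_less[of 0]
    by eventually_elim (intro csub_scaleR csub_diff csub U_mem x, simp)
  show y: "y \<in> X" by (rule Lim_in_closed_set[OF closed mem _ lim]) simp
  have "((\<lambda>h. U s ((U h x - x) /\<^sub>R h)) \<longlongrightarrow> U s y) (at_right 0)"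
    by (rule bcl_tendsto[OF bcl_U[OF s] csub lim mem y])
  moreover have "\<forall>\<^sub>F h in at_right (0::real). U s ((U h x - x) /\<^sub>R h) = (U h (U s x) - U s x) /\<^sub>R h"
    using eventually_at_right_less[of 0]
  proof eventually_elim
    case (elim h)
    have "U s (U h x) = U h (U s x)"
      using U_add[of s h x] U_add[of h s x] s elim x by (simp add: add.commute)
    then show ?case
      using bcl_scaleR[OF bcl_U[OF s] csub_diff[OF csub U_mem[of h] x], of x "inverse h"]
        bcl_diff[OF bcl_U[OF s] csub U_mem[of h x] x] elim x by simp
  qed
  ultimately have "((\<lambda>h. (U h (U s x) - U s x) /\<^sub>R h) \<longlongrightarrow> U s y) (at_right 0)"
    by (rule Lim_transform_eventually)
  then show "(U s x, U s y) \<in> generator_graph X U"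
    using U_mem[OF s x] by (simp add: generator_graph_def)
qed

end

locale contraction_semigroup_on = c0_semigroup_on +
  assumes contraction: "t \<ge> 0 \<Longrightarrow> x \<in> X \<Longrightarrow> norm (U t x) \<le> norm x"
begin

text \<open>Strong continuity at the limit point plus contraction of the remainder gives joint
  continuity in time and argument.\<close>

lemma U_joint_tendsto:
  assumes a: "(a \<longlongrightarrow> t) F" "\<forall>\<^sub>F h in F. a h \<ge> 0" "t \<ge> 0"
    and q: "(q \<longlongrightarrow> x) F" "\<forall>\<^sub>F h in F. q h \<in> X" "x \<in> X"
  shows "((\<lambda>h. U (a h) (q h)) \<longlongrightarrow> U t x) F"
proof -
  have "((\<lambda>h. U (a h) x) \<longlongrightarrow> U t x) F"
    by (rule continuous_on_tendsto_compose[OF U_cont[OF q(3)] a(1)]) (use a in auto)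
  moreover have "((\<lambda>h. U (a h) (q h - x)) \<longlongrightarrow> 0) F"
  proof (rule Lim_null_comparison)
    show "\<forall>\<^sub>F h in F. norm (U (a h) (q h - x)) \<le> norm (q h - x)"
      using a(2) q(2) by eventually_elim (intro contraction csub_diff csub q(3))
    show "((\<lambda>h. norm (q h - x)) \<longlongrightarrow> 0) F"
      using q(1) by (simp add: tendsto_norm_zero_iff LIM_zero_iff)
  qed
  ultimately have "((\<lambda>h. U (a h) x + U (a h) (q h - x)) \<longlongrightarrow> U t x + 0) F"
    by (rule tendsto_add)
  moreover have "\<forall>\<^sub>F h in F. U (a h) x + U (a h) (q h - x) = U (a h) (q h)"
    using a(2) q(2)
  proof eventually_elim
    case (elim h)
    then show ?case using bcl_diff[OF bcl_U csub _ q(3), of "a h" "q h"] by simp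
  qed
  ultimately show ?thesis by (simp add: Lim_transform_eventually)
qed

lemma U_joint_continuous:
  assumes "continuous_on A a" "\<And>s. s \<in> A \<Longrightarrow> a s \<ge> 0" "continuous_on A q" "\<And>s. s \<in> A \<Longrightarrow> q s \<in> X"
  shows "continuous_on A (\<lambda>s. U (a s) (q s))"
  unfolding continuous_on_def
proof
  fix s assume s: "s \<in> A"
  have "\<forall>\<^sub>F h in at s within A. h \<in> A" by (simp add: eventually_at_filter)
  then show "((\<lambda>s. U (a s) (q s)) \<longlongrightarrow> U (a s) (q s)) (at s within A)"
    by (intro U_joint_tendsto) (use assms s in \<open>auto simp: continuous_on_def elim!: eventually_mono\<close>)
qed

end

section \<open>Intertwining of the free evolutions\<close>

lemma right_quotient_tendsto:
  fixes f :: "real \<Rightarrow> 'a::real_normed_vector"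
  assumes "((\<lambda>h. (f h - a) /\<^sub>R h) \<longlongrightarrow> d) (at_right 0)" shows "(f \<longlongrightarrow> a) (at_right 0)"
proof -
  have "((\<lambda>h. h *\<^sub>R ((f h - a) /\<^sub>R h) + a) \<longlongrightarrow> 0 *\<^sub>R d + a) (at_right 0)"
    by (intro tendsto_intros assms)
  moreover have "\<forall>\<^sub>F h in at_right (0::real). h *\<^sub>R ((f h - a) /\<^sub>R h) + a = f h"
    using eventually_at_right_less[of 0] by eventually_elim simp
  ultimately show ?thesis by (simp add: Lim_transform_eventually)
qed

lemma eventually_at_rightI0: "(\<And>h. h > 0 \<Longrightarrow> P h) \<Longrightarrow> \<forall>\<^sub>F h in at_right (0::real). P h"
  using eventually_at_right_less[of "0::real"] by (auto elim: eventually_mono)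

context mean_field_system
begin

abbreviation N :: nat where "N \<equiv> npart S"
abbreviation U :: "nat \<Rightarrow> real \<Rightarrow> 'b \<Rightarrow> 'b" where "U \<equiv> semigroup S"

lemma semigroup_on: "n \<in> {1..N} \<Longrightarrow> contraction_semigroup_on (X n) (U n)"
proof unfold_locales
  assume n: "n \<in> {1..N}"
  show X: "csub (X n)" using n by (intro csub_X) simp
  show "closed (X n)" by (rule closed_X)
  show c0: "c0_semigroup (X n) (U n)" using semigroup[OF n] by (simp add: generates_def)
  show "norm (U n t x) \<le> norm x" if t: "t \<ge> 0" and x: "x \<in> X n" for t x
  proof -
    have "bounded_clinear_on (X n) (X n) (U n t)" using c0 t by (simp add: c0_semigroup_def)
    from op_norm_on_bound[OF this X x] show ?thesis using semigroup_norm[OF n t] by simp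
  qed
qed

lemma semigroup0_on: "contraction_semigroup_on (X 1) (semigroup0 S)"
proof unfold_locales
  show "csub (X 1)" by (intro csub_X) simp
  show "closed (X 1)" by (rule closed_X)
  show c0: "c0_semigroup (X 1) (semigroup0 S)" using semigroup0 by (simp add: generates_def)
  show "norm (semigroup0 S t x) \<le> norm x" if t: "t \<ge> 0" and x: "x \<in> X 1" for t x
    using semigroup0_isometric[OF t x] by simp
qed

lemma generator_U: "n \<in> {1..N} \<Longrightarrow> generator_graph (X n) (U n) = dyn_graph S n"
  using semigroup by (simp add: generates_def)

lemma generator_0: "generator_graph (X 1) (semigroup0 S) = {(f, kin0 S f) | f. f \<in> dom0 S}"
  using semigroup0 by (simp add: generates_def)

lemma bcl_pair_sum: "n \<ge> 1 \<Longrightarrow> bounded_clinear_on (X n) (X n) (pair_sum S n)"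
  unfolding pair_sum_def
  by (intro bcl_sum_fun csub_X) (auto simp: case_prod_beta intro!: bcl_T)

lemma pair_sum_X: "n \<ge> 1 \<Longrightarrow> x \<in> X n \<Longrightarrow> pair_sum S n x \<in> X n"
  using bcl_mem[OF bcl_pair_sum] .

lemma kin_right_derivative:
  assumes n: "n \<in> {1..N}" and xg: "(x, g) \<in> kin_graph S n"
  shows "((\<lambda>h. (U n h x - x) /\<^sub>R h) \<longlongrightarrow> g + pair_sum S n x /\<^sub>R real N) (at_right 0)"
proof -
  have "(x, g + pair_sum S n x /\<^sub>R real N) \<in> dyn_graph S n" using xg by (auto simp: dyn_graph_def)
  then show ?thesis unfolding generator_U[OF n, symmetric] generator_graph_def by simp
qed

lemma dom0_right_derivative:
  "y \<in> dom0 S \<Longrightarrow> ((\<lambda>h. (semigroup0 S h y - y) /\<^sub>R h) \<longlongrightarrow> kin0 S y) (at_right 0)"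
  using generator_0 unfolding generator_graph_def by blast

text \<open>Adding \<open>T_n/N\<close> changes only the second component of the graph, so this is
  at the same time the domain of the generator of \<open>U n\<close> and is invariant under
  it.\<close>

definition kin_dom :: "nat \<Rightarrow> 'b set" where
  "kin_dom n = {x. \<exists>g. (x, g) \<in> kin_graph S n}"

lemma kin_dom_eq: "n \<in> {1..N} \<Longrightarrow> kin_dom n = {x. \<exists>g. (x, g) \<in> generator_graph (X n) (U n)}"
  unfolding generator_U by (auto simp: kin_dom_def dyn_graph_def)

lemma kin_dom_invariant: "n \<in> {1..N} \<Longrightarrow> x \<in> kin_dom n \<Longrightarrow> t \<ge> 0 \<Longrightarrow> U n t x \<in> kin_dom n"
  unfolding kin_dom_eq
  using c0_semigroup_on.generator_orbit(1)[OF contraction_semigroup_on.axioms(1)[OF semigroup_on]] by blast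

lemma dom0_invariant: "y \<in> dom0 S \<Longrightarrow> t \<ge> 0 \<Longrightarrow> semigroup0 S t y \<in> dom0 S"
  using c0_semigroup_on.generator_orbit(1)[OF contraction_semigroup_on.axioms(1)[OF semigroup0_on], of y "kin0 S y" t]
  unfolding generator_0 by blast

lemma kin_dom_subset: "n \<ge> 1 \<Longrightarrow> kin_dom n \<subseteq> X n"
  using kin_subset[of n] by (auto simp: kin_dom_def)

lemma kin_dom_dense: "n \<in> {1..N} \<Longrightarrow> x \<in> X n \<Longrightarrow> x \<in> closure (kin_dom n)"
  unfolding kin_dom_eq
  by (rule c0_semigroup_on.generator_dense[OF contraction_semigroup_on.axioms(1)[OF semigroup_on]])

lemma dom0_dense: "y \<in> X 1 \<Longrightarrow> y \<in> closure (dom0 S)"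
  using c0_semigroup_on.generator_dense[OF contraction_semigroup_on.axioms(1)[OF semigroup0_on]]
  unfolding generator_0 by simp

lemma repl_tendsto:
  assumes l: "l \<in> {1..m}" and v: "(v \<longlongrightarrow> y) F" "(w \<longlongrightarrow> u) F"
    and mem: "\<forall>\<^sub>F h in F. v h \<in> X 1 \<and> w h \<in> X m" and y: "y \<in> X 1" and u: "u \<in> X m"
  shows "((\<lambda>h. repl S m l (v h) (w h)) \<longlongrightarrow> repl S m l y u) F"
proof (rule LIM_zero_cancel, rule Lim_null_comparison)
  have m: "m \<ge> 1" using l by auto
  show "\<forall>\<^sub>F h in F. norm (repl S m l (v h) (w h) - repl S m l y u) \<le>
      norm (v h) * norm (w h - u) + norm (v h - y) * norm u"
    using mem
  proof eventually_elim
    case (elim h)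
    then have vh: "v h \<in> X 1" and wh: "w h \<in> X m" by auto
    have d: "w h - u \<in> X m" "v h - y \<in> X 1" by (intro csub_diff csub_X m order_refl vh wh y u)+
    have "repl S m l (v h) (w h) - repl S m l y u = repl S m l (v h) (w h - u) + repl S m l (v h - y) u"
      unfolding bcl_diff[OF bcl_repl[OF l vh] csub_X[OF m] wh u]
        bcl_diff[OF bcl_repl_arg[OF l u] csub_X[OF order_refl] vh y] by simp
    then show ?case
      using norm_triangle_ineq[of "repl S m l (v h) (w h - u)" "repl S m l (v h - y) u"]
        norm_repl[OF l vh d(1)] norm_repl[OF l d(2) u] by simp
  qed
  have "((\<lambda>h. norm (v h) * norm (w h - u) + norm (v h - y) * norm u) \<longlongrightarrow>
      norm y * norm (u - u) + norm (y - y) * norm u) F"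
    by (intro tendsto_intros v)
  then show "((\<lambda>h. norm (v h) * norm (w h - u) + norm (v h - y) * norm u) \<longlongrightarrow> 0) F"
    by simp
qed

text \<open>A map \<open>\<Phi> x y\<close> that commutes with the free evolution of \<open>x\<close> and \<open>y\<close>: if \<open>x\<close> moves with velocity
  \<open>g'\<close> and \<open>y\<close> with velocity \<open>K\<^sub>0 y\<close>, then \<open>\<Phi> x y\<close> moves with velocity \<open>\<Phi> (g' - K\<^sub>0\<^sup>n x) y + K\<^sub>0\<^sup>m (\<Phi> x y)\<close>.\<close>

definition free_compatible :: "nat \<Rightarrow> nat \<Rightarrow> ('b \<Rightarrow> 'b \<Rightarrow> 'b) \<Rightarrow> bool" where
  "free_compatible n m \<Phi> \<longleftrightarrow>
    (\<forall>y\<in>X 1. bounded_clinear_on (X n) (X m) (\<lambda>x. \<Phi> x y)) \<and>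
    continuous_on (X n \<times> X 1) (\<lambda>z. \<Phi> (fst z) (snd z)) \<and>
    (\<forall>x g y. (x, g) \<in> kin_graph S n \<longrightarrow> y \<in> dom0 S \<longrightarrow> (\<exists>d. (\<Phi> x y, d) \<in> kin_graph S m \<and>
      (\<forall>v w g'. (\<forall>h>0. v h \<in> X n \<and> w h \<in> X 1) \<longrightarrow> g' \<in> X n \<longrightarrow>
        ((\<lambda>h. (v h - x) /\<^sub>R h) \<longlongrightarrow> g') (at_right 0) \<longrightarrow>
        ((\<lambda>h. (w h - y) /\<^sub>R h) \<longlongrightarrow> kin0 S y) (at_right 0) \<longrightarrow>
        ((\<lambda>h. (\<Phi> (v h) (w h) - \<Phi> x y) /\<^sub>R h) \<longlongrightarrow> \<Phi> (g' - g) y + d) (at_right 0))))"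

lemma
  assumes "free_compatible n m \<Phi>"
  shows free_compatible_bcl: "y \<in> X 1 \<Longrightarrow> bounded_clinear_on (X n) (X m) (\<lambda>x. \<Phi> x y)"
    and free_compatible_cont: "continuous_on (X n \<times> X 1) (\<lambda>z. \<Phi> (fst z) (snd z))"
    and free_compatible_deriv: "(x, g) \<in> kin_graph S n \<Longrightarrow> y \<in> dom0 S \<Longrightarrow> \<exists>d. (\<Phi> x y, d) \<in> kin_graph S m \<and>
      (\<forall>v w g'. (\<forall>h>0. v h \<in> X n \<and> w h \<in> X 1) \<longrightarrow> g' \<in> X n \<longrightarrow>
        ((\<lambda>h. (v h - x) /\<^sub>R h) \<longlongrightarrow> g') (at_right 0) \<longrightarrow>
        ((\<lambda>h. (w h - y) /\<^sub>R h) \<longlongrightarrow> kin0 S y) (at_right 0) \<longrightarrow>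
        ((\<lambda>h. (\<Phi> (v h) (w h) - \<Phi> x y) /\<^sub>R h) \<longlongrightarrow> \<Phi> (g' - g) y + d) (at_right 0))"
  using assms unfolding free_compatible_def by blast+

lemma free_compatible_tendsto:
  assumes \<Phi>: "free_compatible n m \<Phi>" and v: "(v \<longlongrightarrow> x) F" "(w \<longlongrightarrow> y) F"
    and mem: "\<forall>\<^sub>F h in F. v h \<in> X n \<and> w h \<in> X 1" and x: "x \<in> X n" and y: "y \<in> X 1"
  shows "((\<lambda>h. \<Phi> (v h) (w h)) \<longlongrightarrow> \<Phi> x y) F"
  using continuous_on_tendsto_compose[OF free_compatible_cont[OF \<Phi>] tendsto_Pair[OF v]] x y mem
  by simp

lemma free_compatible_const:
  assumes n: "n \<ge> 1" and L: "bounded_clinear_on (X n) (X m) L"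
    and kin: "\<And>x g. (x, g) \<in> kin_graph S n \<Longrightarrow> (L x, L g) \<in> kin_graph S m"
  shows "free_compatible n m (\<lambda>x y. L x)"
  unfolding free_compatible_def
proof (intro conjI ballI allI impI)
  show "bounded_clinear_on (X n) (X m) L" by (rule L)
  show "continuous_on (X n \<times> X 1) (\<lambda>z. L (fst z))"
    by (intro continuous_on_compose2[OF bcl_continuous_on[OF L csub_X[OF n]]] continuous_intros) auto
  fix x g y assume xg: "(x, g) \<in> kin_graph S n"
  then have x: "x \<in> X n" and g: "g \<in> X n" using kin_subset[OF n] by auto
  show "\<exists>d. (L x, d) \<in> kin_graph S m \<and>
      (\<forall>v w g'. (\<forall>h>0. v h \<in> X n \<and> w h \<in> X 1) \<longrightarrow> g' \<in> X n \<longrightarrow>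
        ((\<lambda>h. (v h - x) /\<^sub>R h) \<longlongrightarrow> g') (at_right 0) \<longrightarrow>
        ((\<lambda>h. (w h - y) /\<^sub>R h) \<longlongrightarrow> kin0 S y) (at_right 0) \<longrightarrow>
        ((\<lambda>h. (L (v h) - L x) /\<^sub>R h) \<longlongrightarrow> L (g' - g) + d) (at_right 0))"
  proof (intro exI[of _ "L g"] conjI allI impI)
    show "(L x, L g) \<in> kin_graph S m" by (rule kin[OF xg])
    fix v w :: "real \<Rightarrow> 'b" and g' assume vw: "\<forall>h>0. v h \<in> X n \<and> w h \<in> X 1" and g': "g' \<in> X n"
      and lim: "((\<lambda>h. (v h - x) /\<^sub>R h) \<longlongrightarrow> g') (at_right 0)"
    have mem: "(v h - x) /\<^sub>R h \<in> X n" if "h > 0" for h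
      using vw that x by (intro csub_scaleR csub_diff csub_X n) auto
    have "((\<lambda>h. L ((v h - x) /\<^sub>R h)) \<longlongrightarrow> L g') (at_right 0)"
      by (rule bcl_tendsto[OF L csub_X[OF n] lim eventually_at_rightI0[OF mem] g'])
    moreover have "\<forall>\<^sub>F h in at_right (0::real). L ((v h - x) /\<^sub>R h) = (L (v h) - L x) /\<^sub>R h"
    proof (rule eventually_at_rightI0)
      fix h :: real assume "h > 0"
      then have "v h \<in> X n" using vw by simp
      then show "L ((v h - x) /\<^sub>R h) = (L (v h) - L x) /\<^sub>R h"
        using bcl_scaleR[OF L csub_diff[OF csub_X[OF n] _ x]] bcl_diff[OF L csub_X[OF n] _ x] by simp
    qed
    ultimately have "((\<lambda>h. (L (v h) - L x) /\<^sub>R h) \<longlongrightarrow> L g') (at_right 0)" by (rule Lim_transform_eventually)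
    then show "((\<lambda>h. (L (v h) - L x) /\<^sub>R h) \<longlongrightarrow> L (g' - g) + L g) (at_right 0)"
      using bcl_diff[OF L csub_X[OF n] g' g] by simp
  qed
qed

text \<open>A product rule: the quotient of \<open>R(w) \<Phi>\<close> splits into
  \<open>R(w)\<close> of the quotient of \<open>\<Phi>\<close> and \<open>R\<close> of the quotient
  of \<open>w\<close>. In the limit the latter inserts \<open>K_0 y\<close>, which is precisely the
  term that \<open>kin_repl\<close> puts into the graph.\<close>

lemma free_compatible_repl:
  assumes \<Phi>: "free_compatible n m \<Phi>" and n: "n \<ge> 1" and l: "l \<in> {1..m}"
  shows "free_compatible n m (\<lambda>x y. \<Phi> x y - repl S m l y (\<Phi> x y))"
proof -
  have m: "m \<ge> 1" using l by auto
  note b = free_compatible_bcl[OF \<Phi>]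
  have \<Phi>X: "\<Phi> x y \<in> X m" if "x \<in> X n" "y \<in> X 1" for x y using bcl_mem[OF b] that by blast
  show ?thesis
    unfolding free_compatible_def
  proof (intro conjI ballI allI impI)
    fix y assume y: "y \<in> X 1"
    show "bounded_clinear_on (X n) (X m) (\<lambda>x. \<Phi> x y - repl S m l y (\<Phi> x y))"
      by (intro bcl_minus b y csub_X m bcl_compose[OF b bcl_repl[OF l y]])
  next
    have "continuous_on (X n \<times> X 1) (\<lambda>z. repl S m l (snd z) (\<Phi> (fst z) (snd z)))"
      unfolding continuous_on_def
    proof
      fix z assume z: "z \<in> X n \<times> X 1"
      show "((\<lambda>z. repl S m l (snd z) (\<Phi> (fst z) (snd z))) \<longlongrightarrow> repl S m l (snd z) (\<Phi> (fst z) (snd z))) (at z within X n \<times> X 1)"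
      proof (rule repl_tendsto[OF l])
        show "(snd \<longlongrightarrow> snd z) (at z within X n \<times> X 1)" by (intro tendsto_intros)
        show "((\<lambda>z. \<Phi> (fst z) (snd z)) \<longlongrightarrow> \<Phi> (fst z) (snd z)) (at z within X n \<times> X 1)"
          using free_compatible_cont[OF \<Phi>, unfolded continuous_on_def, rule_format, OF z] .
        have "\<forall>\<^sub>F h in at z within X n \<times> X 1. h \<in> X n \<times> X 1" by (simp add: eventually_at_filter)
        then show "\<forall>\<^sub>F h in at z within X n \<times> X 1. snd h \<in> X 1 \<and> \<Phi> (fst h) (snd h) \<in> X m"
          by eventually_elim (use \<Phi>X in auto)
      qed (use z \<Phi>X in auto)
    qed
    then show "continuous_on (X n \<times> X 1) (\<lambda>z. \<Phi> (fst z) (snd z) - repl S m l (snd z) (\<Phi> (fst z) (snd z)))"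
      by (intro continuous_on_diff free_compatible_cont[OF \<Phi>])
  next
    fix x g y assume xg: "(x, g) \<in> kin_graph S n" and yd: "y \<in> dom0 S"
    note y = dom0_X[OF yd] and Ky = kin0_X[OF yd]
    note R = bcl_repl[OF l y]
    have x: "x \<in> X n" and g: "g \<in> X n" using xg kin_subset[OF n] by auto
    obtain d where d: "(\<Phi> x y, d) \<in> kin_graph S m" and
      lim: "\<And>v w g'. (\<forall>h>0. v h \<in> X n \<and> w h \<in> X 1) \<Longrightarrow> g' \<in> X n \<Longrightarrow>
        ((\<lambda>h. (v h - x) /\<^sub>R h) \<longlongrightarrow> g') (at_right 0) \<Longrightarrow>
        ((\<lambda>h. (w h - y) /\<^sub>R h) \<longlongrightarrow> kin0 S y) (at_right 0) \<Longrightarrow>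
        ((\<lambda>h. (\<Phi> (v h) (w h) - \<Phi> x y) /\<^sub>R h) \<longlongrightarrow> \<Phi> (g' - g) y + d) (at_right 0)"
      using free_compatible_deriv[OF \<Phi> xg yd] by blast
    have dX: "d \<in> X m" using d kin_subset[OF m] by auto
    note u = \<Phi>X[OF x y]
    let ?d = "d - (repl S m l y d + repl S m l (kin0 S y) (\<Phi> x y))"
    have "(\<Phi> x y, d) - (repl S m l y (\<Phi> x y), repl S m l y d + repl S m l (kin0 S y) (\<Phi> x y)) \<in> kin_graph S m"
      by (intro csub_diff csub_kin d kin_repl l yd)
    then have kin: "(\<Phi> x y - repl S m l y (\<Phi> x y), ?d) \<in> kin_graph S m" by simp
    show "\<exists>d. (\<Phi> x y - repl S m l y (\<Phi> x y), d) \<in> kin_graph S m \<and>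
      (\<forall>v w g'. (\<forall>h>0. v h \<in> X n \<and> w h \<in> X 1) \<longrightarrow> g' \<in> X n \<longrightarrow>
        ((\<lambda>h. (v h - x) /\<^sub>R h) \<longlongrightarrow> g') (at_right 0) \<longrightarrow>
        ((\<lambda>h. (w h - y) /\<^sub>R h) \<longlongrightarrow> kin0 S y) (at_right 0) \<longrightarrow>
        ((\<lambda>h. (\<Phi> (v h) (w h) - repl S m l (w h) (\<Phi> (v h) (w h)) - (\<Phi> x y - repl S m l y (\<Phi> x y))) /\<^sub>R h) \<longlongrightarrow>
          \<Phi> (g' - g) y - repl S m l y (\<Phi> (g' - g) y) + d) (at_right 0))"
    proof (intro exI[of _ ?d] conjI allI impI kin)
      fix v w :: "real \<Rightarrow> 'b" and g' assume vw: "\<forall>h>0. v h \<in> X n \<and> w h \<in> X 1" and g': "g' \<in> X n"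
        and lv: "((\<lambda>h. (v h - x) /\<^sub>R h) \<longlongrightarrow> g') (at_right 0)"
        and lw: "((\<lambda>h. (w h - y) /\<^sub>R h) \<longlongrightarrow> kin0 S y) (at_right 0)"
      define p where "p h = (\<Phi> (v h) (w h) - \<Phi> x y) /\<^sub>R h" for h
      define q where "q h = (w h - y) /\<^sub>R h" for h
      define e where "e = \<Phi> (g' - g) y + d"
      have gg: "\<Phi> (g' - g) y \<in> X m" by (intro \<Phi>X csub_diff csub_X n g g' y)
      have eX: "e \<in> X m" unfolding e_def by (intro csub_add csub_X m dX gg)
      have pe: "(p \<longlongrightarrow> e) (at_right 0)"
        unfolding p_def e_def by (rule lim[OF vw g' lv lw])
      have qe: "(q \<longlongrightarrow> kin0 S y) (at_right 0)" using lw by (simp add: q_def[abs_def])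
      have wy: "(w \<longlongrightarrow> y) (at_right 0)" by (rule right_quotient_tendsto[OF lw])
      have mem: "v h \<in> X n" "w h \<in> X 1" "\<Phi> (v h) (w h) \<in> X m" if "h > 0" for h
        using vw that \<Phi>X by auto
      have pX: "p h \<in> X m" and qX: "q h \<in> X 1" if "h > 0" for h
        unfolding p_def q_def using mem[OF that] y by (auto intro!: csub_scaleR csub_diff csub_X m u)
      \<comment> \<open>The increment of \<open>\<Phi>\<close> is taken with the moved
        \<open>w h\<close>, that of \<open>w\<close> with the fixed \<open>\<Phi> x y\<close>; then
        no mixed second-order term is left over.\<close>
      have "((\<lambda>h. p h - (repl S m l (w h) (p h) + repl S m l (q h) (\<Phi> x y))) \<longlongrightarrow>
          e - (repl S m l y e + repl S m l (kin0 S y) (\<Phi> x y))) (at_right 0)"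
        by (intro tendsto_diff tendsto_add repl_tendsto[OF l] pe wy qe tendsto_const eventually_at_rightI0 conjI)
          (use mem pX qX y eX u Ky in auto)
      moreover have "\<forall>\<^sub>F h in at_right (0::real). p h - (repl S m l (w h) (p h) + repl S m l (q h) (\<Phi> x y)) =
          (\<Phi> (v h) (w h) - repl S m l (w h) (\<Phi> (v h) (w h)) - (\<Phi> x y - repl S m l y (\<Phi> x y))) /\<^sub>R h"
      proof (rule eventually_at_rightI0)
        fix h :: real assume h: "h > 0"
        note Rw = bcl_repl[OF l mem(2)[OF h]] and Ru = bcl_repl_arg[OF l u]
        have "repl S m l (w h) (p h) = (repl S m l (w h) (\<Phi> (v h) (w h)) - repl S m l (w h) (\<Phi> x y)) /\<^sub>R h"
          unfolding p_def bcl_scaleR[OF Rw csub_diff[OF csub_X[OF m] mem(3)[OF h] u]]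
            bcl_diff[OF Rw csub_X[OF m] mem(3)[OF h] u] ..
        moreover have "repl S m l (q h) (\<Phi> x y) = (repl S m l (w h) (\<Phi> x y) - repl S m l y (\<Phi> x y)) /\<^sub>R h"
          unfolding q_def bcl_scaleR[OF Ru csub_diff[OF csub_X[OF order_refl] mem(2)[OF h] y]]
            bcl_diff[OF Ru csub_X[OF order_refl] mem(2)[OF h] y] ..
        ultimately show "p h - (repl S m l (w h) (p h) + repl S m l (q h) (\<Phi> x y)) =
          (\<Phi> (v h) (w h) - repl S m l (w h) (\<Phi> (v h) (w h)) - (\<Phi> x y - repl S m l y (\<Phi> x y))) /\<^sub>R h"
          by (simp add: p_def scaleR_diff_right)
      qed
      ultimately have "((\<lambda>h. (\<Phi> (v h) (w h) - repl S m l (w h) (\<Phi> (v h) (w h)) - (\<Phi> x y - repl S m l y (\<Phi> x y))) /\<^sub>R h) \<longlongrightarrow>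
          e - (repl S m l y e + repl S m l (kin0 S y) (\<Phi> x y))) (at_right 0)"
        by (rule Lim_transform_eventually)
      moreover have "e - (repl S m l y e + repl S m l (kin0 S y) (\<Phi> x y)) =
          \<Phi> (g' - g) y - repl S m l y (\<Phi> (g' - g) y) + ?d"
        unfolding e_def bcl_add[OF R gg dX] by simp
      ultimately show "((\<lambda>h. (\<Phi> (v h) (w h) - repl S m l (w h) (\<Phi> (v h) (w h)) - (\<Phi> x y - repl S m l y (\<Phi> x y))) /\<^sub>R h) \<longlongrightarrow>
          \<Phi> (g' - g) y - repl S m l y (\<Phi> (g' - g) y) + ?d) (at_right 0)"
        by simp
    qed
  qed
qed

lemma free_compatible_cong:
  assumes \<Phi>: "free_compatible n m \<Phi>" and n: "n \<ge> 1" and eq: "\<And>x y. x \<in> X n \<Longrightarrow> y \<in> X 1 \<Longrightarrow> \<Phi> x y = \<Psi> x y"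
  shows "free_compatible n m \<Psi>"
  unfolding free_compatible_def
proof (intro conjI ballI allI impI)
  fix y assume y: "y \<in> X 1"
  show "bounded_clinear_on (X n) (X m) (\<lambda>x. \<Psi> x y)"
    using free_compatible_bcl[OF \<Phi> y] eq y csub_X[OF n]
    unfolding bounded_clinear_on_def clinear_on_def by (simp add: csub_add csub_scaleC)
next
  show "continuous_on (X n \<times> X 1) (\<lambda>z. \<Psi> (fst z) (snd z))"
    using free_compatible_cont[OF \<Phi>] by (rule continuous_on_cong[THEN iffD1, rotated 2]) (use eq in auto)
next
  fix x g y assume xg: "(x, g) \<in> kin_graph S n" and y: "y \<in> dom0 S"
  have x: "x \<in> X n" and g: "g \<in> X n" using xg kin_subset[OF n] by auto
  obtain d where d: "(\<Phi> x y, d) \<in> kin_graph S m" and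
    lim: "\<And>v w g'. (\<forall>h>0. v h \<in> X n \<and> w h \<in> X 1) \<Longrightarrow> g' \<in> X n \<Longrightarrow>
      ((\<lambda>h. (v h - x) /\<^sub>R h) \<longlongrightarrow> g') (at_right 0) \<Longrightarrow>
      ((\<lambda>h. (w h - y) /\<^sub>R h) \<longlongrightarrow> kin0 S y) (at_right 0) \<Longrightarrow>
      ((\<lambda>h. (\<Phi> (v h) (w h) - \<Phi> x y) /\<^sub>R h) \<longlongrightarrow> \<Phi> (g' - g) y + d) (at_right 0)"
    using free_compatible_deriv[OF \<Phi> xg y] by blast
  show "\<exists>d. (\<Psi> x y, d) \<in> kin_graph S m \<and>
      (\<forall>v w g'. (\<forall>h>0. v h \<in> X n \<and> w h \<in> X 1) \<longrightarrow> g' \<in> X n \<longrightarrow>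
        ((\<lambda>h. (v h - x) /\<^sub>R h) \<longlongrightarrow> g') (at_right 0) \<longrightarrow>
        ((\<lambda>h. (w h - y) /\<^sub>R h) \<longlongrightarrow> kin0 S y) (at_right 0) \<longrightarrow>
        ((\<lambda>h. (\<Psi> (v h) (w h) - \<Psi> x y) /\<^sub>R h) \<longlongrightarrow> \<Psi> (g' - g) y + d) (at_right 0))"
  proof (intro exI[of _ d] conjI allI impI)
    show "(\<Psi> x y, d) \<in> kin_graph S m" using d eq[OF x dom0_X[OF y]] by simp
    fix v w :: "real \<Rightarrow> 'b" and g' assume vw: "\<forall>h>0. v h \<in> X n \<and> w h \<in> X 1" and g': "g' \<in> X n"
      and lv: "((\<lambda>h. (v h - x) /\<^sub>R h) \<longlongrightarrow> g') (at_right 0)"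
      and lw: "((\<lambda>h. (w h - y) /\<^sub>R h) \<longlongrightarrow> kin0 S y) (at_right 0)"
    have "\<forall>\<^sub>F h in at_right (0::real). (\<Phi> (v h) (w h) - \<Phi> x y) /\<^sub>R h = (\<Psi> (v h) (w h) - \<Psi> x y) /\<^sub>R h"
      by (rule eventually_at_rightI0) (use vw eq x dom0_X[OF y] in auto)
    from Lim_transform_eventually[OF lim[OF vw g' lv lw] this]
    show "((\<lambda>h. (\<Psi> (v h) (w h) - \<Psi> x y) /\<^sub>R h) \<longlongrightarrow> \<Psi> (g' - g) y + d) (at_right 0)"
      using eq[OF csub_diff[OF csub_X[OF n] g' g] dom0_X[OF y]] by simp
  qed
qed

lemma free_compatible_proj:
  assumes n: "n \<ge> 1" and m: "m \<ge> 1" and L: "bounded_clinear_on (X n) (X m) L"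
    and kin: "\<And>x g. (x, g) \<in> kin_graph S n \<Longrightarrow> (L x, L g) \<in> kin_graph S m" and J: "J \<subseteq> {1..m}"
  shows "free_compatible n m (\<lambda>x y. proj S m y J (L x))"
  using finite_subset[OF J finite_atLeastAtMost] J
proof (induction J rule: finite_induct)
  case empty
  then show ?case using free_compatible_const[OF n L kin] by simp
next
  case (insert l J)
  then have IH: "free_compatible n m (\<lambda>x y. proj S m y J (L x))" and l: "l \<in> {1..m}" and J: "J \<subseteq> {1..m}" by auto
  show ?case
    by (rule free_compatible_cong[OF free_compatible_repl[OF IH n l] n])
      (simp add: proj_insert[OF m _ l J insert.hyps(2)])
qed

text \<open>The \<open>T\<^sub>j/N\<close> parts of the generators only contribute a bounded commutator.\<close>

lemma intertwining:
  assumes \<Phi>: "free_compatible n m \<Phi>" and n: "n \<in> {1..N}" and m: "m \<in> {1..N}" and x0: "x0 \<in> X n" and y0: "y0 \<in> X 1"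
  shows "((\<lambda>h. (\<Phi> (U n h x0) (semigroup0 S h y0) - U m h (\<Phi> x0 y0)) /\<^sub>R h) \<longlongrightarrow>
    (\<Phi> (pair_sum S n x0) y0 - pair_sum S m (\<Phi> x0 y0)) /\<^sub>R real N) (at_right 0)"
proof -
  have n1: "n \<ge> 1" and m1: "m \<ge> 1" using n m by auto
  interpret Un: contraction_semigroup_on "X n" "U n" by (rule semigroup_on[OF n])
  interpret Um: contraction_semigroup_on "X m" "U m" by (rule semigroup_on[OF m])
  interpret S0: contraction_semigroup_on "X 1" "semigroup0 S" by (rule semigroup0_on)
  \<comment> \<open>The velocity of \<open>\<Phi>\<close> along the evolved arguments minus the
    velocity under \<open>U m\<close>. The free parts cancel, so \<open>\<beta>\<close> is bounded
    and continuous on the whole space although its derivation needs the domain.\<close>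
  define \<beta> where "\<beta> x y = (\<Phi> (pair_sum S n x) y - pair_sum S m (\<Phi> x y)) /\<^sub>R real N" for x y
  have \<Phi>X: "\<Phi> x y \<in> X m" if "x \<in> X n" "y \<in> X 1" for x y
    using bcl_mem[OF free_compatible_bcl[OF \<Phi>]] that by blast
  have \<beta>X: "\<beta> x y \<in> X m" if "x \<in> X n" "y \<in> X 1" for x y
    unfolding \<beta>_def using that by (intro csub_scaleR csub_diff csub_X m1 pair_sum_X \<Phi>X n1)
  have \<beta>cont: "continuous_on (X n \<times> X 1) (\<lambda>z. \<beta> (fst z) (snd z))"
  proof -
    have "continuous_on (X n \<times> X 1) (\<lambda>z. pair_sum S n (fst z))"
      by (intro continuous_on_compose2[OF bcl_continuous_on[OF bcl_pair_sum csub_X]] continuous_intros n1) auto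
    then have "continuous_on (X n \<times> X 1) (\<lambda>z. (pair_sum S n (fst z), snd z))"
      by (intro continuous_intros)
    then have 1: "continuous_on (X n \<times> X 1) (\<lambda>z. \<Phi> (pair_sum S n (fst z)) (snd z))"
      using continuous_on_compose2[OF free_compatible_cont[OF \<Phi>]] pair_sum_X[OF n1] by fastforce
    have 2: "continuous_on (X n \<times> X 1) (\<lambda>z. pair_sum S m (\<Phi> (fst z) (snd z)))"
      by (intro continuous_on_compose2[OF bcl_continuous_on[OF bcl_pair_sum csub_X] free_compatible_cont[OF \<Phi>]] m1)
        (use \<Phi>X in auto)
    show ?thesis unfolding \<beta>_def by (intro continuous_intros 1 2)
  qed
  have base: "((\<lambda>h. (\<Phi> (U n h x) (semigroup0 S h y) - U m h (\<Phi> x y)) /\<^sub>R h) \<longlongrightarrow> \<beta> x y) (at_right 0)"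
    if xd: "x \<in> kin_dom n" and yd: "y \<in> dom0 S" for x y
  proof -
    obtain g where xg: "(x, g) \<in> kin_graph S n" using xd by (auto simp: kin_dom_def)
    have x: "x \<in> X n" and g: "g \<in> X n" using xg kin_subset[OF n1] by auto
    note y = dom0_X[OF yd]
    obtain d where d: "(\<Phi> x y, d) \<in> kin_graph S m" and
      lim: "\<And>v w g'. (\<forall>h>0. v h \<in> X n \<and> w h \<in> X 1) \<Longrightarrow> g' \<in> X n \<Longrightarrow>
        ((\<lambda>h. (v h - x) /\<^sub>R h) \<longlongrightarrow> g') (at_right 0) \<Longrightarrow>
        ((\<lambda>h. (w h - y) /\<^sub>R h) \<longlongrightarrow> kin0 S y) (at_right 0) \<Longrightarrow>
        ((\<lambda>h. (\<Phi> (v h) (w h) - \<Phi> x y) /\<^sub>R h) \<longlongrightarrow> \<Phi> (g' - g) y + d) (at_right 0)"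
      using free_compatible_deriv[OF \<Phi> xg yd] by blast
    let ?g = "g + pair_sum S n x /\<^sub>R real N"
    have "((\<lambda>h. (\<Phi> (U n h x) (semigroup0 S h y) - \<Phi> x y) /\<^sub>R h) \<longlongrightarrow> \<Phi> (?g - g) y + d) (at_right 0)"
      by (intro lim kin_right_derivative[OF n xg] dom0_right_derivative[OF yd] csub_add csub_scaleR csub_X n1 pair_sum_X g x)
        (use x y in \<open>auto intro: Un.U_mem S0.U_mem[unfolded One_nat_def]\<close>)
    then have "((\<lambda>h. (\<Phi> (U n h x) (semigroup0 S h y) - \<Phi> x y) /\<^sub>R h - (U m h (\<Phi> x y) - \<Phi> x y) /\<^sub>R h) \<longlongrightarrow>
        \<Phi> (?g - g) y + d - (d + pair_sum S m (\<Phi> x y) /\<^sub>R real N)) (at_right 0)"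
      by (intro tendsto_diff kin_right_derivative[OF m d])
    moreover have "\<Phi> (?g - g) y = \<Phi> (pair_sum S n x) y /\<^sub>R real N"
      using bcl_scaleR[OF free_compatible_bcl[OF \<Phi> y] pair_sum_X[OF n1 x]] by simp
    ultimately show ?thesis
      by (simp add: \<beta>_def scaleR_diff_right)
  qed
  define \<beta>0 where "\<beta>0 = \<beta> x0 y0"
  have \<beta>0: "\<beta>0 \<in> X m" unfolding \<beta>0_def by (rule \<beta>X[OF x0 y0])
  \<comment> \<open>Uniformity near \<open>(x0, y0)\<close> is what allows the estimate from the
    domain to survive the limit to \<open>x0\<close> and \<open>y0\<close>, which need not lie in
    it.\<close>
  have unif: "\<exists>\<delta>>0. \<forall>x\<in>X n. \<forall>y\<in>X 1. norm (x - x0) < \<delta> \<longrightarrow> norm (y - y0) < \<delta> \<longrightarrow>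
      (\<forall>s\<in>{0..\<delta>}. \<forall>r\<in>{0..\<delta>}. norm (U m r (\<beta> (U n s x) (semigroup0 S s y)) - \<beta>0) \<le> e)" if e: "e > 0" for e
  proof -
    obtain d1 where d1: "d1 > 0" "\<And>z. z \<in> X n \<times> X 1 \<Longrightarrow> dist z (x0, y0) < d1 \<Longrightarrow>
        dist (\<beta> (fst z) (snd z)) \<beta>0 < e / 2"
    proof -
      have "(x0, y0) \<in> X n \<times> X 1" "e / 2 > 0" using x0 y0 e by auto
      from \<beta>cont[unfolded continuous_on_iff, rule_format, OF this] show thesis
        using that by (auto simp: \<beta>0_def)
    qed
    have cont0: "\<exists>d>0. \<forall>s\<in>{0..d}. norm (V s z - z) < \<epsilon>" if V: "contraction_semigroup_on Y V" and z: "z \<in> Y" and \<epsilon>: "\<epsilon> > 0"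
      for Y V and z :: 'b and \<epsilon>
    proof -
      interpret V: contraction_semigroup_on Y V by (rule V)
      have "\<exists>d>0. \<forall>s\<in>{0..}. dist s 0 < d \<longrightarrow> dist (V s z) (V 0 z) < \<epsilon>"
        using V.U_cont[OF z] \<epsilon> unfolding continuous_on_iff by (meson atLeast_iff order_refl)
      then obtain d where "d > 0" "\<forall>s\<in>{0..}. dist s 0 < d \<longrightarrow> dist (V s z) z < \<epsilon>"
        unfolding V.U_0[OF z] by blast
      then show ?thesis by (intro exI[of _ "d / 2"]) (auto simp: dist_norm)
    qed
    obtain d2 where d2: "d2 > 0" "\<forall>s\<in>{0..d2}. norm (U n s x0 - x0) < d1 / 4"
      using cont0[OF Un.contraction_semigroup_on_axioms x0, of "d1 / 4"] d1(1) by auto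
    obtain d3 where d3: "d3 > 0" "\<forall>s\<in>{0..d3}. norm (semigroup0 S s y0 - y0) < d1 / 4"
      using cont0[OF S0.contraction_semigroup_on_axioms y0, of "d1 / 4"] d1(1) by auto
    obtain d4 where d4: "d4 > 0" "\<forall>s\<in>{0..d4}. norm (U m s \<beta>0 - \<beta>0) < e / 2"
      using cont0[OF Um.contraction_semigroup_on_axioms \<beta>0, of "e / 2"] e by auto
    define \<delta> where "\<delta> = min (min d2 d3) (min d4 (d1 / 4))"
    have \<delta>: "\<delta> > 0" "\<delta> \<le> d2" "\<delta> \<le> d3" "\<delta> \<le> d4" "\<delta> \<le> d1 / 4" using d1 d2 d3 d4 by (auto simp: \<delta>_def)
    show ?thesis
    proof (intro exI[of _ \<delta>] conjI ballI impI)
      fix x y s r assume x: "x \<in> X n" and y: "y \<in> X 1" and xx: "norm (x - x0) < \<delta>" and yy: "norm (y - y0) < \<delta>"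
        and s: "s \<in> {0..\<delta>}" and r: "r \<in> {0..\<delta>}"
      have s0: "s \<ge> 0" and r0: "r \<ge> 0" using s r by auto
      let ?x = "U n s x" and ?y = "semigroup0 S s y"
      have X: "?x \<in> X n" "?y \<in> X 1" by (intro Un.U_mem S0.U_mem s0 x y)+
      have "norm (?x - U n s x0) \<le> norm (x - x0)"
        using Un.contraction[OF s0 csub_diff[OF Un.csub x x0]] bcl_diff[OF Un.bcl_U[OF s0] Un.csub x x0] by simp
      moreover have "norm (U n s x0 - x0) < d1 / 4" using d2(2) s \<delta> by simp
      ultimately have 1: "dist ?x x0 < d1 / 2"
        using norm_triangle_ineq[of "?x - U n s x0" "U n s x0 - x0"] xx \<delta> by (simp add: dist_norm)
      have "norm (?y - semigroup0 S s y0) \<le> norm (y - y0)"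
        using S0.contraction[OF s0 csub_diff[OF S0.csub y y0]] bcl_diff[OF S0.bcl_U[OF s0] S0.csub y y0] by simp
      moreover have "norm (semigroup0 S s y0 - y0) < d1 / 4" using d3(2) s \<delta> by simp
      ultimately have 2: "dist ?y y0 < d1 / 2"
        using norm_triangle_ineq[of "?y - semigroup0 S s y0" "semigroup0 S s y0 - y0"] yy \<delta> by (simp add: dist_norm)
      have "dist (?x, ?y) (x0, y0) \<le> dist ?x x0 + dist ?y y0"
        unfolding dist_Pair_Pair by (rule sqrt_sum_squares_le_sum) auto
      then have "dist (\<beta> ?x ?y) \<beta>0 < e / 2" using d1(2)[of "(?x, ?y)"] X 1 2 by simp
      moreover have "norm (U m r (\<beta> ?x ?y) - U m r \<beta>0) \<le> norm (\<beta> ?x ?y - \<beta>0)"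
        using Um.contraction[OF r0 csub_diff[OF Um.csub \<beta>X[OF X] \<beta>0]] bcl_diff[OF Um.bcl_U[OF r0] Um.csub \<beta>X[OF X] \<beta>0] by simp
      moreover have "norm (U m r \<beta>0 - \<beta>0) < e / 2" using d4(2) r \<delta> by simp
      ultimately show "norm (U m r (\<beta> ?x ?y) - \<beta>0) \<le> e"
        using norm_triangle_ineq[of "U m r (\<beta> ?x ?y) - U m r \<beta>0" "U m r \<beta>0 - \<beta>0"] by (simp add: dist_norm)
    qed (rule \<delta>)
  qed
  have step: "norm (\<Phi> (U n h x) (semigroup0 S h y) - U m h (\<Phi> x y) - h *\<^sub>R \<beta>0) \<le> e * h"
    if e: "e > 0" and h: "h \<ge> 0" and xd: "x \<in> kin_dom n" and yd: "y \<in> dom0 S"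
      and bd: "\<And>s r. s \<in> {0..h} \<Longrightarrow> r \<in> {0..h} \<Longrightarrow> norm (U m r (\<beta> (U n s x) (semigroup0 S s y)) - \<beta>0) \<le> e"
    for e h x y
  proof -
    have x: "x \<in> X n" using xd kin_dom_subset[OF n1] by auto
    note y = dom0_X[OF yd]
    define z where "z s = \<Phi> (U n s x) (semigroup0 S s y)" for s
    have mem: "U n s x \<in> X n" "semigroup0 S s y \<in> X 1" "z s \<in> X m" if "s \<ge> 0" for s
      unfolding z_def by (intro Un.U_mem S0.U_mem \<Phi>X that x y)+
    \<comment> \<open>Duhamel interpolation: \<open>s\<close> runs from letting \<open>U m\<close>
      act for the whole time \<open>h\<close> to evolving the arguments for the whole time, with the
      expected main term subtracted. The right derivative is controlled by \<open>base\<close> at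
      the point reached at time \<open>s\<close>, which is still in the domain.\<close>
    define \<phi> where "\<phi> s = U m (h - s) (z s) - s *\<^sub>R \<beta>0" for s
    have "continuous_on {0..h} (\<lambda>s. (U n s x, semigroup0 S s y))"
      by (intro continuous_intros continuous_on_subset[OF Un.U_cont[OF x]] continuous_on_subset[OF S0.U_cont[OF y]]) auto
    then have zc: "continuous_on {0..h} z"
      using continuous_on_compose2[OF free_compatible_cont[OF \<Phi>], of "{0..h}" "\<lambda>s. (U n s x, semigroup0 S s y)"] mem
      by (simp add: z_def[abs_def] image_subset_iff)
    have \<phi>c: "continuous_on {0..h} \<phi>"
      unfolding \<phi>_def by (intro continuous_intros Um.U_joint_continuous zc) (use mem in auto)
    have "norm (\<phi> h - \<phi> 0) \<le> e * h"
    proof (rule right_mean_value[OF \<phi>c h])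
      fix s e' :: real assume s: "0 \<le> s" "s < h" and e': "e' > 0"
      define w where "w k = (\<Phi> (U n k (U n s x)) (semigroup0 S k (semigroup0 S s y)) - U m k (z s)) /\<^sub>R k" for k
      let ?b = "\<beta> (U n s x) (semigroup0 S s y)"
      have b: "?b \<in> X m" by (intro \<beta>X mem s)
      have "(w \<longlongrightarrow> ?b) (at_right 0)"
        unfolding w_def z_def using s by (intro base kin_dom_invariant n xd dom0_invariant yd)
      then have "\<forall>\<^sub>F k in at_right 0. dist (w k) ?b < e'" using e' by (rule tendstoD)
      moreover have "\<forall>\<^sub>F k in at_right (0::real). 0 < k \<and> k < h - s"
        using s eventually_at_right_real[of 0 "h - s"] by (auto elim: eventually_mono)
      ultimately show "\<forall>\<^sub>F k in at_right 0. norm (\<phi> (s + k) - \<phi> s) \<le> k * (e + e')"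
      proof eventually_elim
        case (elim k)
        let ?r = "h - (s + k)"
        have r: "?r \<ge> 0" and k: "k \<ge> 0" "k > 0" using elim by auto
        have zsk: "z (s + k) = \<Phi> (U n k (U n s x)) (semigroup0 S k (semigroup0 S s y))"
          unfolding z_def using Un.U_add[of k s x] S0.U_add[of k s y] k s x y by (simp add: add.commute)
        have "U m (h - s) (z s) = U m ?r (U m k (z s))"
          using Um.U_add[OF r k(1) mem(3)[OF s(1)]] by simp
        moreover have "z (s + k) = U m k (z s) + k *\<^sub>R w k"
          unfolding zsk w_def using k by simp
        moreover have wX: "w k \<in> X m"
          unfolding w_def using mem s k x y by (intro csub_scaleR csub_diff csub_X m1 Um.U_mem \<Phi>X Un.U_mem S0.U_mem) auto
        moreover have "U m k (z s) \<in> X m" using mem s k by (intro Um.U_mem) auto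
        ultimately have "\<phi> (s + k) - \<phi> s = k *\<^sub>R (U m ?r (w k) - \<beta>0)"
          unfolding \<phi>_def
          by (simp add: bcl_add[OF Um.bcl_U[OF r]] csub_scaleR[OF Um.csub] bcl_scaleR[OF Um.bcl_U[OF r]]
              scaleR_diff_right scaleR_add_left)
        moreover have "norm (U m ?r (w k) - U m ?r ?b) \<le> norm (w k - ?b)"
          using Um.contraction[OF r csub_diff[OF Um.csub wX b]] bcl_diff[OF Um.bcl_U[OF r] Um.csub wX b] by simp
        moreover have "norm (U m ?r ?b - \<beta>0) \<le> e" using s k r by (intro bd) auto
        ultimately show ?case
          using elim k norm_triangle_ineq[of "U m ?r (w k) - U m ?r ?b" "U m ?r ?b - \<beta>0"]
          by (simp add: dist_norm)
      qed
    qed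
    moreover have "\<phi> h - \<phi> 0 = \<Phi> (U n h x) (semigroup0 S h y) - U m h (\<Phi> x y) - h *\<^sub>R \<beta>0"
      using mem[OF h] mem[of 0] x y by (simp add: \<phi>_def z_def Um.U_0 Un.U_0 S0.U_0[unfolded One_nat_def])
    ultimately show ?thesis by simp
  qed
  show ?thesis
    unfolding \<beta>_def[symmetric] \<beta>0_def[symmetric]
  proof (rule tendstoI)
    fix e :: real assume e: "e > 0"
    obtain \<delta> where \<delta>: "\<delta> > 0" and bd: "\<And>x y s r. x \<in> X n \<Longrightarrow> y \<in> X 1 \<Longrightarrow> norm (x - x0) < \<delta> \<Longrightarrow> norm (y - y0) < \<delta> \<Longrightarrow>
        s \<in> {0..\<delta>} \<Longrightarrow> r \<in> {0..\<delta>} \<Longrightarrow> norm (U m r (\<beta> (U n s x) (semigroup0 S s y)) - \<beta>0) \<le> e / 2"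
      using unif[of "e / 2"] e by (metis half_gt_zero)
    \<comment> \<open>For fixed \<open>h\<close> the estimate is passed to the limit along
      approximants from the domain; only afterwards is \<open>h\<close> sent to 0.\<close>
    obtain xs where xs: "\<And>k. xs k \<in> kin_dom n" "xs \<longlonglongrightarrow> x0"
      using kin_dom_dense[OF n x0] by (auto simp: closure_sequential)
    obtain ys where ys: "\<And>k. ys k \<in> dom0 S" "ys \<longlonglongrightarrow> y0"
      using dom0_dense[OF y0] by (auto simp: closure_sequential)
    have xsX: "xs k \<in> X n" and ysX: "ys k \<in> X 1" for k
      using xs(1) ys(1) kin_dom_subset[OF n1] dom0_X by auto
    have "\<forall>\<^sub>F h in at_right (0::real). 0 < h \<and> h < \<delta>"
      using \<delta> eventually_at_right_real[of 0 \<delta>] by (auto elim: eventually_mono)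
    then show "\<forall>\<^sub>F h in at_right 0. dist ((\<Phi> (U n h x0) (semigroup0 S h y0) - U m h (\<Phi> x0 y0)) /\<^sub>R h) \<beta>0 < e"
    proof eventually_elim
      case (elim h)
      then have h: "h \<ge> 0" "h > 0" "h < \<delta>" by auto
      have "(\<lambda>k. norm (\<Phi> (U n h (xs k)) (semigroup0 S h (ys k)) - U m h (\<Phi> (xs k) (ys k)) - h *\<^sub>R \<beta>0)) \<longlonglongrightarrow>
          norm (\<Phi> (U n h x0) (semigroup0 S h y0) - U m h (\<Phi> x0 y0) - h *\<^sub>R \<beta>0)"
        by (intro tendsto_intros free_compatible_tendsto[OF \<Phi>] bcl_tendsto[OF Um.bcl_U[OF h(1)] Um.csub]
            bcl_tendsto[OF Un.bcl_U[OF h(1)] Un.csub] bcl_tendsto[OF S0.bcl_U[OF h(1)] S0.csub] xs ys always_eventually allI conjI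
            Un.U_mem S0.U_mem h xsX ysX x0 y0 \<Phi>X)
      moreover have "\<forall>\<^sub>F k in sequentially. norm (\<Phi> (U n h (xs k)) (semigroup0 S h (ys k)) - U m h (\<Phi> (xs k) (ys k)) - h *\<^sub>R \<beta>0) \<le> e / 2 * h"
      proof -
        have "\<forall>\<^sub>F k in sequentially. dist (xs k) x0 < \<delta>" "\<forall>\<^sub>F k in sequentially. dist (ys k) y0 < \<delta>"
          using tendstoD[OF xs(2) \<delta>] tendstoD[OF ys(2) \<delta>] by auto
        then show ?thesis
        proof eventually_elim
          case (elim k)
          show ?case
            using elim h e by (intro step xs ys bd[OF xsX ysX]) (auto simp: dist_norm)
        qed
      qed
      ultimately have "norm (\<Phi> (U n h x0) (semigroup0 S h y0) - U m h (\<Phi> x0 y0) - h *\<^sub>R \<beta>0) \<le> e / 2 * h"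
        by (rule tendsto_upperbound) simp
      moreover have "(\<Phi> (U n h x0) (semigroup0 S h y0) - U m h (\<Phi> x0 y0)) /\<^sub>R h - \<beta>0 =
          inverse h *\<^sub>R (\<Phi> (U n h x0) (semigroup0 S h y0) - U m h (\<Phi> x0 y0) - h *\<^sub>R \<beta>0)"
        using h by (simp add: scaleR_diff_right)
      ultimately have "norm ((\<Phi> (U n h x0) (semigroup0 S h y0) - U m h (\<Phi> x0 y0)) /\<^sub>R h - \<beta>0) \<le> e / 2"
        using h by (simp only: norm_scaleR abs_inverse abs_of_pos divide_inverse_commute[symmetric] pos_divide_le_eq)
      then show ?case using e by (simp add: dist_norm)
    qed
  qed
qed

end

section \<open>The evolution of the marginals\<close>

locale mean_field_evolution = mean_field_system S
  for S :: "('h::complex_hilbert, 'f::complex_hilbert, 'b::complex_banach) mean_field_data" +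
  fixes FN F :: "real \<Rightarrow> 'b"
  assumes state: "state S (npart S) (FN 0)" and particle: "particle_solution S (FN 0) FN"
    and F0: "F 0 \<in> pos_cone S 1" "norm (F 0) = 1" and mean_field: "mean_field_solution S (F 0) F"
begin

lemma N1: "N \<in> {1..N}"
  using npart_ge_1 by simp

interpretation UN: contraction_semigroup_on "X N" "U N"
  by (rule semigroup_on[OF N1])

interpretation S0: contraction_semigroup_on "X 1" "semigroup0 S"
  by (rule semigroup0_on)

lemma FN0_X: "FN 0 \<in> X N"
  using state pos_cone_X by (auto simp: state_def)

lemma FN_orbit:
  assumes t: "t \<ge> 0" shows "FN t = U N t (FN 0)"
proof -
  have "particle_solution S (FN 0) (\<lambda>t. U N t (FN 0))"
    unfolding particle_solution_def mild_solution_def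
    using UN.U_cont[OF FN0_X] UN.U_mem[OF _ FN0_X] UN.orbit_integral[OF FN0_X] generator_U[OF N1] by auto
  moreover obtain f where f: "\<forall>g. particle_solution S (FN 0) g \<longrightarrow> (\<forall>t\<ge>0. g t = f t)"
    using particle_solution_unique[OF FN0_X] by blast
  ultimately have "U N t (FN 0) = f t" using t by blast
  then show ?thesis using f particle t by simp
qed

lemma FN_X: "t \<ge> 0 \<Longrightarrow> FN t \<in> X N"
  by (subst FN_orbit) (auto intro: UN.U_mem FN0_X)

lemma FN_add:
  assumes "t \<ge> 0" "h \<ge> 0" shows "FN (t + h) = U N h (FN t)"
proof -
  have "FN (t + h) = U N (h + t) (FN 0)"
    using FN_orbit[of "t + h"] assms by (simp only: add.commute add_nonneg_nonneg)
  also have "\<dots> = U N h (U N t (FN 0))" by (rule UN.U_add[OF assms(2,1) FN0_X])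
  also have "U N t (FN 0) = FN t" by (rule FN_orbit[OF assms(1), symmetric])
  finally show ?thesis .
qed

lemma FN_cont: "continuous_on {0..} FN"
  by (rule continuous_on_eq[OF UN.U_cont[OF FN0_X]]) (rule FN_orbit[symmetric], simp)

lemma FN_norm: "t \<ge> 0 \<Longrightarrow> norm (FN t) = 1"
  by (subst FN_orbit) (use semigroup_isometric[OF _ FN0_X] state in \<open>auto simp: state_def\<close>)

lemma FN_ell:
  assumes t: "t \<ge> 0" shows "ell S N (FN t) = 1"
proof -
  have "U N t (FN 0) \<in> pos_cone S N" using semigroup_positive[OF t] state by (simp add: state_def)
  then have "FN t \<in> pos_cone S N" by (simp only: FN_orbit[OF t])
  then show ?thesis using ell_pos_cone[OF npart_ge_1] FN_norm[OF t] by simp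
qed

lemma F_pos:
  assumes t: "t \<ge> 0" shows "F t \<in> pos_cone S 1 \<and> norm (F t) = 1"
proof -
  obtain f where f: "\<forall>g. mean_field_solution S (F 0) g \<longrightarrow> (\<forall>t\<ge>0. g t = f t)"
    "\<forall>t\<ge>0. f t \<in> pos_cone S 1 \<and> norm (f t) = 1"
    using mean_field_solution_unique[OF F0] by blast
  then have "F t = f t" using mean_field t by blast
  then show ?thesis using f(2) t by simp
qed

lemma F_X: "t \<ge> 0 \<Longrightarrow> F t \<in> X 1"
  using F_pos pos_cone_X by blast

lemma F_norm: "t \<ge> 0 \<Longrightarrow> norm (F t) = 1"
  using F_pos by blast

lemma F_ell: "t \<ge> 0 \<Longrightarrow> ell S 1 (F t) = 1"
  using ell_pos_cone[of 1 "F t"] F_pos by simp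

lemma F_cont: "continuous_on {0..} F"
  using mean_field by (simp add: mean_field_solution_def)

definition q :: "real \<Rightarrow> 'b" where "q t = mf_op S (F t) (F t)"

lemma q_X: "t \<ge> 0 \<Longrightarrow> q t \<in> X 1"
  using bcl_mem[OF marg_linear[of 2] bcl_mem[OF pot_bounded tens_11_X[OF F_X F_X]]]
  by (simp add: q_def mf_op_def)

lemma q_cont: "continuous_on {0..} q"
proof -
  have mem: "tens S 1 1 (F t) (F t) \<in> X 2" if "t \<ge> 0" for t
    using that by (intro tens_11_X F_X)
  have cs: "csub (X 2)" by (rule csub_X) simp
  have "continuous_on {0..} (\<lambda>t. (F t, F t))" by (intro continuous_intros F_cont)
  from continuous_on_compose2[OF tens_continuous[OF order_refl order_refl] this]
  have 1: "continuous_on {0..} (\<lambda>t. tens S 1 1 (F t) (F t))"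
    using F_X by (simp add: image_subset_iff)
  have 2: "continuous_on {0..} (\<lambda>t. pot S (tens S 1 1 (F t) (F t)))"
    by (rule continuous_on_compose2[OF bcl_continuous_on[OF pot_bounded cs] 1])
      (rule image_subsetI, rule mem, simp)
  show ?thesis
    unfolding q_def mf_op_def
    by (rule continuous_on_compose2[OF bcl_continuous_on[OF marg_linear[OF order_refl] cs] 2])
      (rule image_subsetI, rule bcl_mem[OF pot_bounded mem], simp)
qed

text \<open>\<open>F\<close> itself need not be differentiable. Compared with its free evolution,
  the increment is a Duhamel integral over \<open>[t, t + h]\<close>, whose average tends to the
  source \<open>q t\<close>.\<close>

lemma F_increment:
  assumes t: "t \<ge> 0"
  shows "((\<lambda>h. (F (t + h) - semigroup0 S h (F t)) /\<^sub>R h) \<longlongrightarrow> q t) (at_right 0)"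
proof -
  let ?V = "semigroup0 S"
  have Fe: "F t = ?V t (F 0) + integral {0..t} (\<lambda>s. ?V (t - s) (q s))" if "t \<ge> 0" for t
    using mean_field that unfolding mean_field_solution_def q_def by blast
  have F0X: "F 0 \<in> X 1" by (rule F_X) simp
  have c: "continuous_on {a..b} (\<lambda>s. ?V (r - s) (q s))" if "0 \<le> a" "b \<le> r" for a b r
    using that by (intro S0.U_joint_continuous continuous_intros continuous_on_subset[OF q_cont]) (auto intro: q_X[unfolded One_nat_def])
  have "((\<lambda>h. integral {t..t + h} (\<lambda>s. ?V (t + h - s) (q s)) /\<^sub>R h) \<longlongrightarrow> q t) (at_right 0)"
  proof (rule right_average_tendsto)
    show "continuous_on {t..t + h} (\<lambda>s. ?V (t + h - s) (q s))" for h using t by (intro c) auto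
    fix e :: real assume e: "e > 0"
    obtain d1 where d1: "d1 > 0" "\<And>s. s \<ge> 0 \<Longrightarrow> dist s t < d1 \<Longrightarrow> dist (q s) (q t) < e / 2"
      using q_cont t e unfolding continuous_on_iff by (metis atLeast_iff half_gt_zero)
    obtain d2 where d2: "d2 > 0" "\<And>s. s \<ge> 0 \<Longrightarrow> dist s 0 < d2 \<Longrightarrow> dist (?V s (q t)) (?V 0 (q t)) < e / 2"
      using S0.U_cont[OF q_X[OF t]] e unfolding continuous_on_iff by (metis atLeast_iff half_gt_zero order_refl)
    have "\<forall>\<^sub>F h in at_right (0::real). 0 < h \<and> h < min d1 d2"
      using d1 d2 eventually_at_right_real[of 0 "min d1 d2"] by (auto elim: eventually_mono)
    then show "\<forall>\<^sub>F h in at_right 0. \<forall>s\<in>{t..t + h}. norm (?V (t + h - s) (q s) - q t) \<le> e"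
    proof eventually_elim
      case (elim h)
      show ?case
      proof
      fix s assume "s \<in> {t..t + h}"
      then have s: "s \<ge> 0" "t + h - s \<ge> 0" "dist s t < d1" "dist (t + h - s) 0 < d2"
        using t elim by (auto simp: dist_real_def)
      have "norm (?V (t + h - s) (q s) - ?V (t + h - s) (q t)) \<le> norm (q s - q t)"
        using S0.contraction[OF s(2) csub_diff[OF S0.csub q_X[OF s(1)] q_X[OF t]]]
          bcl_diff[OF S0.bcl_U[OF s(2)] S0.csub q_X[OF s(1)] q_X[OF t]] by simp
      moreover have "norm (q s - q t) < e / 2" using d1(2)[OF s(1,3)] by (simp add: dist_norm)
      moreover have "norm (?V (t + h - s) (q t) - q t) < e / 2"
        using d2(2)[OF s(2,4)] S0.U_0[OF q_X[OF t]] by (simp add: dist_norm)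
      ultimately show "norm (?V (t + h - s) (q s) - q t) \<le> e"
        using norm_triangle_ineq[of "?V (t + h - s) (q s) - ?V (t + h - s) (q t)" "?V (t + h - s) (q t) - q t"] by simp
      qed
    qed
  qed
  moreover have "\<forall>\<^sub>F h in at_right (0::real). integral {t..t + h} (\<lambda>s. ?V (t + h - s) (q s)) /\<^sub>R h =
      (F (t + h) - ?V h (F t)) /\<^sub>R h"
  proof (rule eventually_at_rightI0)
    fix h :: real assume h: "h > 0"
    then have h0: "h \<ge> 0" by simp
    have mem: "?V (t - s) (q s) \<in> X 1" if "s \<in> {0..t}" for s using that by (intro S0.U_mem q_X) auto
    note I = bcl_integral[OF S0.bcl_U[OF h0] S0.csub S0.closed c[OF order_refl order_refl] mem t]
    have "?V h (F t) = ?V h (?V t (F 0)) + ?V h (integral {0..t} (\<lambda>s. ?V (t - s) (q s)))"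
      unfolding Fe[OF t] by (rule bcl_add[OF S0.bcl_U[OF h0] S0.U_mem[OF t F0X] I(1)])
    also have "?V h (?V t (F 0)) = ?V (t + h) (F 0)"
      using S0.U_add[OF h0 t F0X] by (simp add: add.commute)
    also have "?V h (integral {0..t} (\<lambda>s. ?V (t - s) (q s))) = integral {0..t} (\<lambda>s. ?V (t + h - s) (q s))"
    proof -
      have "?V h (?V (t - s) (q s)) = ?V (t + h - s) (q s)" if "s \<in> {0..t}" for s
        using S0.U_add[OF h0 _ q_X, of "t - s" s] that by (simp add: algebra_simps)
      then have "integral {0..t} (\<lambda>s. ?V h (?V (t - s) (q s))) = integral {0..t} (\<lambda>s. ?V (t + h - s) (q s))"
        by (rule Henstock_Kurzweil_Integration.integral_cong)
      then show ?thesis using I(2) by (rule trans[rotated])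
    qed
    finally have 1: "?V h (F t) = ?V (t + h) (F 0) + integral {0..t} (\<lambda>s. ?V (t + h - s) (q s))" .
    have "integral {0..t} (\<lambda>s. ?V (t + h - s) (q s)) + integral {t..t + h} (\<lambda>s. ?V (t + h - s) (q s)) =
        integral {0..t + h} (\<lambda>s. ?V (t + h - s) (q s))"
      using t h by (intro Henstock_Kurzweil_Integration.integral_combine integrable_continuous_real c) auto
    then have "integral {t..t + h} (\<lambda>s. ?V (t + h - s) (q s)) = F (t + h) - ?V h (F t)"
      unfolding 1 using Fe[of "t + h"] t h by (simp add: algebra_simps)
    then show "integral {t..t + h} (\<lambda>s. ?V (t + h - s) (q s)) /\<^sub>R h = (F (t + h) - ?V h (F t)) /\<^sub>R h"
      by simp
  qed
  ultimately show ?thesis by (rule Lim_transform_eventually)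
qed

abbreviation v :: real where "v \<equiv> pot_norm S"

lemma v_nonneg: "v \<ge> 0"
proof -
  have 0: "0 \<in> X 2" by (intro csub_zero csub_X) simp
  obtain C where C: "C \<ge> 0" "\<And>x. x \<in> X 2 \<Longrightarrow> norm (pot S x) \<le> C * norm x" using bcl_bound[OF pot_bounded] by blast
  have "bdd_above {norm (pot S x) |x. x \<in> X 2 \<and> norm x \<le> 1}"
    by (intro bdd_aboveI[of _ C]) (auto intro: order_trans[OF C(2)] mult_left_le C(1))
  then have "norm (pot S 0) \<le> v"
    unfolding pot_norm_def op_norm_on_def using 0 by (intro cSup_upper) auto
  then show ?thesis using norm_ge_zero order_trans by blast
qed

lemma norm_T:
  assumes i: "1 \<le> i" "i < r" "r \<le> n" and x: "x \<in> X n" shows "norm (T n i r x) \<le> v * norm x"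
proof -
  have "norm (T n i r x) \<le> op_norm_on (X n) (T n i r) * norm x"
    by (rule op_norm_on_bound[OF bcl_T[OF i] csub_X x]) (use i in simp)
  also have "\<dots> \<le> v * norm x" using pair_op_bounded[OF i] by (intro mult_right_mono) auto
  finally show ?thesis .
qed

section \<open>Preservation of permutation symmetry\<close>

definition pairs :: "nat \<Rightarrow> (nat \<times> nat) set" where
  "pairs n = {(i, r). 1 \<le> i \<and> i < r \<and> r \<le> n}"

lemma pairs_subset: "pairs n \<subseteq> {1..n} \<times> {1..n}"
  by (auto simp: pairs_def)

lemma finite_pairs: "finite (pairs n)"
  using pairs_subset by (rule finite_subset) simp

lemma card_pairs: "card (pairs n) \<le> n * n"
  using card_mono[OF _ pairs_subset[of n]] by simp

lemma pair_sum_pairs: "pair_sum S n x = (\<Sum>(i, r)\<in>pairs n. T n i r x)"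
  by (simp add: pair_sum_def pairs_def)

text \<open>The action of a transposition on unordered pairs, represented in increasing order
  because \<open>T\<close> is defined for increasing slots only.\<close>

definition sort_swp :: "nat \<Rightarrow> nat \<Rightarrow> nat \<times> nat \<Rightarrow> nat \<times> nat" where
  "sort_swp k s = (\<lambda>(i, r). if swp k s i < swp k s r then (swp k s i, swp k s r) else (swp k s r, swp k s i))"

lemma sort_swp_pairs:
  assumes "k \<in> {1..n}" "s \<in> {1..n}" "p \<in> pairs n"
  shows "sort_swp k s p \<in> pairs n" "sort_swp k s (sort_swp k s p) = p"
  using assms by (auto simp: pairs_def sort_swp_def swp_def split: if_splits)

text \<open>When the transposition reverses the order of the two slots, a further flip of the target
  slots restores it, so that \<open>T_comm\<close> applies to the composition.\<close>

lemma T_reverse: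
  assumes i: "1 \<le> i" "i < r" "r \<le> n" and k: "k \<in> {1..n}" and s: "s \<in> {1..n}"
    and lt: "swp k s r < swp k s i" and x: "x \<in> X n"
  shows "swap_conj S n (swp k s r) (swp k s i) (swap_conj S n k s (T n i r x)) =
    T n (swp k s r) (swp k s i) (swap_conj S n (swp k s r) (swp k s i) (swap_conj S n k s x))"
proof -
  let ?i = "swp k s r" and ?r = "swp k s i"
  have i': "1 \<le> ?i" "?r \<le> n" and m: "?i \<in> {1..n}" "?r \<in> {1..n}" using i k s by (auto simp: swp_def)
  let ?\<pi> = "\<lambda>p. swp k s (swp ?i ?r p)"
  show ?thesis
  proof (rule T_comm[OF bcl_compose[OF bcl_swap[OF k s] bcl_swap[OF m]] i i'(1) lt i'(2) _ x])
    fix a assume a: "fam a"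
    have "swap_conj S n ?i ?r (swap_conj S n k s (ptens S (a(i := b1, r := b2)) n)) =
        1 *\<^sub>C ptens S ((\<lambda>p. a (?\<pi> p))(?i := b1, ?r := b2)) n"
      if b: "b1 \<in> X 1" "b2 \<in> X 1" for b1 b2
    proof -
      have inj: "?\<pi> p = i \<longleftrightarrow> p = ?i" "?\<pi> p = r \<longleftrightarrow> p = ?r" for p
        by (auto simp: swp_def split: if_splits)
      have "(\<lambda>p. (a(i := b1, r := b2)) (?\<pi> p)) = (\<lambda>p. a (?\<pi> p))(?i := b1, ?r := b2)"
        by (rule ext) (simp only: fun_upd_apply inj)
      moreover have "fam (\<lambda>p. (a(i := b1, r := b2)) (swp k s p))" using a b by simp
      ultimately show ?thesis
        unfolding swap_ptens[OF fam_upd[OF fam_upd[OF a b(1)] b(2)] k s]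
        by (subst swap_ptens[OF _ m]) simp_all
    qed
    then show "\<exists>c a'. fam a' \<and> (\<forall>b1\<in>X 1. \<forall>b2\<in>X 1.
        swap_conj S n ?i ?r (swap_conj S n k s (ptens S (a(i := b1, r := b2)) n)) = c *\<^sub>C ptens S (a'(?i := b1, ?r := b2)) n)"
      using a by (intro exI[of _ 1] exI[of _ "\<lambda>p. a (?\<pi> p)"]) simp
  qed
qed

lemma swap_swap:
  assumes k: "k \<in> {1..n}" and s: "s \<in> {1..n}" and x: "x \<in> X n"
  shows "swap_conj S n k s (swap_conj S n k s x) = x"
proof -
  have n: "n \<ge> 1" using k by auto
  note b = bcl_swap[OF k s]
  show ?thesis
  proof (rule bcl_ext[OF n bcl_compose[OF b b] bcl_id _ x])
    fix a assume a: "fam a"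
    have "fam (\<lambda>i. a (swp k s i))" using a by simp
    from swap_ptens[OF this k s] show "swap_conj S n k s (swap_conj S n k s (ptens S a n)) = ptens S a n"
      unfolding swap_ptens[OF a k s] by simp
  qed
qed

text \<open>All transpositions are summed up because the commutator estimate for one of them
  involves the defects of others; only the total satisfies a closed inequality.\<close>

definition asymmetry :: "nat \<Rightarrow> 'b \<Rightarrow> real" where
  "asymmetry n x = (\<Sum>(k, s)\<in>{1..n} \<times> {1..n}. norm (x - swap_conj S n k s x))"

lemma asymmetry_ge: "k \<in> {1..n} \<Longrightarrow> s \<in> {1..n} \<Longrightarrow> norm (x - swap_conj S n k s x) \<le> asymmetry n x"
  unfolding asymmetry_def
  by (rule order_trans[OF _ member_le_sum[of "(k, s)"]]) (auto simp: case_prod_beta)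

lemma asymmetry_nonneg: "asymmetry n x \<ge> 0"
  unfolding asymmetry_def by (intro sum_nonneg) auto

text \<open>For pairs whose order is kept the terms match exactly. For reversed pairs an extra flip
  remains around the interaction; \<open>T_symmetric\<close> controls it up to the failure of
  \<open>x\<close> to be symmetric.\<close>

lemma commutator_swap:
  assumes k: "k \<in> {1..n}" and s: "s \<in> {1..n}" and x: "x \<in> X n"
  shows "norm (swap_conj S n k s (pair_sum S n x) - pair_sum S n (swap_conj S n k s x)) \<le> real (n * n) * (v * (3 * asymmetry n x))"
proof -
  have n: "n \<ge> 1" using k by auto
  define z where "z = swap_conj S n k s x"
  note \<sigma> = bcl_swap[OF k s]
  have z: "z \<in> X n" unfolding z_def by (rule bcl_mem[OF \<sigma> x])
  have TX: "T n i r x \<in> X n" if "(i, r) \<in> pairs n" "x \<in> X n" for i r x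
    using that bcl_mem[OF bcl_T] by (auto simp: pairs_def)
  have "swap_conj S n k s (pair_sum S n x) = (\<Sum>p\<in>pairs n. swap_conj S n k s (T n (fst p) (snd p) x))"
    unfolding pair_sum_pairs case_prod_beta using TX x by (intro bcl_sum[OF \<sigma>] csub_X n) auto
  moreover have "pair_sum S n z = (\<Sum>p\<in>pairs n. T n (fst (sort_swp k s p)) (snd (sort_swp k s p)) z)"
    unfolding pair_sum_pairs case_prod_beta
    by (rule sum.reindex_bij_witness[of _ "sort_swp k s" "sort_swp k s"]) (use sort_swp_pairs[OF k s] in auto)
  ultimately have "norm (swap_conj S n k s (pair_sum S n x) - pair_sum S n z) =
      norm (\<Sum>p\<in>pairs n. swap_conj S n k s (T n (fst p) (snd p) x) - T n (fst (sort_swp k s p)) (snd (sort_swp k s p)) z)"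
    by (simp add: sum_subtractf)
  also have "\<dots> \<le> (\<Sum>p\<in>pairs n. v * (3 * asymmetry n x))"
  proof (rule order_trans[OF norm_sum], rule sum_mono)
    fix p assume p: "p \<in> pairs n"
    obtain i r where pi: "p = (i, r)" by fastforce
    have i: "1 \<le> i" "i < r" "r \<le> n" using p pi by (auto simp: pairs_def)
    show "norm (swap_conj S n k s (T n (fst p) (snd p) x) - T n (fst (sort_swp k s p)) (snd (sort_swp k s p)) z) \<le> v * (3 * asymmetry n x)"
    proof (cases "swp k s i < swp k s r")
      case True
      then have "swap_conj S n k s (T n i r x) = T n (swp k s i) (swp k s r) z"
        unfolding z_def by (intro T_swap i k s x)
      then show ?thesis using True pi v_nonneg asymmetry_nonneg[of n x] by (simp add: sort_swp_def)
    next
      case False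
      have "swp k s i \<noteq> swp k s r" using i by (metis swp_swp nat_neq_iff)
      then have lt: "swp k s r < swp k s i" using False by simp
      let ?i = "swp k s r" and ?r = "swp k s i"
      have i': "1 \<le> ?i" "?i < ?r" "?r \<le> n" and m: "?i \<in> {1..n}" "?r \<in> {1..n}" using i k s lt by (auto simp: swp_def)
      note \<tau> = bcl_swap[OF m] and \<tau>n = norm_swap[OF m]
      define \<tau> where "\<tau> = swap_conj S n ?i ?r"
      define T' where "T' = T n ?i ?r"
      have \<tau>b: "bounded_clinear_on (X n) (X n) \<tau>" and T'b: "bounded_clinear_on (X n) (X n) T'"
        unfolding \<tau>_def T'_def by (rule bcl_swap[OF m], rule bcl_T[OF i'])
      note X = csub_X[OF n] bcl_mem[OF \<tau>b] bcl_mem[OF T'b]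
      have \<sigma>T: "swap_conj S n k s (T n i r x) = \<tau> (T' (\<tau> z))"
      proof -
        have "\<tau> (swap_conj S n k s (T n i r x)) = T' (\<tau> z)"
          unfolding \<tau>_def T'_def z_def by (rule T_reverse[OF i k s lt x])
        then show ?thesis
          using swap_swap[OF m bcl_mem[OF \<sigma> bcl_mem[OF bcl_T[OF i] x]]] unfolding \<tau>_def by simp
      qed
      have \<tau>z: "\<tau> z \<in> X n" by (intro X z)
      have "\<tau> (T' (z + \<tau> z)) = T' (z + \<tau> z)"
        unfolding \<tau>_def T'_def by (rule T_symmetric[OF i' z])
      then have sym: "\<tau> (T' z) + \<tau> (T' (\<tau> z)) = T' z + T' (\<tau> z)"
        unfolding bcl_add[OF T'b z \<tau>z] bcl_add[OF \<tau>b X(3)[OF z] X(3)[OF \<tau>z]] .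
      define w where "w = z - \<tau> z"
      have w: "w \<in> X n" unfolding w_def by (intro csub_diff X z)
      define D where "D = \<tau> (T' (\<tau> z)) - T' z"
      \<comment> \<open>The symmetrised identity \<open>sym\<close> expresses the difference caused
        by the flip solely through the antisymmetric part \<open>w\<close>.\<close>
      have "2 *\<^sub>R D = - (\<tau> (T' w) + T' w)"
        unfolding D_def w_def bcl_diff[OF T'b X(1) z \<tau>z] bcl_diff[OF \<tau>b X(1) X(3)[OF z] X(3)[OF \<tau>z]] scaleR_2
        using sym by (simp add: algebra_simps)
      then have "2 * norm D = norm (\<tau> (T' w) + T' w)" by (metis norm_minus_cancel norm_scaleR abs_numeral)
      also have "\<dots> \<le> norm (T' w) + norm (T' w)"
        using norm_triangle_ineq[of "\<tau> (T' w)" "T' w"] \<tau>n[OF X(3)[OF w]] by (simp add: \<tau>_def)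
      also have "\<dots> \<le> 2 * (v * norm w)" using norm_T[OF i' w] by (simp add: T'_def)
      finally have D: "norm D \<le> v * norm w" by simp
      \<comment> \<open>Comparing \<open>z\<close> and its flip with \<open>x\<close> and its flip
        gives three defects of \<open>x\<close>, hence the factor 3.\<close>
      have "w = (z - x) + (x - \<tau> x) + \<tau> (x - z)"
        unfolding w_def bcl_diff[OF \<tau>b X(1) x z] by simp
      then have "norm w \<le> norm (z - x) + norm (x - \<tau> x) + norm (\<tau> (x - z))"
        using norm_triangle_ineq[of "(z - x) + (x - \<tau> x)" "\<tau> (x - z)"] norm_triangle_ineq[of "z - x" "x - \<tau> x"] by simp
      also have "norm (\<tau> (x - z)) = norm (x - z)" unfolding \<tau>_def by (intro \<tau>n csub_diff X x z)
      also have "norm (z - x) = norm (x - z)" by (rule norm_minus_commute)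
      also have "norm (x - z) \<le> asymmetry n x" unfolding z_def by (rule asymmetry_ge[OF k s])
      also have "norm (x - \<tau> x) \<le> asymmetry n x" unfolding \<tau>_def by (rule asymmetry_ge[OF m])
      finally have "norm w \<le> 3 * asymmetry n x"
        using asymmetry_ge[OF k s, of x] by (simp add: z_def)
      then have "norm D \<le> v * (3 * asymmetry n x)" using D v_nonneg by (meson mult_left_mono order_trans)
      then show ?thesis using False pi by (simp add: sort_swp_def D_def \<sigma>T T'_def)
    qed
  qed
  also have "\<dots> \<le> real (n * n) * (v * (3 * asymmetry n x))"
    using card_pairs[of n] v_nonneg asymmetry_nonneg[of n x] by (simp add: mult_right_mono del: of_nat_mult)
  finally show ?thesis by (simp add: z_def)
qed

text \<open>The defect of each transposition is driven by a commutator that is itself bounded by the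
  total defect, which starts at zero; Gronwall keeps it zero.\<close>

lemma FN_symmetric:
  assumes "t \<ge> 0" shows "symmetric S N (FN t)"
proof -
  \<comment> \<open>One factor \<open>N * N\<close> counts the transpositions, the other bounds the
    number of interacting pairs; the factor \<open>1/N\<close> of the generator is estimated by
    1.\<close>
  define c where "c = 3 * real (N * N) * real (N * N) * v"
  have c: "c \<ge> 0" using v_nonneg by (simp add: c_def)
  have term_dini: "\<forall>\<^sub>F h in at_right 0. norm (FN (t + h) - swap_conj S N k s (FN (t + h))) \<le>
      norm (FN t - swap_conj S N k s (FN t)) + h * (real (N * N) * (v * (3 * asymmetry N (FN t))) + e)"
    if k: "k \<in> {1..N}" and s: "s \<in> {1..N}" and t: "t \<ge> 0" and e: "e > 0" for k s t e
  proof -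
    let ?\<sigma> = "swap_conj S N k s" and ?x = "FN t"
    note \<sigma> = bcl_swap[OF k s] and x = FN_X[OF t]
    have \<sigma>x: "?\<sigma> ?x \<in> X N" by (rule bcl_mem[OF \<sigma> x])
    have fc: "free_compatible N N (\<lambda>x y. ?\<sigma> x)"
      by (rule free_compatible_const[OF npart_ge_1 \<sigma> kin_swap[OF k s]])
    let ?d = "(?\<sigma> (pair_sum S N ?x) - pair_sum S N (?\<sigma> ?x)) /\<^sub>R real N"
    have "((\<lambda>h. (?\<sigma> (U N h ?x) - U N h (?\<sigma> ?x)) /\<^sub>R h) \<longlongrightarrow> ?d) (at_right 0)"
      by (rule intertwining[OF fc N1 N1 x F_X[OF t]])
    then have "\<forall>\<^sub>F h in at_right 0. dist ((?\<sigma> (U N h ?x) - U N h (?\<sigma> ?x)) /\<^sub>R h) ?d < e"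
      using e by (rule tendstoD)
    moreover have "\<forall>\<^sub>F h in at_right (0::real). h > 0" by (rule eventually_at_right_less)
    ultimately show ?thesis
    proof eventually_elim
      case (elim h)
      define w where "w = (?\<sigma> (U N h ?x) - U N h (?\<sigma> ?x)) /\<^sub>R h"
      have h0: "h \<ge> 0" using elim by simp
      have "norm ?d \<le> norm (?\<sigma> (pair_sum S N ?x) - pair_sum S N (?\<sigma> ?x))"
        using npart_ge_1 by (simp add: mult_left_le_one_le inverse_le_1_iff)
      also have "\<dots> \<le> real (N * N) * (v * (3 * asymmetry N ?x))" by (rule commutator_swap[OF k s x])
      finally have "norm w \<le> real (N * N) * (v * (3 * asymmetry N ?x)) + e"
        using elim norm_triangle_ineq2[of w ?d] by (simp add: w_def dist_norm)
      moreover have eq: "FN (t + h) - ?\<sigma> (FN (t + h)) = U N h (?x - ?\<sigma> ?x) - h *\<^sub>R w"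
        unfolding FN_add[OF t h0] w_def bcl_diff[OF UN.bcl_U[OF h0] UN.csub x \<sigma>x] using elim by simp
      moreover have "norm (U N h (?x - ?\<sigma> ?x)) \<le> norm (?x - ?\<sigma> ?x)"
        by (rule UN.contraction[OF h0 csub_diff[OF UN.csub x \<sigma>x]])
      moreover have "norm (h *\<^sub>R w) = h * norm w" using h0 by simp
      moreover have "h * norm w \<le> h * (real (N * N) * (v * (3 * asymmetry N ?x)) + e)"
        using calculation(1) h0 by (rule mult_left_mono)
      ultimately show ?case
        unfolding eq using norm_triangle_ineq4[of "U N h (?x - ?\<sigma> ?x)" "h *\<^sub>R w"] by linarith
    qed
  qed
  have "asymmetry N (FN t) \<le> 0"
  proof (rule gronwall_dini[of t "\<lambda>t. asymmetry N (FN t)" c])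
    show "continuous_on {0..t} (\<lambda>t. asymmetry N (FN t))"
      unfolding asymmetry_def case_prod_beta
      by (intro continuous_intros continuous_on_compose2[OF bcl_continuous_on[OF bcl_swap csub_X]] continuous_on_subset[OF FN_cont])
        (use npart_ge_1 in \<open>auto intro: FN_X\<close>)
    have "asymmetry N (FN 0) = 0"
      unfolding asymmetry_def using state by (intro sum.neutral) (auto simp: state_def symmetric_def)
    then show "asymmetry N (FN 0) \<le> 0" by simp
    fix r e :: real assume r: "0 \<le> r" and e: "e > 0"
    define e' where "e' = e / real (N * N)"
    have e': "e' > 0" using e npart_ge_1 by (simp add: e'_def)
    have "\<forall>\<^sub>F h in at_right 0. \<forall>p\<in>{1..N} \<times> {1..N}. norm (FN (r + h) - swap_conj S N (fst p) (snd p) (FN (r + h))) \<le>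
      norm (FN r - swap_conj S N (fst p) (snd p) (FN r)) + h * (real (N * N) * (v * (3 * asymmetry N (FN r))) + e')"
      using term_dini[OF _ _ r e'] by (intro eventually_ball_finite) auto
    then show "\<forall>\<^sub>F h in at_right 0. asymmetry N (FN (r + h)) \<le> asymmetry N (FN r) + h * (c * asymmetry N (FN r) + e)"
    proof eventually_elim
      case (elim h)
      have "asymmetry N (FN (r + h)) \<le> (\<Sum>p\<in>{1..N} \<times> {1..N}. norm (FN r - swap_conj S N (fst p) (snd p) (FN r)) +
          h * (real (N * N) * (v * (3 * asymmetry N (FN r))) + e'))"
        unfolding asymmetry_def[of N "FN (r + h)"] case_prod_beta using elim by (intro sum_mono) auto
      also have "\<dots> = asymmetry N (FN r) + real (N * N) * (h * (real (N * N) * (v * (3 * asymmetry N (FN r))) + e'))"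
        by (simp add: sum.distrib asymmetry_def case_prod_beta)
      also have "real (N * N) * (h * (real (N * N) * (v * (3 * asymmetry N (FN r))) + e')) = h * (c * asymmetry N (FN r) + real (N * N) * e')"
        by (simp add: c_def algebra_simps)
      also have "real (N * N) * e' = e" using npart_ge_1 by (simp add: e'_def)
      finally show ?case .
    qed
  qed (use c assms in auto)
  then have "norm (FN t - swap_conj S N k s (FN t)) \<le> 0" if "k \<in> {1..N}" "s \<in> {1..N}" for k s
    using asymmetry_ge[OF that, of "FN t"] by linarith
  then have "swap_conj S N k s (FN t) = FN t" if "k \<in> {1..N}" "s \<in> {1..N}" for k s
    using that by (metis norm_le_zero_iff right_minus_eq)
  then show ?thesis by (simp add: symmetric_def)
qed

end

section \<open>The hierarchy of inequalities for the correlation errors\<close>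

context mean_field_system
begin

lemma kin_marginal:
  assumes j: "1 \<le> j" "j \<le> n" and xg: "(x, g) \<in> kin_graph S n"
  shows "(marginal S j n x, marginal S j n g) \<in> kin_graph S j"
  using j(2) xg
proof (induction n arbitrary: x g rule: dec_induct)
  case (step n)
  then show ?case using kin_marg[of "Suc n" x g] step.IH j(1) by simp
qed simp

lemma free_compatible_marginal_proj:
  assumes j: "1 \<le> j" "j \<le> n" and J: "J \<subseteq> {1..j}"
  shows "free_compatible n j (\<lambda>x y. proj S j y J (marginal S j n x))"
  using j by (intro free_compatible_proj bcl_marginal kin_marginal J) auto

lemma proj_tendsto:
  assumes m: "m \<ge> 1" and J: "J \<subseteq> {1..m}" and u: "(u \<longlongrightarrow> x) F" and w: "(w \<longlongrightarrow> y) F"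
    and mem: "\<forall>\<^sub>F h in F. u h \<in> X m \<and> w h \<in> X 1" and x: "x \<in> X m" and y: "y \<in> X 1"
  shows "((\<lambda>h. proj S m (w h) J (u h)) \<longlongrightarrow> proj S m y J x) F"
  using free_compatible_tendsto[OF free_compatible_marginal_proj[OF m order_refl J] u w mem x y] by simp

text \<open>The Leibniz rule for the product of \<open>1 - R_l\<close> in the inserted element. Two
  nearby curves are compared instead of one being differentiated: only the deviation of
  \<open>F\<close> from its free evolution has a right derivative.\<close>

lemma proj_derivative:
  assumes m: "m \<ge> 1" and J: "J \<subseteq> {1..m}"
    and u: "(u \<longlongrightarrow> x) (at_right 0)" and w: "(w \<longlongrightarrow> y) (at_right 0)" and w': "(w' \<longlongrightarrow> y) (at_right 0)"
    and d: "((\<lambda>h. (w h - w' h) /\<^sub>R h) \<longlongrightarrow> z) (at_right 0)"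
    and mem: "\<And>h. h > 0 \<Longrightarrow> u h \<in> X m" "\<And>h. h > 0 \<Longrightarrow> w h \<in> X 1" "\<And>h. h > 0 \<Longrightarrow> w' h \<in> X 1"
    and x: "x \<in> X m" and y: "y \<in> X 1" and z: "z \<in> X 1"
  shows "((\<lambda>h. (proj S m (w h) J (u h) - proj S m (w' h) J (u h)) /\<^sub>R h) \<longlongrightarrow>
    - (\<Sum>l\<in>J. repl S m l z (proj S m y (J - {l}) x))) (at_right 0)"
  using J
proof (induction J rule: subset_Icc_induct)
  case empty
  show ?case by simp
next
  case (insert l J)
  note l = insert.hyps(1) and J = insert.hyps(2) and lJ = insert.hyps(3)
  have fJ: "finite J" using finite_subset[OF J] by simp
  define a where "a h = proj S m (w h) J (u h)" for h
  define a' where "a' h = proj S m (w' h) J (u h)" for h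
  define p where "p h = (a h - a' h) /\<^sub>R h" for h
  define r where "r h = (w h - w' h) /\<^sub>R h" for h
  define e where "e = - (\<Sum>l\<in>J. repl S m l z (proj S m y (J - {l}) x))"
  have aX: "a h \<in> X m" "a' h \<in> X m" if "h > 0" for h
    unfolding a_def a'_def by (intro proj_X m J mem that)+
  have pX: "p h \<in> X m" and rX: "r h \<in> X 1" if "h > 0" for h
    unfolding p_def r_def by (intro csub_scaleR csub_diff csub_X m order_refl aX mem that)+
  have sub: "J - {k} \<subseteq> {1..m}" for k using J by auto
  have PX: "proj S m y J x \<in> X m" "proj S m y (J - {k}) x \<in> X m" for k
    by (intro proj_X m y J x sub)+
  have eX: "e \<in> X m"
    unfolding e_def using csub_diff[OF csub_X[OF m] csub_zero[OF csub_X[OF m]] csub_sum[OF csub_X[OF m]], of J]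
      repl_X[OF _ z] J by (auto simp: subset_iff)
  have pe: "(p \<longlongrightarrow> e) (at_right 0)"
    unfolding p_def a_def a'_def e_def by (rule insert.IH)
  have a'lim: "(a' \<longlongrightarrow> proj S m y J x) (at_right 0)"
    unfolding a'_def by (rule proj_tendsto[OF m J u w' eventually_at_rightI0 x y]) (use mem in auto)
  have "((\<lambda>h. p h - (repl S m l (w h) (p h) + repl S m l (r h) (a' h))) \<longlongrightarrow>
      e - (repl S m l y e + repl S m l z (proj S m y J x))) (at_right 0)"
    by (intro tendsto_diff tendsto_add repl_tendsto[OF l] pe w a'lim d[folded r_def] eventually_at_rightI0 conjI
        mem pX rX aX y z eX PX)
  moreover have "\<forall>\<^sub>F h in at_right (0::real). p h - (repl S m l (w h) (p h) + repl S m l (r h) (a' h)) =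
      (proj S m (w h) (insert l J) (u h) - proj S m (w' h) (insert l J) (u h)) /\<^sub>R h"
  proof (rule eventually_at_rightI0)
    fix h :: real assume h: "h > 0"
    note Rw = bcl_repl[OF l mem(2)[OF h]] and Ra = bcl_repl_arg[OF l aX(2)[OF h]]
    have "repl S m l (w h) (p h) = (repl S m l (w h) (a h) - repl S m l (w h) (a' h)) /\<^sub>R h"
      unfolding p_def bcl_scaleR[OF Rw csub_diff[OF csub_X[OF m] aX[OF h]]] bcl_diff[OF Rw csub_X[OF m] aX[OF h]] ..
    moreover have "repl S m l (r h) (a' h) = (repl S m l (w h) (a' h) - repl S m l (w' h) (a' h)) /\<^sub>R h"
      unfolding r_def bcl_scaleR[OF Ra csub_diff[OF csub_X[OF order_refl] mem(2,3)[OF h]]]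
        bcl_diff[OF Ra csub_X[OF order_refl] mem(2,3)[OF h]] ..
    ultimately show "p h - (repl S m l (w h) (p h) + repl S m l (r h) (a' h)) =
        (proj S m (w h) (insert l J) (u h) - proj S m (w' h) (insert l J) (u h)) /\<^sub>R h"
      unfolding proj_insert[OF m mem(2)[OF h] l J lJ] proj_insert[OF m mem(3)[OF h] l J lJ]
      by (simp add: p_def a_def a'_def scaleR_diff_right)
  qed
  ultimately have "((\<lambda>h. (proj S m (w h) (insert l J) (u h) - proj S m (w' h) (insert l J) (u h)) /\<^sub>R h) \<longlongrightarrow>
      e - (repl S m l y e + repl S m l z (proj S m y J x))) (at_right 0)"
    by (rule Lim_transform_eventually)
  moreover have "e - (repl S m l y e + repl S m l z (proj S m y J x)) =
      - (\<Sum>k\<in>insert l J. repl S m k z (proj S m y (insert l J - {k}) x))"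
  proof -
    note R = bcl_repl[OF l y]
    have RX: "repl S m k z (proj S m y (J - {k}) x) \<in> X m" if "k \<in> J" for k using that J by (intro repl_X z) auto
    have "repl S m k z (proj S m y (insert l J - {k}) x) =
        repl S m k z (proj S m y (J - {k}) x) - repl S m l y (repl S m k z (proj S m y (J - {k}) x))" if k: "k \<in> J" for k
    proof -
      have km: "k \<in> {1..m}" and kl: "l \<noteq> k" using k J lJ by auto
      have "insert l J - {k} = insert l (J - {k})" using kl by auto
      then have "proj S m y (insert l J - {k}) x = proj S m y (J - {k}) x - repl S m l y (proj S m y (J - {k}) x)"
        using proj_insert[OF m y l sub, of k x] lJ by simp
      then show ?thesis
        using bcl_diff[OF bcl_repl[OF km z] csub_X[OF m] PX(2) repl_X[OF l y]] repl_comm[OF l km kl y z] by simp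
    qed
    then have 1: "(\<Sum>k\<in>J. repl S m k z (proj S m y (insert l J - {k}) x)) =
        (\<Sum>k\<in>J. repl S m k z (proj S m y (J - {k}) x)) - (\<Sum>k\<in>J. repl S m l y (repl S m k z (proj S m y (J - {k}) x)))"
      by (simp add: sum_subtractf)
    have 2: "repl S m l y e = - (\<Sum>k\<in>J. repl S m l y (repl S m k z (proj S m y (J - {k}) x)))"
    proof -
      have "repl S m l y (\<Sum>k\<in>J. repl S m k z (proj S m y (J - {k}) x)) = (\<Sum>k\<in>J. repl S m l y (repl S m k z (proj S m y (J - {k}) x)))"
        by (intro bcl_sum[OF R] csub_X m RX)
      moreover have "repl S m l y e = - repl S m l y (\<Sum>k\<in>J. repl S m k z (proj S m y (J - {k}) x))"
        unfolding e_def using bcl_diff[OF R csub_X[OF m] csub_zero[OF csub_X[OF m]] csub_sum[OF csub_X[OF m] RX], of J]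
          bcl_zero[OF R csub_X[OF m]] by simp
      ultimately show ?thesis by simp
    qed
    have "insert l J - {l} = J" using lJ by auto
    then show ?thesis unfolding 2 using 1 fJ lJ by (simp add: e_def)
  qed
  ultimately show ?case by simp
qed

lemma proj_union:
  assumes n: "n \<ge> 1" and y: "y \<in> X 1" and I: "I \<subseteq> {1..n}" and J: "J \<subseteq> {1..n}" "I \<inter> J = {}"
  shows "proj S n y I (proj S n y J x) = proj S n y (I \<union> J) x"
proof -
  have "I \<inter> J = {} \<longrightarrow> proj S n y I (proj S n y J x) = proj S n y (I \<union> J) x"
    using I
  proof (induction I rule: subset_Icc_induct)
    case (insert l I)
    show ?case
    proof
      assume d: "insert l I \<inter> J = {}"
      then have u: "I \<union> J \<subseteq> {1..n}" "l \<notin> I \<union> J" "I \<inter> J = {}" using insert.hyps J by auto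
      then show "proj S n y (insert l I) (proj S n y J x) = proj S n y (insert l I \<union> J) x"
        using proj_insert[OF n y insert.hyps(1) u(1,2)] proj_insert[OF n y insert.hyps(1-3)] insert.IH by simp
    qed
  qed simp
  then show ?thesis using J by simp
qed

lemma T_marginal:
  assumes i: "1 \<le> i" "i < r" "r \<le> j" "j \<le> n" and x: "x \<in> X n"
  shows "marginal S j n (T n i r x) = T j i r (marginal S j n x)"
  using i(4) x
proof (induction n arbitrary: x rule: dec_induct)
  case (step n)
  have n2: "Suc n \<ge> 2" using i step by simp
  have "marg S (Suc n) (T (Suc n) i r x) = T n i r (marg S (Suc n) x)"
    using T_marg[of i r "Suc n" x] i step by simp
  then show ?case using step bcl_mem[OF marg_linear[OF n2]] by simp
qed simp

text \<open>Traced-out particles may be relabelled, so interactions with any of them can be moved to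
  particle \<open>j + 1\<close>.\<close>

lemma marginal_swap_tail:
  assumes j: "1 \<le> j" "j \<le> n" and k: "k \<in> {j+1..n}" and s: "s \<in> {j+1..n}" and x: "x \<in> X n"
  shows "marginal S j n (swap_conj S n k s x) = marginal S j n x"
proof -
  have ks: "k \<in> {1..n}" "s \<in> {1..n}" and n: "1 \<le> n" using j k s by auto
  note m = bcl_marginal[OF j]
  show ?thesis
  proof (rule bcl_ext[OF n bcl_compose[OF bcl_swap[OF ks] m] m _ x])
    fix a assume a: "fam a"
    have fs: "fam (\<lambda>i. a (swp k s i))" using a by simp
    have "(\<Prod>i=j+1..n. ell S 1 (a (swp k s i))) = (\<Prod>i=j+1..n. ell S 1 (a i))"
      by (rule prod.reindex_bij_witness[of _ "swp k s" "swp k s"]) (use k s in \<open>auto simp: swp_def\<close>)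
    moreover have "ptens S (\<lambda>i. a (swp k s i)) j = ptens S a j"
      by (rule ptens_cong) (use k s in \<open>auto simp: swp_def\<close>)
    ultimately show "marginal S j n (swap_conj S n k s (ptens S a n)) = marginal S j n (ptens S a n)"
      unfolding swap_ptens[OF a ks] marginal_ptens[OF j a] marginal_ptens[OF j fs] by simp
  qed
qed

end

context mean_field_evolution
begin

interpretation UN: contraction_semigroup_on "X N" "U N"
  by (rule semigroup_on[OF N1])

interpretation S0: contraction_semigroup_on "X 1" "semigroup0 S"
  by (rule semigroup0_on)

abbreviation Fm :: "nat \<Rightarrow> real \<Rightarrow> 'b" where "Fm j t \<equiv> marginal S j N (FN t)"

lemma Fm_X: "1 \<le> j \<Longrightarrow> j \<le> N \<Longrightarrow> t \<ge> 0 \<Longrightarrow> Fm j t \<in> X j"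
  by (rule bcl_mem[OF bcl_marginal FN_X])

lemma Fm_norm: "1 \<le> j \<Longrightarrow> j \<le> N \<Longrightarrow> t \<ge> 0 \<Longrightarrow> norm (Fm j t) \<le> 1"
  using norm_marginal_le[OF _ _ FN_X] FN_norm by fastforce

lemma Fm_Suc: "1 \<le> j \<Longrightarrow> Suc j \<le> N \<Longrightarrow> marg S (Suc j) (Fm (Suc j) t) = Fm j t"
  by (rule marginal_Suc_self)

definition E :: "nat \<Rightarrow> real \<Rightarrow> 'b" where
  "E j t = proj S j (F t) {1..j} (Fm j t)"

text \<open>Order 0 counts as 1, which bounds the term with \<open>F\<close> in every slot. The
  convention also covers truncated subtraction: for \<open>j = 1\<close> both
  \<open>err (j - 1)\<close> and \<open>err (j - 2)\<close> are \<open>err 0\<close>.\<close>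

definition err :: "nat \<Rightarrow> real \<Rightarrow> real" where
  "err j t = (if j = 0 then 1 else norm (E j t))"

lemma err_0 [simp]: "err 0 t = 1"
  by (simp add: err_def)

lemma err_nonneg: "err j t \<ge> 0"
  by (simp add: err_def)

lemma corr_error_E: "1 \<le> j \<Longrightarrow> j \<le> N \<Longrightarrow> t \<ge> 0 \<Longrightarrow> corr_error S j (FN t) (F t) = E j t"
  unfolding E_def by (intro corr_error_eq_proj F_X FN_X FN_symmetric FN_ell)

lemma err_le:
  assumes "j \<le> N" "t \<ge> 0" shows "err j t \<le> 2 ^ j"
proof (cases "j = 0")
  case False
  then have j: "1 \<le> j" by simp
  have "norm (E j t) \<le> 2 ^ card {1..j} * norm (Fm j t)"
    unfolding E_def using j assms by (intro norm_proj F_X F_norm Fm_X order_refl) auto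
  also have "\<dots> \<le> 2 ^ card {1..j} * 1"
    using Fm_norm[OF j assms] by (intro mult_left_mono) auto
  finally show ?thesis using False by (simp add: err_def)
qed simp

lemma err_cont:
  assumes "j \<le> N" shows "continuous_on {0..} (err j)"
proof (cases "j = 0")
  case False
  then have j: "1 \<le> j" by simp
  have "continuous_on {0..} (\<lambda>t. (FN t, F t))" by (intro continuous_intros FN_cont F_cont)
  from continuous_on_compose2[OF free_compatible_cont[OF free_compatible_marginal_proj[OF j assms order_refl]] this]
  have "continuous_on {0..} (\<lambda>t. norm (E j t))"
    unfolding E_def using FN_X F_X by (intro continuous_on_norm) (simp add: image_subset_iff)
  then show ?thesis using False by (simp add: err_def[abs_def])
qed (simp add: err_def[abs_def])

lemma norm_repls_proj_err:
  assumes t: "t \<ge> 0" and n: "1 \<le> n" "n \<le> N" and K: "K \<subseteq> {1..n}"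
  shows "norm (repls S n (F t) K (proj S n (F t) ({1..n} - K) (Fm n t))) \<le> err (n - card K) t"
proof (cases "K = {1..n}")
  case True
  have "norm (repls S n (F t) {1..n} (Fm n t)) \<le> norm (Fm n t)"
    using t n by (intro norm_repls F_X F_norm Fm_X order_refl)
  then show ?thesis using True Fm_norm[OF n t] by simp
next
  case False
  let ?J = "{1..n} - K"
  have J: "?J \<subseteq> {1..n}" "?J \<noteq> {}" and K': "{1..n} - ?J = K" using K False by auto
  have card: "card ?J = n - card K" using K by (subst card_Diff_subset) (auto intro: finite_subset)
  have "card ?J \<noteq> 0" using J(2) by auto
  then show ?thesis
    using norm_repls_proj[OF F_X[OF t] F_norm[OF t] FN_X[OF t] FN_symmetric[OF t] J n(2)]
    unfolding K' card by (simp add: err_def E_def)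
qed

text \<open>Only the slots in \<open>I\<close> are resolved; in the others the product is already
  present, so each summand carries the full product outside \<open>K\<close>.\<close>

lemma partial_resolution:
  assumes t: "t \<ge> 0" and n: "1 \<le> n" "n \<le> N" and I: "I \<subseteq> {1..n}"
  shows "proj S n (F t) ({1..n} - I) (Fm n t) =
    (\<Sum>K\<in>Pow I. repls S n (F t) K (proj S n (F t) ({1..n} - K) (Fm n t)))"
proof -
  let ?w = "proj S n (F t) ({1..n} - I) (Fm n t)"
  have w: "?w \<in> X n" by (intro proj_X n F_X t Fm_X) auto
  have "?w = (\<Sum>K\<in>Pow I. repls S n (F t) K (proj S n (F t) (I - K) ?w))"
    by (rule proj_resolution[OF n(1) F_X[OF t] I w])
  also have "\<dots> = (\<Sum>K\<in>Pow I. repls S n (F t) K (proj S n (F t) ({1..n} - K) (Fm n t)))"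
  proof (intro sum.cong refl)
    fix K assume K: "K \<in> Pow I"
    then have "(I - K) \<union> ({1..n} - I) = {1..n} - K" using I by auto
    moreover have "proj S n (F t) (I - K) ?w = proj S n (F t) ((I - K) \<union> ({1..n} - I)) (Fm n t)"
      using I by (intro proj_union n F_X t) auto
    ultimately show "repls S n (F t) K (proj S n (F t) (I - K) ?w) = repls S n (F t) K (proj S n (F t) ({1..n} - K) (Fm n t))"
      by simp
  qed
  finally show ?thesis .
qed

lemma Pow_pair_sum:
  assumes "i \<noteq> r"
  shows "(\<Sum>K\<in>Pow {i, r}. f K) = f {} + f {i} + f {r} + (f {i, r} :: 'z::comm_monoid_add)"
proof -
  have "Pow {i, r} = {{}, {i}, {r}, {i, r}}" by (auto simp: Pow_insert)
  then show ?thesis using assms by (simp add: add.assoc)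
qed

text \<open>An interaction leaves two slots unprojected, and resolving these gives four terms. The
  lowest order comes from \<open>F\<close> in both slots; the second estimate removes it, which is
  the gain behind the cancellation of the \<open>O(1)\<close> collision terms.\<close>

lemma norm_proj_pair:
  assumes t: "t \<ge> 0" and n: "1 \<le> n" "n \<le> N" and i: "i \<in> {1..n}" "r \<in> {1..n}" "i \<noteq> r"
  defines "w \<equiv> proj S n (F t) ({1..n} - {i, r}) (Fm n t)"
  shows "norm w \<le> err n t + 2 * err (n - 1) t + err (n - 2) t"
    and "norm (w - repl S n i (F t) (repl S n r (F t) w)) \<le> err n t + 2 * err (n - 1) t"
proof -
  have I: "{i, r} \<subseteq> {1..n}" using i by auto
  let ?f = "\<lambda>K. repls S n (F t) K (proj S n (F t) ({1..n} - K) (Fm n t))"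
  have w: "w = ?f {} + ?f {i} + ?f {r} + ?f {i, r}"
    unfolding w_def using partial_resolution[OF t n I] Pow_pair_sum[OF i(3), of ?f] by (rule trans)
  have b: "norm (?f {}) \<le> err n t" "norm (?f {i}) \<le> err (n - 1) t" "norm (?f {r}) \<le> err (n - 1) t"
    "norm (?f {i, r}) \<le> err (n - 2) t"
    using norm_repls_proj_err[OF t n, of "{}"] norm_repls_proj_err[OF t n, of "{i}"]
      norm_repls_proj_err[OF t n, of "{r}"] norm_repls_proj_err[OF t n I] i by (auto simp: numeral_2_eq_2)
  have 3: "norm (?f {} + ?f {i} + ?f {r}) \<le> err n t + 2 * err (n - 1) t"
    using norm_triangle_ineq[of "?f {} + ?f {i}" "?f {r}"] norm_triangle_ineq[of "?f {}" "?f {i}"] b by linarith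
  show "norm w \<le> err n t + 2 * err (n - 1) t + err (n - 2) t"
    unfolding w using norm_triangle_ineq[of "?f {} + ?f {i} + ?f {r}" "?f {i, r}"] 3 b(4) by linarith
  have "?f {i, r} = repl S n i (F t) (repl S n r (F t) w)"
    using repls_insert[OF n(1) F_X[OF t] i(1), of "{r}"] repls_insert[OF n(1) F_X[OF t] i(2), of "{}"] i
    by (simp add: w_def)
  then have "w - repl S n i (F t) (repl S n r (F t) w) = ?f {} + ?f {i} + ?f {r}"
    by (simp add: w)
  then show "norm (w - repl S n i (F t) (repl S n r (F t) w)) \<le> err n t + 2 * err (n - 1) t"
    using 3 by simp
qed

text \<open>In the resolution over all slots the term with \<open>F\<close> everywhere is the
  chaotic state; the others are grouped by the number of slots not filled with
  \<open>F\<close>.\<close>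

lemma chaos_le_sum_err:
  assumes t: "t \<ge> 0" and n: "1 \<le> n" "n \<le> N"
  shows "norm (Fm n t - tpower S (F t) n) \<le> (\<Sum>k=1..n. real (n choose k) * err k t)"
proof -
  let ?f = "\<lambda>K. repls S n (F t) K (proj S n (F t) ({1..n} - K) (Fm n t))"
  have "Fm n t = (\<Sum>K\<in>Pow {1..n}. ?f K)"
    using partial_resolution[OF t n order_refl] by simp
  also have "\<dots> = ?f {1..n} + (\<Sum>K\<in>Pow {1..n} - {{1..n}}. ?f K)"
    by (rule sum.remove) auto
  also have "?f {1..n} = tpower S (F t) n"
    using repls_all[OF n(1) F_X[OF t] Fm_X[OF n t]] ell_marginal[OF n FN_X[OF t]] FN_ell[OF t] by simp
  finally have eq: "Fm n t = tpower S (F t) n + (\<Sum>K\<in>Pow {1..n} - {{1..n}}. ?f K)" .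
  have "Fm n t - tpower S (F t) n = (\<Sum>K\<in>Pow {1..n} - {{1..n}}. ?f K)"
    by (rule iffD2[OF diff_eq_eq, OF trans[OF eq add.commute]])
  then have "norm (Fm n t - tpower S (F t) n) \<le> (\<Sum>K\<in>Pow {1..n} - {{1..n}}. norm (?f K))"
    using norm_sum[of ?f "Pow {1..n} - {{1..n}}"] by (simp only:)
  also have "\<dots> \<le> (\<Sum>K\<in>Pow {1..n} - {{1..n}}. err (n - card K) t)"
    by (intro sum_mono norm_repls_proj_err t n) auto
  also have "\<dots> = (\<Sum>J\<in>Pow {1..n} - {{}}. err (card J) t)"
    by (rule sum.reindex_bij_witness[of _ "\<lambda>J. {1..n} - J" "\<lambda>K. {1..n} - K"])
      (auto simp: double_diff card_Diff_subset finite_subset)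
  also have "\<dots> = (\<Sum>k=1..n. \<Sum>J\<in>{J \<in> Pow {1..n} - {{}}. card J = k}. err (card J) t)"
  proof (rule sum.group[symmetric])
    show "card ` (Pow {1..n} - {{}}) \<subseteq> {1..n}"
    proof
      fix k assume "k \<in> card ` (Pow {1..n} - {{}})"
      then obtain J where J: "J \<subseteq> {1..n}" "J \<noteq> {}" "k = card J" by auto
      have "finite J" using J(1) finite_subset by blast
      then have "card J \<noteq> 0" using J(2) by simp
      moreover have "card J \<le> n" using card_mono[OF _ J(1)] by simp
      ultimately show "k \<in> {1..n}" using J(3) by auto
    qed
  qed auto
  also have "\<dots> = (\<Sum>k=1..n. real (n choose k) * err k t)"
  proof (intro sum.cong refl)
    fix k assume k: "k \<in> {1..n}"
    then have "{J \<in> Pow {1..n} - {{}}. card J = k} = {J. J \<subseteq> {1..n} \<and> card J = k}" by auto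
    then show "(\<Sum>J\<in>{J \<in> Pow {1..n} - {{}}. card J = k}. err (card J) t) = real (n choose k) * err k t"
      using n_subsets[of "{1..n}" k] by simp
  qed
  finally show ?thesis .
qed

text \<open>The first line is the effect of the bounded interaction once \<open>U j\<close> has been
  split off; the sum is the response of the product to the mean field source in each inserted
  \<open>F\<close>.\<close>

definition drift :: "nat \<Rightarrow> real \<Rightarrow> 'b" where
  "drift j t = (proj S j (F t) {1..j} (marginal S j N (pair_sum S N (FN t))) - pair_sum S j (E j t)) /\<^sub>R real N -
     (\<Sum>l=1..j. repl S j l (q t) (proj S j (F t) ({1..j} - {l}) (Fm j t)))"

text \<open>The freely evolved \<open>F\<close> serves as intermediate point. Replacing
  \<open>E_j\<close> by it is an instance of \<open>intertwining\<close>, and passing from it to the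
  true \<open>F(t + h)\<close> is an instance of \<open>proj_derivative\<close>.\<close>

lemma E_increment:
  assumes t: "t \<ge> 0" and j: "1 \<le> j" "j \<le> N"
  shows "((\<lambda>h. (E j (t + h) - U j h (E j t)) /\<^sub>R h) \<longlongrightarrow> drift j t) (at_right 0)"
proof -
  have jN: "j \<in> {1..N}" using j by simp
  let ?\<Phi> = "\<lambda>x y. proj S j y {1..j} (marginal S j N x)"
  note fc = free_compatible_marginal_proj[OF j order_refl]
  note m = bcl_marginal[OF j]
  have A: "((\<lambda>h. (?\<Phi> (U N h (FN t)) (semigroup0 S h (F t)) - U j h (E j t)) /\<^sub>R h) \<longlongrightarrow>
      (?\<Phi> (pair_sum S N (FN t)) (F t) - pair_sum S j (E j t)) /\<^sub>R real N) (at_right 0)"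
    using intertwining[OF fc N1 jN FN_X[OF t] F_X[OF t]] by (simp add: E_def)
  have Vlim: "((\<lambda>h. semigroup0 S h (F t)) \<longlongrightarrow> F t) (at_right 0)"
  proof -
    have "((\<lambda>h. semigroup0 S h (F t)) \<longlongrightarrow> semigroup0 S 0 (F t)) (at_right 0)"
      by (rule continuous_on_tendsto_compose[OF S0.U_cont[OF F_X[OF t]]]) (auto intro: eventually_at_rightI0)
    then show ?thesis by (simp only: S0.U_0[OF F_X[OF t]])
  qed
  have Flim: "((\<lambda>h. F (t + h)) \<longlongrightarrow> F t) (at_right 0)"
    by (rule continuous_on_tendsto_compose[OF F_cont]) (use t in \<open>auto intro!: eventually_at_rightI0 tendsto_eq_intros\<close>)
  have FNlim: "((\<lambda>h. Fm j (t + h)) \<longlongrightarrow> Fm j t) (at_right 0)"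
  proof (rule bcl_tendsto[OF m UN.csub])
    show "((\<lambda>h. FN (t + h)) \<longlongrightarrow> FN t) (at_right 0)"
      by (rule continuous_on_tendsto_compose[OF FN_cont]) (use t in \<open>auto intro!: eventually_at_rightI0 tendsto_eq_intros\<close>)
    show "\<forall>\<^sub>F h in at_right 0. FN (t + h) \<in> X N"
      by (rule eventually_at_rightI0, rule FN_X) (use t in simp)
  qed (rule FN_X[OF t])
  have B: "((\<lambda>h. (proj S j (F (t + h)) {1..j} (Fm j (t + h)) - proj S j (semigroup0 S h (F t)) {1..j} (Fm j (t + h))) /\<^sub>R h) \<longlongrightarrow>
      - (\<Sum>l\<in>{1..j}. repl S j l (q t) (proj S j (F t) ({1..j} - {l}) (Fm j t)))) (at_right 0)"
    by (rule proj_derivative[OF j(1) order_refl FNlim Flim Vlim F_increment[OF t]])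
      (use t in \<open>intro Fm_X F_X S0.U_mem q_X j; simp\<close>)+
  have "((\<lambda>h. (?\<Phi> (U N h (FN t)) (semigroup0 S h (F t)) - U j h (E j t)) /\<^sub>R h +
      (proj S j (F (t + h)) {1..j} (Fm j (t + h)) - proj S j (semigroup0 S h (F t)) {1..j} (Fm j (t + h))) /\<^sub>R h) \<longlongrightarrow>
      (?\<Phi> (pair_sum S N (FN t)) (F t) - pair_sum S j (E j t)) /\<^sub>R real N +
      - (\<Sum>l\<in>{1..j}. repl S j l (q t) (proj S j (F t) ({1..j} - {l}) (Fm j t)))) (at_right 0)"
    by (rule tendsto_add[OF A B])
  then have "((\<lambda>h. (?\<Phi> (U N h (FN t)) (semigroup0 S h (F t)) - U j h (E j t)) /\<^sub>R h +
      (proj S j (F (t + h)) {1..j} (Fm j (t + h)) - proj S j (semigroup0 S h (F t)) {1..j} (Fm j (t + h))) /\<^sub>R h) \<longlongrightarrow>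
      drift j t) (at_right 0)"
    by (simp add: drift_def)
  moreover have "\<forall>\<^sub>F h in at_right (0::real). (?\<Phi> (U N h (FN t)) (semigroup0 S h (F t)) - U j h (E j t)) /\<^sub>R h +
      (proj S j (F (t + h)) {1..j} (Fm j (t + h)) - proj S j (semigroup0 S h (F t)) {1..j} (Fm j (t + h))) /\<^sub>R h =
      (E j (t + h) - U j h (E j t)) /\<^sub>R h"
  proof (rule eventually_at_rightI0)
    fix h :: real assume "h > 0"
    then have "U N h (FN t) = FN (t + h)" using FN_add[OF t, of h] by simp
    then show "(?\<Phi> (U N h (FN t)) (semigroup0 S h (F t)) - U j h (E j t)) /\<^sub>R h +
      (proj S j (F (t + h)) {1..j} (Fm j (t + h)) - proj S j (semigroup0 S h (F t)) {1..j} (Fm j (t + h))) /\<^sub>R h =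
      (E j (t + h) - U j h (E j t)) /\<^sub>R h"
      by (simp add: E_def flip: scaleR_add_right)
  qed
  ultimately show ?thesis by (rule Lim_transform_eventually)
qed

lemma err_dini:
  assumes t: "t \<ge> 0" and j: "1 \<le> j" "j \<le> N" and e: "e > 0"
  shows "\<forall>\<^sub>F h in at_right 0. err j (t + h) \<le> err j t + h * (norm (drift j t) + e)"
proof -
  interpret Uj: contraction_semigroup_on "X j" "U j" by (rule semigroup_on) (use j in simp)
  have EX: "E j t \<in> X j" unfolding E_def by (intro proj_X F_X Fm_X j t order_refl)
  have "\<forall>\<^sub>F h in at_right 0. dist ((E j (t + h) - U j h (E j t)) /\<^sub>R h) (drift j t) < e"
    using E_increment[OF t j] e by (rule tendstoD)
  moreover have "\<forall>\<^sub>F h in at_right (0::real). h > 0" by (rule eventually_at_right_less)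
  ultimately show ?thesis
  proof eventually_elim
    case (elim h)
    define w where "w = (E j (t + h) - U j h (E j t)) /\<^sub>R h"
    have h0: "h \<ge> 0" using elim by simp
    have eq: "E j (t + h) = U j h (E j t) + h *\<^sub>R w" using elim by (simp add: w_def)
    have "norm w \<le> norm (drift j t) + e"
      using elim norm_triangle_ineq2[of w "drift j t"] by (simp add: w_def dist_norm)
    then have "h * norm w \<le> h * (norm (drift j t) + e)" using h0 by (rule mult_left_mono)
    moreover have "norm (h *\<^sub>R w) = h * norm w" using h0 by simp
    moreover have "norm (U j h (E j t)) \<le> norm (E j t)" by (rule Uj.contraction[OF h0 EX])
    ultimately have "norm (E j (t + h)) \<le> norm (E j t) + h * (norm (drift j t) + e)"
      unfolding eq using norm_triangle_ineq[of "U j h (E j t)" "h *\<^sub>R w"] by linarith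
    then show ?case using j by (simp add: err_def)
  qed
qed

text \<open>Pairs of kept particles form \<open>T_j\<close>, pairs of traced-out particles
  contribute nothing, and by symmetry each kept particle meets \<open>N - j\<close> identical
  partners.\<close>

lemma marginal_pair_sum:
  assumes t: "t \<ge> 0" and j: "1 \<le> j" "Suc j \<le> N"
  shows "marginal S j N (pair_sum S N (FN t)) =
    pair_sum S j (Fm j t) + real (N - j) *\<^sub>R (\<Sum>i=1..j. C j i (Fm (Suc j) t))"
proof -
  have jN: "j \<le> N" using j by simp
  let ?x = "FN t"
  note x = FN_X[OF t] and m = bcl_marginal[OF j(1) jN]
  let ?g = "\<lambda>p. marginal S j N (T N (fst p) (snd p) ?x)"
  have TX: "T N (fst p) (snd p) ?x \<in> X N" if "p \<in> pairs N" for p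
    using that bcl_mem[OF bcl_T x] by (auto simp: pairs_def)
  have "marginal S j N (pair_sum S N ?x) = (\<Sum>p\<in>pairs N. ?g p)"
    unfolding pair_sum_pairs case_prod_beta by (rule bcl_sum[OF m UN.csub TX])
  also have "pairs N = pairs j \<union> ({1..j} \<times> {j+1..N} \<union> {(i, r). j < i \<and> i < r \<and> r \<le> N})"
    using jN by (auto simp: pairs_def)
  also have "(\<Sum>p\<in>\<dots>. ?g p) = (\<Sum>p\<in>pairs j. ?g p) + ((\<Sum>p\<in>{1..j} \<times> {j+1..N}. ?g p) +
      (\<Sum>p\<in>{(i, r). j < i \<and> i < r \<and> r \<le> N}. ?g p))"
  proof -
    have fin: "finite {(i, r). j < i \<and> i < r \<and> r \<le> N}"
      by (rule finite_subset[of _ "{..N} \<times> {..N}"]) auto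
    have d: "({1..j} \<times> {j+1..N}) \<inter> {(i, r). j < i \<and> i < r \<and> r \<le> N} = {}"
      "pairs j \<inter> ({1..j} \<times> {j+1..N} \<union> {(i, r). j < i \<and> i < r \<and> r \<le> N}) = {}"
      by (auto simp: pairs_def)
    show ?thesis
      using sum.union_disjoint[OF finite_pairs _ d(2), of ?g] sum.union_disjoint[OF _ fin d(1), of ?g] fin by simp
  qed
  also have "(\<Sum>p\<in>pairs j. ?g p) = pair_sum S j (Fm j t)"
    unfolding pair_sum_pairs case_prod_beta
    by (intro sum.cong refl T_marginal x jN) (auto simp: pairs_def)
  also have "(\<Sum>p\<in>{(i, r). j < i \<and> i < r \<and> r \<le> N}. ?g p) = 0"
    by (intro sum.neutral ballI) (auto intro!: marginal_pair_op j x)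
  also have "(\<Sum>p\<in>{1..j} \<times> {j+1..N}. ?g p) = (\<Sum>i=1..j. \<Sum>r=j+1..N. C j i (Fm (Suc j) t))"
  proof -
    \<comment> \<open>Symmetry of the state lets the partner \<open>r\<close> be renamed to
      \<open>j + 1\<close>; the renaming involves only traced-out slots and keeps the order of the
      pair.\<close>
    have H: "marginal S j N (T N i r ?x) = C j i (Fm (Suc j) t)" if i: "i \<in> {1..j}" and r: "r \<in> {j+1..N}" for i r
    proof -
      have i': "1 \<le> i" "i < Suc j" "Suc j \<le> N" and rm: "r \<in> {1..N}" "Suc j \<in> {1..N}" using i r j by auto
      have sw: "swp r (Suc j) i = i" "swp r (Suc j) (Suc j) = r" using i r by (auto simp: swp_def)
      have "swap_conj S N r (Suc j) (T N i (Suc j) ?x) = T N i r (swap_conj S N r (Suc j) ?x)"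
        using T_swap[OF i' rm _ x] i r by (simp add: sw)
      also have "swap_conj S N r (Suc j) ?x = ?x"
        using FN_symmetric[OF t] rm by (simp add: symmetric_def)
      finally have "marginal S j N (T N i r ?x) = marginal S j N (swap_conj S N r (Suc j) (T N i (Suc j) ?x))"
        by simp
      also have "\<dots> = marginal S j N (T N i (Suc j) ?x)"
        using r j by (intro marginal_swap_tail jN bcl_mem[OF bcl_T[OF i'] x]) auto
      also have "\<dots> = marg S (Suc j) (marginal S (Suc j) N (T N i (Suc j) ?x))"
        using j by (simp add: marginal_Suc_self)
      also have "marginal S (Suc j) N (T N i (Suc j) ?x) = T (Suc j) i (Suc j) (Fm (Suc j) t)"
        using i' by (intro T_marginal x) auto
      finally show ?thesis by (simp add: C_def)
    qed
    have "(\<Sum>p\<in>{1..j} \<times> {j+1..N}. ?g p) = (\<Sum>p\<in>{1..j} \<times> {j+1..N}. C j (fst p) (Fm (Suc j) t))"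
      by (rule sum.cong[OF refl], rule H) auto
    also have "\<dots> = (\<Sum>i=1..j. \<Sum>r=j+1..N. C j i (Fm (Suc j) t))"
      unfolding sum.cartesian_product case_prod_beta ..
    finally show ?thesis .
  qed
  also have "(\<Sum>i=1..j. \<Sum>r=j+1..N. C j i (Fm (Suc j) t)) = real (N - j) *\<^sub>R (\<Sum>i=1..j. C j i (Fm (Suc j) t))"
    by (simp add: scaleR_sum_right sum_constant_scaleR)
  finally show ?thesis by simp
qed

text \<open>The factors in slots other than \<open>i\<close> and \<open>r\<close> commute with the
  interaction. The two remaining ones cost a factor 4 on the three errors from
  \<open>norm_proj_pair\<close>, and the interaction acting on \<open>E_j\<close> adds one more
  \<open>err j\<close>: hence 5, 8 and 4.\<close>

lemma norm_proj_T_commutator: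
  assumes t: "t \<ge> 0" and j: "1 \<le> j" "j \<le> N" and p: "(i, r) \<in> pairs j"
  shows "norm (proj S j (F t) {1..j} (T j i r (Fm j t)) - T j i r (E j t)) \<le>
    v * (5 * err j t + 8 * err (j - 1) t + 4 * err (j - 2) t)"
proof -
  have i: "1 \<le> i" "i < r" "r \<le> j" and m: "i \<in> {1..j}" "r \<in> {1..j}" "i \<noteq> r" using p by (auto simp: pairs_def)
  let ?J = "{1..j} - {i, r}" and ?y = "F t"
  note y = F_X[OF t] and y1 = F_norm[OF t] and Fj = Fm_X[OF j t] and Tb = bcl_T[OF i]
  have J: "?J \<subseteq> {1..j}" "r \<notin> ?J" "insert r ?J \<subseteq> {1..j}" "i \<notin> insert r ?J" "insert i (insert r ?J) = {1..j}"
    using m by auto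
  define w where "w = proj S j ?y ?J (Fm j t)"
  have w: "w \<in> X j" unfolding w_def by (intro proj_X j y J Fj)
  have Tw: "T j i r w \<in> X j" by (rule bcl_mem[OF Tb w])
  have "T j i r (proj S j ?y ?J (Fm j t)) = proj S j ?y ((\<lambda>l. l) ` ?J) (T j i r (Fm j t))"
    by (rule proj_comm[OF j(1) y j(1) Tb _ J(1) _ _ Fj]) (use T_repl[OF i _ _ _ y] in auto)
  then have "proj S j ?y ?J (T j i r (Fm j t)) = T j i r w" by (simp add: w_def)
  then have "proj S j ?y {1..j} (T j i r (Fm j t)) = proj S j ?y {i, r} (T j i r w)"
  proof -
    have "{i, r} \<union> ?J = {1..j}" "{i, r} \<subseteq> {1..j}" "{i, r} \<inter> ?J = {}" using m by auto
    then show ?thesis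
      using proj_union[OF j(1) y _ J(1), of "{i, r}" "T j i r (Fm j t)"]
        \<open>proj S j ?y ?J (T j i r (Fm j t)) = T j i r w\<close> by (simp only:)
  qed
  moreover have "norm (proj S j ?y {i, r} (T j i r w)) \<le> 2 ^ card {i, r} * norm (T j i r w)"
    using m by (intro norm_proj j y y1 Tw) auto
  moreover have "card {i, r} = 2" using m by simp
  moreover have "norm (T j i r w) \<le> v * norm w" by (rule norm_T[OF i w])
  ultimately have 1: "norm (proj S j ?y {1..j} (T j i r (Fm j t))) \<le> 4 * (v * norm w)" by simp
  have "E j t \<in> X j" unfolding E_def by (intro proj_X j y order_refl Fj)
  then have 2: "norm (T j i r (E j t)) \<le> v * err j t" using norm_T[OF i] j by (simp add: err_def)
  have "v * norm w \<le> v * (err j t + 2 * err (j - 1) t + err (j - 2) t)"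
    unfolding w_def by (intro mult_left_mono norm_proj_pair t j m v_nonneg)
  then show ?thesis
    using 1 2 norm_triangle_ineq4[of "proj S j ?y {1..j} (T j i r (Fm j t))" "T j i r (E j t)"]
    by (simp add: algebra_simps)
qed

lemma norm_C:
  assumes i: "i \<in> {1..j}" and z: "z \<in> X (Suc j)" shows "norm (C j i z) \<le> v * norm z"
proof -
  have i': "1 \<le> i" "i < Suc j" "Suc j \<le> Suc j" using i by auto
  have "norm (C j i z) \<le> norm (T (Suc j) i (Suc j) z)"
    unfolding C_def using i by (intro norm_marg_le bcl_mem[OF bcl_T[OF i'] z]) auto
  also have "\<dots> \<le> v * norm z" by (rule norm_T[OF i' z])
  finally show ?thesis .
qed

text \<open>The \<open>O(1)\<close> parts of the two terms cancel because \<open>Q(F, F)\<close> arises from \<open>C j i\<close> by inserting \<open>F\<close> in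
  both slots, and \<open>C j i\<close> has trace zero in slot \<open>i\<close>.\<close>

lemma norm_collision_difference:
  assumes t: "t \<ge> 0" and N3: "N \<ge> 3" and j: "1 \<le> j" "Suc j \<le> N" and i: "i \<in> {1..j}"
  shows "norm ((real (N - j) / real N) *\<^sub>R proj S j (F t) {1..j} (C j i (Fm (Suc j) t)) -
      repl S j i (q t) (proj S j (F t) ({1..j} - {i}) (Fm j t))) \<le>
    v * (2 * (err (Suc j) t + 2 * err j t) + real j / real N * err (j - 1) t)"
proof -
  have j': "1 \<le> Suc j" "j \<le> N" using j by auto
  let ?y = "F t" and ?J = "{1..j} - {i}"
  note y = F_X[OF t] and yl = F_ell[OF t]
  note FS = Fm_X[OF j'(1) j(2) t]
  have J: "?J \<subseteq> {1..j}" "i \<notin> ?J" "insert i ?J = {1..j}" "?J \<subseteq> {1..Suc j}" "?J = {1..Suc j} - {i, Suc j}"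
    using i by auto
  have m: "i \<in> {1..Suc j}" "Suc j \<in> {1..Suc j}" "i \<noteq> Suc j" using i by auto
  define w where "w = proj S (Suc j) ?y ?J (Fm (Suc j) t)"
  have w: "w \<in> X (Suc j)" unfolding w_def by (intro proj_X j' y J FS)
  \<comment> \<open>The part of \<open>w\<close> with \<open>F\<close> in both interacting slots,
    that is, its lowest-order component; on it the collision operator reproduces the mean field
    source.\<close>
  define u where "u = repl S (Suc j) i ?y (repl S (Suc j) (Suc j) ?y w)"
  have u: "u \<in> X (Suc j)" unfolding u_def by (intro repl_X m y)
  note Cb = bcl_C[OF i]
  have "C j i (proj S (Suc j) ?y ?J (Fm (Suc j) t)) = proj S j ?y ((\<lambda>l. l) ` ?J) (C j i (Fm (Suc j) t))"
    by (rule proj_comm[OF j'(1) y j(1) Cb _ J(4) _ _ FS]) (use repl_C[OF i _ _ y] in auto)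
  then have "proj S j ?y {1..j} (C j i (Fm (Suc j) t)) = C j i w - repl S j i ?y (C j i w)"
    using proj_insert[OF j(1) y i J(1,2)] J(3) by (simp add: w_def)
  then have 1: "proj S j ?y {1..j} (C j i (Fm (Suc j) t)) = C j i w"
    using repl_C_same[OF N3 i y yl w] by simp
  have "repl S j i (q t) (proj S j ?y ?J (Fm j t)) = repl S j i (q t) (marg S (Suc j) w)"
    unfolding w_def using marg_proj(1)[OF j(1) y J(1) FS] Fm_Suc[OF j] by simp
  also have "\<dots> = C j i u"
    unfolding u_def q_def by (rule repl_mf_op[OF i y yl w, symmetric])
  finally have 2: "repl S j i (q t) (proj S j ?y ?J (Fm j t)) = C j i u" .
  \<comment> \<open>The collision prefactor falls short of 1 by \<open>j/N\<close>. The full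
    collision cancels the source up to \<open>w - u\<close>; the deficit multiplies all of
    \<open>w\<close>, including its lowest order.\<close>
  have frac: "real (N - j) / real N = 1 - real j / real N" using j' N3 by (simp add: of_nat_diff field_simps)
  have "(real (N - j) / real N) *\<^sub>R C j i w - C j i u = C j i (w - u) - (real j / real N) *\<^sub>R C j i w"
    unfolding frac bcl_diff[OF Cb csub_X[OF j'(1)] w u] by (simp add: scaleR_left_diff_distrib)
  then have "norm ((real (N - j) / real N) *\<^sub>R C j i w - C j i u) \<le> norm (C j i (w - u)) + (real j / real N) * norm (C j i w)"
    using norm_triangle_ineq4[of "C j i (w - u)" "(real j / real N) *\<^sub>R C j i w"] by simp
  also have "\<dots> \<le> v * norm (w - u) + (real j / real N) * (v * norm w)"
    using csub_diff[OF csub_X[OF j'(1)] w u] w by (intro add_mono mult_left_mono norm_C i) auto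
  also have "\<dots> = v * (norm (w - u) + real j / real N * norm w)"
    by (simp add: algebra_simps)
  also have "\<dots> \<le> v * ((err (Suc j) t + 2 * err j t) + real j / real N * (err (Suc j) t + 2 * err j t + err (j - 1) t))"
  proof (intro mult_left_mono add_mono v_nonneg)
    note np = norm_proj_pair[OF t j'(1) j(2) m, folded J(5), folded w_def, folded u_def]
    show "norm (w - u) \<le> err (Suc j) t + 2 * err j t" using np(2) by simp
    show "norm w \<le> err (Suc j) t + 2 * err j t + err (j - 1) t" using np(1) by simp
  qed simp
  also have "\<dots> \<le> v * (2 * (err (Suc j) t + 2 * err j t) + real j / real N * err (j - 1) t)"
  proof (rule mult_left_mono[OF _ v_nonneg])
    \<comment> \<open>Here \<open>j/N \<le> 1\<close> is simply dropped. It is kept in front of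
      \<open>err (j - 1)\<close>, where the factor \<open>1/N\<close> is essential.\<close>
    have "real j / real N * (err (Suc j) t + 2 * err j t) \<le> 1 * (err (Suc j) t + 2 * err j t)"
      using j' N3 err_nonneg[of "Suc j" t] err_nonneg[of j t] by (intro mult_right_mono) auto
    then show "err (Suc j) t + 2 * err j t + real j / real N * (err (Suc j) t + 2 * err j t + err (j - 1) t) \<le>
        2 * (err (Suc j) t + 2 * err j t) + real j / real N * err (j - 1) t"
      by (simp add: algebra_simps)
  qed
  finally show ?thesis unfolding 1 2 .
qed

text \<open>At most \<open>j^2\<close> pairs with weights 5, 8, 4 carry the factor
  \<open>1/N\<close>, and \<open>j\<close> collisions contribute 4 times \<open>err j\<close>, twice
  \<open>err (j+1)\<close> and \<open>j/N\<close> times \<open>err (j-1)\<close>. Since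
  \<open>j \<le> N\<close>, the pair contribution \<open>5 j^2/N\<close> is at most
  \<open>5 j\<close>, giving 9, 2, 9 and 4.\<close>

lemma norm_drift:
  assumes t: "t \<ge> 0" and N3: "N \<ge> 3" and j: "1 \<le> j" "Suc j \<le> N"
  shows "norm (drift j t) \<le> v * (9 * real j * err j t + 2 * real j * err (Suc j) t +
    (real j)\<^sup>2 / real N * (9 * err (j - 1) t + 4 * err (j - 2) t))"
proof -
  have jN: "j \<le> N" using j by simp
  let ?y = "F t"
  note y = F_X[OF t] and Fj = Fm_X[OF j(1) jN t] and FS = Fm_X[OF _ j(2) t]
  note P = bcl_proj[OF j(1) y order_refl]
  have CX: "C j i (Fm (Suc j) t) \<in> X j" if "i \<in> {1..j}" for i using bcl_mem[OF bcl_C[OF that] FS] by simp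
  have TX: "T j (fst p) (snd p) z \<in> X j" if "p \<in> pairs j" "z \<in> X j" for p z
    using that bcl_mem[OF bcl_T] by (auto simp: pairs_def)
  let ?A = "\<Sum>p\<in>pairs j. proj S j ?y {1..j} (T j (fst p) (snd p) (Fm j t)) - T j (fst p) (snd p) (E j t)"
  let ?B = "\<lambda>i. (real (N - j) / real N) *\<^sub>R proj S j ?y {1..j} (C j i (Fm (Suc j) t)) -
      repl S j i (q t) (proj S j ?y ({1..j} - {i}) (Fm j t))"
  have sX: "(\<Sum>i=1..j. C j i (Fm (Suc j) t)) \<in> X j" by (intro csub_sum csub_X j CX)
  have pX: "pair_sum S j (Fm j t) \<in> X j" by (rule pair_sum_X[OF j(1) Fj])
  have PS: "proj S j ?y {1..j} (\<Sum>i=1..j. C j i (Fm (Suc j) t)) = (\<Sum>i=1..j. proj S j ?y {1..j} (C j i (Fm (Suc j) t)))"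
    by (rule bcl_sum[OF P csub_X[OF j(1)] CX])
  have PT: "proj S j ?y {1..j} (\<Sum>p\<in>pairs j. T j (fst p) (snd p) (Fm j t)) =
      (\<Sum>p\<in>pairs j. proj S j ?y {1..j} (T j (fst p) (snd p) (Fm j t)))"
    by (rule bcl_sum[OF P csub_X[OF j(1)] TX[OF _ Fj]])
  have M: "proj S j ?y {1..j} (marginal S j N (pair_sum S N (FN t))) =
      proj S j ?y {1..j} (pair_sum S j (Fm j t)) + real (N - j) *\<^sub>R (\<Sum>i=1..j. proj S j ?y {1..j} (C j i (Fm (Suc j) t)))"
    unfolding marginal_pair_sum[OF t j] bcl_add[OF P pX csub_scaleR[OF csub_X[OF j(1)] sX]]
      bcl_scaleR[OF P sX] PS ..
  have A: "proj S j ?y {1..j} (pair_sum S j (Fm j t)) - pair_sum S j (E j t) = ?A"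
    unfolding pair_sum_pairs case_prod_beta PT sum_subtractf ..
  have B: "(\<Sum>i=1..j. ?B i) = (real (N - j) / real N) *\<^sub>R (\<Sum>i=1..j. proj S j ?y {1..j} (C j i (Fm (Suc j) t))) -
      (\<Sum>i=1..j. repl S j i (q t) (proj S j ?y ({1..j} - {i}) (Fm j t)))"
    by (simp add: sum_subtractf scaleR_sum_right)
  have comb: "p = b + c *\<^sub>R s \<Longrightarrow> b - d = a \<Longrightarrow> (p - d) /\<^sub>R n - r = a /\<^sub>R n + ((c / n) *\<^sub>R s - r)"
    for p b s d a r :: 'b and c n :: real
    by (auto simp: scaleR_diff_right scaleR_add_right divide_inverse_commute)
  have "drift j t = ?A /\<^sub>R real N + (\<Sum>i=1..j. ?B i)"
    unfolding drift_def B by (rule comb[OF M A])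
  then have "norm (drift j t) \<le> norm ?A / real N + (\<Sum>i=1..j. norm (?B i))"
    using norm_triangle_ineq[of "?A /\<^sub>R real N" "\<Sum>i=1..j. ?B i"] norm_sum[of ?B "{1..j}"]
    by (simp add: divide_inverse_commute)
  also have "norm ?A \<le> (real j)\<^sup>2 * (v * (5 * err j t + 8 * err (j - 1) t + 4 * err (j - 2) t))"
  proof -
    have nn: "v * (5 * err j t + 8 * err (j - 1) t + 4 * err (j - 2) t) \<ge> 0"
      using v_nonneg err_nonneg by (intro mult_nonneg_nonneg) (auto intro: add_nonneg_nonneg)
    have "norm ?A \<le> (\<Sum>p\<in>pairs j. v * (5 * err j t + 8 * err (j - 1) t + 4 * err (j - 2) t))"
      by (rule order_trans[OF norm_sum], rule sum_mono, rule norm_proj_T_commutator[OF t j(1) jN]) simp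
    also have "\<dots> = real (card (pairs j)) * (v * (5 * err j t + 8 * err (j - 1) t + 4 * err (j - 2) t))" by simp
    also have "\<dots> \<le> real (j * j) * (v * (5 * err j t + 8 * err (j - 1) t + 4 * err (j - 2) t))"
      using card_pairs[of j] by (intro mult_right_mono nn) (simp only: of_nat_le_iff)
    finally show ?thesis by (simp add: power2_eq_square)
  qed
  also have "(\<Sum>i=1..j. norm (?B i)) \<le> (\<Sum>i=1..j. v * (2 * (err (Suc j) t + 2 * err j t) + real j / real N * err (j - 1) t))"
    by (intro sum_mono norm_collision_difference t N3 j)
  also have "\<dots> = real j * (v * (2 * (err (Suc j) t + 2 * err j t) + real j / real N * err (j - 1) t))" by simp
  finally have "norm (drift j t) \<le> (real j)\<^sup>2 * (v * (5 * err j t + 8 * err (j - 1) t + 4 * err (j - 2) t)) / real N +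
      real j * (v * (2 * (err (Suc j) t + 2 * err j t) + real j / real N * err (j - 1) t))"
    using N3 by (simp add: divide_right_mono)
  also have "\<dots> = v * ((real j)\<^sup>2 / real N * (5 * err j t) + 4 * real j * err j t + 2 * real j * err (Suc j) t +
    (real j)\<^sup>2 / real N * (9 * err (j - 1) t + 4 * err (j - 2) t))"
    by (simp add: divide_inverse algebra_simps power2_eq_square)
  also have "\<dots> \<le> v * (9 * real j * err j t + 2 * real j * err (Suc j) t +
    (real j)\<^sup>2 / real N * (9 * err (j - 1) t + 4 * err (j - 2) t))"
  proof (rule mult_left_mono[OF _ v_nonneg])
    have "(real j)\<^sup>2 / real N \<le> real j"
      using jN N3 mult_left_mono[of "real j" "real N" "real j"] by (simp add: divide_le_eq power2_eq_square)
    then have "(real j)\<^sup>2 / real N * (5 * err j t) \<le> real j * (5 * err j t)"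
      using err_nonneg[of j t] by (intro mult_right_mono) auto
    then show "(real j)\<^sup>2 / real N * (5 * err j t) + 4 * real j * err j t + 2 * real j * err (Suc j) t +
        (real j)\<^sup>2 / real N * (9 * err (j - 1) t + 4 * err (j - 2) t) \<le>
        9 * real j * err j t + 2 * real j * err (Suc j) t + (real j)\<^sup>2 / real N * (9 * err (j - 1) t + 4 * err (j - 2) t)"
      by simp
  qed
  finally show ?thesis .
qed

end

section \<open>Propagation of the correlation bounds\<close>

lemma Suc_power_le:
  assumes "1 \<le> j" shows "real (Suc j) ^ Suc j \<le> 6 * (real j * real j ^ j)"
proof -
  have j: "real j > 0" using assms by simp
  have "(1 + 1 / real j) ^ j \<le> exp (1 / real j) ^ j"
    by (intro power_mono) auto
  also have "\<dots> = exp 1" using j by (simp add: exp_of_nat_mult[symmetric])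
  also have "\<dots> \<le> 3" by (rule exp_le)
  finally have "(1 + 1 / real j) ^ j * real j ^ j \<le> 3 * real j ^ j"
    by (intro mult_right_mono) auto
  moreover have "(1 + 1 / real j) ^ j * real j ^ j = real (Suc j) ^ j"
    using j by (simp add: power_mult_distrib[symmetric] field_simps)
  ultimately have "real (Suc j) ^ j \<le> 3 * real j ^ j" by simp
  moreover have "real (Suc j) \<le> 2 * real j" using assms by simp
  ultimately have "real (Suc j) * real (Suc j) ^ j \<le> (2 * real j) * (3 * real j ^ j)"
    by (intro mult_mono) auto
  then show ?thesis by simp
qed

text \<open>The right factor bounds a single term of the exponential series.\<close>

lemma pow_le_exp_fact: "real k ^ k \<le> exp (real k) * fact k"
proof -
  have s: "(\<lambda>n. real k ^ n /\<^sub>R fact n) sums exp (real k)" by (rule exp_converges)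
  have "sum (\<lambda>n. real k ^ n /\<^sub>R fact n) {k} \<le> suminf (\<lambda>n. real k ^ n /\<^sub>R fact n)"
    by (rule sum_le_suminf) (use s in \<open>auto simp: sums_iff\<close>)
  then show ?thesis using s by (simp add: sums_iff field_simps)
qed

text \<open>The growth \<open>k^k\<close> of the correlation bounds is compensated by the factorial
  in the binomial coefficient, leaving a geometric series with an additional factor
  \<open>e\<close>.\<close>

lemma binomial_pow_le: "real (j choose k) * real k ^ k \<le> (exp 1 * real j) ^ k"
proof -
  have "(j choose k) * fact k \<le> j ^ k" by (rule binomial_fact_pow)
  then have b: "real (j choose k) * fact k \<le> real j ^ k"
    by (metis of_nat_fact of_nat_le_iff of_nat_mult of_nat_power)
  have "real (j choose k) * real k ^ k \<le> real (j choose k) * (exp (real k) * fact k)"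
    by (intro mult_left_mono pow_le_exp_fact) simp
  also have "\<dots> = exp (real k) * (real (j choose k) * fact k)" by simp
  also have "\<dots> \<le> exp (real k) * real j ^ k" using b by (intro mult_left_mono) auto
  also have "exp (real k) = exp 1 ^ k" using exp_of_nat_mult[of k "1::real"] by simp
  finally show ?thesis by (simp add: power_mult_distrib)
qed

text \<open>The subtracted term carries the induction; only the bound by twice the first term is
  used later.\<close>

lemma geometric_tail_le:
  fixes x :: real
  assumes "0 \<le> x" "x \<le> 1 / 2" "1 \<le> j"
  shows "(\<Sum>k=2..j. x ^ k) \<le> 2 * x\<^sup>2 - 2 * x ^ Suc j"
  using assms(3)
proof (induction j rule: dec_induct)
  case base
  show ?case by (simp add: power2_eq_square)
next
  case (step j)
  have "2 * x * x ^ Suc j \<le> 1 * x ^ Suc j" using assms by (intro mult_right_mono) auto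
  then show ?case using step by simp
qed

context mean_field_evolution
begin

text \<open>While \<open>a j / \<surd>N < 2\<close>, the drift of \<open>err j\<close> is at most \<open>46 M v j G\<close>, whereas \<open>G\<close> grows at rate \<open>50 v j\<close>;
  hence the improvement by the factor \<open>46/50\<close>. For the remaining \<open>j\<close> the trivial bound \<open>2\<^sup>j\<close> is at most \<open>G\<close>.\<close>

lemma err_step:
  fixes C0 M :: real
  defines "a \<equiv> \<lambda>s. 3 * C0 * exp (50 * v * s)"
  defines "G \<equiv> \<lambda>(j::nat) s. (a s * real j / sqrt (real N)) ^ j"
  assumes C0: "C0 \<ge> 1" and N3: "N \<ge> 3"
    and init: "\<And>j. j \<in> {1..N} \<Longrightarrow> err j 0 \<le> C0 ^ j * (real j / sqrt (real N)) ^ j"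
    and M: "M \<ge> 1" "\<And>j s. s \<ge> 0 \<Longrightarrow> j \<le> N \<Longrightarrow> err j s \<le> M * G j s"
    and t: "t \<ge> 0" and jN: "j \<le> N"
  shows "err j t \<le> max 1 (23 / 25 * M) * G j t"
proof -
  have sN: "sqrt (real N) > 1" "sqrt (real N) \<le> real N" "sqrt (real N) * sqrt (real N) = real N"
    using N3 sqrt_le_D[of "real N" "real N"] real_sqrt_le_mono[of "real N" "real N * real N"] by auto
  have G0: "G j s \<ge> 0" for j s using C0 sN by (simp add: G_def a_def)
  have a3: "a s \<ge> 3" if "s \<ge> 0" for s
  proof -
    have "1 \<le> exp (50 * v * s)" using v_nonneg that by simp
    then have "3 * 1 \<le> 3 * (C0 * exp (50 * v * s))" using C0 by (intro mult_left_mono) (auto intro: mult_ge1_I)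
    then show ?thesis by (simp add: a_def)
  qed
  have a_mono: "a s \<le> a t" if "s \<le> t" for s t
    using C0 v_nonneg that by (simp add: a_def mult_left_mono)
  consider "j = 0" | "j \<ge> 1" "a t * real j / sqrt (real N) \<ge> 2" | "j \<ge> 1" "a t * real j / sqrt (real N) < 2"
    by linarith
  then show ?thesis
  proof cases
    case 1
    then show ?thesis by (simp add: G_def)
  next
    case 2
    have "err j t \<le> 2 ^ j" by (rule err_le[OF jN t])
    also have "\<dots> \<le> G j t" unfolding G_def using 2 by (intro power_mono) auto
    also have "\<dots> \<le> max 1 (23 / 25 * M) * G j t" using G0[of j t] mult_right_mono[of 1 "max 1 (23 / 25 * M)" "G j t"] by simp
    finally show ?thesis .
  next
    case 3
    \<comment> \<open>Because \<open>a \<ge> 3\<close>, the case assumption forces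
      \<open>j < N\<close>: wherever the evolution inequality is used, a marginal of order
      \<open>j + 1\<close> exists.\<close>
    have "3 * real j \<le> a t * real j" using a3[OF t] by (intro mult_right_mono) auto
    also have "\<dots> < 2 * sqrt (real N)" using 3 sN by (simp add: pos_divide_less_eq)
    finally have "real j < real N" using sN by linarith
    then have j: "1 \<le> j" "Suc j \<le> N" using 3 by auto
    have drift: "norm (drift j s) \<le> 46 * M * (v * real j * G j s)" if s: "0 \<le> s" "s \<le> t" for s
    proof -
      define b where "b = a s / sqrt (real N)"
      have Gb: "G k s = b ^ k * real k ^ k" for k
        by (simp add: G_def b_def power_mult_distrib[symmetric])
      have b0: "b > 0" using a3[OF s(1)] sN by (simp add: b_def)
      have "b * real j \<le> a t * real j / sqrt (real N)"
        using a_mono[OF s(2)] sN by (simp add: b_def divide_right_mono mult_right_mono)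
      then have bj: "b * real j \<le> 2" using 3 by simp
      have bN: "1 / real N \<le> b"
      proof -
        have "1 / real N \<le> 1 / sqrt (real N)" using sN N3 by (intro divide_left_mono) auto
        also have "\<dots> \<le> b" using a3[OF s(1)] sN by (simp add: b_def divide_right_mono)
        finally show ?thesis .
      qed
      have bN2: "1 / real N \<le> b * b"
      proof -
        have "1 * 1 \<le> a s * a s" using a3[OF s(1)] by (intro mult_mono) auto
        then show ?thesis using sN by (simp add: b_def divide_right_mono)
      qed
      \<comment> \<open>Going up costs \<open>b j\<close> times 6, and \<open>b j \<le> 2\<close> in
        this case.\<close>
      have up: "G (Suc j) s \<le> 12 * G j s"
      proof -
        have "G (Suc j) s \<le> b ^ Suc j * (6 * (real j * real j ^ j))"
          unfolding Gb using b0 by (intro mult_left_mono Suc_power_le j) auto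
        also have "\<dots> = (b * real j) * (6 * G j s)" by (simp add: Gb)
        also have "\<dots> \<le> 2 * (6 * G j s)" using bj G0[of j s] by (intro mult_right_mono) auto
        finally show ?thesis by simp
      qed
      have jpos: "real j \<ge> 1" using j by simp
      \<comment> \<open>Going down loses powers of \<open>b\<close> in \<open>G\<close>. One lost
        power is paid by \<open>1/N \<le> b\<close>, two lost powers by
        \<open>1/N \<le> b * b\<close>.\<close>
      have down1: "(real j)\<^sup>2 / real N * G (j - 1) s \<le> real j * G j s"
      proof -
        obtain i where i: "j = Suc i" using j by (cases j) auto
        have "real i ^ i \<le> real j ^ i" using i by (intro power_mono) auto
        then have g: "G (j - 1) s \<le> b ^ i * real j ^ i" unfolding Gb i using b0 by (simp add: mult_left_mono)
        have "(real j)\<^sup>2 / real N * G (j - 1) s \<le> (real j)\<^sup>2 * b * (b ^ i * real j ^ i)"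
          using bN g G0[of "j - 1" s] b0 mult_left_mono[OF bN, of "(real j)\<^sup>2"] by (intro mult_mono) auto
        also have "\<dots> = real j * G j s" by (simp add: Gb i power2_eq_square)
        finally show ?thesis .
      qed
      have down2: "(real j)\<^sup>2 / real N * G (j - 2) s \<le> real j * G j s"
      proof (cases "j = 1")
        case True
        then show ?thesis using bN by (simp add: Gb)
      next
        case False
        then obtain i where i: "j = Suc (Suc i)" using j by (metis Suc_le_D not_less_eq_eq One_nat_def le_antisym)
        have "real i ^ i \<le> real j ^ i" using i by (intro power_mono) auto
        then have g: "G (j - 2) s \<le> b ^ i * real j ^ i" unfolding Gb i using b0 by (simp add: mult_left_mono)
        have "(real j)\<^sup>2 / real N * G (j - 2) s \<le> (real j)\<^sup>2 * (b * b) * (b ^ i * real j ^ i)"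
          using g G0[of "j - 2" s] b0 mult_left_mono[OF bN2, of "(real j)\<^sup>2"] by (intro mult_mono) auto
        also have "\<dots> = G j s" by (simp add: Gb i power2_eq_square)
        also have "\<dots> \<le> real j * G j s" using jpos G0[of j s] mult_right_mono[OF jpos, of "G j s"] by simp
        finally show ?thesis .
      qed
      have e: "err j s \<le> M * G j s" "err (Suc j) s \<le> M * G (Suc j) s" "err (j - 1) s \<le> M * G (j - 1) s"
        "err (j - 2) s \<le> M * G (j - 2) s"
        using j by (auto intro: M(2)[OF s(1)])
      let ?x = "(real j)\<^sup>2 / real N"
      have "9 * real j * err j s + 2 * real j * err (Suc j) s + ?x * (9 * err (j - 1) s + 4 * err (j - 2) s) \<le>
          9 * real j * (M * G j s) + 2 * real j * (M * (12 * G j s)) + ?x * (9 * (M * G (j - 1) s) + 4 * (M * G (j - 2) s))"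
        using e order_trans[OF e(2) mult_left_mono[OF up, of M]] M(1) by (intro add_mono mult_left_mono) auto
      \<comment> \<open>Here \<open>33 = 9 + 2 * 12\<close>; with the two lower orders the total
        becomes 46.\<close>
      also have "\<dots> = M * (33 * (real j * G j s) + 9 * (?x * G (j - 1) s) + 4 * (?x * G (j - 2) s))"
        by (simp add: algebra_simps)
      also have "\<dots> \<le> M * (33 * (real j * G j s) + 9 * (real j * G j s) + 4 * (real j * G j s))"
        using down1 down2 M(1) by (intro mult_left_mono add_mono) auto
      finally have "v * (9 * real j * err j s + 2 * real j * err (Suc j) s + ?x * (9 * err (j - 1) s + 4 * err (j - 2) s)) \<le>
          v * (M * (46 * (real j * G j s)))"
        by (intro mult_left_mono v_nonneg) simp
      then show ?thesis using norm_drift[OF s(1) N3 j] by (simp add: mult_ac)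
    qed
    have Gadd: "G j (s + h) = G j s * exp (50 * v * real j * h)" for s h
      by (simp add: G_def a_def power_mult_distrib power_divide exp_add distrib_left exp_of_nat_mult[symmetric] mult_ac)
    \<comment> \<open>The error is integrated against the growth of \<open>G\<close>: since
      \<open>G\<close> grows at rate at least \<open>50 v j\<close>, the drift is dominated by
      \<open>46/50 = 23/25\<close> of \<open>M\<close> times that growth.\<close>
    define f where "f s = err j s - err j 0 - 23 / 25 * M * (G j s - G j 0)" for s
    have "f t \<le> 0"
    proof (rule gronwall_dini[of t f 0])
      show "continuous_on {0..t} f"
        unfolding f_def G_def a_def by (intro continuous_intros continuous_on_subset[OF err_cont[OF jN]]) (use sN in auto)
      fix s e :: real assume s: "0 \<le> s" "s < t" "e > 0"
      have "\<forall>\<^sub>F h in at_right (0::real). h > 0" by (rule eventually_at_right_less)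
      then show "\<forall>\<^sub>F h in at_right 0. f (s + h) \<le> f s + h * (0 * f s + e)"
        using err_dini[OF s(1) j(1) jN s(3)]
      proof eventually_elim
        case (elim h)
        have "G j s * (1 + 50 * v * real j * h) \<le> G j (s + h)"
          unfolding Gadd using G0[of j s] by (intro mult_left_mono) auto
        then have "23 / 25 * M * (G j s * (50 * v * real j * h)) \<le> 23 / 25 * M * (G j (s + h) - G j s)"
          using M(1) by (intro mult_left_mono) (auto simp: distrib_left)
        moreover have "h * norm (drift j s) \<le> h * (46 * M * (v * real j * G j s))"
          using drift[of s] s elim by (intro mult_left_mono) auto
        moreover have "23 / 25 * M * (G j s * (50 * v * real j * h)) = h * (46 * M * (v * real j * G j s))"
          by simp
        ultimately have "h * norm (drift j s) \<le> 23 / 25 * M * (G j (s + h) - G j s)" by linarith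
        moreover have "h * (norm (drift j s) + e) = h * norm (drift j s) + h * e" by (rule distrib_left)
        moreover have "23 / 25 * M * (G j (s + h) - G j s) = 23 / 25 * M * (G j (s + h) - G j 0) - 23 / 25 * M * (G j s - G j 0)"
          by (simp only: right_diff_distrib[symmetric] diff_diff_eq2 diff_add_cancel)
        ultimately show ?case unfolding f_def mult_zero_left add_0 using elim(2) by linarith
      qed
    qed (use t in \<open>auto simp: f_def\<close>)
    moreover have "err j 0 \<le> G j 0"
    proof -
      have "err j 0 \<le> (C0 * (real j / sqrt (real N))) ^ j"
        unfolding power_mult_distrib using init[of j] j by simp
      also have "\<dots> \<le> G j 0" unfolding G_def a_def using C0 sN by (intro power_mono) (auto simp: divide_right_mono mult_right_mono)
      finally show ?thesis .
    qed
    moreover have GG: "G j 0 \<le> G j t"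
      unfolding G_def using a_mono[OF t] a3[of 0] sN by (intro power_mono) (auto simp: divide_right_mono mult_right_mono)
    ultimately have "err j t \<le> G j 0 + 23 / 25 * M * (G j t - G j 0)" by (simp add: f_def)
    also have "\<dots> \<le> max 1 (23 / 25 * M) * G j 0 + max 1 (23 / 25 * M) * (G j t - G j 0)"
      using GG G0[of j 0] mult_right_mono[of 1 "max 1 (23 / 25 * M)" "G j 0"]
        mult_right_mono[of "23 / 25 * M" "max 1 (23 / 25 * M)" "G j t - G j 0"] by linarith
    also have "\<dots> = max 1 (23 / 25 * M) * G j t" by (simp add: algebra_simps)
    finally show ?thesis .
  qed
qed

text \<open>A bootstrap: each use of \<open>err_step\<close> improves the factor for all orders and
  times at once, by \<open>23/25\<close> until it reaches 1. The coupling to \<open>j + 1\<close> is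
  harmless because no order is settled before another.\<close>

lemma err_bound:
  assumes C0: "C0 \<ge> 1" and N3: "N \<ge> 3"
    and init: "\<And>j. j \<in> {1..N} \<Longrightarrow> err j 0 \<le> C0 ^ j * (real j / sqrt (real N)) ^ j"
    and t: "t \<ge> 0" and j: "j \<le> N"
  shows "err j t \<le> (3 * C0 * exp (50 * v * t) * real j / sqrt (real N)) ^ j"
proof -
  define G where "G j s = (3 * C0 * exp (50 * v * s) * real j / sqrt (real N)) ^ j" for j :: nat and s
  have sN: "sqrt (real N) \<ge> 1" using N3 by simp
  \<comment> \<open>No \<open>G j\<close> is smaller than \<open>(1 / sqrt N) ^ N\<close>, so this
    factor lifts all of them above the trivial bound \<open>2 ^ N\<close>.\<close>
  define M where "M = 2 ^ N * sqrt (real N) ^ N"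
  have M1: "M \<ge> 1" unfolding M_def using sN by (intro mult_ge1_I one_le_power) auto
  have base: "err j s \<le> M * G j s" if s: "s \<ge> 0" and j: "j \<le> N" for j s
  proof -
    have x: "(1 / sqrt (real N)) ^ N \<le> (1 / sqrt (real N)) ^ j"
      using sN j by (intro power_decreasing) auto
    have "(1 / sqrt (real N)) ^ j \<le> G j s"
    proof (cases "j = 0")
      case False
      have "1 \<le> C0 * exp (50 * v * s)" using C0 v_nonneg s by (intro mult_ge1_I) auto
      then have "1 * 1 \<le> (3 * C0 * exp (50 * v * s)) * real j" using False by (intro mult_mono) auto
      then show ?thesis unfolding G_def using sN by (intro power_mono divide_right_mono) auto
    qed (simp add: G_def)
    then have "M * (1 / sqrt (real N)) ^ N \<le> M * G j s" using x M1 by (intro mult_left_mono) auto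
    moreover have "M * (1 / sqrt (real N)) ^ N = 2 ^ N" using sN by (simp add: M_def power_divide)
    moreover have "err j s \<le> 2 ^ N" using order_trans[OF err_le[OF j s] power_increasing[OF j, of "2::real"]] by simp
    ultimately show ?thesis by simp
  qed
  have iter: "\<forall>s\<ge>0. \<forall>j\<le>N. err j s \<le> max 1 ((23 / 25) ^ n * M) * G j s" for n
  proof (induction n)
    case 0
    then show ?case using base M1 by (simp add: max_def)
  next
    case (Suc n)
    have *: "max 1 (23 / 25 * max 1 ((23 / 25) ^ n * M)) = max 1 ((23 / 25) ^ Suc n * M)"
      by (simp add: max_def)
    show ?case
    proof (intro allI impI)
      fix s :: real and j assume "s \<ge> 0" "j \<le> N"
      then have "err j s \<le> max 1 (23 / 25 * max 1 ((23 / 25) ^ n * M)) * G j s"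
        unfolding G_def using Suc.IH by (intro err_step[OF C0 N3 init]) (auto simp: G_def)
      then show "err j s \<le> max 1 ((23 / 25) ^ Suc n * M) * G j s" unfolding * .
    qed
  qed
  \<comment> \<open>Finitely many rounds bring the factor from \<open>M\<close> down to 1; their
    number may depend on \<open>N\<close>.\<close>
  obtain n where "(23 / 25 :: real) ^ n < 1 / M"
    using real_arch_pow_inv[of "1 / M" "23 / 25"] M1 by auto
  then have "(23 / 25) ^ n * M \<le> 1" using M1 by (simp add: field_simps)
  then have "max 1 ((23 / 25) ^ n * M) = 1" by simp
  then show ?thesis using iter[of n] t j by (simp add: G_def)
qed

text \<open>The general bound only gives order \<open>1/sqrt N\<close> for \<open>err 1\<close>. In
  its own inequality, however, the coupling is to \<open>err 2\<close>, already of order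
  \<open>1/N\<close>, and to explicit terms of order \<open>1/N\<close>, so Gronwall recovers the
  better order.\<close>

lemma err_1_bound:
  assumes C0: "C0 \<ge> 1" and N3: "N \<ge> 3" and B0: "B0 > 0"
    and init: "\<And>j. j \<in> {1..N} \<Longrightarrow> err j 0 \<le> C0 ^ j * (real j / sqrt (real N)) ^ j"
    and init1: "err 1 0 \<le> B0 / real N" and t: "t \<ge> 0"
  shows "err 1 t \<le> (B0 + C0\<^sup>2) / real N * exp (100 * v * t)"
proof -
  define \<beta> where "\<beta> = (B0 + C0\<^sup>2) / real N"
  have \<beta>: "\<beta> > 0" "C0\<^sup>2 / real N \<le> \<beta>" "B0 / real N \<le> \<beta>" "1 / real N \<le> \<beta>"
    using B0 C0 N3 one_le_power[OF C0, of 2] by (auto simp: \<beta>_def power2_eq_square intro!: divide_right_mono divide_pos_pos add_pos_nonneg)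
  define f where "f s = err 1 s - \<beta> * exp (100 * v * s)" for s
  have "f t \<le> 0"
  proof (rule gronwall_dini[of t f "9 * v"])
    show "continuous_on {0..t} f"
      unfolding f_def using N3 by (intro continuous_intros continuous_on_subset[OF err_cont]) auto
    show "f 0 \<le> 0" using init1 \<beta>(3) by (simp add: f_def)
    fix s e :: real assume s: "0 \<le> s" "s < t" "e > 0"
    define x where "x = exp (100 * v * s)"
    have x1: "x \<ge> 1" using v_nonneg s by (simp add: x_def)
    have "err 2 s \<le> (3 * C0 * exp (50 * v * s) * real 2 / sqrt (real N)) ^ 2"
      by (rule err_bound[OF C0 N3 init s(1)]) (use N3 in auto)
    \<comment> \<open>Squaring \<open>3 * 2\<close> gives 36, and squaring the exponential doubles
      the rate 50 to 100.\<close>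
    also have "\<dots> = 36 * (C0\<^sup>2 / real N) * x"
      by (simp add: power_mult_distrib power_divide x_def exp_double[symmetric])
    also have "\<dots> \<le> 36 * \<beta> * x" using \<beta> x1 by (intro mult_right_mono) auto
    finally have e2: "err 2 s \<le> 36 * (\<beta> * x)" by simp
    have "norm (drift 1 s) \<le> v * (9 * real 1 * err 1 s + 2 * real 1 * err (Suc 1) s +
        (real 1)\<^sup>2 / real N * (9 * err (1 - 1) s + 4 * err (1 - 2) s))"
      using N3 by (intro norm_drift s) auto
    \<comment> \<open>Both lower orders are \<open>err 0 = 1\<close> for \<open>j = 1\<close>, so
      \<open>9 + 4 = 13\<close>.\<close>
    also have "\<dots> = v * (9 * err 1 s + 2 * err 2 s + 13 * (1 / real N))"
      by (simp add: numeral_2_eq_2)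
    also have "\<dots> \<le> v * (9 * err 1 s + 2 * (36 * (\<beta> * x)) + 13 * (\<beta> * x))"
    proof (intro mult_left_mono add_mono e2 v_nonneg)
      have "1 / real N \<le> \<beta> * 1" using \<beta> by simp
      also have "\<dots> \<le> \<beta> * x" using \<beta> x1 by (intro mult_left_mono) auto
      finally show "1 / real N \<le> \<beta> * x" .
    qed auto
    \<comment> \<open>The source is \<open>72 + 13 = 85\<close>; adding the 9 from
      \<open>err 1\<close> itself stays below the rate 100 of the comparison function.\<close>
    also have "\<dots> = 9 * v * err 1 s + 85 * (v * (\<beta> * x))" by (simp add: algebra_simps)
    finally have d: "norm (drift 1 s) \<le> 9 * v * err 1 s + 85 * (v * (\<beta> * x))" .
    have "\<forall>\<^sub>F h in at_right (0::real). h > 0" by (rule eventually_at_right_less)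
    moreover have "\<forall>\<^sub>F h in at_right 0. err 1 (s + h) \<le> err 1 s + h * (norm (drift 1 s) + e)"
      using N3 by (intro err_dini s) auto
    ultimately show "\<forall>\<^sub>F h in at_right 0. f (s + h) \<le> f s + h * (9 * v * f s + e)"
    proof eventually_elim
      case (elim h)
      have "\<beta> * x * (1 + 100 * v * h) \<le> \<beta> * x * exp (100 * v * h)"
        using \<beta> x1 by (intro mult_left_mono) auto
      also have "\<dots> = \<beta> * exp (100 * v * (s + h))" by (simp add: x_def distrib_left exp_add)
      finally have 1: "\<beta> * x + 100 * (h * (v * (\<beta> * x))) \<le> \<beta> * exp (100 * v * (s + h))"
        by (simp add: algebra_simps)
      have "h * norm (drift 1 s) \<le> h * (9 * v * err 1 s + 85 * (v * (\<beta> * x)))"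
        using d elim by (intro mult_left_mono) auto
      moreover have "h * (v * (\<beta> * x)) \<ge> 0" using elim v_nonneg \<beta> x1 by simp
      ultimately show ?case using 1 elim(2) by (simp add: f_def x_def algebra_simps)
    qed
  qed (use t v_nonneg in auto)
  then show ?thesis by (simp add: f_def \<beta>_def)
qed

text \<open>The estimate is quadratic in \<open>x\<close>, so where \<open>x\<close> is not small
  the trivial bound 2 suffices. Otherwise the sum over \<open>k \<ge> 2\<close> is geometric, and
  the term \<open>k = 1\<close> needs the sharper bound of order \<open>1/N\<close>.\<close>

lemma chaos_bound:
  assumes C0: "C0 \<ge> 1" and B0: "B0 > 0"
    and init: "\<And>j. j \<in> {1..N} \<Longrightarrow> err j 0 \<le> C0 ^ j * (real j / sqrt (real N)) ^ j"
    and init1: "err 1 0 \<le> B0 / real N" and t: "t \<ge> 0" and j: "j \<in> {1..N}"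
    and D: "D \<ge> (B0 + C0\<^sup>2) / 2 + 18 * (exp 1)\<^sup>2 * C0\<^sup>2" "D \<ge> B0 + C0\<^sup>2" "D \<ge> 72 * (exp 1)\<^sup>2 * C0\<^sup>2"
  shows "norm (Fm j t - tpower S (F t) j) \<le> D * exp (100 * v * t) * (real j)\<^sup>2 / real N"
proof -
  have j1: "1 \<le> j" "j \<le> N" using j by auto
  have N0: "real N > 0" using j1 by simp
  define a where "a = 3 * C0 * exp (50 * v * t)"
  \<comment> \<open>The ratio of the geometric series: the correlation scale
    \<open>a j / sqrt N\<close> times the \<open>e\<close> from
    \<open>binomial_pow_le\<close>.\<close>
  define x where "x = exp 1 * (a * real j / sqrt (real N))"
  define X where "X = exp (100 * v * t)"
  have X1: "X \<ge> 1" using v_nonneg t by (simp add: X_def)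
  have a2: "a\<^sup>2 = 9 * C0\<^sup>2 * X" by (simp add: a_def X_def power_mult_distrib exp_double[symmetric])
  have "1 \<le> C0 * exp (50 * v * t)" using C0 v_nonneg t by (intro mult_ge1_I) auto
  then have a3: "a \<ge> 3" by (simp add: a_def)
  have e1: "exp 1 \<ge> (2::real)" using exp_ge_add_one_self[of 1] by simp
  have x0: "x \<ge> 0" using a3 by (simp add: x_def)
  have x2: "x\<^sup>2 = (exp 1)\<^sup>2 * (9 * C0\<^sup>2 * X) * ((real j)\<^sup>2 / real N)"
    by (simp add: x_def power_mult_distrib power_divide a2)
  have goal: "D' * (X * ((real j)\<^sup>2 / real N)) \<le> D * exp (100 * v * t) * (real j)\<^sup>2 / real N" if "D' \<le> D" for D'
    using mult_right_mono[OF that, of "X * ((real j)\<^sup>2 / real N)"] X1 by (simp add: X_def)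
  show ?thesis
  proof (cases "x \<ge> 1 / 2")
    case True
    have "norm (Fm j t - tpower S (F t) j) \<le> norm (Fm j t) + norm (tpower S (F t) j)" by (rule norm_triangle_ineq4)
    also have "\<dots> \<le> 1 + 1"
    proof (intro add_mono Fm_norm j1 t)
      have "tpower S (F t) j = repls S j (F t) {1..j} (Fm j t)"
        using repls_all[OF j1(1) F_X[OF t] Fm_X[OF j1 t]] ell_marginal[OF j1 FN_X[OF t]] FN_ell[OF t] by simp
      then have "norm (tpower S (F t) j) \<le> norm (Fm j t)"
        using norm_repls[OF j1(1) F_X[OF t] F_norm[OF t] order_refl Fm_X[OF j1 t]] by simp
      then show "norm (tpower S (F t) j) \<le> 1" using Fm_norm[OF j1 t] by simp
    qed
    also have "\<dots> \<le> 8 * x\<^sup>2" using power_mono[OF True, of 2] by (simp add: power_divide)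
    also have "\<dots> = (72 * (exp 1)\<^sup>2 * C0\<^sup>2) * (X * ((real j)\<^sup>2 / real N))" by (simp add: x2)
    also have "\<dots> \<le> D * exp (100 * v * t) * (real j)\<^sup>2 / real N" by (rule goal[OF D(3)])
    finally show ?thesis .
  next
    case False
    then have xs: "x \<le> 1 / 2" by simp
    \<comment> \<open>Small \<open>x\<close> forces \<open>sqrt N \<ge> 12\<close>, which provides
      the condition \<open>N \<ge> 3\<close> of the hierarchy estimates.\<close>
    have "3 * 1 \<le> a * real j" using a3 j1 by (intro mult_mono) auto
    then have "2 * 3 \<le> exp 1 * (a * real j)" using e1 by (intro mult_mono) auto
    moreover have "exp 1 * (a * real j) \<le> sqrt (real N) / 2"
      using xs N0 by (simp add: x_def field_simps)
    ultimately have "sqrt (real N) \<ge> 12" by simp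
    then have "real N \<ge> 12\<^sup>2" using N0 by (metis real_sqrt_le_iff real_sqrt_abs abs_numeral)
    then have N3: "N \<ge> 3" by simp
    define b where "b = (B0 + C0\<^sup>2) / real N * X"
    have e1b: "err 1 t \<le> b" unfolding b_def X_def by (rule err_1_bound[OF C0 N3 B0 init init1 t])
    have b0: "b \<ge> 0" unfolding b_def using B0 X1 by simp
    have "norm (Fm j t - tpower S (F t) j) \<le> (\<Sum>k=1..j. real (j choose k) * err k t)"
      by (rule chaos_le_sum_err[OF t j1])
    also have "\<dots> = real j * err 1 t + (\<Sum>k=2..j. real (j choose k) * err k t)"
      using sum.atLeast_Suc_atMost[OF j1(1), of "\<lambda>k. real (j choose k) * err k t"] by (simp add: numeral_2_eq_2)
    also have "\<dots> \<le> real j * b + (\<Sum>k=2..j. x ^ k)"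
    proof (intro add_mono mult_left_mono e1b sum_mono)
      fix k assume k: "k \<in> {2..j}"
      have "err k t \<le> (a * real k / sqrt (real N)) ^ k"
        unfolding a_def by (rule err_bound[OF C0 N3 init t]) (use k j1 in auto)
      then have "real (j choose k) * err k t \<le> real (j choose k) * (a * real k / sqrt (real N)) ^ k"
        by (intro mult_left_mono) auto
      also have "\<dots> = (a / sqrt (real N)) ^ k * (real (j choose k) * real k ^ k)"
        by (simp add: power_mult_distrib power_divide)
      also have "\<dots> \<le> (a / sqrt (real N)) ^ k * (exp 1 * real j) ^ k"
        using a3 by (intro mult_left_mono binomial_pow_le) auto
      also have "\<dots> = x ^ k" by (simp add: x_def power_mult_distrib[symmetric] mult_ac)
      finally show "real (j choose k) * err k t \<le> x ^ k" .
    qed simp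
    finally have main: "norm (Fm j t - tpower S (F t) j) \<le> real j * b + (\<Sum>k=2..j. x ^ k)" .
    show ?thesis
    proof (cases "j = 1")
      case True
      then have "norm (Fm j t - tpower S (F t) j) \<le> (B0 + C0\<^sup>2) * (X * ((real j)\<^sup>2 / real N))"
        using main by (simp add: b_def)
      also have "\<dots> \<le> D * exp (100 * v * t) * (real j)\<^sup>2 / real N" by (rule goal[OF D(2)])
      finally show ?thesis .
    next
      case False
      \<comment> \<open>For \<open>j \<ge> 2\<close> one has \<open>j \<le> j^2/2\<close>, so the
        first-order term is halved and leaves room for the tail; for \<open>j = 1\<close> the tail
        is empty.\<close>
      then have j2: "2 \<le> real j" using j1 by simp
      have "real j * 2 \<le> real j * real j" using j2 by (intro mult_left_mono) auto
      then have "real j * b \<le> (real j)\<^sup>2 / 2 * b" using b0 by (intro mult_right_mono) (auto simp: power2_eq_square)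
      moreover have "(\<Sum>k=2..j. x ^ k) \<le> 2 * x\<^sup>2"
        using geometric_tail_le[OF x0 xs j1(1)] zero_le_power[OF x0, of "Suc j"] by linarith
      ultimately have "norm (Fm j t - tpower S (F t) j) \<le> (real j)\<^sup>2 / 2 * b + 2 * x\<^sup>2" using main by linarith
      also have "\<dots> = ((B0 + C0\<^sup>2) / 2 + 18 * (exp 1)\<^sup>2 * C0\<^sup>2) * (X * ((real j)\<^sup>2 / real N))"
      proof -
      have "(real j)\<^sup>2 / 2 * b = (B0 + C0\<^sup>2) / 2 * (X * ((real j)\<^sup>2 / real N))" by (simp add: b_def)
      moreover have "2 * x\<^sup>2 = 18 * (exp 1)\<^sup>2 * C0\<^sup>2 * (X * ((real j)\<^sup>2 / real N))" by (simp add: x2)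
      ultimately show ?thesis by (simp only: distrib_right)
    qed
      also have "\<dots> \<le> D * exp (100 * v * t) * (real j)\<^sup>2 / real N" by (rule goal[OF D(1)])
      finally show ?thesis .
    qed
  qed
qed

end

text \<open>The constants of the theorem dominate those of the argument: the summand with
  \<open>C1 - 2\<close> covers \<open>C0^2\<close>, and \<open>8 (e C2)^2\<close> covers the trivial
  regime.\<close>

lemma constants:
  fixes C0 B0 :: real
  assumes C0: "C0 \<ge> 1" and B0: "B0 > 0"
    and C1: "C1 = 4 * (16 * (2 * exp 1) powr (1 / (12 * exp 1) + 1) / \<bar>ln (1 - 1 / (24 * exp 1))\<bar>)"
    and C2: "C2 = 16 * (2 * exp 1) powr (1 + 1 / (12 * exp 1)) * C0"
    and D: "D = max (B0 + 1 / 2 + 16 * C2\<^sup>2 / (C1 - 2)) (8 * (exp 1 * C2)\<^sup>2)"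
  shows "C1 \<ge> 50" "D \<ge> (B0 + C0\<^sup>2) / 2 + 18 * (exp 1)\<^sup>2 * C0\<^sup>2" "D \<ge> B0 + C0\<^sup>2" "D \<ge> 72 * (exp 1)\<^sup>2 * C0\<^sup>2"
proof -
  define W :: real where "W = (2 * exp 1) powr (1 + 1 / (12 * exp 1))"
  define L :: real where "L = \<bar>ln (1 - 1 / (24 * exp 1))\<bar>"
  have e1: "exp 1 \<ge> (2::real)" using exp_ge_add_one_self[of 1] by simp
  have "(2 * exp 1) powr 1 \<le> W" unfolding W_def using e1 by (intro powr_mono) auto
  then have W: "W \<ge> 2 * exp 1" by simp
  then have W4: "W \<ge> 4" using e1 by simp
  define y :: real where "y = 1 / (24 * exp 1)"
  have y: "0 < y" "y \<le> 1 / 48" using e1 by (auto simp: y_def divide_simps)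
  have ln_up: "ln (1 - y) \<le> - y" using ln_le_minus_one[of "1 - y"] y by simp
  have "ln (1 / (1 - y)) \<le> 1 / (1 - y) - 1" using y by (intro ln_le_minus_one) auto
  moreover have "1 / (1 - y) - 1 \<le> 1" using y by (simp add: divide_simps)
  ultimately have ln_lo: "ln (1 - y) \<ge> - 1" using y by (simp add: ln_div)
  have L: "y \<le> L" "L \<le> 1" unfolding L_def y_def[symmetric] using ln_up ln_lo y by auto
  have C1W: "C1 = 64 * W / L" unfolding C1 W_def L_def by (simp add: add.commute)
  have C2W: "C2 = 16 * W * C0" unfolding C2 W_def by simp
  have L0: "L > 0" using L y by linarith
  have "64 * W * L \<le> 64 * W * 1" using L W4 by (intro mult_left_mono) auto
  then have C1lo: "C1 \<ge> 64 * W" unfolding C1W using L0 by (simp add: pos_le_divide_eq)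
  show C50: "C1 \<ge> 50" using C1lo W4 by simp
  \<comment> \<open>An upper bound on \<open>C1\<close> is needed as well, since
    \<open>C1 - 2\<close> is a denominator in \<open>D\<close>; it comes from the lower bound
    \<open>y\<close> for the logarithm and from \<open>2 e \<le> W\<close>.\<close>
  have "C1 \<le> 64 * W / y" unfolding C1W using L y W4 by (intro divide_left_mono mult_pos_pos) auto
  also have "\<dots> = 1536 * W * exp 1" by (simp add: y_def)
  also have "\<dots> \<le> 1536 * W * W" using W W4 e1 by (intro mult_left_mono) auto
  finally have C1up: "C1 \<le> 1536 * (W * W)" by simp
  have "C0\<^sup>2 * (C1 - 2) \<le> C0\<^sup>2 * (4096 * (W * W))" using C1up zero_le_square[of W] by (intro mult_left_mono) (linarith, simp)
  also have "\<dots> = 16 * C2\<^sup>2" by (simp add: C2W power2_eq_square)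
  finally have "C0\<^sup>2 \<le> 16 * C2\<^sup>2 / (C1 - 2)" using C50 by (simp add: pos_le_divide_eq)
  then have D1: "B0 + C0\<^sup>2 \<le> D" unfolding D by simp
  have "9 * C0\<^sup>2 \<le> C2\<^sup>2"
  proof -
    have "3 * C0 \<le> C2" unfolding C2W using W4 C0 by (intro mult_right_mono) auto
    then have "(3 * C0)\<^sup>2 \<le> C2\<^sup>2" using C0 by (intro power_mono) auto
    then show ?thesis by (simp add: power_mult_distrib)
  qed
  then have "8 * ((exp 1)\<^sup>2 * (9 * C0\<^sup>2)) \<le> 8 * ((exp 1)\<^sup>2 * C2\<^sup>2)" by (intro mult_left_mono) auto
  then have D2: "72 * (exp 1)\<^sup>2 * C0\<^sup>2 \<le> D" unfolding D by (simp add: power_mult_distrib le_max_iff_disj)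
  \<comment> \<open>The mixed condition is one half of the second plus one quarter of the
    third.\<close>
  have "y / 2 + 18 * x \<le> D" if "y \<le> D" "72 * x \<le> D" "x \<ge> 0" for x y :: real
    using that by simp
  from this[OF D1, of "(exp 1)\<^sup>2 * C0\<^sup>2"]
  show "D \<ge> (B0 + C0\<^sup>2) / 2 + 18 * (exp 1)\<^sup>2 * C0\<^sup>2"
    using D2 by (simp add: mult.assoc)
  show "D \<ge> B0 + C0\<^sup>2" "D \<ge> 72 * (exp 1)\<^sup>2 * C0\<^sup>2" by (fact D1 D2)+
qed

theorem corollary2p3:
  fixes S :: "('h::complex_hilbert, 'f::complex_hilbert, 'b::complex_banach) mean_field_data"
    and FN F :: "real \<Rightarrow> 'b"
    and N :: nat
    and C0 B0 C1 C2 B1 B2 D1 D2 :: real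
  assumes "mean_field_system S"
    and "N = npart S"
    and "state S N (FN 0)" and "particle_solution S (FN 0) FN"
    and "F 0 \<in> pos_cone S 1" and "norm (F 0) = 1" and "mean_field_solution S (F 0) F"
    and "C0 \<ge> 1"
    and "\<forall>j\<in>{1..N}. norm (corr_error S j (FN 0) (F 0)) \<le> C0 ^ j * (real j / sqrt (real N)) ^ j"
    and "B0 > 0"
    and "norm (corr_error S 1 (FN 0) (F 0)) \<le> B0 / real N"
    and "C1 = 4 * (16 * (2 * exp 1) powr (1 / (12 * exp 1) + 1) / \<bar>ln (1 - 1 / (24 * exp 1))\<bar>)"
    and "C2 = 16 * (2 * exp 1) powr (1 + 1 / (12 * exp 1)) * C0"
    and "B1 = 2 * C1"
    and "B2 = B0 + 1 / 2 + 16 * C2\<^sup>2 / (C1 - 2)"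
    and "D1 = max B1 (2 * C1)"
    and "D2 = max B2 (8 * (exp 1 * C2)\<^sup>2)"
  shows "\<forall>t>0. \<forall>j\<in>{1..N}.
    norm (marginal S j N (FN t) - tpower S (F t) j)
      \<le> D2 * exp (D1 * t * pot_norm S) * (real j)\<^sup>2 / real N"
proof (intro allI impI ballI)
  fix t :: real and j assume t: "t > 0" and j: "j \<in> {1..N}"
  interpret mean_field_evolution S FN F
    using assms(3-7) unfolding assms(2)
    by (intro mean_field_evolution.intro mean_field_evolution_axioms.intro assms(1))
  have N: "N = npart S" by fact
  have err0: "err j 0 = norm (corr_error S j (FN 0) (F 0))" if "j \<in> {1..npart S}" for j
    using that corr_error_E[of j 0] by (simp add: err_def)
  note K = constants[OF assms(8,10,12,13) assms(17)[unfolded assms(15)]]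
  have "norm (marginal S j N (FN t) - tpower S (F t) j) \<le> D2 * exp (100 * pot_norm S * t) * (real j)\<^sup>2 / real N"
    unfolding N
  proof (rule chaos_bound[OF assms(8,10) _ _ _ _ K(2-4)])
    show "err j 0 \<le> C0 ^ j * (real j / sqrt (real (npart S))) ^ j" if "j \<in> {1..npart S}" for j
      using assms(9) that err0[OF that] by (simp add: N)
    show "err 1 0 \<le> B0 / real (npart S)"
      using assms(11) err0[of 1] npart_ge_1 by (simp add: N)
  qed (use t j N in auto)
  also have "\<dots> \<le> D2 * exp (D1 * t * pot_norm S) * (real j)\<^sup>2 / real N"
  proof -
    \<comment> \<open>\<open>D1\<close> is at least \<open>2 * C1\<close>, and
      \<open>C1 \<ge> 50\<close>.\<close>
    have "100 * (t * pot_norm S) \<le> D1 * (t * pot_norm S)"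
      using K(1) t v_nonneg assms(14,16) by (intro mult_right_mono) auto
    moreover have "D2 \<ge> 0" using K(3) assms(10) by (smt (verit) zero_le_power2)
    ultimately show ?thesis
      by (intro divide_right_mono mult_right_mono mult_left_mono) (auto simp: mult_ac)
  qed
  finally show "norm (marginal S j N (FN t) - tpower S (F t) j) \<le> D2 * exp (D1 * t * pot_norm S) * (real j)\<^sup>2 / real N" .
qed

end
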